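(* Let $d\ge1$, $q\in(0,1]$, $n=[dq^{-1}]+1$, $m=[(d+1)q^{-1}]+1$, fix $\ell_0>0$ and, if $d\ge2$, fix $M>0$. Let $\Lambda,\Omega\subset\mathbb R^d$ be basic domains, with Lipschitz constants at most $M$ if $d\ge2$. Let $\alpha,\ell,\rho>0$ with $\alpha\ell\rho\ge\ell_0$. Suppose that the symbol $a\in\mathbf S^{(n,m)}$ has support contained in $B(\mathbf u,\ell)\times B(\boldsymbol\mu,\rho)$ for some $\mathbf u,\boldsymbol\mu\in\mathbb R^d$. Then for $t=0$ or $t=1$ $$\|\chi_\Lambda\,\mathrm{Op}_{\alpha,t}(a)\,(I-\chi_\Lambda)\|_{\mathfrak S_q}\le C_q\,(\alpha\ell\rho)^{\frac{d-1}{q}}\,\mathsf N^{(n,m)}(a;\ell,\rho),$$ $$\|P_{\Omega,\alpha}\,\mathrm{Op}_{\alpha,t}(a)\,(I-P_{\Omega,\alpha})\|_{\mathfrak S_q}\le C_q\,(\alpha\ell\rho)^{\frac{d-1}{q}}\,\mathsf N^{(m,n)}(a;\ell,\rho),$$ where the second estimate is regarded as trivial (right-hand side $+\infty$) if $a\notin\mathbf S^{(m,n)}$. The constant $C_q$ depends only on $d,q,\ell_0$ and, for $d\ge2$, on $M$; it is independent of $a,\mathbf u,\boldsymbol\mu,\alpha,\ell,\rho$.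
   Context: $[\,\cdot\,]$ is the integer part; $B(\mathbf u,r)$ is the open ball of radius $r$ centred at $\mathbf u$; $I$ is the identity operator. For $0<q<\infty$, $\mathfrak S_q$ is the set of compact operators $A$ on a Hilbert space (here $L^2(\mathbb R^d)$) with singular values $s_k(A)$ such that $\|A\|_{\mathfrak S_q}=(\sum_k s_k(A)^q)^{1/q}<\infty$. Basic domains: for $d\ge2$, $\Lambda\subset\mathbb R^d$ is a basic domain if, with a suitable choice of Cartesian coordinates $\mathbf x=(\hat{\mathbf x},x_d)$, $\hat{\mathbf x}\in\mathbb R^{d-1}$, one has $\Lambda=\{\mathbf x: x_d>\Phi(\hat{\mathbf x})\}$ with a function $\Phi$ having finite Lipschitz constant $M_\Phi=\sup_{\hat{\mathbf x}\ne\hat{\mathbf y}}|\Phi(\hat{\mathbf x})-\Phi(\hat{\mathbf y})|/|\hat{\mathbf x}-\hat{\mathbf y}|$. The coordinates for $\Lambda$ and $\Omega$ may differ. For $d=1$ a basic domain is $(-\infty,0)$ or $(0,\infty)$. For a symbol $a(\mathbf x,\boldsymbol\xi)$, $\alpha>0$, $t\in[0,1]$: $(\mathrm{Op}_{\alpha,t}(a)u)(\mathbf x)=\big(\frac{\alpha}{2\pi}\big)^d\iint e^{i\alpha(\mathbf x-\mathbf y)\cdot\boldsymbol\xi}a((1-t)\mathbf x+t\mathbf y,\boldsymbol\xi)u(\mathbf y)\,d\mathbf y\,d\boldsymbol\xi$ for Schwartz $u$ (and extended to $L^2$); if $a$ depends only on $\boldsymbol\xi$ this is independent of $t$ and denoted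 $\mathrm{Op}_\alpha(a)$. $\chi_\Lambda$ is (multiplication by) the characteristic function of $\Lambda$ and $P_{\Omega,\alpha}=\mathrm{Op}_\alpha(\chi_\Omega)$, $\chi_\Omega=\chi_\Omega(\boldsymbol\xi)$. For $\ell,\rho>0$, $\mathsf N^{(j,k)}(a;\ell,\rho)=\max_{0\le i\le j,\,0\le r\le k}\sup_{\mathbf w,\boldsymbol\xi}\ell^i\rho^r|\nabla_{\mathbf w}^i\nabla_{\boldsymbol\xi}^r a(\mathbf w,\boldsymbol\xi)|$, where $\nabla^i$ is the tensor of all partial derivatives of order $i$. $\mathbf S^{(j,k)}$ is the class of complex-valued functions $a$, with the derivatives involved existing and continuous, for which this norm is finite for some (equivalently all) $\ell,\rho>0$. *)

theory Defs
  imports "HOL-Analysis.Analysis"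
begin

definition square_integrable :: "('a::euclidean_space \<Rightarrow> complex) \<Rightarrow> bool" where
  "square_integrable f \<longleftrightarrow>
     f \<in> borel_measurable lborel \<and> integrable lborel (\<lambda>x. (cmod (f x))\<^sup>2)"

definition L2_rel :: "('a::euclidean_space \<Rightarrow> complex) \<Rightarrow> ('a \<Rightarrow> complex) \<Rightarrow> bool" where
  "L2_rel f g \<longleftrightarrow> square_integrable f \<and> square_integrable g \<and> (AE x in lborel. f x = g x)"

lemma square_integrable_scale:
  assumes "square_integrable f"
  shows "square_integrable (\<lambda>x. c * f x)"
  using assms by (auto simp: square_integrable_def norm_mult power_mult_distrib)

lemma square_integrable_add:
  assumes "square_integrable f" "square_integrable g"
  shows "square_integrable (\<lambda>x. f x + g x)"
proof -
  have [measurable]: "f \<in> borel_measurable lborel" "g \<in> borel_measurable lborel"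
    using assms by (auto simp: square_integrable_def)
  have bound: "(cmod (f x + g x))\<^sup>2 \<le> 2 * (cmod (f x))\<^sup>2 + 2 * (cmod (g x))\<^sup>2" for x
  proof -
    have "(cmod (f x + g x))\<^sup>2 \<le> (cmod (f x) + cmod (g x))\<^sup>2"
      by (intro power_mono norm_triangle_ineq) auto
    also have "\<dots> \<le> 2 * (cmod (f x))\<^sup>2 + 2 * (cmod (g x))\<^sup>2"
      using sum_squares_bound[of "cmod (f x)" "cmod (g x)"]
      by (simp add: power2_sum)
    finally show ?thesis .
  qed
  have "integrable lborel (\<lambda>x. 2 * (cmod (f x))\<^sup>2 + 2 * (cmod (g x))\<^sup>2)"
    using assms by (auto simp: square_integrable_def)
  then have "integrable lborel (\<lambda>x. (cmod (f x + g x))\<^sup>2)"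
    by (rule Bochner_Integration.integrable_bound) (simp_all add: bound)
  then show ?thesis
    by (simp add: square_integrable_def)
qed

lemma square_integrable_mult_cnj:
  assumes "square_integrable f" "square_integrable g"
  shows "integrable lborel (\<lambda>x. f x * cnj (g x))"
proof -
  have [measurable]: "f \<in> borel_measurable lborel" "g \<in> borel_measurable lborel"
    using assms by (auto simp: square_integrable_def)
  have [measurable]: "cnj \<in> borel_measurable borel"
    by (rule borel_measurable_continuous_onI[OF continuous_on_cnj[OF continuous_on_id]])
  have "integrable lborel (\<lambda>x. (cmod (f x))\<^sup>2 + (cmod (g x))\<^sup>2)"
    using assms by (auto simp: square_integrable_def)
  moreover have "(\<lambda>x. f x * cnj (g x)) \<in> borel_measurable lborel"
    by measurable
  moreover have "cmod (f x * cnj (g x)) \<le> norm ((cmod (f x))\<^sup>2 + (cmod (g x))\<^sup>2)" for x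
  proof -
    have "2 * (cmod (f x) * cmod (g x)) \<le> (cmod (f x))\<^sup>2 + (cmod (g x))\<^sup>2"
      using sum_squares_bound[of "cmod (f x)" "cmod (g x)"] by simp
    moreover have "0 \<le> cmod (f x) * cmod (g x)" by simp
    ultimately show ?thesis
      unfolding norm_mult complex_mod_cnj real_norm_def by linarith
  qed
  ultimately show ?thesis
    by (rule Bochner_Integration.integrable_bound[OF _ _ AE_I2])
qed

quotient_type (overloaded) 'a L2 = "'a::euclidean_space \<Rightarrow> complex" / partial: L2_rel
proof (rule part_equivpI)
  show "\<exists>f::'a \<Rightarrow> complex. L2_rel f f"
    by (rule exI[of _ "\<lambda>_. 0"]) (simp add: L2_rel_def square_integrable_def)
  show "symp (L2_rel :: ('a \<Rightarrow> complex) \<Rightarrow> _)"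
    by (simp add: symp_def L2_rel_def eq_commute)
  show "transp (L2_rel :: ('a \<Rightarrow> complex) \<Rightarrow> _)"
  proof (rule transpI)
    fix f g h :: "'a \<Rightarrow> complex"
    assume *: "L2_rel f g" "L2_rel g h"
    then have "AE x in lborel. f x = g x" "AE x in lborel. g x = h x"
      by (simp_all only: L2_rel_def)
    then have "AE x in lborel. f x = h x"
      by eventually_elim simp
    with * show "L2_rel f h"
      by (simp only: L2_rel_def)
  qed
qed

lift_definition cinner :: "'a::euclidean_space L2 \<Rightarrow> 'a L2 \<Rightarrow> complex"
  is "\<lambda>f g. LINT x|lborel. f x * cnj (g x)"
proof -
  fix f f' g g' :: "'a \<Rightarrow> complex"
  assume f: "L2_rel f f'" and g: "L2_rel g g'"
  have "(\<lambda>x. f x * cnj (g x)) \<in> borel_measurable lborel"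
      "(\<lambda>x. f' x * cnj (g' x)) \<in> borel_measurable lborel"
    using f g by (simp_all only: L2_rel_def borel_measurable_integrable square_integrable_mult_cnj)
  moreover have "AE x in lborel. f x = f' x" "AE x in lborel. g x = g' x"
    using f g by (simp_all only: L2_rel_def)
  then have "AE x in lborel. f x * cnj (g x) = f' x * cnj (g' x)"
    by eventually_elim simp
  ultimately show "(LINT x|lborel. f x * cnj (g x)) = (LINT x|lborel. f' x * cnj (g' x))"
    by (rule integral_cong_AE)
qed

lift_definition scaleC :: "complex \<Rightarrow> 'a::euclidean_space L2 \<Rightarrow> 'a L2"
  is "\<lambda>c f x. c * f x"
proof -
  fix c :: complex and f f' :: "'a \<Rightarrow> complex"
  assume f: "L2_rel f f'"
  then have "AE x in lborel. f x = f' x"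
    by (simp only: L2_rel_def)
  then have "AE x in lborel. c * f x = c * f' x"
    by eventually_elim simp
  then show "L2_rel (\<lambda>x. c * f x) (\<lambda>x. c * f' x)"
    using f by (simp only: L2_rel_def square_integrable_scale)
qed

instantiation L2 :: (euclidean_space) real_vector
begin

lift_definition zero_L2 :: "'a L2" is "\<lambda>_. 0"
  by (simp add: L2_rel_def square_integrable_def)

lift_definition plus_L2 :: "'a L2 \<Rightarrow> 'a L2 \<Rightarrow> 'a L2" is "\<lambda>f g x. f x + g x"
proof -
  fix f f' g g' :: "'a \<Rightarrow> complex"
  assume "L2_rel f f'" "L2_rel g g'"
  moreover from this have "AE x in lborel. f x = f' x" "AE x in lborel. g x = g' x"
    by (simp_all add: L2_rel_def)
  then have "AE x in lborel. f x + g x = f' x + g' x"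
    by eventually_elim simp
  ultimately show "L2_rel (\<lambda>x. f x + g x) (\<lambda>x. f' x + g' x)"
    by (simp add: L2_rel_def square_integrable_add)
qed

definition scaleR_L2 :: "real \<Rightarrow> 'a L2 \<Rightarrow> 'a L2" where
  "scaleR_L2 r u = scaleC (complex_of_real r) u"

definition uminus_L2 :: "'a L2 \<Rightarrow> 'a L2" where
  "uminus_L2 u = scaleC (-1) u"

definition minus_L2 :: "'a L2 \<Rightarrow> 'a L2 \<Rightarrow> 'a L2" where
  "minus_L2 u v = u + - v"

instance
proof
  fix u v w :: "'a L2" and r s :: real
  show "u + v + w = u + (v + w)"
    by transfer (simp add: L2_rel_def add.assoc square_integrable_add)
  show "u + v = v + u"
    by transfer (simp add: L2_rel_def add.commute square_integrable_add)
  show "0 + u = u"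
    by transfer (auto simp: L2_rel_def)
  show "- u + u = 0"
    unfolding uminus_L2_def
    by transfer (auto simp: L2_rel_def square_integrable_def)
  show "u - v = u + - v"
    by (simp add: minus_L2_def)
  show "r *\<^sub>R (u + v) = r *\<^sub>R u + r *\<^sub>R v"
    unfolding scaleR_L2_def
    by transfer (simp add: L2_rel_def distrib_left square_integrable_add square_integrable_scale)
  show "(r + s) *\<^sub>R u = r *\<^sub>R u + s *\<^sub>R u"
    unfolding scaleR_L2_def
    by transfer (simp add: L2_rel_def distrib_right square_integrable_add square_integrable_scale)
  show "r *\<^sub>R s *\<^sub>R u = (r * s) *\<^sub>R u"
    unfolding scaleR_L2_def
    by transfer (simp add: L2_rel_def mult.assoc square_integrable_scale)
  show "1 *\<^sub>R u = u"
    unfolding scaleR_L2_def by transfer (auto simp: L2_rel_def)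
qed

end

instantiation L2 :: (euclidean_space) real_inner
begin

definition inner_L2 :: "'a L2 \<Rightarrow> 'a L2 \<Rightarrow> real" where
  "inner_L2 u v = Re (cinner u v)"

definition norm_L2 :: "'a L2 \<Rightarrow> real" where
  "norm_L2 u = sqrt (inner u u)"

definition sgn_L2 :: "'a L2 \<Rightarrow> 'a L2" where
  "sgn_L2 u = u /\<^sub>R norm u"

definition dist_L2 :: "'a L2 \<Rightarrow> 'a L2 \<Rightarrow> real" where
  "dist_L2 u v = norm (u - v)"

definition uniformity_L2 :: "('a L2 \<times> 'a L2) filter" where
  "uniformity_L2 = (INF e\<in>{0<..}. principal {(x, y). dist x y < e})"

definition open_L2 :: "'a L2 set \<Rightarrow> bool" where
  "open_L2 U \<longleftrightarrow> (\<forall>x\<in>U. eventually (\<lambda>(x', y). x' = x \<longrightarrow> y \<in> U) uniformity)"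

instance
proof
  fix u v w :: "'a L2" and r :: real
  show "dist u v = norm (u - v)"
    by (simp add: dist_L2_def)
  show "sgn u = u /\<^sub>R norm u"
    by (simp add: sgn_L2_def)
  show "uniformity = (INF e\<in>{0<..}. principal {(x::'a L2, y). dist x y < e})"
    by (simp add: uniformity_L2_def)
  show "open U \<longleftrightarrow> (\<forall>x\<in>U. eventually (\<lambda>(x', y). x' = x \<longrightarrow> y \<in> U) uniformity)" for U :: "'a L2 set"
    by (simp add: open_L2_def)
  have cnj: "cinner u v = cnj (cinner v u)" for u v :: "'a L2"
    by transfer (simp only: Bochner_Integration.integral_cnj[symmetric] complex_cnj_mult
        complex_cnj_cnj mult.commute)
  show "inner u v = inner v u"
    using cnj[of u v] by (simp add: inner_L2_def)
  have "cinner (u + v) w = cinner u w + cinner v w"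
    by transfer (simp add: L2_rel_def distrib_right square_integrable_mult_cnj)
  then show "inner (u + v) w = inner u w + inner v w"
    by (simp add: inner_L2_def)
  have "cinner (scaleC c u) v = c * cinner u v" for c
    by transfer (simp add: mult.assoc)
  then show "inner (r *\<^sub>R u) v = r * inner u v"
    by (simp add: inner_L2_def scaleR_L2_def)
  have self: "(LINT x|lborel. f x * cnj (f x)) = complex_of_real (LINT x|lborel. (cmod (f x))\<^sup>2)"
    for f :: "'a \<Rightarrow> complex"
  proof -
    have "f x * cnj (f x) = complex_of_real ((cmod (f x))\<^sup>2)" for x
      using complex_norm_square[of "f x"] by simp
    then show ?thesis
      by (simp only: integral_complex_of_real)
  qed
  have "Re (cinner u u) \<ge> 0 \<and> (Re (cinner u u) = 0 \<longleftrightarrow> u = 0)"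
  proof (transfer fixing: r)
    fix f :: "'a \<Rightarrow> complex"
    assume f: "L2_rel f f"
    have "(LINT x|lborel. (cmod (f x))\<^sup>2) = 0 \<longleftrightarrow> (AE x in lborel. (cmod (f x))\<^sup>2 = 0)"
      using f by (intro integral_nonneg_eq_0_iff_AE) (auto simp: L2_rel_def square_integrable_def)
    then show "Re (LINT x|lborel. f x * cnj (f x)) \<ge> 0 \<and>
        (Re (LINT x|lborel. f x * cnj (f x)) = 0 \<longleftrightarrow> L2_rel f (\<lambda>_. 0))"
      using f unfolding self by (auto simp: L2_rel_def square_integrable_def)
  qed
  then show "inner u u \<ge> 0" "inner u u = 0 \<longleftrightarrow> u = 0"
    by (auto simp: inner_L2_def)
  show "norm u = sqrt (inner u u)"
    by (simp add: norm_L2_def)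
qed

end

type_synonym 'a L2_op = "'a L2 \<Rightarrow>\<^sub>L 'a L2"

definition hadjoint :: "'a::euclidean_space L2_op \<Rightarrow> 'a L2_op" where
  "hadjoint A = (THE B. \<forall>u v. cinner (blinfun_apply A u) v = cinner u (blinfun_apply B v))"

definition complex_linear :: "'a::euclidean_space L2_op \<Rightarrow> bool" where
  "complex_linear A \<longleftrightarrow> (\<forall>c u. blinfun_apply A (scaleC c u) = scaleC c (blinfun_apply A u))"

definition compact_operator :: "'a::euclidean_space L2_op \<Rightarrow> bool" where
  "compact_operator A \<longleftrightarrow> complex_linear A \<and> compact (closure (blinfun_apply A ` cball 0 1))"

definition orthonormal :: "(nat \<Rightarrow> 'a::euclidean_space L2) \<Rightarrow> nat \<Rightarrow> bool" where
  "orthonormal v n \<longleftrightarrow> (\<forall>i<n. \<forall>j<n. cinner (v i) (v j) = (if i = j then 1 else 0))"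

text \<open>
  The singular values of a compact operator \<open>A\<close> are the square roots of the eigenvalues of
  \<open>A\<^sup>* A\<close>, repeated according to their multiplicity and enumerated in nonincreasing order,
  continued by zeros if there are only finitely many positive ones.  The index starts at 0, so
  \<open>singular_value A k\<close> is the largest \<open>\<sigma> > 0\<close> such that at least \<open>k + 1\<close> of them (counted with
  multiplicity, that is, with orthonormal eigenvectors) are at least \<open>\<sigma>\<close>, and it is 0 if there
  is no such \<open>\<sigma>\<close>.
\<close>

definition singular_value :: "'a::euclidean_space L2_op \<Rightarrow> nat \<Rightarrow> real" where
  "singular_value A k = Sup (insert 0 {\<sigma>. \<sigma> > 0 \<and> (\<exists>v s. orthonormal v (Suc k) \<and>
     (\<forall>i<Suc k. s i \<ge> \<sigma> \<and> blinfun_apply (hadjoint A o\<^sub>L A) (v i) = (s i)\<^sup>2 *\<^sub>R v i))})"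

definition schatten_class :: "real \<Rightarrow> 'a::euclidean_space L2_op set" where
  "schatten_class q = {A. compact_operator A \<and> summable (\<lambda>k. singular_value A k powr q)}"

definition schatten_norm :: "real \<Rightarrow> 'a::euclidean_space L2_op \<Rightarrow> real" where
  "schatten_norm q A = (\<Sum>k. singular_value A k powr q) powr (1 / q)"

definition dir_deriv :: "'v::real_normed_vector \<Rightarrow> ('v \<Rightarrow> complex) \<Rightarrow> 'v \<Rightarrow> complex" where
  "dir_deriv v f z = vector_derivative (\<lambda>s::real. f (z + s *\<^sub>R v)) (at 0)"

definition has_dir_deriv :: "'v::real_normed_vector \<Rightarrow> ('v \<Rightarrow> complex) \<Rightarrow> bool" where
  "has_dir_deriv v f \<longleftrightarrow> (\<forall>z. (\<lambda>s::real. f (z + s *\<^sub>R v)) differentiable (at 0))"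

definition partial_deriv :: "'d::finite list \<Rightarrow> (real^'d \<Rightarrow> complex) \<Rightarrow> real^'d \<Rightarrow> complex" where
  "partial_deriv I f = foldr (\<lambda>i. dir_deriv (axis i 1)) I f"

definition schwartz :: "(real^'d::finite \<Rightarrow> complex) \<Rightarrow> bool" where
  "schwartz f \<longleftrightarrow>
     (\<forall>I i. has_dir_deriv (axis i 1) (partial_deriv I f)) \<and>
     (\<forall>I (N::nat). bounded (range (\<lambda>x. (1 + norm x) ^ N *\<^sub>R partial_deriv I f x)))"

text \<open>
  A symbol is a function of the pair \<open>(w, \<xi>)\<close>.  The lists \<open>I\<close> and \<open>J\<close> hold the coordinates of
  \<open>w\<close> and \<open>\<xi>\<close>, respectively, with respect to which \<open>a\<close> is differentiated, so
  the \<open>mixed_deriv I J a\<close> with \<open>length I = i\<close> and \<open>length J = r\<close> are the components of the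
  tensor \<open>\<nabla>\<^sub>w\<^sup>i \<nabla>\<^sub>\<xi>\<^sup>r a\<close>, whose modulus is taken to be the Euclidean one.
\<close>

definition mixed_deriv ::
  "'d::finite list \<Rightarrow> 'd list \<Rightarrow> ((real^'d) \<times> (real^'d) \<Rightarrow> complex) \<Rightarrow> (real^'d) \<times> (real^'d) \<Rightarrow> complex" where
  "mixed_deriv I J a =
     foldr (\<lambda>i. dir_deriv (axis i 1, 0)) I (foldr (\<lambda>j. dir_deriv (0, axis j 1)) J a)"

definition deriv_tensor_norm ::
  "nat \<Rightarrow> nat \<Rightarrow> ((real^'d::finite) \<times> (real^'d) \<Rightarrow> complex) \<Rightarrow> (real^'d) \<times> (real^'d) \<Rightarrow> real" where
  "deriv_tensor_norm i r a z =
     sqrt (\<Sum>I | length I = i. \<Sum>J | length J = r. (cmod (mixed_deriv I J a z))\<^sup>2)"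

definition symbol_class :: "nat \<Rightarrow> nat \<Rightarrow> ((real^'d::finite) \<times> (real^'d) \<Rightarrow> complex) set" where
  "symbol_class j k = {a.
     (\<forall>J i. length J < k \<longrightarrow> has_dir_deriv (0, axis i 1) (mixed_deriv [] J a)) \<and>
     (\<forall>I J i. length I < j \<and> length J \<le> k \<longrightarrow> has_dir_deriv (axis i 1, 0) (mixed_deriv I J a)) \<and>
     (\<forall>I J. length I \<le> j \<and> length J \<le> k \<longrightarrow> continuous_on UNIV (mixed_deriv I J a)) \<and>
     (\<forall>i\<le>j. \<forall>r\<le>k. bounded (range (deriv_tensor_norm i r a)))}"

definition symbol_norm ::
  "nat \<Rightarrow> nat \<Rightarrow> ((real^'d::finite) \<times> (real^'d) \<Rightarrow> complex) \<Rightarrow> real \<Rightarrow> real \<Rightarrow> real" where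
  "symbol_norm j k a l \<rho> =
     (MAX (i, r) \<in> {..j} \<times> {..k}. SUP z. l ^ i * \<rho> ^ r * deriv_tensor_norm i r a z)"

definition Op_fun ::
  "real \<Rightarrow> real \<Rightarrow> ((real^'d::finite) \<times> (real^'d) \<Rightarrow> complex) \<Rightarrow> (real^'d \<Rightarrow> complex) \<Rightarrow> real^'d \<Rightarrow> complex" where
  "Op_fun \<alpha> t a u x = of_real ((\<alpha> / (2 * pi)) ^ CARD('d)) *
     (LINT \<xi>|lborel. LINT y|lborel.
        cis (\<alpha> * ((x - y) \<bullet> \<xi>)) * a ((1 - t) *\<^sub>R x + t *\<^sub>R y, \<xi>) * u y)"

text \<open>
  The bounded extension to \<open>L\<^sup>2\<close> of the operator given by \<open>Op_fun\<close> on Schwartz functions.  It is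
  unique because these are dense; it is automatically complex linear although \<open>L2_op\<close> only
  requires real linearity.
\<close>

definition Op :: "real \<Rightarrow> real \<Rightarrow> ((real^'d::finite) \<times> (real^'d) \<Rightarrow> complex) \<Rightarrow> (real^'d) L2_op" where
  "Op \<alpha> t a = (THE T. \<forall>u. schwartz u \<longrightarrow>
     (AE x in lborel. rep_L2 (blinfun_apply T (abs_L2 u)) x = Op_fun \<alpha> t a u x))"

definition chi_op :: "(real^'d::finite) set \<Rightarrow> (real^'d) L2_op" where
  "chi_op S = Blinfun (\<lambda>u. abs_L2 (\<lambda>x. indicator S x * rep_L2 u x))"

text \<open>For a symbol depending only on \<open>\<xi>\<close> the operator does not depend on \<open>t\<close>; we take \<open>t = 0\<close>.\<close>

definition P_op :: "(real^'d::finite) set \<Rightarrow> real \<Rightarrow> (real^'d) L2_op" where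
  "P_op \<Omega> \<alpha> = Op \<alpha> 0 (\<lambda>(x, \<xi>). indicator \<Omega> \<xi>)"

text \<open>
  A choice of Cartesian coordinates \<open>x = (x', x\<^sub>d)\<close> enters only through the unit vector \<open>e\<close> of the
  last axis: \<open>x\<^sub>d = x \<bullet> e\<close>, and \<open>x'\<close> is identified with the component of \<open>x\<close> in the hyperplane
  orthogonal to \<open>e\<close>, on which \<open>\<Phi>\<close> is defined.  (A shift of the origin is absorbed by \<open>\<Phi>\<close>.)
  In dimension 1 the basic domains are the two open half-lines starting at 0, and \<open>M\<close> plays
  no role.
\<close>

definition basic_domain :: "real \<Rightarrow> (real^'d::finite) set \<Rightarrow> bool" where
  "basic_domain M \<Lambda> \<longleftrightarrow>
     (if CARD('d) = 1
      then \<exists>e. norm e = 1 \<and> \<Lambda> = {x. x \<bullet> e > 0}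
      else \<exists>e \<Phi>. norm e = 1 \<and> M-lipschitz_on {x. x \<bullet> e = 0} \<Phi> \<and>
             \<Lambda> = {x. x \<bullet> e > \<Phi> (x - (x \<bullet> e) *\<^sub>R e)})"

end

theory Submission
 imports Defs "HOL-Probability.Probability" "HOL-Computational_Algebra.Polynomial"
begin

text \<open>
 Let \<open>h = 1 / (\<alpha> \<rho>)\<close>, so that the support of the symbol in \<open>x\<close> has a radius of \<open>L = \<alpha> l \<rho>\<close> units \<open>h\<close>.  The kernel of the operator
 oscillates on the scale \<open>h\<close> and, since the symbol has \<open>m\<close> derivatives in \<open>\<xi>\<close>, decays like \<open>(|x - y| / h)\<^sup>-\<^sup>m\<close>.  If \<open>x\<close> lies in
 \<open>\<Lambda>\<close> and \<open>y\<close> outside, only points \<open>x\<close> near the boundary contribute, and \<open>\<Lambda>\<close> being the domain above a Lipschitz graph, there are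
 \<open>O(L\<^sup>d\<^sup>-\<^sup>1)\<close> cubes of side \<open>h\<close> at any given distance \<open>\<kappa> h\<close> from it.  This is the origin of the exponent \<open>(d - 1) / q\<close>.

 The Schatten norm is controlled by approximation with operators of finite rank (\<open>schatten_bound\<close>).  A cube at
 distance \<open>\<kappa> h\<close> is divided into \<open>N\<^sup>d\<close> cubes, in each of which the rows of the kernel are interpolated polynomially in \<open>x\<close>, up
 to a phase (\<open>interpolation_error\<close>).  As the symbol has \<open>n\<close> derivatives in \<open>x\<close>, the error is of order \<open>N\<^sup>-\<^sup>n (1 + \<kappa>)\<^sup>-\<^sup>m\<close>
 (\<open>row_approximation\<close>, \<open>sandwich_row_approximation\<close>).  Letting \<open>N\<^sup>d\<close> be about \<open>T / (1 + \<kappa>)\<^sup>2\<close> and summing over the layers of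
 cubes (\<open>lattice_count\<close>, \<open>boundary_layers\<close>) gives the rank \<open>O(L\<^sup>d\<^sup>-\<^sup>1 T)\<close> with an error that decays in \<open>T\<close> fast enough for the
 exponent \<open>q\<close>; here the values of \<open>n\<close> and \<open>m\<close> enter (\<open>boundary_estimate\<close>).

 The right quantization is the adjoint of a left quantization, and conjugation by the Fourier transform
 exchanges the two variables of the symbol as well as the two quantizations.  So the second estimate is the first one for the symbol with
 exchanged variables (\<open>P_op_sandwich\<close>, \<open>FT_conj_left\<close>, \<open>FT_conj_right\<close>), for which the derivatives have to be
 taken in the other order (\<open>partial_derivatives_commute\<close>).

 All this presupposes that \<open>L\<^sup>2\<close> is complete, that Schwartz functions are dense in it, and that the Fourier transform
 is unitary, which is proved from Gaussian regularization.
\<close>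

section \<open>The space of square integrable functions\<close>

lemma square_integrable_rep: "square_integrable (rep_L2 u)"
 using Quotient3_rep_reflp[OF Quotient3_L2, of u] by (simp add: L2_rel_def)

lemma abs_rep_L2 [simp]: "abs_L2 (rep_L2 u) = u"
 using Quotient3_abs_rep[OF Quotient3_L2] by auto

lemma AE_rep_abs: "square_integrable f ==> AE x in lborel. rep_L2 (abs_L2 f) x = f x"
 using Quotient3_rep_abs[OF Quotient3_L2, of f] by (simp add: L2_rel_def)

lemma abs_L2_eqI:
 assumes "square_integrable f" "square_integrable g" "AE x in lborel. f x = g x"
 shows "abs_L2 f = abs_L2 g"
 using Quotient3_rel_abs[OF Quotient3_L2, of f g] assms by (simp add: L2_rel_def)

lemma square_integrable_measurable: "square_integrable f ==> f \<in> borel_measurable borel"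
 by (simp add: square_integrable_def)

lemma rep_L2_measurable [measurable]: "rep_L2 u \<in> borel_measurable borel"
 using square_integrable_rep by (rule square_integrable_measurable)

lemma L2_eqI:
 assumes "AE x in lborel. rep_L2 u x = rep_L2 v x"
 shows "u = v"
 using abs_L2_eqI[OF square_integrable_rep square_integrable_rep assms] by simp

lemma cnj_measurable [measurable (raw)]:
 "f \<in> borel_measurable M ==> (\<lambda>x. cnj (f x)) \<in> borel_measurable M"
 by (rule measurable_compose[OF _ borel_measurable_continuous_onI[OF continuous_on_cnj[OF continuous_on_id]]])

lemma abs_L2_add:
 assumes "square_integrable f" "square_integrable g"
 shows "abs_L2 f + abs_L2 g = abs_L2 (\<lambda>x. f x + g x)"
 using assms by (simp add: plus_L2.abs_eq L2_rel_def)

lemma abs_L2_scaleC: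
 assumes "square_integrable f"
 shows "scaleC c (abs_L2 f) = abs_L2 (\<lambda>x. c * f x)"
 using assms by (simp add: scaleC.abs_eq L2_rel_def)

lemma abs_L2_zero: "abs_L2 (\<lambda>_. 0) = 0"
 by (simp add: zero_L2_def)

lemma square_integrable_zero: "square_integrable (\<lambda>_. 0)"
 by (simp add: square_integrable_def)

lemma cinner_abs:
 assumes "square_integrable f" "square_integrable g"
 shows "cinner (abs_L2 f) (abs_L2 g) = (LINT x|lborel. f x * cnj (g x))"
 using assms by (simp add: cinner.abs_eq L2_rel_def)

lemma cinner_rep: "cinner u v = (LINT x|lborel. rep_L2 u x * cnj (rep_L2 v x))"
 using cinner_abs[OF square_integrable_rep square_integrable_rep, of u v] by simp

lemma AE_rep_add: "AE x in lborel. rep_L2 (u + v) x = rep_L2 u x + rep_L2 v x"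
proof -
 have "u + v = abs_L2 (\<lambda>x. rep_L2 u x + rep_L2 v x)"
  using abs_L2_add[OF square_integrable_rep square_integrable_rep, of u v] by simp
 then show ?thesis
  by (simp add: AE_rep_abs square_integrable_add square_integrable_rep)
qed

lemma AE_rep_scaleC: "AE x in lborel. rep_L2 (scaleC c u) x = c * rep_L2 u x"
proof -
 have "scaleC c u = abs_L2 (\<lambda>x. c * rep_L2 u x)"
  using abs_L2_scaleC[OF square_integrable_rep, of c u] by simp
 then show ?thesis
  by (simp add: AE_rep_abs square_integrable_scale square_integrable_rep)
qed

lemma scaleC_of_real: "scaleC (of_real r) u = r *\<^sub>R u"
 by (simp add: scaleR_L2_def)

lemma scaleC_one [simp]: "scaleC 1 u = u"
 using scaleC_of_real[of 1 u] by simp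

lemma scaleC_zero_right [simp]: "scaleC c 0 = 0"
 by (simp flip: abs_L2_zero add: abs_L2_scaleC square_integrable_zero)

lemma scaleC_zero_left [simp]: "scaleC 0 u = 0"
 using scaleC_of_real[of 0 u] by simp

lemma scaleC_add_right: "scaleC c (u + v) = scaleC c u + scaleC c v"
 by (rule L2_eqI, use AE_rep_scaleC[of c "u+v"] AE_rep_scaleC[of c u] AE_rep_scaleC[of c v]
   AE_rep_add[of u v] AE_rep_add[of "scaleC c u" "scaleC c v"] in eventually_elim)
  (simp add: algebra_simps)

lemma scaleC_add_left: "scaleC (a + b) u = scaleC a u + scaleC b u"
 by (rule L2_eqI, use AE_rep_scaleC[of "a+b" u] AE_rep_scaleC[of a u] AE_rep_scaleC[of b u]
   AE_rep_add[of "scaleC a u" "scaleC b u"] in eventually_elim)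
  (simp add: algebra_simps)

lemma scaleC_scaleC [simp]: "scaleC a (scaleC b u) = scaleC (a * b) u"
 by (rule L2_eqI, use AE_rep_scaleC[of "a*b" u] AE_rep_scaleC[of a "scaleC b u"] AE_rep_scaleC[of b u]
   in eventually_elim) (simp add: algebra_simps)

lemma scaleC_minus1: "scaleC (-1) u = - u"
 using scaleC_of_real[of "-1" u] by simp

lemma scaleC_diff_right: "scaleC c (u - v) = scaleC c u - scaleC c v"
proof -
 have "scaleC c (- v) = - scaleC c v"
  using scaleC_scaleC[of c "-1" v] scaleC_scaleC[of "-1" c v]
  by (simp only: scaleC_minus1 mult.commute)
 then show ?thesis
  using scaleC_add_right[of c u "- v"] by (simp del: scaleC_scaleC)
qed

lemma scaleC_sum_right: "scaleC c (sum f A) = (\<Sum>i\<in>A. scaleC c (f i))"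
 by (induction A rule: infinite_finite_induct) (auto simp: scaleC_add_right)

lemma AE_rep_diff: "AE x in lborel. rep_L2 (u - v) x = rep_L2 u x - rep_L2 v x"
 using AE_rep_add[of u "- v"] AE_rep_scaleC[of "-1" v]
 by eventually_elim (simp add: scaleC_minus1)

lemma square_integrable_diff:
 "square_integrable f ==> square_integrable g ==> square_integrable (\<lambda>x. f x - g x)"
 using square_integrable_add[of f "\<lambda>x. (-1) * g x"] square_integrable_scale[of g "-1"] by simp

lemma abs_L2_diff:
 assumes "square_integrable f" "square_integrable g"
 shows "abs_L2 f - abs_L2 g = abs_L2 (\<lambda>x. f x - g x)"
 using abs_L2_add[OF assms(1) square_integrable_scale[OF assms(2), of "-1"]]
  abs_L2_scaleC[OF assms(2), of "-1"]
 by (simp add: scaleC_minus1 diff_conv_add_uminus del: add_uminus_conv_diff)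

lemma cinner_cnj: "cnj (cinner u v) = cinner v u"
 unfolding cinner_rep
 by (simp only: Bochner_Integration.integral_cnj[symmetric] complex_cnj_mult
    complex_cnj_cnj mult.commute)

lemma cinner_add_left: "cinner (u + v) w = cinner u w + cinner v w"
proof -
 have "cinner (u + v) w = (LINT x|lborel. rep_L2 u x * cnj (rep_L2 w x) + rep_L2 v x * cnj (rep_L2 w x))"
  unfolding cinner_rep
  by (rule integral_cong_AE) (use AE_rep_add[of u v] in \<open>auto simp: algebra_simps\<close>)
 also have "... = cinner u w + cinner v w"
  unfolding cinner_rep
  by (intro Bochner_Integration.integral_add square_integrable_mult_cnj square_integrable_rep)
 finally show ?thesis .
qed

lemma cinner_scaleC_left: "cinner (scaleC c u) v = c * cinner u v"
proof -
 have "cinner (scaleC c u) v = (LINT x|lborel. c * (rep_L2 u x * cnj (rep_L2 v x)))"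
  unfolding cinner_rep
  by (rule integral_cong_AE) (use AE_rep_scaleC[of c u] in \<open>auto simp: algebra_simps\<close>)
 then show ?thesis by (simp add: cinner_rep)
qed

lemma cinner_add_right: "cinner u (v + w) = cinner u v + cinner u w"
 by (metis cinner_add_left cinner_cnj complex_cnj_add)

lemma cinner_scaleC_right: "cinner u (scaleC c v) = cnj c * cinner u v"
 by (metis cinner_scaleC_left cinner_cnj complex_cnj_mult)

lemma cinner_minus_left: "cinner (- u) v = - cinner u v"
 using cinner_scaleC_left[of "-1" u v] by (simp add: scaleC_minus1)

lemma cinner_minus_right: "cinner u (- v) = - cinner u v"
 using cinner_scaleC_right[of u "-1" v] by (simp add: scaleC_minus1)

lemma cinner_diff_left: "cinner (u - v) w = cinner u w - cinner v w"
 using cinner_add_left[of u "- v" w] by (simp add: cinner_minus_left)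

lemma cinner_diff_right: "cinner u (v - w) = cinner u v - cinner u w"
 using cinner_add_right[of u v "- w"] by (simp add: cinner_minus_right)

lemma cinner_zero_left [simp]: "cinner 0 v = 0"
 using cinner_scaleC_left[of 0 0 v] by simp

lemma cinner_zero_right [simp]: "cinner v 0 = 0"
 using cinner_scaleC_right[of v 0 0] by simp

lemma cinner_scaleR_left: "cinner (r *\<^sub>R u) v = of_real r * cinner u v"
 using cinner_scaleC_left[of "of_real r" u v] by (simp add: scaleC_of_real)

lemma cinner_scaleR_right: "cinner u (r *\<^sub>R v) = of_real r * cinner u v"
 using cinner_scaleC_right[of u "of_real r" v] by (simp add: scaleC_of_real)

lemma cinner_sum_left: "cinner (sum f A) v = (\<Sum>i\<in>A. cinner (f i) v)"
 by (induction A rule: infinite_finite_induct) (auto simp: cinner_add_left)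

lemma cinner_sum_right: "cinner v (sum f A) = (\<Sum>i\<in>A. cinner v (f i))"
 by (induction A rule: infinite_finite_induct) (auto simp: cinner_add_right)

lemma cinner_self: "cinner u u = of_real ((norm u)\<^sup>2)"
proof -
 have "Im (cinner u u) = 0"
  using cinner_cnj[of u u] by (metis complex_cnj_cancel_iff cnj.simps(2) add.inverse_neutral
    equal_neg_zero)
 moreover have "Re (cinner u u) = (norm u)\<^sup>2"
  by (simp add: norm_L2_def inner_L2_def[symmetric])
 ultimately show ?thesis by (simp add: complex_eq_iff)
qed

lemma norm_L2_sq: "(norm u)\<^sup>2 = (LINT x|lborel. (cmod (rep_L2 u x))\<^sup>2)"
proof -
 have "of_real ((norm u)\<^sup>2) = (LINT x|lborel. complex_of_real ((cmod (rep_L2 u x))\<^sup>2))"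
  unfolding cinner_self[symmetric] cinner_rep by (simp only: complex_norm_square)
 then show ?thesis by (simp only: integral_complex_of_real of_real_eq_iff)
qed

lemma norm_abs_L2_sq:
 assumes "square_integrable f"
 shows "(norm (abs_L2 f))\<^sup>2 = (LINT x|lborel. (cmod (f x))\<^sup>2)"
 unfolding norm_L2_sq
 by (rule integral_cong_AE) (use AE_rep_abs[OF assms] square_integrable_measurable[OF assms] in auto)

lemma nn_norm_abs_L2:
 assumes "square_integrable f"
 shows "(\<integral>\<^sup>+x. ennreal ((cmod (f x))\<^sup>2) \<partial>lborel) = ennreal ((norm (abs_L2 f))\<^sup>2)"
 unfolding norm_abs_L2_sq[OF assms]
 by (rule nn_integral_eq_integral) (use assms in \<open>auto simp: square_integrable_def\<close>)

lemma square_integrable_nnI: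
 assumes "f \<in> borel_measurable borel" "(\<integral>\<^sup>+x. ennreal ((cmod (f x))\<^sup>2) \<partial>lborel) < \<infinity>"
 shows "square_integrable f"
 using assms by (auto simp: square_integrable_def integrable_iff_bounded)

lemma norm_scaleC: "norm (scaleC c u) = cmod c * norm u"
proof -
 have "complex_of_real ((norm (scaleC c u))\<^sup>2) = of_real ((cmod c * norm u)\<^sup>2)"
  unfolding cinner_self[symmetric] cinner_scaleC_left cinner_scaleC_right
  by (simp add: cinner_self power_mult_distrib complex_norm_square[of c] mult_ac flip: of_real_power)
 then show ?thesis
  by (simp only: of_real_eq_iff) (simp add: power2_eq_iff_nonneg)
qed

lemma Cauchy_Schwarz_cinner: "cmod (cinner u v) \<le> norm u * norm v"
proof (cases "cinner u v = 0")
 case False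
 define w where "w = cnj (cinner u v) / cmod (cinner u v)"
 have w: "cmod w = 1" using False by (simp add: w_def norm_divide)
 have "cinner (scaleC w u) v = cmod (cinner u v)"
  using False by (simp add: cinner_scaleC_left w_def field_simps complex_norm_square[symmetric] power2_eq_square)
 then have "cmod (cinner u v) = inner (scaleC w u) v"
  by (simp add: inner_L2_def)
 also have "... \<le> norm (scaleC w u) * norm v" by (rule norm_cauchy_schwarz)
 finally show ?thesis by (simp add: norm_scaleC w)
qed simp

lemma cinner_eqI:
 assumes "\<And>u. cinner u v = cinner u w"
 shows "v = w"
proof -
 have "cinner (v - w) (v - w) = 0"
  using assms[of "v - w"] by (simp add: cinner_diff_right)
 then show ?thesis by (simp add: cinner_self)
qed

lemma bounded_linear_cinner_left: "bounded_linear (\<lambda>u. cinner u v)"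
 by (rule bounded_linear_intro[where K = "norm v"])
  (auto simp: cinner_add_left cinner_scaleR_left scaleR_conv_of_real Cauchy_Schwarz_cinner)

lemma tendsto_cinner_left: "(f \<longlongrightarrow> a) F ==> ((\<lambda>x. cinner (f x) v) \<longlongrightarrow> cinner a v) F"
 by (rule bounded_linear.tendsto[OF bounded_linear_cinner_left])

lemma tendsto_cinner_right: "(f \<longlongrightarrow> a) F ==> ((\<lambda>x. cinner v (f x)) \<longlongrightarrow> cinner v a) F"
 using tendsto_cnj[OF tendsto_cinner_left, of f a F v] by (simp add: cinner_cnj)

text \<open>
 Along a subsequence with \<open>\<parallel>f\<^sub>n\<^sub>+\<^sub>1 - f\<^sub>n\<parallel> < 2\<^sup>-\<^sup>n\<close> the sum of \<open>2\<^sup>n |f\<^sub>n\<^sub>+\<^sub>1 - f\<^sub>n|\<^sup>2\<close> has a finite integral,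
 so that almost everywhere the increments are dominated by a geometric sequence and \<open>f\<^sub>n\<close>
 converges pointwise; Fatou's lemma makes the pointwise limit the limit in the norm.
\<close>

lemma L2_Cauchy_convergent:
 fixes X :: "nat => 'a::euclidean_space L2"
 assumes X: "Cauchy X"
 shows "convergent X"
proof -
 have "\<exists>r. strict_mono r \<and> (\<forall>n. norm (X (r (Suc n)) - X (r n)) < (1/2) ^ n)"
 proof -
  have "\<exists>M. \<forall>i\<ge>M. \<forall>j\<ge>M. norm (X i - X j) < (1/2) ^ n" for n
   using X by (auto simp: Cauchy_iff)
  then obtain M where M: "\<And>n i j. i \<ge> M n ==> j \<ge> M n ==> norm (X i - X j) < (1/2) ^ n"
   by metis
  define r where "r = rec_nat (M 0) (\<lambda>n k. max (Suc k) (M (Suc n)))"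
  have r0: "r 0 = M 0" and rS: "r (Suc n) = max (Suc (r n)) (M (Suc n))" for n
   by (auto simp: r_def)
  have rM: "r n \<ge> M n" for n by (cases n) (auto simp: r0 rS)
  have "strict_mono r" unfolding strict_mono_Suc_iff by (simp add: rS less_max_iff_disj)
  moreover have "norm (X (r (Suc n)) - X (r n)) < (1/2) ^ n" for n
   using rM[of n] by (intro M) (auto simp: rS)
  ultimately show ?thesis by blast
 qed
 then obtain r where r: "strict_mono r" "\<And>n. norm (X (r (Suc n)) - X (r n)) < (1/2) ^ n" by blast
 define f where "f n = rep_L2 (X (r n))" for n
 have f [measurable]: "f n \<in> borel_measurable borel" for n by (simp add: f_def)
 define g where "g n x = f (Suc n) x - f n x" for n x
 have g [measurable]: "g n \<in> borel_measurable borel" for n by (simp add: g_def[abs_def])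
 have gi: "(\<integral>\<^sup>+x. ennreal ((cmod (g n x))\<^sup>2) \<partial>lborel) \<le> ennreal ((1/4) ^ n)" for n
 proof -
  have "square_integrable (g n)"
   unfolding g_def f_def by (intro square_integrable_diff square_integrable_rep)
  moreover have "abs_L2 (g n) = X (r (Suc n)) - X (r n)"
   unfolding g_def f_def by (subst abs_L2_diff[symmetric]) (auto intro: square_integrable_rep)
  moreover have "(norm (X (r (Suc n)) - X (r n)))\<^sup>2 \<le> (1/4) ^ n"
   using power_mono[OF less_imp_le[OF r(2)[of n]], of 2]
   by (simp add: power2_eq_square flip: power_mult_distrib)
  ultimately show ?thesis
   by (simp add: nn_norm_abs_L2 ennreal_leI)
 qed
 have "AE x in lborel. (\<Sum>n. ennreal (2 ^ n * (cmod (g n x))\<^sup>2)) \<noteq> \<infinity>"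
 proof (rule nn_integral_PInf_AE)
  have "(\<integral>\<^sup>+x. (\<Sum>n. ennreal (2 ^ n * (cmod (g n x))\<^sup>2)) \<partial>lborel)
    = (\<Sum>n. \<integral>\<^sup>+x. ennreal (2 ^ n * (cmod (g n x))\<^sup>2) \<partial>lborel)"
   by (rule nn_integral_suminf) auto
  also have "... \<le> (\<Sum>n. ennreal ((1/2) ^ n))"
  proof (rule suminf_le)
   fix n
   have "(\<integral>\<^sup>+x. ennreal (2 ^ n * (cmod (g n x))\<^sup>2) \<partial>lborel)
     = ennreal (2 ^ n) * (\<integral>\<^sup>+x. ennreal ((cmod (g n x))\<^sup>2) \<partial>lborel)"
    by (subst nn_integral_cmult[symmetric]) (auto simp: ennreal_mult)
   also have "... \<le> ennreal (2 ^ n) * ennreal ((1/4) ^ n)"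
    by (intro mult_left_mono gi) auto
   also have "... = ennreal ((1/2) ^ n)"
    by (subst ennreal_mult[symmetric]) (auto simp flip: power_mult_distrib)
   finally show "(\<integral>\<^sup>+x. ennreal (2 ^ n * (cmod (g n x))\<^sup>2) \<partial>lborel) \<le> ennreal ((1/2) ^ n)" .
  qed auto
  also have "... < \<infinity>"
   by (subst suminf_ennreal2) (auto intro: summable_geometric)
  finally show "(\<integral>\<^sup>+x. (\<Sum>n. ennreal (2 ^ n * (cmod (g n x))\<^sup>2)) \<partial>lborel) \<noteq> \<infinity>" by simp
 qed auto
 then have conv: "AE x in lborel. convergent (\<lambda>n. f n x)"
 proof (rule eventually_mono)
  fix x assume fin: "(\<Sum>n. ennreal (2 ^ n * (cmod (g n x))\<^sup>2)) \<noteq> \<infinity>"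
  obtain C where C: "(\<Sum>n. ennreal (2 ^ n * (cmod (g n x))\<^sup>2)) = ennreal C" "C \<ge> 0"
   by (rule ennreal_cases[of "\<Sum>n. ennreal (2 ^ n * (cmod (g n x))\<^sup>2)"])
    (use fin in \<open>simp_all only: infinity_ennreal_def not_True_eq_False\<close>)
  have "cmod (g n x) \<le> sqrt C * (1 / sqrt 2) ^ n" for n
  proof -
   have "ennreal (2 ^ n * (cmod (g n x))\<^sup>2) \<le> ennreal C"
    using sum_le_suminf[OF summableI finite.insertI[OF finite.emptyI],
      of n "\<lambda>n. ennreal (2 ^ n * (cmod (g n x))\<^sup>2)"]
    unfolding C(1) by (simp only: sum.insert finite.emptyI empty_iff not_False_eq_True sum.empty add_0_right zero_le)
   then have "2 ^ n * (cmod (g n x))\<^sup>2 \<le> C" using C(2) by simp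
   then have "(cmod (g n x))\<^sup>2 \<le> C * (1/2) ^ n" by (simp add: field_simps)
   then have "sqrt ((cmod (g n x))\<^sup>2) \<le> sqrt (C * (1/2) ^ n)" by (rule real_sqrt_le_mono)
   then show ?thesis by (simp add: real_sqrt_mult real_sqrt_power real_sqrt_divide)
  qed
  moreover have "summable (\<lambda>n. sqrt C * (1 / sqrt 2) ^ n)"
   by (intro summable_mult summable_geometric) (auto simp: real_less_lsqrt)
  ultimately have "summable (\<lambda>n. g n x)"
   by (intro summable_comparison_test'[of "\<lambda>n. sqrt C * (1 / sqrt 2) ^ n" 0 "\<lambda>n. g n x"])
  then have "convergent (\<lambda>n. \<Sum>i<n. g i x)" by (simp add: summable_iff_convergent)
  moreover have "(\<Sum>i<n. g i x) = f n x - f 0 x" for n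
   unfolding g_def by (rule sum_lessThan_telescope)
  ultimately have "convergent (\<lambda>n. f n x - f 0 x)" by simp
  then have "convergent (\<lambda>n. (f n x - f 0 x) + f 0 x)" by (intro convergent_add convergent_const)
  then show "convergent (\<lambda>n. f n x)" by simp
 qed
 define F where "F x = lim (\<lambda>n. f n x)" for x
 have F [measurable]: "F \<in> borel_measurable borel"
  unfolding F_def by (rule borel_measurable_lim_metric) simp
 have Fl: "AE x in lborel. (\<lambda>n. f n x) \<longlonglongrightarrow> F x"
  using conv by eventually_elim (simp add: F_def convergent_LIMSEQ_iff)
 have bound: "(\<integral>\<^sup>+x. ennreal ((cmod (F x - rep_L2 (X k) x))\<^sup>2) \<partial>lborel) \<le> ennreal (e\<^sup>2)"
  if N: "\<And>i j. i \<ge> N ==> j \<ge> N ==> norm (X i - X j) < e" and k: "k \<ge> N" for N k e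
 proof -
  have "(\<integral>\<^sup>+x. ennreal ((cmod (F x - rep_L2 (X k) x))\<^sup>2) \<partial>lborel)
    = (\<integral>\<^sup>+x. liminf (\<lambda>n. ennreal ((cmod (f n x - rep_L2 (X k) x))\<^sup>2)) \<partial>lborel)"
  proof (rule nn_integral_cong_AE, use Fl in eventually_elim)
   case (elim x)
   then have "(\<lambda>n. ennreal ((cmod (f n x - rep_L2 (X k) x))\<^sup>2)) \<longlonglongrightarrow> ennreal ((cmod (F x - rep_L2 (X k) x))\<^sup>2)"
    by (intro tendsto_intros tendsto_ennrealI)
   then show ?case by (rule lim_imp_Liminf[OF sequentially_bot, symmetric])
  qed
  also have "... \<le> liminf (\<lambda>n. (\<integral>\<^sup>+x. ennreal ((cmod (f n x - rep_L2 (X k) x))\<^sup>2) \<partial>lborel))"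
   by (rule nn_integral_liminf) auto
  also have "... \<le> ennreal (e\<^sup>2)"
  proof (rule order_trans[OF Liminf_mono Liminf_const[THEN eq_refl]])
   show "\<forall>\<^sub>F n in sequentially. (\<integral>\<^sup>+x. ennreal ((cmod (f n x - rep_L2 (X k) x))\<^sup>2) \<partial>lborel) \<le> ennreal (e\<^sup>2)"
   proof (rule eventually_sequentiallyI[of N])
    fix n assume "n \<ge> N"
    then have rn: "r n \<ge> N" using strict_mono_imp_increasing[OF r(1), of n] by simp
    have "(\<integral>\<^sup>+x. ennreal ((cmod (f n x - rep_L2 (X k) x))\<^sup>2) \<partial>lborel) = ennreal ((norm (X (r n) - X k))\<^sup>2)"
     unfolding f_def
     by (subst nn_norm_abs_L2) (auto intro!: square_integrable_diff square_integrable_rep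
       simp: abs_L2_diff[symmetric] square_integrable_rep)
    also have "... \<le> ennreal (e\<^sup>2)"
     using less_imp_le[OF N[OF rn k]] by (intro ennreal_leI power_mono) auto
    finally show "(\<integral>\<^sup>+x. ennreal ((cmod (f n x - rep_L2 (X k) x))\<^sup>2) \<partial>lborel) \<le> ennreal (e\<^sup>2)" .
   qed
  qed simp
  finally show ?thesis .
 qed
 obtain N1 where N1: "\<And>i j. i \<ge> N1 ==> j \<ge> N1 ==> norm (X i - X j) < 1"
  using X unfolding Cauchy_iff by (metis zero_less_one)
 have "square_integrable (\<lambda>x. F x - rep_L2 (X N1) x)"
  by (rule square_integrable_nnI)
   (use le_less_trans[OF bound[OF N1, of N1] ennreal_less_top] in \<open>simp_all\<close>)
 then have "square_integrable (\<lambda>x. (F x - rep_L2 (X N1) x) + rep_L2 (X N1) x)"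
  by (intro square_integrable_add square_integrable_rep)
 then have Fs: "square_integrable F" by simp
 have "X \<longlonglongrightarrow> abs_L2 F"
 proof (rule metric_LIMSEQ_I)
  fix e :: real assume e: "e > 0"
  then obtain N where N: "\<And>i j. i \<ge> N ==> j \<ge> N ==> norm (X i - X j) < e/2"
   using X unfolding Cauchy_iff by (metis half_gt_zero)
  have "dist (X k) (abs_L2 F) < e" if "k \<ge> N" for k
  proof -
   have "abs_L2 F - X k = abs_L2 (\<lambda>x. F x - rep_L2 (X k) x)"
    using abs_L2_diff[OF Fs square_integrable_rep, of "X k"] by simp
   then have "ennreal ((norm (abs_L2 F - X k))\<^sup>2) \<le> ennreal ((e/2)\<^sup>2)"
    using bound[of N "e/2" k, OF N that]
    by (simp only: nn_norm_abs_L2[OF square_integrable_diff[OF Fs square_integrable_rep]])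
   then have "norm (abs_L2 F - X k) \<le> e/2"
    using e by (subst (asm) ennreal_le_iff) (auto intro: power2_le_imp_le)
   then show ?thesis using e by (simp add: dist_norm norm_minus_commute)
  qed
  then show "\<exists>N. \<forall>k\<ge>N. dist (X k) (abs_L2 F) < e" by blast
 qed
 then show ?thesis by (auto simp: convergent_def)
qed

instance L2 :: (euclidean_space) banach
 by standard (rule L2_Cauchy_convergent)

section \<open>Singular values and approximation by finite rank operators\<close>

definition is_adjoint :: "'a::euclidean_space L2_op => 'a L2_op => bool" where
 "is_adjoint A B \<longleftrightarrow> (\<forall>u v. cinner (blinfun_apply A u) v = cinner u (blinfun_apply B v))"

lemma is_adjointD: "is_adjoint A B ==> cinner (blinfun_apply A u) v = cinner u (blinfun_apply B v)"
 by (simp add: is_adjoint_def)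

lemma is_adjoint_sym: "is_adjoint A B ==> is_adjoint B A"
 unfolding is_adjoint_def by (metis cinner_cnj)

lemma is_adjoint_compose:
 "is_adjoint A A' ==> is_adjoint B B' ==> is_adjoint (A o\<^sub>L B) (B' o\<^sub>L A')"
 by (simp add: is_adjoint_def)

lemma hadjoint_eq:
 assumes "is_adjoint A B"
 shows "hadjoint A = B"
 unfolding hadjoint_def
proof (rule the_equality)
 show "\<forall>u v. cinner (blinfun_apply A u) v = cinner u (blinfun_apply B v)"
  using assms by (simp add: is_adjoint_def)
next
 fix C assume "\<forall>u v. cinner (blinfun_apply A u) v = cinner u (blinfun_apply C v)"
 then show "C = B"
  using assms by (intro blinfun_eqI cinner_eqI) (simp add: is_adjoint_def)
qed

lemma is_adjoint_complex_linear:
 assumes "is_adjoint A B"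
 shows "complex_linear A"
proof -
 have "blinfun_apply A (scaleC c u) = scaleC c (blinfun_apply A u)" for c u
  by (rule cinner_eqI)
   (simp only: cinner_scaleC_right is_adjointD[OF is_adjoint_sym[OF assms], symmetric])
 then show ?thesis by (simp add: complex_linear_def)
qed

definition proj :: "(nat => 'a::euclidean_space L2) => nat => 'a L2 => 'a L2" where
 "proj f r y = (\<Sum>j<r. scaleC (cinner y (f j)) (f j))"

lemma proj_add: "proj f r (x + y) = proj f r x + proj f r y"
 by (simp add: proj_def cinner_add_left scaleC_add_left sum.distrib)

lemma proj_scaleC: "proj f r (scaleC c x) = scaleC c (proj f r x)"
 by (simp add: proj_def cinner_scaleC_left scaleC_sum_right)

lemma proj_scaleR: "proj f r (t *\<^sub>R x) = t *\<^sub>R (proj f r x)"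
 using proj_scaleC[of f r "of_real t" x] by (simp add: scaleC_of_real)

lemma proj_diff: "proj f r (x - y) = proj f r x - proj f r y"
 using proj_add[of f r x "- y"] proj_scaleR[of f r "-1" y] by simp

lemma proj_zero [simp]: "proj f r 0 = 0"
 by (simp add: proj_def)

lemma proj_sum: "proj f r (sum g A) = (\<Sum>i\<in>A. proj f r (g i))"
 by (induction A rule: infinite_finite_induct) (auto simp: proj_add)

lemma cinner_proj_left: "cinner (proj f r x) y = cinner x (proj f r y)"
 by (simp add: proj_def cinner_sum_left cinner_sum_right cinner_scaleC_left cinner_scaleC_right
   cinner_cnj mult.commute)

lemma orthonormalD: "orthonormal f r ==> i < r ==> j < r ==> cinner (f i) (f j) = (if i = j then 1 else 0)"
 by (simp add: orthonormal_def)

lemma orthonormal_norm: "orthonormal f r ==> i < r ==> norm (f i) = 1"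
 using cinner_self[of "f i"] orthonormalD[of f r i i] norm_ge_zero[of "f i"]
 by (simp add: power2_eq_1_iff del: of_real_power norm_ge_zero)

lemma cinner_proj_basis:
 assumes "orthonormal f r" "i < r"
 shows "cinner (proj f r y) (f i) = cinner y (f i)"
proof -
 have "cinner (proj f r y) (f i) = (\<Sum>j<r. if j = i then cinner y (f j) else 0)"
  unfolding proj_def cinner_sum_left
  by (rule sum.cong) (use orthonormalD[OF assms(1) _ assms(2)] in \<open>auto simp: cinner_scaleC_left\<close>)
 then show ?thesis using assms(2) by simp
qed

lemma proj_proj: "orthonormal f r ==> proj f r (proj f r y) = proj f r y"
 by (subst (1 3) proj_def) (simp add: cinner_proj_basis)

lemma cinner_proj_self: "cinner (proj f r y) y = of_real (\<Sum>j<r. (cmod (cinner y (f j)))\<^sup>2)"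
 unfolding proj_def cinner_sum_left cinner_scaleC_left
 by (subst cinner_cnj[symmetric]) (simp add: complex_norm_square[symmetric] mult.commute)

lemma norm_diff_proj:
 assumes "orthonormal f r"
 shows "(norm (y - proj f r y))\<^sup>2 = (norm y)\<^sup>2 - (\<Sum>j<r. (cmod (cinner y (f j)))\<^sup>2)"
proof -
 have "complex_of_real ((norm (y - proj f r y))\<^sup>2) = cinner y y - cinner (proj f r y) y"
  unfolding cinner_self[symmetric] cinner_diff_left cinner_diff_right
  by (simp add: cinner_proj_left proj_proj[OF assms])
 also have "... = of_real ((norm y)\<^sup>2 - (\<Sum>j<r. (cmod (cinner y (f j)))\<^sup>2))"
  by (simp add: cinner_self cinner_proj_self)
 finally show ?thesis by (simp only: of_real_eq_iff)
qed

lemma Bessel_inequality: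
 assumes "orthonormal f r"
 shows "(\<Sum>j<r. (cmod (cinner y (f j)))\<^sup>2) \<le> (norm y)\<^sup>2"
 using norm_diff_proj[OF assms, of y] zero_le_power2[of "norm (y - proj f r y)"] by linarith

lemma norm_diff_proj_le:
 assumes "orthonormal f r"
 shows "norm (y - proj f r y) \<le> norm y"
proof (rule power2_le_imp_le)
 have "0 \<le> (\<Sum>j<r. (cmod (cinner y (f j)))\<^sup>2)" by (rule sum_nonneg) simp
 then show "(norm (y - proj f r y))\<^sup>2 \<le> (norm y)\<^sup>2"
  unfolding norm_diff_proj[OF assms] by simp
qed simp

lemma proj_best_approximation:
 assumes "orthonormal f r" "proj f r g = g"
 shows "norm (y - proj f r y) \<le> norm (y - g)"
proof -
 have "y - proj f r y = (y - g) - proj f r (y - g)"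
  unfolding proj_diff assms(2) by simp
 then have "norm (y - proj f r y) = norm ((y - g) - proj f r (y - g))" by (rule arg_cong)
 also have "... \<le> norm (y - g)" by (rule norm_diff_proj_le[OF assms(1)])
 finally show ?thesis .
qed

lemma orthonormal_basis_of_family:
 assumes "finite I"
 shows "\<exists>r f. r \<le> card I \<and> orthonormal f r \<and> (\<forall>i\<in>I. proj f r (e i) = e i)"
 using assms
proof induction
 case empty
 show ?case by (intro exI[of _ 0] exI[of _ "\<lambda>_. 0"]) (simp add: orthonormal_def)
next
 case (insert i I)
 then obtain r f where rf: "r \<le> card I" "orthonormal f r" "\<And>j. j \<in> I ==> proj f r (e j) = e j"
  by blast
 define z where "z = e i - proj f r (e i)"
 show ?case
 proof (cases "z = 0")
  case True
  then have "proj f r (e i) = e i" by (simp add: z_def)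
  then show ?thesis using rf insert.hyps by (intro exI[of _ r] exI[of _ f]) auto
 next
  case False
  define f' where "f' = f(r := z /\<^sub>R norm z)"
  have zf: "cinner z (f j) = 0" "cinner (f j) z = 0" if "j < r" for j
  proof -
   show *: "cinner z (f j) = 0"
    using that by (simp add: z_def cinner_diff_left cinner_proj_basis[OF rf(2)])
   show "cinner (f j) z = 0"
    using * cinner_cnj[of z "f j"] by simp
  qed
  have "orthonormal f' (Suc r)"
   using False zf rf(2)
   by (auto simp: orthonormal_def f'_def less_Suc_eq cinner_scaleR_left cinner_scaleR_right cinner_self
     power2_eq_square divide_simps)
  moreover have pS: "proj f' (Suc r) y = proj f r y + scaleC (cinner y z / (norm z)\<^sup>2) z" for y
  proof -
   have "proj f' (Suc r) y = proj f r y + scaleC (cinner y (z /\<^sub>R norm z)) (z /\<^sub>R norm z)"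
    by (simp add: proj_def f'_def)
   also have "scaleC (cinner y (z /\<^sub>R norm z)) (z /\<^sub>R norm z) = scaleC (cinner y z / (norm z)\<^sup>2) z"
    unfolding scaleC_of_real[symmetric] cinner_scaleC_right scaleC_scaleC
    by (simp add: field_simps power2_eq_square)
   finally show ?thesis .
  qed
  have zp: "cinner (proj f r y) z = 0" for y
   unfolding proj_def cinner_sum_left by (rule sum.neutral) (simp add: cinner_scaleC_left zf)
  have "proj f' (Suc r) (e j) = e j" if "j \<in> I" for j
   using zp[of "e j"] rf(3)[OF that] by (simp add: pS)
  moreover have "proj f' (Suc r) (e i) = e i"
  proof -
   have "cinner (e i) z = cinner z z"
    using zp[of "e i"] by (simp add: z_def cinner_diff_left)
   then have "proj f' (Suc r) (e i) = proj f r (e i) + z"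
    using False by (simp add: pS cinner_self)
   then show ?thesis by (simp add: z_def)
  qed
  ultimately show ?thesis
   using rf insert.hyps by (intro exI[of _ "Suc r"] exI[of _ f']) auto
 qed
qed

text \<open>
 \<open>rank_approx B r c\<close>: after removing a suitable \<open>r\<close>-dimensional subspace of the range, the operator
 has squared Hilbert-Schmidt norm at most \<open>c\<close>.  The latter is expressed through finite orthonormal
 systems, so that neither the trace nor an orthonormal basis of the whole space is involved.
\<close>

definition rank_approx :: "'a::euclidean_space L2_op => nat => real => bool" where
 "rank_approx B r c \<longleftrightarrow> (\<exists>f. orthonormal f r \<and> (\<forall>N v. orthonormal v N \<longrightarrow>
   (\<Sum>i<N. (norm (blinfun_apply B (v i) - proj f r (blinfun_apply B (v i))))\<^sup>2) \<le> c))"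

lemma rank_approx_nonneg:
 assumes "rank_approx B r c"
 shows "0 \<le> c"
proof -
 obtain f where "\<forall>N v. orthonormal v N \<longrightarrow>
   (\<Sum>i<N. (norm (blinfun_apply B (v i) - proj f r (blinfun_apply B (v i))))\<^sup>2) \<le> c"
  using assms unfolding rank_approx_def by blast
 from this[rule_format, of "\<lambda>_. 0" 0] show ?thesis by (simp add: orthonormal_def)
qed

lemma rank_approxI:
 assumes I: "finite I"
  and B: "\<And>N v. orthonormal v N ==>
   (\<Sum>i<N. (norm (blinfun_apply B (v i) - (\<Sum>j\<in>I. scaleC (g v i j) (e j))))\<^sup>2) \<le> c"
 shows "\<exists>r\<le>card I. rank_approx B r c"
proof -
 obtain r f where rf: "r \<le> card I" "orthonormal f r" "\<And>j. j \<in> I ==> proj f r (e j) = e j"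
  using orthonormal_basis_of_family[OF I] by blast
 have "(\<Sum>i<N. (norm (blinfun_apply B (v i) - proj f r (blinfun_apply B (v i))))\<^sup>2) \<le> c"
  if "orthonormal v N" for v N
 proof -
  have "proj f r (\<Sum>j\<in>I. scaleC (g v i j) (e j)) = (\<Sum>j\<in>I. scaleC (g v i j) (e j))" for i
   unfolding proj_sum proj_scaleC by (rule sum.cong) (auto simp: rf(3))
  then have "(\<Sum>i<N. (norm (blinfun_apply B (v i) - proj f r (blinfun_apply B (v i))))\<^sup>2)
   \<le> (\<Sum>i<N. (norm (blinfun_apply B (v i) - (\<Sum>j\<in>I. scaleC (g v i j) (e j))))\<^sup>2)"
   by (intro sum_mono power_mono proj_best_approximation[OF rf(2)]) auto
  also have "... \<le> c" by (rule B[OF that])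
  finally show ?thesis .
 qed
 then have "rank_approx B r c" using rf(2) unfolding rank_approx_def by blast
 then show ?thesis using rf(1) by blast
qed

text \<open>
 If \<open>B u\<^sub>i = s\<^sub>i w\<^sub>i\<close> with orthonormal systems \<open>u\<close> and \<open>w\<close>, the projection onto an \<open>r\<close>-dimensional space
 can absorb at most \<open>r\<close> of the total mass \<open>N\<close> of the \<open>w\<^sub>i\<close>; the rest of each is multiplied by at
 least \<open>\<sigma>\<close>.
\<close>

lemma rank_approx_count:
 assumes B: "rank_approx B r c" and u: "orthonormal u N" and w: "orthonormal w N"
  and s: "\<And>i. i < N ==> blinfun_apply B (u i) = s i *\<^sub>R w i \<and> \<sigma> \<le> s i" and "0 \<le> \<sigma>"
 shows "(real N - real r) * \<sigma>\<^sup>2 \<le> c"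
proof -
 obtain f where f: "orthonormal f r"
  and fc: "(\<Sum>i<N. (norm (blinfun_apply B (u i) - proj f r (blinfun_apply B (u i))))\<^sup>2) \<le> c"
  using B u unfolding rank_approx_def by blast
 define b where "b i j = (cmod (cinner (w i) (f j)))\<^sup>2" for i j
 have "(real N - real r) * \<sigma>\<^sup>2 \<le> \<sigma>\<^sup>2 * (\<Sum>i<N. 1 - (\<Sum>j<r. b i j))"
 proof -
  have "(\<Sum>i<N. b i j) \<le> 1" if "j < r" for j
  proof -
   have "(\<Sum>i<N. b i j) = (\<Sum>i<N. (cmod (cinner (f j) (w i)))\<^sup>2)"
    unfolding b_def by (rule sum.cong) (auto simp: cinner_cnj[of "f j", symmetric])
   also have "... \<le> (norm (f j))\<^sup>2" by (rule Bessel_inequality[OF w])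
   finally show ?thesis using orthonormal_norm[OF f that] by simp
  qed
  then have "(\<Sum>j<r. \<Sum>i<N. b i j) \<le> (\<Sum>j<r. 1)" by (intro sum_mono) auto
  then have "real N - real r \<le> (\<Sum>i<N. 1 - (\<Sum>j<r. b i j))"
   unfolding sum_subtractf sum.swap[of b] by simp
  then have "\<sigma>\<^sup>2 * (real N - real r) \<le> \<sigma>\<^sup>2 * (\<Sum>i<N. 1 - (\<Sum>j<r. b i j))"
   by (rule mult_left_mono) simp
  then show ?thesis by (simp only: mult.commute)
 qed
 also have "... = (\<Sum>i<N. \<sigma>\<^sup>2 * (1 - (\<Sum>j<r. b i j)))" by (rule sum_distrib_left)
 also have "... \<le> (\<Sum>i<N. (norm (blinfun_apply B (u i) - proj f r (blinfun_apply B (u i))))\<^sup>2)"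
 proof (rule sum_mono)
  fix i assume "i \<in> {..<N}"
  then have i: "i < N" by simp
  have eq: "(norm (blinfun_apply B (u i) - proj f r (blinfun_apply B (u i))))\<^sup>2 = (s i)\<^sup>2 * (1 - (\<Sum>j<r. b i j))"
   using s[OF i] norm_diff_proj[OF f, of "w i"] orthonormal_norm[OF w i]
   by (simp add: proj_scaleR b_def scaleR_diff_right[symmetric] power_mult_distrib)
  have "(\<Sum>j<r. b i j) \<le> 1"
   using Bessel_inequality[OF f, of "w i"] orthonormal_norm[OF w i] by (simp add: b_def)
  then show "\<sigma>\<^sup>2 * (1 - (\<Sum>j<r. b i j)) \<le> (norm (blinfun_apply B (u i) - proj f r (blinfun_apply B (u i))))\<^sup>2"
   unfolding eq using s[OF i] \<open>0 \<le> \<sigma>\<close> by (intro mult_right_mono power_mono) auto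
 qed
 also note fc
 finally show ?thesis .
qed

definition singular_candidate :: "'a::euclidean_space L2_op => nat => real => bool" where
 "singular_candidate A k \<sigma> \<longleftrightarrow> \<sigma> > 0 \<and> (\<exists>v s. orthonormal v (Suc k) \<and>
   (\<forall>i<Suc k. s i \<ge> \<sigma> \<and> blinfun_apply (hadjoint A o\<^sub>L A) (v i) = (s i)\<^sup>2 *\<^sub>R v i))"

lemma singular_value_candidate: "singular_value A k = Sup (insert 0 {\<sigma>. singular_candidate A k \<sigma>})"
 by (simp add: singular_value_def singular_candidate_def)

lemma singular_candidate_vectors:
 assumes adj: "is_adjoint A A'" and "singular_candidate A k \<sigma>"
 obtains u w s where "orthonormal u (Suc k)" "orthonormal w (Suc k)" "\<sigma> > 0"
  "\<And>i. i < Suc k ==> blinfun_apply A (u i) = s i *\<^sub>R w i \<and> blinfun_apply A' (w i) = s i *\<^sub>R u i \<and> \<sigma> \<le> s i"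
proof -
 obtain v s where \<sigma>: "\<sigma> > 0" and v: "orthonormal v (Suc k)" and s: "\<And>i. i < Suc k ==> \<sigma> \<le> s i"
  and e: "\<And>i. i < Suc k ==> blinfun_apply A' (blinfun_apply A (v i)) = (s i)\<^sup>2 *\<^sub>R v i"
  using assms(2) unfolding singular_candidate_def hadjoint_eq[OF adj] by auto
 have s0: "s i > 0" if "i < Suc k" for i using s[OF that] \<sigma> by simp
 define w where "w i = blinfun_apply A (v i) /\<^sub>R s i" for i
 have "cinner (blinfun_apply A (v i)) (blinfun_apply A (v j)) = of_real ((s j)\<^sup>2) * (if i = j then 1 else 0)"
  if "i < Suc k" "j < Suc k" for i j
  unfolding is_adjointD[OF adj] e[OF that(2)] cinner_scaleR_right orthonormalD[OF v that] ..
 then have "orthonormal w (Suc k)"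
  unfolding orthonormal_def w_def
  using less_imp_neq[OF s0] by (auto simp: cinner_scaleR_left cinner_scaleR_right power2_eq_square field_simps)
 moreover have "blinfun_apply A (v i) = s i *\<^sub>R w i" "blinfun_apply A' (w i) = s i *\<^sub>R v i" if "i < Suc k" for i
  using s0[OF that] e[OF that] by (auto simp: w_def blinfun.scaleR_right power2_eq_square)
 ultimately show ?thesis using that[of v w s] v \<sigma> s by blast
qed

lemma singular_candidate_le_norm:
 assumes "is_adjoint A A'" "singular_candidate A k \<sigma>"
 shows "\<sigma> \<le> norm A"
proof -
 obtain u w s where *: "orthonormal u (Suc k)" "orthonormal w (Suc k)" "\<sigma> > 0"
  "\<And>i. i < Suc k ==> blinfun_apply A (u i) = s i *\<^sub>R w i \<and> blinfun_apply A' (w i) = s i *\<^sub>R u i \<and> \<sigma> \<le> s i"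
  using singular_candidate_vectors[OF assms] by metis
 have "norm (blinfun_apply A (u 0)) = \<bar>s 0\<bar>"
  using *(4)[of 0] orthonormal_norm[OF *(2), of 0] by simp
 moreover have "norm (blinfun_apply A (u 0)) \<le> norm A * norm (u 0)" by (rule norm_blinfun)
 ultimately show ?thesis
  using *(3) *(4)[of 0] orthonormal_norm[OF *(1), of 0] orthonormal_norm[OF *(2), of 0] by auto
qed

lemma singular_value_nonneg:
 assumes "is_adjoint A A'"
 shows "0 \<le> singular_value A k"
 unfolding singular_value_candidate
proof (rule cSup_upper)
 show "bdd_above (insert 0 {\<sigma>. singular_candidate A k \<sigma>})"
  by (rule bdd_aboveI[of _ "norm A"]) (auto dest: singular_candidate_le_norm[OF assms])
qed simp

lemma singular_value_rank_approx:
 assumes adj: "is_adjoint A A'" and B: "B \<in> {A, A'}" "rank_approx B r c" and r: "r < Suc k"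
 shows "(singular_value A k)\<^sup>2 \<le> c / (real (Suc k) - real r)"
proof -
 have pos: "real (Suc k) - real r > 0" using r by linarith
 have "\<sigma> \<le> sqrt (c / (real (Suc k) - real r))" if cand: "singular_candidate A k \<sigma>" for \<sigma>
 proof -
  obtain u w s where *: "orthonormal u (Suc k)" "orthonormal w (Suc k)" "\<sigma> > 0"
   "\<And>i. i < Suc k ==> blinfun_apply A (u i) = s i *\<^sub>R w i \<and> blinfun_apply A' (w i) = s i *\<^sub>R u i \<and> \<sigma> \<le> s i"
   using singular_candidate_vectors[OF adj cand] by metis
  have "(real (Suc k) - real r) * \<sigma>\<^sup>2 \<le> c"
  proof (cases "B = A")
   case True
   then show ?thesis
    using rank_approx_count[OF B(2) *(1) *(2), of s \<sigma>] * by auto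
  next
   case False
   then show ?thesis
    using rank_approx_count[OF B(2) *(2) *(1), of s \<sigma>] * B by auto
  qed
  then have "\<sigma>\<^sup>2 \<le> c / (real (Suc k) - real r)" using pos by (simp add: field_simps)
  then show ?thesis by (rule real_le_rsqrt)
 qed
 moreover have "0 \<le> c / (real (Suc k) - real r)"
  using rank_approx_nonneg[OF B(2)] pos by simp
 ultimately have "singular_value A k \<le> sqrt (c / (real (Suc k) - real r))"
  unfolding singular_value_candidate by (intro cSup_least) auto
 then have "(singular_value A k)\<^sup>2 \<le> (sqrt (c / (real (Suc k) - real r)))\<^sup>2"
  using singular_value_nonneg[OF adj] by (intro power_mono) auto
 then show ?thesis using \<open>0 \<le> c / _\<close> by simp
qed

lemma rank_approx_operator_norm:
 assumes "rank_approx B r c"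
 obtains f where "orthonormal f r"
  "\<And>v. norm (blinfun_apply B v - proj f r (blinfun_apply B v)) \<le> sqrt c * norm v"
proof -
 obtain f where f: "orthonormal f r"
  and fc: "\<And>N v. orthonormal v N ==> (\<Sum>i<N. (norm (blinfun_apply B (v i) - proj f r (blinfun_apply B (v i))))\<^sup>2) \<le> c"
  using assms unfolding rank_approx_def by blast
 have "norm (blinfun_apply B v - proj f r (blinfun_apply B v)) \<le> sqrt c * norm v" for v
 proof (cases "v = 0")
  case False
  define w where "w = v /\<^sub>R norm v"
  have "orthonormal (\<lambda>_. w) 1"
   using False by (simp add: orthonormal_def w_def cinner_scaleR_left cinner_scaleR_right cinner_self power2_eq_square)
  from fc[OF this] have "norm (blinfun_apply B w - proj f r (blinfun_apply B w)) \<le> sqrt c"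
   by (simp add: real_le_rsqrt)
  then have "norm v * norm (blinfun_apply B w - proj f r (blinfun_apply B w)) \<le> norm v * sqrt c"
   by (rule mult_left_mono) simp
  moreover have v: "v = norm v *\<^sub>R w" using False by (simp add: w_def)
  have "blinfun_apply B (norm v *\<^sub>R w) - proj f r (blinfun_apply B (norm v *\<^sub>R w))
    = norm v *\<^sub>R (blinfun_apply B w - proj f r (blinfun_apply B w))"
   by (simp only: blinfun.scaleR_right proj_scaleR scaleR_diff_right)
  then have "norm (blinfun_apply B v - proj f r (blinfun_apply B v))
    = norm v * norm (blinfun_apply B w - proj f r (blinfun_apply B w))"
   unfolding v[symmetric] by simp
  ultimately show ?thesis by (simp only: mult.commute)
 qed (simp add: blinfun.zero_right)
 then show ?thesis using that f by blast
qed

lemma compact_coefficient_set: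
 fixes f :: "nat => 'a::euclidean_space L2"
 shows "compact {\<Sum>j<r. scaleC (c j) (f j) |c. \<forall>j<r. cmod (c j) \<le> b}" (is "compact (?K r)")
proof (induction r)
 case (Suc r)
 have "?K (Suc r) = {x + y |x y. x \<in> ?K r \<and> y \<in> (\<lambda>z. scaleC z (f r)) ` cball 0 b}"
 proof (intro equalityI subsetI)
  fix x assume "x \<in> ?K (Suc r)"
  then show "x \<in> {x + y |x y. x \<in> ?K r \<and> y \<in> (\<lambda>z. scaleC z (f r)) ` cball 0 b}"
   by (fastforce simp: less_Suc_eq)
 next
  fix x assume "x \<in> {x + y |x y. x \<in> ?K r \<and> y \<in> (\<lambda>z. scaleC z (f r)) ` cball 0 b}"
  then obtain c z where cz: "x = (\<Sum>j<r. scaleC (c j) (f j)) + scaleC z (f r)" "\<And>j. j < r ==> cmod (c j) \<le> b" "cmod z \<le> b"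
   by auto
  then have "x = (\<Sum>j<Suc r. scaleC ((c(r := z)) j) (f j))" by simp
  then show "x \<in> ?K (Suc r)" using cz(2,3) by (auto intro!: exI[of _ "c(r := z)"] simp: less_Suc_eq)
 qed
 moreover have "compact ((\<lambda>z. scaleC z (f r)) ` cball 0 b)"
 proof (rule compact_continuous_image[OF linear_continuous_on compact_cball])
  show "bounded_linear (\<lambda>z. scaleC z (f r))"
   by (rule bounded_linear_intro[where K = "norm (f r)"])
    (auto simp: scaleC_add_left norm_scaleC scaleC_of_real[symmetric] scaleR_conv_of_real)
 qed
 ultimately show ?case using compact_sums[OF Suc] by simp
qed simp

lemma compact_closure_uniform_approx:
 fixes S :: "'a::euclidean_space L2 set"
 assumes "\<And>e. e > 0 ==> \<exists>K. compact K \<and> (\<forall>x\<in>S. \<exists>y\<in>K. dist x y \<le> e)"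
 shows "compact (closure S)"
 unfolding compact_eq_totally_bounded
proof (intro conjI allI impI, simp add: complete_eq_closed)
 fix e :: real assume e: "e > 0"
 obtain K where K: "compact K" "\<And>x. x \<in> S ==> \<exists>y\<in>K. dist x y \<le> e/4"
  using assms[of "e/4"] e by auto
 obtain k where k: "finite k" "K \<subseteq> (\<Union>x\<in>k. ball x (e/4))"
  using K(1) e unfolding compact_eq_totally_bounded by (metis zero_less_divide_iff zero_less_numeral)
 have "closure S \<subseteq> (\<Union>x\<in>k. ball x e)"
 proof
  fix x assume "x \<in> closure S"
  then obtain y where y: "y \<in> S" "dist y x < e/4"
   using e by (meson closure_approachable zero_less_divide_iff zero_less_numeral)
  obtain z where z: "z \<in> K" "dist y z \<le> e/4" using K(2)[OF y(1)] by blast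
  obtain p where p: "p \<in> k" "dist p z < e/4" using k(2) z(1) by auto
  have "dist p x \<le> dist p z + dist y z + dist y x"
   using dist_triangle[of p x z] dist_triangle[of z x y] by (simp add: dist_commute)
  then show "x \<in> (\<Union>x\<in>k. ball x e)" using p y z e by (intro UN_I[of p]) auto
 qed
 then show "\<exists>k. finite k \<and> closure S \<subseteq> (\<Union>x\<in>k. ball x e)" using k(1) by blast
qed

lemma compact_operator_rank_approx:
 assumes adj: "is_adjoint A A'" and B: "B \<in> {A, A'}"
  and ap: "\<And>e. e > 0 ==> \<exists>r c. c \<le> e \<and> rank_approx B r c"
 shows "compact_operator A"
 unfolding compact_operator_def
proof (intro conjI compact_closure_uniform_approx)
 show "complex_linear A" by (rule is_adjoint_complex_linear[OF adj])
 fix e :: real assume e: "e > 0"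
 obtain r c where rc: "c \<le> e\<^sup>2" "rank_approx B r c"
  using ap[of "e\<^sup>2"] e by auto
 obtain f where f: "orthonormal f r"
  "\<And>v. norm (blinfun_apply B v - proj f r (blinfun_apply B v)) \<le> sqrt c * norm v"
  using rank_approx_operator_norm[OF rc(2)] by metis
 have ce: "sqrt c \<le> e" using rc(1) e by (simp add: real_le_lsqrt)
 have fB: "norm (blinfun_apply B v - proj f r (blinfun_apply B v)) \<le> e * norm v" for v
  using f(2)[of v] mult_right_mono[OF ce, of "norm v"] by simp
 have coeff: "cmod (cinner x (f j)) \<le> norm x" if "j < r" for x j
  using Cauchy_Schwarz_cinner[of x "f j"] orthonormal_norm[OF f(1) that] by simp
 show "\<exists>K. compact K \<and> (\<forall>x\<in>blinfun_apply A ` cball 0 1. \<exists>y\<in>K. dist x y \<le> e)"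
 proof (cases "B = A")
  case True
  let ?K = "{\<Sum>j<r. scaleC (c j) (f j) |c. \<forall>j<r. cmod (c j) \<le> norm A}"
  have "\<exists>y\<in>?K. dist (blinfun_apply A v) y \<le> e" if v: "norm v \<le> 1" for v
  proof
   have "norm (blinfun_apply A v) \<le> norm A"
    using norm_blinfun[of A v] mult_left_mono[OF v, of "norm A"] by simp
   then have "cmod (cinner (blinfun_apply A v) (f j)) \<le> norm A" if "j < r" for j
    using coeff[OF that, of "blinfun_apply A v"] by linarith
   then show "proj f r (blinfun_apply A v) \<in> ?K"
    unfolding proj_def by (intro CollectI exI[of _ "\<lambda>j. cinner (blinfun_apply A v) (f j)"] conjI refl) simp
   show "dist (blinfun_apply A v) (proj f r (blinfun_apply A v)) \<le> e"
    unfolding dist_norm using order_trans[OF fB mult_left_le[OF v less_imp_le[OF e]]] True by simp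
  qed
  then show ?thesis
   by (intro exI[of _ ?K] conjI compact_coefficient_set) auto
 next
  case False
  then have BA: "B = A'" using B by simp
  let ?K = "blinfun_apply A ` {\<Sum>j<r. scaleC (c j) (f j) |c. \<forall>j<r. cmod (c j) \<le> 1}"
  have "\<exists>y\<in>?K. dist (blinfun_apply A v) y \<le> e" if v: "norm v \<le> 1" for v
  proof
   have "cmod (cinner v (f j)) \<le> 1" if "j < r" for j
    using coeff[OF that, of v] v by linarith
   then have "proj f r v \<in> {\<Sum>j<r. scaleC (c j) (f j) |c. \<forall>j<r. cmod (c j) \<le> 1}"
    unfolding proj_def by (intro CollectI exI[of _ "\<lambda>j. cinner v (f j)"] conjI refl) simp
   then show "blinfun_apply A (proj f r v) \<in> ?K" by simp
   define z where "z = blinfun_apply A v - blinfun_apply A (proj f r v)"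
   have "(norm z)\<^sup>2 = cmod (cinner z z)"
    by (simp add: cinner_self norm_power)
   also have "cinner z z = cinner v (blinfun_apply A' z - proj f r (blinfun_apply A' z))"
    by (subst (1) z_def) (simp add: cinner_diff_left cinner_diff_right is_adjointD[OF adj] cinner_proj_left)
   also have "cmod ... \<le> norm v * norm (blinfun_apply A' z - proj f r (blinfun_apply A' z))"
    by (rule Cauchy_Schwarz_cinner)
   also have "... \<le> 1 * (e * norm z)"
    using fB[of z] v BA by (intro mult_mono) auto
   finally have "norm z * norm z \<le> e * norm z" by (simp add: power2_eq_square)
   then have "norm z \<le> e" using e by (cases "norm z = 0") (auto simp: mult_le_cancel_right)
   then show "dist (blinfun_apply A v) (blinfun_apply A (proj f r v)) \<le> e"
    by (simp add: dist_norm z_def)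
  qed
  moreover have "compact ?K"
   by (intro compact_continuous_image compact_coefficient_set linear_continuous_on blinfun.bounded_linear_right)
  ultimately show ?thesis by auto
 qed
qed

lemma singular_candidate_unitary:
 assumes C: "is_adjoint C C'" and U: "is_adjoint U V" and VU: "V o\<^sub>L U = id_blinfun" and UV: "U o\<^sub>L V = id_blinfun"
  and cand: "singular_candidate (V o\<^sub>L C o\<^sub>L U) k \<sigma>"
 shows "singular_candidate C k \<sigma>"
proof -
 have UV': "blinfun_apply U (blinfun_apply V x) = x" for x
  using UV by (metis blinfun_compose.rep_eq comp_apply id_blinfun.rep_eq id_apply)
 have VU': "blinfun_apply V (blinfun_apply U x) = x" for x
  using VU by (metis blinfun_compose.rep_eq comp_apply id_blinfun.rep_eq id_apply)
 have adj: "is_adjoint (V o\<^sub>L C o\<^sub>L U) (V o\<^sub>L (C' o\<^sub>L U))"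
  by (intro is_adjoint_compose C U is_adjoint_sym[OF U])
 obtain v s where v: "\<sigma> > 0" "orthonormal v (Suc k)"
  "\<And>i. i < Suc k ==> s i \<ge> \<sigma> \<and> blinfun_apply V (blinfun_apply C' (blinfun_apply C (blinfun_apply U (v i)))) = (s i)\<^sup>2 *\<^sub>R v i"
  using cand unfolding singular_candidate_def hadjoint_eq[OF adj] by (auto simp: UV')
 have "orthonormal (\<lambda>i. blinfun_apply U (v i)) (Suc k)"
  using v(2) by (simp add: orthonormal_def is_adjointD[OF U] VU')
 moreover have "blinfun_apply C' (blinfun_apply C (blinfun_apply U (v i))) = (s i)\<^sup>2 *\<^sub>R blinfun_apply U (v i)"
  if "i < Suc k" for i
  using arg_cong[OF conjunct2[OF v(3)[OF that]], of "blinfun_apply U"] by (simp add: UV' blinfun.scaleR_right)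
 ultimately show ?thesis
  unfolding singular_candidate_def hadjoint_eq[OF C] using v
  by (intro conjI exI[of _ "\<lambda>i. blinfun_apply U (v i)"] exI[of _ s]) auto
qed

text \<open>
 A unitary operator carries orthonormal eigenvectors of \<open>C\<^sup>* C\<close> to those of the conjugated operator with the same eigenvalues.
\<close>

lemma singular_value_unitary:
 assumes C: "is_adjoint C C'" and U: "is_adjoint U V" and VU: "V o\<^sub>L U = id_blinfun" and UV: "U o\<^sub>L V = id_blinfun"
 shows "singular_value (V o\<^sub>L C o\<^sub>L U) k = singular_value C k"
proof -
 have adj: "is_adjoint (V o\<^sub>L C o\<^sub>L U) (V o\<^sub>L (C' o\<^sub>L U))"
  by (intro is_adjoint_compose C U is_adjoint_sym[OF U])
 have "blinfun_apply U (blinfun_apply V x) = x" for x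
  using UV by (metis blinfun_compose.rep_eq comp_apply id_blinfun.rep_eq id_apply)
 then have "U o\<^sub>L (V o\<^sub>L C o\<^sub>L U) o\<^sub>L V = C"
  by (intro blinfun_eqI) simp
 then have "singular_candidate (V o\<^sub>L C o\<^sub>L U) k \<sigma> = singular_candidate C k \<sigma>" for \<sigma>
  using singular_candidate_unitary[OF C U VU UV]
   singular_candidate_unitary[OF adj is_adjoint_sym[OF U] UV VU, of k \<sigma>] by metis
 then show ?thesis by (simp add: singular_value_candidate)
qed

lemma compact_operator_unitary:
 assumes C: "is_adjoint C C'" "compact_operator C" and U: "is_adjoint U V" and VU: "V o\<^sub>L U = id_blinfun"
 shows "compact_operator (V o\<^sub>L C o\<^sub>L U)"
 unfolding compact_operator_def
proof
 show "complex_linear (V o\<^sub>L C o\<^sub>L U)"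
  by (rule is_adjoint_complex_linear[OF is_adjoint_compose[OF is_adjoint_compose[OF is_adjoint_sym[OF U] C(1)] U]])
 have nU: "norm (blinfun_apply U x) = norm x" for x
 proof -
  have "blinfun_apply V (blinfun_apply U x) = x"
   using VU by (metis blinfun_compose.rep_eq comp_apply id_blinfun.rep_eq id_apply)
  then have "complex_of_real ((norm (blinfun_apply U x))\<^sup>2) = of_real ((norm x)\<^sup>2)"
   unfolding cinner_self[symmetric] is_adjointD[OF U] by simp
  then show ?thesis by (simp only: of_real_eq_iff) (simp add: power2_eq_iff_nonneg)
 qed
 have "blinfun_apply (V o\<^sub>L C o\<^sub>L U) ` cball 0 1 \<subseteq> blinfun_apply V ` closure (blinfun_apply C ` cball 0 1)"
 proof
  fix y assume "y \<in> blinfun_apply (V o\<^sub>L C o\<^sub>L U) ` cball 0 1"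
  then obtain x where x: "norm x \<le> 1" "y = blinfun_apply V (blinfun_apply C (blinfun_apply U x))" by auto
  then have "blinfun_apply C (blinfun_apply U x) \<in> blinfun_apply C ` cball 0 1" by (simp add: nU)
  then show "y \<in> blinfun_apply V ` closure (blinfun_apply C ` cball 0 1)"
   using x(2) closure_subset by blast
 qed
 moreover have *: "compact (blinfun_apply V ` closure (blinfun_apply C ` cball 0 1))"
  using C(2) unfolding compact_operator_def
  by (intro compact_continuous_image linear_continuous_on blinfun.bounded_linear_right) blast
 ultimately have "closure (blinfun_apply (V o\<^sub>L C o\<^sub>L U) ` cball 0 1) \<subseteq> blinfun_apply V ` closure (blinfun_apply C ` cball 0 1)"
  by (intro closure_minimal compact_imp_closed)
 then show "compact (closure (blinfun_apply (V o\<^sub>L C o\<^sub>L U) ` cball 0 1))"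
  using * by (metis closed_Int_compact closed_closure inf.absorb1)
qed

text \<open>
 The summation behind the Schatten bound: below the scale \<open>Y\<close> the terms grow no faster than an inverse square
 root, above it they decay with an exponent \<open>\<theta> > 1\<close>, so that either part contributes a multiple of \<open>Y\<close>.
\<close>

lemma sum_inverse_sqrt_le: "(\<Sum>k<n. 1 / sqrt (real (Suc k))) \<le> 2 * sqrt (real n)"
proof (induction n)
 case (Suc n)
 have "1 / sqrt (real (Suc n)) \<le> 2 * sqrt (real (Suc n)) - 2 * sqrt (real n)"
 proof -
  have "2 * sqrt (real n) * sqrt (real (Suc n)) \<le> real n + real (Suc n)"
   using sum_squares_bound[of "sqrt (real n)" "sqrt (real (Suc n))"] by simp
  then have "1 + 2 * sqrt (real n) * sqrt (real (Suc n)) \<le> 2 * (sqrt (real (Suc n)) * sqrt (real (Suc n)))"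
   by simp
  then show ?thesis by (simp add: divide_simps algebra_simps del: real_sqrt_mult_self)
 qed
 then show ?case using Suc by simp
qed simp

lemma powr_minus_telescope:
 fixes x \<theta> :: real
 assumes "\<theta> > 1" "x > 1"
 shows "x powr - \<theta> \<le> ((x - 1) powr (1 - \<theta>) - x powr (1 - \<theta>)) / (\<theta> - 1)"
proof -
 have "\<exists>z. x - 1 < z \<and> z < x \<and>
   x powr (1 - \<theta>) - (x - 1) powr (1 - \<theta>) = (x - (x - 1)) * ((1 - \<theta>) * z powr (1 - \<theta> - 1))"
  by (rule MVT2) (use assms in \<open>auto intro!: derivative_eq_intros simp: has_real_derivative_powr\<close>)
 then obtain z where z: "x - 1 < z" "z < x" "x powr (1 - \<theta>) - (x - 1) powr (1 - \<theta>) = (1 - \<theta>) * z powr - \<theta>"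
  by auto
 have "x powr - \<theta> \<le> z powr - \<theta>" using z assms by (intro powr_mono2') auto
 then have "(\<theta> - 1) * x powr - \<theta> \<le> (\<theta> - 1) * z powr - \<theta>" using assms by (intro mult_left_mono) auto
 also have "... = (x - 1) powr (1 - \<theta>) - x powr (1 - \<theta>)" using z(3) by (simp add: algebra_simps)
 finally show ?thesis using assms by (simp add: field_simps)
qed

lemma sum_two_scale_bound:
 fixes Y \<theta> :: real
 assumes Y: "Y \<ge> 1" and \<theta>: "\<theta> > 1"
  and f: "\<And>k. real (Suc k) \<le> Y ==> f k \<le> sqrt (Y / real (Suc k))"
   "\<And>k. real (Suc k) > Y ==> f k \<le> (Y / real (Suc k)) powr \<theta>"
 shows "(\<Sum>k<n. f k) \<le> (2 + 2 powr (\<theta> - 1) / (\<theta> - 1)) * Y"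
proof -
 define m where "m = nat \<lfloor>Y\<rfloor>"
 have m: "real m \<le> Y" "Y < real m + 1" "m \<ge> 1"
  using Y by (auto simp: m_def nat_le_iff le_nat_iff le_floor_iff)
 have m3: "real m \<ge> 1" using m(3) by simp
 have m2: "Y \<le> real m * 2" using m(2) m3 by linarith
 define g where "g k = Y powr \<theta> * (real k powr (1 - \<theta>)) / (\<theta> - 1)" for k
 have "(\<Sum>k<m. f k) \<le> (\<Sum>k<m. sqrt Y * (1 / sqrt (real (Suc k))))"
 proof (rule sum_mono)
  fix k assume "k \<in> {..<m}"
  then have "real (Suc k) \<le> Y" using m(1) by (auto intro: order_trans[rotated])
  from f(1)[OF this] show "f k \<le> sqrt Y * (1 / sqrt (real (Suc k)))" by (simp add: real_sqrt_divide)
 qed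
 also have "... \<le> sqrt Y * (2 * sqrt (real m))"
  unfolding sum_distrib_left[symmetric] using Y by (intro mult_left_mono sum_inverse_sqrt_le) auto
 also have "... \<le> sqrt Y * (2 * sqrt Y)" using m(1) Y by (intro mult_left_mono) auto
 also have "... = 2 * Y" using Y by simp
 finally have 1: "(\<Sum>k<m. f k) \<le> 2 * Y" .
 have step: "f k \<le> g k - g (Suc k)" if "k \<ge> m" for k
 proof -
  have "real (Suc k) > Y" using that m(2) by linarith
  then have "f k \<le> (Y / real (Suc k)) powr \<theta>" by (rule f(2))
  also have "... = Y powr \<theta> * real (Suc k) powr - \<theta>"
   using Y by (subst powr_divide) (auto simp: powr_minus divide_inverse)
  also have "... \<le> Y powr \<theta> * (((real (Suc k) - 1) powr (1 - \<theta>) - real (Suc k) powr (1 - \<theta>)) / (\<theta> - 1))"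
   using that m(3) \<theta> by (intro mult_left_mono powr_minus_telescope) auto
  also have "... = g k - g (Suc k)" by (simp add: g_def field_simps diff_divide_distrib)
  finally show ?thesis .
 qed
 have 2: "(\<Sum>k\<in>{m..<m + j}. f k) \<le> g m - g (m + j)" for j
 proof (induction j)
  case (Suc j)
  then show ?case using step[of "m + j"] by simp
 qed simp
 have g0: "g k \<ge> 0" for k using \<theta> by (simp add: g_def)
 have gm: "g m \<le> 2 powr (\<theta> - 1) / (\<theta> - 1) * Y"
 proof -
  have "real m powr (1 - \<theta>) \<le> (Y / 2) powr (1 - \<theta>)"
   using m2 Y \<theta> by (intro powr_mono2') auto
  then have "g m \<le> Y powr \<theta> * (Y / 2) powr (1 - \<theta>) / (\<theta> - 1)"
   unfolding g_def using \<theta> by (intro divide_right_mono mult_left_mono) auto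
  also have "Y powr \<theta> * (Y / 2) powr (1 - \<theta>) = (Y powr \<theta> * Y powr (1 - \<theta>)) * 2 powr (\<theta> - 1)"
   using Y powr_minus[of 2 "1 - \<theta>"] by (subst powr_divide) (auto simp: field_simps)
  also have "Y powr \<theta> * Y powr (1 - \<theta>) = Y" using Y by (simp flip: powr_add)
  finally show ?thesis by (simp add: mult.commute)
 qed
 show ?thesis
 proof (cases "n \<le> m")
  case True
  then have "real (Suc k) \<le> Y" if "k < n" for k using that m(1) by (auto intro: order_trans[rotated])
  then have "(\<Sum>k<n. f k) \<le> (\<Sum>k<n. sqrt Y * (1 / sqrt (real (Suc k))))"
   using f(1) by (intro sum_mono) (auto simp: real_sqrt_divide)
  also have "... \<le> sqrt Y * (2 * sqrt (real n))"
   unfolding sum_distrib_left[symmetric] using Y by (intro mult_left_mono sum_inverse_sqrt_le) auto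
  also have "... \<le> sqrt Y * (2 * sqrt Y)" using m(1) Y True by (intro mult_left_mono) auto
  also have "... = 2 * Y" using Y by simp
  also have "... \<le> (2 + 2 powr (\<theta> - 1) / (\<theta> - 1)) * Y"
   using Y \<theta> by (intro mult_right_mono) auto
  finally show ?thesis .
 next
  case False
  then obtain j where j: "n = m + j" by (metis le_add_diff_inverse nat_le_linear)
  have "(\<Sum>k<n. f k) = (\<Sum>k<m. f k) + (\<Sum>k\<in>{m..<m + j}. f k)"
   unfolding j lessThan_atLeast0 by (subst sum.atLeastLessThan_concat) auto
  then show ?thesis using 1 2[of j] gm g0[of "m + j"] by (simp add: algebra_simps)
 qed
qed

text \<open>
 The singular values can only be counted through operators of finite rank: if \<open>B\<close> is approximated with
 \<open>Y T / 2\<close> dimensions up to a squared Hilbert-Schmidt error \<open>Z Y T\<^sup>-\<^sup>\<gamma>\<close>, then \<open>T = (k + 1) / Y\<close> bounds \<open>(k + 1) s\<^sub>k\<^sup>2 / 2\<close>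
 by this error.  With \<open>\<gamma> = 2/q - 1/2\<close> the power \<open>s\<^sub>k\<^sup>q\<close> decays like \<open>k\<close> to the exponent \<open>- (1 + q / 4)\<close>,
 which is summable.  Since \<open>A\<close> and its adjoint have the same singular values, either may be approximated.
\<close>

lemma schatten_bound:
 fixes A :: "'a::euclidean_space L2_op"
 assumes q: "0 < q" "q \<le> 1" and Y: "Y \<ge> 1" and Z: "Z \<ge> 0"
  and adj: "is_adjoint A A'" and B: "B \<in> {A, A'}"
  and B0: "rank_approx B 0 (Z * Y)"
  and B1: "\<And>T. T \<ge> 1 ==> \<exists>r. real r \<le> Y * T / 2 \<and> rank_approx B r (Z * Y * T powr - (2 / q - 1 / 2))"
 shows "A \<in> schatten_class q"
  and "schatten_norm q A \<le> sqrt (2 * Z) * ((2 + 2 powr (q / 4) / (q / 4)) * Y) powr (1 / q)"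
proof -
 define \<gamma> where "\<gamma> = 2 / q - 1 / 2"
 have \<gamma>: "\<gamma> > 0" using q by (simp add: \<gamma>_def field_simps)
 have compact: "compact_operator A"
 proof (rule compact_operator_rank_approx[OF adj B])
  fix e :: real assume e: "e > 0"
  have "((\<lambda>T. Z * Y * T powr - \<gamma>) \<longlongrightarrow> Z * Y * 0) at_top"
   using \<gamma> by (intro tendsto_mult_left tendsto_neg_powr filterlim_ident) auto
  then have "\<forall>\<^sub>F T in at_top. Z * Y * T powr - \<gamma> < e"
   using e by (intro order_tendstoD) auto
  then have "\<forall>\<^sub>F T in at_top. Z * Y * T powr - \<gamma> < e \<and> T \<ge> 1"
   using eventually_ge_at_top[of "1::real"] by eventually_elim auto
  then obtain T where "Z * Y * T powr - \<gamma> < e" "T \<ge> 1"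
   by (metis (mono_tags, lifting) eventually_happens trivial_limit_at_top_linorder)
  then show "\<exists>r c. c \<le> e \<and> rank_approx B r c"
   using B1[of T] unfolding \<gamma>_def by (meson less_imp_le)
 qed
 have sv0: "singular_value A k \<ge> 0" for k by (rule singular_value_nonneg[OF adj])
 define f where "f k = (singular_value A k / sqrt (2 * Z)) powr q" for k
 have small: "f k \<le> sqrt (Y / real (Suc k))" if "real (Suc k) \<le> Y" for k
 proof (cases "Z = 0")
  case False
  have "(singular_value A k)\<^sup>2 \<le> Z * Y / real (Suc k)"
   using singular_value_rank_approx[OF adj B B0, of k] by simp
  also have "... \<le> 2 * Z * Y / real (Suc k)" using Z Y by (simp add: divide_right_mono)
  finally have "(singular_value A k / sqrt (2 * Z))\<^sup>2 \<le> Y / real (Suc k)"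
   using False Z by (simp add: power_divide field_simps)
  then have *: "singular_value A k / sqrt (2 * Z) \<le> sqrt (Y / real (Suc k))"
   by (rule real_le_rsqrt)
  then have "f k \<le> sqrt (Y / real (Suc k)) powr q"
   unfolding f_def using q sv0[of k] Z by (intro powr_mono2) auto
  also have "... \<le> sqrt (Y / real (Suc k)) powr 1"
   using q that by (intro powr_mono) (auto simp: field_simps)
  finally show ?thesis using Y by simp
 qed (use Y in \<open>simp add: f_def\<close>)
 have large: "f k \<le> (Y / real (Suc k)) powr (1 + q / 4)" if k: "real (Suc k) > Y" for k
 proof (cases "Z = 0")
  case False
  define T where "T = real (Suc k) / Y"
  have T: "T \<ge> 1" using k Y by (simp add: T_def)
  obtain r where r: "real r \<le> Y * T / 2" "rank_approx B r (Z * Y * T powr - \<gamma>)"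
   using B1[OF T] unfolding \<gamma>_def by blast
  have r2: "real r \<le> real (Suc k) / 2" using r(1) Y by (simp add: T_def)
  then have "real r < real (Suc k)" by (rule le_less_trans) simp
  then have "r < Suc k" by simp
  have "(singular_value A k)\<^sup>2 \<le> Z * Y * T powr - \<gamma> / (real (Suc k) - real r)"
   by (rule singular_value_rank_approx[OF adj B r(2) \<open>r < Suc k\<close>])
  also have "... \<le> Z * Y * T powr - \<gamma> / (real (Suc k) / 2)"
   using r2 \<open>r < Suc k\<close> Z Y by (intro divide_left_mono mult_pos_pos) (simp_all add: mult_nonneg_nonneg)
  also have "... = 2 * Z * (T powr - \<gamma> / T)" using Y by (simp add: T_def field_simps)
  also have "T powr - \<gamma> / T = T powr (- \<gamma> - 1)"
   using T by (simp add: powr_diff)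
  finally have "(singular_value A k / sqrt (2 * Z))\<^sup>2 \<le> T powr (- \<gamma> - 1)"
   using False Z by (simp add: power_divide field_simps)
  then have "singular_value A k / sqrt (2 * Z) \<le> sqrt (T powr (- \<gamma> - 1))" by (rule real_le_rsqrt)
  also have "... = T powr ((- \<gamma> - 1) / 2)" using T by (simp add: powr_half_sqrt[symmetric] powr_powr)
  finally have "f k \<le> (T powr ((- \<gamma> - 1) / 2)) powr q"
   unfolding f_def using q sv0[of k] Z by (intro powr_mono2) auto
  also have "(- \<gamma> - 1) / 2 * q = - (1 + q / 4)"
   using q by (simp add: \<gamma>_def diff_divide_distrib) (simp add: algebra_simps)
  then have "(T powr ((- \<gamma> - 1) / 2)) powr q = T powr - (1 + q / 4)"
   by (simp only: powr_powr)
  also have "... = (1 / T) powr (1 + q / 4)"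
   unfolding powr_minus_divide using T by (simp add: powr_divide)
  finally show ?thesis by (simp add: T_def)
 qed (use Y in \<open>simp add: f_def\<close>)
 have sumf: "(\<Sum>k<n. f k) \<le> (2 + 2 powr (q / 4) / (q / 4)) * Y" for n
  using sum_two_scale_bound[OF Y _ small large, of n] q by simp
 have svf: "singular_value A k powr q = sqrt (2 * Z) powr q * f k" for k
 proof (cases "Z = 0")
  case True
  have "(singular_value A k)\<^sup>2 \<le> 0"
   using singular_value_rank_approx[OF adj B B0, of k] True by simp
  then show ?thesis using q True by simp
 next
  case False
  have "singular_value A k = sqrt (2 * Z) * (singular_value A k / sqrt (2 * Z))"
   using False Z by simp
  then show ?thesis
   unfolding f_def using sv0[of k] Z by (metis divide_nonneg_nonneg powr_mult real_sqrt_ge_zero zero_le_mult_iff zero_le_numeral)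
 qed
 have f0: "f k \<ge> 0" for k by (simp add: f_def)
 have summable: "summable f"
  by (rule summableI_nonneg_bounded[OF f0 sumf])
 have sumf': "(\<Sum>k. f k) \<le> (2 + 2 powr (q / 4) / (q / 4)) * Y"
  by (rule suminf_le_const[OF summable sumf])
 have "summable (\<lambda>k. singular_value A k powr q)"
  unfolding svf by (rule summable_mult[OF summable])
 then show "A \<in> schatten_class q" using compact by (simp add: schatten_class_def)
 have "(\<Sum>k. singular_value A k powr q) = sqrt (2 * Z) powr q * (\<Sum>k. f k)"
  unfolding svf by (rule suminf_mult[OF summable])
 also have "... \<le> sqrt (2 * Z) powr q * ((2 + 2 powr (q / 4) / (q / 4)) * Y)"
  by (intro mult_left_mono sumf') auto
 finally have "schatten_norm q A \<le> (sqrt (2 * Z) powr q * ((2 + 2 powr (q / 4) / (q / 4)) * Y)) powr (1 / q)"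
  unfolding schatten_norm_def using q
  by (intro powr_mono2 suminf_nonneg \<open>summable (\<lambda>k. singular_value A k powr q)\<close>) simp_all
 also have "... = sqrt (2 * Z) * ((2 + 2 powr (q / 4) / (q / 4)) * Y) powr (1 / q)"
  using q Z unfolding powr_mult powr_powr by simp
 finally show "schatten_norm q A \<le> sqrt (2 * Z) * ((2 + 2 powr (q / 4) / (q / 4)) * Y) powr (1 / q)" .
qed

section \<open>Multiplication and kernel operators\<close>

lemma square_integrable_bound:
 assumes "square_integrable g" "f \<in> borel_measurable borel" "\<And>x. cmod (f x) \<le> cmod (g x)"
 shows "square_integrable f"
proof -
 have "integrable lborel (\<lambda>x. (cmod (g x))\<^sup>2)" using assms(1) by (simp add: square_integrable_def)
 then have "integrable lborel (\<lambda>x. (cmod (f x))\<^sup>2)"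
  using assms(2,3) by (rule_tac Bochner_Integration.integrable_bound) (auto intro!: power_mono)
 then show ?thesis using assms(2) by (simp add: square_integrable_def)
qed

lemma norm_abs_L2_le:
 assumes "square_integrable f" "square_integrable g" "\<And>x. cmod (f x) \<le> cmod (g x)"
 shows "norm (abs_L2 f) \<le> norm (abs_L2 g)"
proof (rule power2_le_imp_le)
 show "(norm (abs_L2 f))\<^sup>2 \<le> (norm (abs_L2 g))\<^sup>2"
  unfolding norm_abs_L2_sq[OF assms(1)] norm_abs_L2_sq[OF assms(2)]
  using assms by (intro integral_mono power_mono) (auto simp: square_integrable_def)
qed simp

lemma bounded_linear_abs_L2I:
 fixes F :: "'a::euclidean_space L2 => 'a => complex"
 assumes si: "\<And>u. square_integrable (F u)"
  and add: "\<And>u v. AE x in lborel. F (u + v) x = F u x + F v x"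
  and scale: "\<And>(r::real) u. AE x in lborel. F (r *\<^sub>R u) x = r * F u x"
  and bound: "\<And>u. norm (abs_L2 (F u)) \<le> norm u * K"
 shows "bounded_linear (\<lambda>u. abs_L2 (F u))"
proof (rule bounded_linear_intro[where K = K])
 show "abs_L2 (F (u + v)) = abs_L2 (F u) + abs_L2 (F v)" for u v
  unfolding abs_L2_add[OF si si] by (intro abs_L2_eqI si square_integrable_add add)
 show "abs_L2 (F (r *\<^sub>R u)) = r *\<^sub>R abs_L2 (F u)" for r u
  unfolding scaleC_of_real[symmetric] abs_L2_scaleC[OF si]
  by (intro abs_L2_eqI si square_integrable_scale, unfold scaleC_of_real, rule scale)
qed (rule bound)

lemma AE_rep_scaleR: "AE x in lborel. rep_L2 (r *\<^sub>R u) x = r * rep_L2 u x"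
 using AE_rep_scaleC[of "of_real r" u] by (simp add: scaleC_of_real)

lemma square_integrable_indicator:
 assumes "S \<in> sets borel" "square_integrable f"
 shows "square_integrable (\<lambda>x. indicator S x * f x)"
 by (rule square_integrable_bound[OF assms(2)])
  (use assms square_integrable_measurable[OF assms(2)] in \<open>auto split: split_indicator\<close>)

lemma bounded_linear_chi:
 fixes S :: "(real^'n::finite) set"
 assumes S: "S \<in> sets borel"
 shows "bounded_linear (\<lambda>u. abs_L2 (\<lambda>x. indicator S x * rep_L2 u x))"
proof (rule bounded_linear_abs_L2I[where K = 1])
 fix u v :: "(real^'n) L2" and r :: real
 show "square_integrable (\<lambda>x. indicator S x * rep_L2 u x)"
  by (intro square_integrable_indicator S square_integrable_rep)
 show "AE x in lborel. indicator S x * rep_L2 (u + v) x = indicator S x * rep_L2 u x + indicator S x * rep_L2 v x"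
  using AE_rep_add[of u v] by eventually_elim (simp add: algebra_simps)
 show "AE x in lborel. indicator S x * rep_L2 (r *\<^sub>R u) x = r * (indicator S x * rep_L2 u x)"
  using AE_rep_scaleR[of r u] by eventually_elim simp
 have "norm (abs_L2 (\<lambda>x. indicator S x * rep_L2 u x)) \<le> norm (abs_L2 (rep_L2 u))"
  by (intro norm_abs_L2_le square_integrable_indicator S square_integrable_rep)
   (auto split: split_indicator)
 then show "norm (abs_L2 (\<lambda>x. indicator S x * rep_L2 u x)) \<le> norm u * 1" by simp
qed

lemma chi_op_apply:
 "S \<in> sets borel ==> blinfun_apply (chi_op S) u = abs_L2 (\<lambda>x. indicator S x * rep_L2 u x)"
 unfolding chi_op_def by (rule bounded_linear_Blinfun_apply[OF bounded_linear_chi, THEN fun_cong])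

lemma AE_rep_chi_op:
 fixes S :: "(real^'n::finite) set"
 assumes "S \<in> sets borel"
 shows "AE x in lborel. rep_L2 (blinfun_apply (chi_op S) u) x = indicator S x * rep_L2 u x"
 unfolding chi_op_apply[OF assms]
 by (intro AE_rep_abs square_integrable_indicator assms square_integrable_rep)

lemma is_adjoint_chi_op:
 fixes S :: "(real^'n::finite) set"
 assumes S: "S \<in> sets borel"
 shows "is_adjoint (chi_op S) (chi_op S)"
 unfolding is_adjoint_def cinner_rep
proof (intro allI integral_cong_AE)
 fix u v :: "(real^'n) L2"
 show "AE x in lborel. rep_L2 (blinfun_apply (chi_op S) u) x * cnj (rep_L2 v x) =
   rep_L2 u x * cnj (rep_L2 (blinfun_apply (chi_op S) v) x)"
  using AE_rep_chi_op[OF S, of u] AE_rep_chi_op[OF S, of v]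
  by eventually_elim (auto split: split_indicator)
qed simp_all

lemma id_minus_chi_op:
 fixes S :: "(real^'n::finite) set"
 assumes "S \<in> sets borel"
 shows "id_blinfun - chi_op S = chi_op (- S)"
proof (rule blinfun_eqI)
 fix u :: "(real^'n) L2"
 have mS: "- S \<in> sets borel" using assms by (rule borel_comp)
 have "u - blinfun_apply (chi_op S) u = blinfun_apply (chi_op (- S)) u"
  by (rule L2_eqI, use AE_rep_diff[of u "blinfun_apply (chi_op S) u"] AE_rep_chi_op[OF assms, of u]
   AE_rep_chi_op[OF mS, of u] in eventually_elim) (auto split: split_indicator)
 then show "blinfun_apply (id_blinfun - chi_op S) u = blinfun_apply (chi_op (- S)) u"
  by (simp add: blinfun.diff_left)
qed

definition kernel_op :: "('a::euclidean_space \<times> 'a => complex) => 'a L2_op" where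
 "kernel_op k = Blinfun (\<lambda>u. abs_L2 (\<lambda>x. LINT y|lborel. k (x, y) * rep_L2 u y))"

definition bounded_kernel :: "('a::euclidean_space \<times> 'a => complex) => bool" where
 "bounded_kernel k \<longleftrightarrow> k \<in> borel_measurable borel \<and>
   (\<exists>B R. \<forall>x y. cmod (k (x, y)) \<le> B * indicator (ball 0 R) x * indicator (ball 0 R) y)"

lemma bounded_kernelE:
 assumes "bounded_kernel k"
 obtains B R where "B \<ge> 0" "k \<in> borel_measurable borel"
  "\<And>x y. cmod (k (x, y)) \<le> B * indicator (ball 0 R) x * indicator (ball 0 R) y"
proof -
 obtain B R where "k \<in> borel_measurable borel"
  and B: "\<And>x y. cmod (k (x, y)) \<le> B * indicator (ball 0 R) x * indicator (ball 0 R) y"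
  using assms unfolding bounded_kernel_def by blast
 moreover have "cmod (k (x, y)) \<le> \<bar>B\<bar> * indicator (ball 0 R) x * indicator (ball 0 R) y" for x y
  using B[of x y] by (auto split: split_indicator)
 ultimately show ?thesis using that[of "\<bar>B\<bar>" R] by simp
qed

lemma ball_borel [measurable]: "ball c r \<in> sets borel"
 by (rule borel_open) simp

lemma square_integrable_ball: "square_integrable (\<lambda>x. of_real B * indicator (ball 0 R) x)"
proof (rule square_integrable_scale)
 have "integrable lborel (indicat_real (ball (0::'a) R))"
  using emeasure_lborel_ball_finite[of "0::'a" R] by (intro integrable_real_indicator) (auto simp: less_top)
 moreover have "(cmod (indicator (ball 0 R) x))\<^sup>2 = indicat_real (ball 0 R) x" for x :: 'a
  by (auto split: split_indicator)
 moreover have "(indicator (ball 0 R) :: 'a => complex) \<in> borel_measurable borel" by measurable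
 ultimately show "square_integrable (\<lambda>x::'a. indicator (ball 0 R) x)"
  by (simp add: square_integrable_def)
qed

lemma bounded_kernel_row:
 assumes "bounded_kernel k"
 shows "square_integrable (\<lambda>y. k (x, y))" "square_integrable (\<lambda>y. cnj (k (x, y)))"
proof -
 obtain B R where B: "B \<ge> 0" and [measurable]: "k \<in> borel_measurable borel"
  and k: "\<And>x y. cmod (k (x, y)) \<le> B * indicator (ball 0 R) x * indicator (ball 0 R) y"
  using bounded_kernelE[OF assms] by metis
 have "cmod (k (x, y)) \<le> cmod (of_real B * indicator (ball 0 R) y)" for y
  using k[of x y] B by (cases "x \<in> ball 0 R"; cases "y \<in> ball 0 R") (auto simp: indicator_def)
 moreover have "(\<lambda>y. k (x, y)) \<in> borel_measurable borel"
  by (rule measurable_compose[OF _ \<open>k \<in> borel_measurable borel\<close>]) (simp add: borel_prod[symmetric])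
 ultimately show "square_integrable (\<lambda>y. k (x, y))" "square_integrable (\<lambda>y. cnj (k (x, y)))"
  by (auto intro!: square_integrable_bound[OF square_integrable_ball])
qed

lemma kernel_row_cinner:
 assumes "bounded_kernel k"
 shows "(LINT y|lborel. k (x, y) * rep_L2 u y) = cinner u (abs_L2 (\<lambda>y. cnj (k (x, y))))"
 using cinner_abs[OF square_integrable_rep bounded_kernel_row(2)[OF assms], of u x]
 by (simp add: mult.commute)

lemma bounded_kernel_row_norm:
 fixes k :: "'a::euclidean_space \<times> 'a => complex"
 assumes "\<And>x y. cmod (k (x, y)) \<le> B * indicator (ball 0 R) x * indicator (ball 0 R) y" "bounded_kernel k"
 shows "norm (abs_L2 (\<lambda>y. cnj (k (x, y)))) \<le> norm (abs_L2 (\<lambda>y::'a. of_real B * indicator (ball 0 R) y)) * indicator (ball 0 R) x"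
proof (cases "x \<in> ball 0 R")
 case True
 have "cmod (cnj (k (x, y))) \<le> cmod (of_real B * indicator (ball 0 R) y)" for y
  using assms(1)[of x y] True by (cases "y \<in> ball 0 R") (auto simp: indicator_def)
 then have "norm (abs_L2 (\<lambda>y. cnj (k (x, y)))) \<le> norm (abs_L2 (\<lambda>y::'a. of_real B * indicator (ball 0 R) y))"
  by (intro norm_abs_L2_le bounded_kernel_row(2) assms(2) square_integrable_ball)
 then show ?thesis using True by simp
next
 case False
 then have "(\<lambda>y. cnj (k (x, y))) = (\<lambda>_. 0)" using assms(1)[of x] by auto
 then show ?thesis by (simp add: abs_L2_zero)
qed

lemma kernel_integral_measurable:
 assumes "bounded_kernel (k :: 'a::euclidean_space \<times> 'a => complex)"
 shows "(\<lambda>x. LINT y|lborel. k (x, y) * rep_L2 u y) \<in> borel_measurable borel"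
proof -
 have [measurable]: "k \<in> borel_measurable (borel \<Otimes>\<^sub>M borel)"
  using assms by (simp add: bounded_kernel_def borel_prod)
 have "(\<lambda>(x, y). k (x, y) * rep_L2 u y) \<in> borel_measurable (borel \<Otimes>\<^sub>M (lborel :: 'a measure))"
  by measurable
 then show ?thesis
  by (rule lborel.borel_measurable_lebesgue_integral)
qed

lemma square_integrable_kernel_integral:
 assumes "bounded_kernel k"
 shows "square_integrable (\<lambda>x. LINT y|lborel. k (x, y) * rep_L2 u y)"
  and "\<exists>K. \<forall>u. norm (abs_L2 (\<lambda>x. LINT y|lborel. k (x, y) * rep_L2 u y)) \<le> norm u * K"
proof -
 obtain B R where B: "B \<ge> 0"
  and k: "\<And>x y. cmod (k (x, y)) \<le> B * indicator (ball 0 R) x * indicator (ball 0 R) y"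
  using bounded_kernelE[OF assms] by metis
 define D where "D = norm (abs_L2 (\<lambda>y::'a. of_real B * indicator (ball 0 R) y))"
 have b: "cmod (LINT y|lborel. k (x, y) * rep_L2 u y) \<le> cmod (of_real (norm u * D) * indicator (ball 0 R) x)" for x u
 proof -
  have "cmod (LINT y|lborel. k (x, y) * rep_L2 u y) \<le> norm u * norm (abs_L2 (\<lambda>y. cnj (k (x, y))))"
   unfolding kernel_row_cinner[OF assms] by (rule Cauchy_Schwarz_cinner)
  also have "... \<le> norm u * (D * indicator (ball 0 R) x)"
   unfolding D_def by (intro mult_left_mono bounded_kernel_row_norm k assms) simp
  also have "... = cmod (of_real (norm u * D) * indicator (ball 0 R) x)"
   by (simp add: norm_mult D_def indicator_def)
  finally show ?thesis .
 qed
 show si: "square_integrable (\<lambda>x. LINT y|lborel. k (x, y) * rep_L2 u y)" for u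
  by (rule square_integrable_bound[OF square_integrable_ball kernel_integral_measurable[OF assms] b])
 define D2 where "D2 = norm (abs_L2 (\<lambda>y::'a. of_real 1 * indicator (ball 0 R) y))"
 have "norm (abs_L2 (\<lambda>x. LINT y|lborel. k (x, y) * rep_L2 u y)) \<le> norm u * (D * D2)" for u
 proof -
  have "norm (abs_L2 (\<lambda>x. LINT y|lborel. k (x, y) * rep_L2 u y))
    \<le> norm (abs_L2 (\<lambda>x::'a. of_real (norm u * D) * indicator (ball 0 R) x))"
   by (intro norm_abs_L2_le si square_integrable_ball b)
  also have "(\<lambda>x::'a. complex_of_real (norm u * D) * indicator (ball 0 R) x)
    = (\<lambda>x. of_real (norm u * D) * (of_real 1 * indicator (ball 0 R) x))" by simp
  also have "abs_L2 ... = scaleC (of_real (norm u * D)) (abs_L2 (\<lambda>x. of_real 1 * indicator (ball 0 R) x))"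
   by (rule abs_L2_scaleC[OF square_integrable_ball, symmetric])
  also have "norm ... = norm u * (D * D2)"
   unfolding norm_scaleC D2_def norm_of_real abs_mult by (simp add: D_def)
  finally show ?thesis .
 qed
 then show "\<exists>K. \<forall>u. norm (abs_L2 (\<lambda>x. LINT y|lborel. k (x, y) * rep_L2 u y)) \<le> norm u * K" by blast
qed

lemma kernel_op_apply:
 assumes k: "bounded_kernel k"
 shows "blinfun_apply (kernel_op k) u = abs_L2 (\<lambda>x. LINT y|lborel. k (x, y) * rep_L2 u y)"
proof -
 obtain K where K: "\<And>u. norm (abs_L2 (\<lambda>x. LINT y|lborel. k (x, y) * rep_L2 u y)) \<le> norm u * K"
  using square_integrable_kernel_integral(2)[OF k] by blast
 have "bounded_linear (\<lambda>u. abs_L2 (\<lambda>x. LINT y|lborel. k (x, y) * rep_L2 u y))"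
 proof (rule bounded_linear_abs_L2I[where K = K])
  fix u v :: "'a L2" and r :: real
  show "square_integrable (\<lambda>x. LINT y|lborel. k (x, y) * rep_L2 u y)"
   by (rule square_integrable_kernel_integral(1)[OF k])
  show "AE x in lborel. (LINT y|lborel. k (x, y) * rep_L2 (u + v) y) =
    (LINT y|lborel. k (x, y) * rep_L2 u y) + (LINT y|lborel. k (x, y) * rep_L2 v y)"
   unfolding kernel_row_cinner[OF k] by (simp add: cinner_add_left)
  show "AE x in lborel. (LINT y|lborel. k (x, y) * rep_L2 (r *\<^sub>R u) y) =
    r * (LINT y|lborel. k (x, y) * rep_L2 u y)"
   unfolding kernel_row_cinner[OF k] by (simp add: cinner_scaleR_left)
 qed (rule K)
 then show ?thesis
  unfolding kernel_op_def by (rule bounded_linear_Blinfun_apply[THEN fun_cong])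
qed

lemma AE_rep_kernel_op:
 assumes "bounded_kernel k"
 shows "AE x in lborel. rep_L2 (blinfun_apply (kernel_op k) u) x = cinner u (abs_L2 (\<lambda>y. cnj (k (x, y))))"
 unfolding kernel_op_apply[OF assms] kernel_row_cinner[OF assms, symmetric]
 by (intro AE_rep_abs square_integrable_kernel_integral(1) assms)

definition adjoint_kernel :: "('a \<times> 'a => complex) => 'a \<times> 'a => complex" where
 "adjoint_kernel k = (\<lambda>(x, y). cnj (k (y, x)))"

lemma bounded_kernel_adjoint:
 assumes "bounded_kernel (k :: 'a::euclidean_space \<times> 'a => complex)"
 shows "bounded_kernel (adjoint_kernel k)"
proof -
 obtain B R where [measurable]: "k \<in> borel_measurable borel"
  and k: "\<And>x y. cmod (k (x, y)) \<le> B * indicator (ball 0 R) x * indicator (ball 0 R) y"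
  using bounded_kernelE[OF assms] by metis
 have "(\<lambda>z::'a \<times> 'a. (snd z, fst z)) \<in> borel_measurable borel"
  by (intro borel_measurable_continuous_onI continuous_intros)
 then have "adjoint_kernel k \<in> borel_measurable borel"
  unfolding adjoint_kernel_def case_prod_beta by measurable
 moreover have "cmod (adjoint_kernel k (x, y)) \<le> B * indicator (ball 0 R) x * indicator (ball 0 R) y" for x y
  using k[of y x] by (simp add: adjoint_kernel_def mult_ac)
 ultimately show ?thesis unfolding bounded_kernel_def by blast
qed

lemma integrable_L2_on_ball:
 fixes u :: "'a::euclidean_space L2"
 shows "integrable lborel (\<lambda>x. indicator (ball 0 R) x * rep_L2 u x)"
proof -
 have "cnj (indicator S x) = indicator S x" for S and x :: 'a by (simp add: indicator_def)
 then show ?thesis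
  using square_integrable_mult_cnj[OF square_integrable_rep[of u] square_integrable_ball[of 1 R]]
  by (simp add: mult.commute)
qed

lemma integrable_kernel_pairing:
 assumes "bounded_kernel (k :: 'a::euclidean_space \<times> 'a => complex)"
 shows "integrable (lborel \<Otimes>\<^sub>M lborel) (\<lambda>(x, y). k (x, y) * rep_L2 u y * cnj (rep_L2 v x))"
proof -
 obtain B R where B: "B \<ge> 0" and "k \<in> borel_measurable borel"
  and k: "\<And>x y. cmod (k (x, y)) \<le> B * indicator (ball 0 R) x * indicator (ball 0 R) y"
  using bounded_kernelE[OF assms] by metis
 then have [measurable]: "k \<in> borel_measurable (borel \<Otimes>\<^sub>M borel)" by (simp add: borel_prod)
 let ?g = "\<lambda>(x, y). (of_real B * (indicator (ball 0 R) x * rep_L2 v x)) * (indicator (ball 0 R) y * rep_L2 u y)"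
 have "integrable (lborel \<Otimes>\<^sub>M lborel) ?g"
 proof (rule lborel_pair.Fubini_integrable)
  show "?g \<in> borel_measurable (lborel \<Otimes>\<^sub>M lborel)" by measurable
  show "integrable lborel (\<lambda>x. LINT y|lborel. cmod (case (x, y) of (x, y) =>
    (of_real B * (indicator (ball 0 R) x * rep_L2 v x)) * (indicator (ball 0 R) y * rep_L2 u y)))"
   unfolding prod.case norm_mult[of "of_real B * _"]
   by (simp add: norm_mult[of "of_real B"] integrable_norm[OF integrable_L2_on_ball] del: norm_mult)
  show "AE x in lborel. integrable lborel (\<lambda>y. case (x, y) of (x, y) =>
    (of_real B * (indicator (ball 0 R) x * rep_L2 v x)) * (indicator (ball 0 R) y * rep_L2 u y))"
   unfolding prod.case by (intro AE_I2 integrable_mult_right integrable_L2_on_ball)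
 qed
 then show ?thesis
 proof (rule Bochner_Integration.integrable_bound)
  show "(\<lambda>(x, y). k (x, y) * rep_L2 u y * cnj (rep_L2 v x)) \<in> borel_measurable (lborel \<Otimes>\<^sub>M lborel)"
   by measurable
  show "AE z in lborel \<Otimes>\<^sub>M lborel. norm (case z of (x, y) => k (x, y) * rep_L2 u y * cnj (rep_L2 v x)) \<le> norm (?g z)"
  proof (intro AE_I2, clarify)
   fix x y :: 'a
   have "cmod (k (x, y)) * (cmod (rep_L2 u y) * cmod (rep_L2 v x))
     \<le> (B * indicator (ball 0 R) x * indicator (ball 0 R) y) * (cmod (rep_L2 u y) * cmod (rep_L2 v x))"
    by (intro mult_right_mono k) simp
   then show "norm (k (x, y) * rep_L2 u y * cnj (rep_L2 v x)) \<le> norm (of_real B * (indicator (ball 0 R) x * rep_L2 v x) * (indicator (ball 0 R) y * rep_L2 u y))"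
    using B by (cases "x \<in> ball 0 R"; cases "y \<in> ball 0 R") (auto simp: norm_mult mult_ac)
  qed
 qed
qed

lemma is_adjoint_kernel_op:
 assumes k: "bounded_kernel (k :: 'a::euclidean_space \<times> 'a => complex)"
 shows "is_adjoint (kernel_op k) (kernel_op (adjoint_kernel k))"
 unfolding is_adjoint_def
proof (intro allI)
 fix u v :: "'a L2"
 note ka = bounded_kernel_adjoint[OF k]
 let ?f = "\<lambda>x y. k (x, y) * rep_L2 u y * cnj (rep_L2 v x)"
 have "cinner (blinfun_apply (kernel_op k) u) v = cinner (abs_L2 (\<lambda>x. LINT y|lborel. k (x, y) * rep_L2 u y)) (abs_L2 (rep_L2 v))"
  by (simp add: kernel_op_apply[OF k])
 also have "... = (LINT x|lborel. (LINT y|lborel. k (x, y) * rep_L2 u y) * cnj (rep_L2 v x))"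
  by (intro cinner_abs square_integrable_kernel_integral(1) k square_integrable_rep)
 also have "... = (LINT x|lborel. LINT y|lborel. ?f x y)" by simp
 also have "... = (LINT y|lborel. LINT x|lborel. ?f x y)"
  by (rule lborel_pair.Fubini_integral[OF integrable_kernel_pairing[OF k], symmetric])
 also have "... = (LINT y|lborel. rep_L2 u y * cnj (LINT x|lborel. adjoint_kernel k (y, x) * rep_L2 v x))"
  by (simp add: adjoint_kernel_def mult_ac flip: Bochner_Integration.integral_cnj integral_mult_right_zero)
 also have "... = cinner (abs_L2 (rep_L2 u)) (abs_L2 (\<lambda>y. LINT x|lborel. adjoint_kernel k (y, x) * rep_L2 v x))"
  by (intro cinner_abs[symmetric] square_integrable_kernel_integral(1) ka square_integrable_rep)
 also have "... = cinner u (blinfun_apply (kernel_op (adjoint_kernel k)) v)"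
  by (simp add: kernel_op_apply[OF ka])
 finally show "cinner (blinfun_apply (kernel_op k) u) v = cinner u (blinfun_apply (kernel_op (adjoint_kernel k)) v)" .
qed

section \<open>Schwartz functions\<close>

lemma has_dir_derivD:
 assumes "has_dir_deriv v f"
 shows "((\<lambda>s. f (z + s *\<^sub>R v)) has_vector_derivative dir_deriv v f (z + t *\<^sub>R v)) (at t)"
proof -
 have "(\<lambda>s. f ((z + t *\<^sub>R v) + s *\<^sub>R v)) differentiable (at 0)"
  using assms by (simp add: has_dir_deriv_def)
 then have "((\<lambda>s. f ((z + t *\<^sub>R v) + s *\<^sub>R v)) has_vector_derivative dir_deriv v f (z + t *\<^sub>R v)) (at (t - t))"
  by (simp add: dir_deriv_def vector_derivative_works)
 then have "((\<lambda>s. f ((z + t *\<^sub>R v) + s *\<^sub>R v)) \<circ> (\<lambda>s. s - t) has_vector_derivative 1 *\<^sub>R dir_deriv v f (z + t *\<^sub>R v)) (at t)"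
  by (intro vector_diff_chain_at) (auto intro!: derivative_eq_intros simp: has_vector_derivative_def)
 then show ?thesis by (simp add: o_def algebra_simps)
qed

lemma dir_deriv_eqI:
 assumes "\<And>z. ((\<lambda>s. f (z + s *\<^sub>R v)) has_vector_derivative g z) (at 0)"
 shows "has_dir_deriv v f" "dir_deriv v f = g"
 using assms by (auto simp: has_dir_deriv_def dir_deriv_def vector_derivative_at intro: differentiableI_vector)

lemma partial_deriv_Cons: "partial_deriv (i # I) f = dir_deriv (axis i 1) (partial_deriv I f)"
 by (simp add: partial_deriv_def)

lemma schwartz_partial_deriv:
 assumes "schwartz f"
 shows "schwartz (partial_deriv J f)"
proof -
 have "partial_deriv I (partial_deriv J f) = partial_deriv (I @ J) f" for I
  by (simp add: partial_deriv_def)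
 then show ?thesis using assms by (simp add: schwartz_def)
qed

lemma schwartz_decay:
 assumes "schwartz f"
 obtains C where "C \<ge> 0" "\<And>x. cmod (f x) * (1 + norm x) ^ N \<le> C"
proof -
 have "bounded (range (\<lambda>x. (1 + norm x) ^ N *\<^sub>R partial_deriv [] f x))"
  using assms unfolding schwartz_def by blast
 then obtain C where "C > 0" "\<And>x. norm ((1 + norm x) ^ N *\<^sub>R f x) \<le> C"
  unfolding bounded_pos by (auto simp: partial_deriv_def)
 then show ?thesis by (intro that[of C]) (auto simp: mult.commute)
qed

lemma schwartz_line_derivative:
 fixes f :: "real^'n::finite => complex"
 assumes "schwartz f"
 shows "((\<lambda>s. f (z + s *\<^sub>R axis i 1)) has_vector_derivative partial_deriv [i] f (z + t *\<^sub>R axis i 1)) (at t)"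
proof -
 have "has_dir_deriv (axis i 1) (partial_deriv [] f)"
  using assms unfolding schwartz_def by blast
 from has_dir_derivD[OF this, of z t] show ?thesis by (simp add: partial_deriv_def)
qed

lemma lipschitz_of_bounded_partials:
 fixes f :: "real^'n::finite => complex"
 assumes f: "\<And>i z t. ((\<lambda>s. f (z + s *\<^sub>R axis i 1)) has_vector_derivative g i (z + t *\<^sub>R axis i 1)) (at t)"
  and b: "\<And>i z. cmod (g i z) \<le> B"
 shows "cmod (f x - f y) \<le> B * real CARD('n) * norm (x - y)"
proof -
 have B: "B \<ge> 0" using b norm_ge_zero order_trans by blast
 have "cmod (f x - f (\<chi> i. if i \<in> I then y $ i else x $ i)) \<le> B * (\<Sum>i\<in>I. \<bar>x $ i - y $ i\<bar>)" if "finite I" for I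
  using that
 proof (induction I)
  case empty
  have "(\<chi> i. x $ i) = x" by (simp add: vec_eq_iff)
  then show ?case by simp
 next
  case (insert j I)
  define p where "p = (\<chi> i. if i \<in> I then y $ i else x $ i)"
  have "(\<chi> i. if i \<in> insert j I then y $ i else x $ i) = p + (y $ j - x $ j) *\<^sub>R axis j 1"
   using insert.hyps by (auto simp: p_def vec_eq_iff axis_def)
  moreover have "cmod (f (p + (y $ j - x $ j) *\<^sub>R axis j 1) - f (p + 0 *\<^sub>R axis j 1)) \<le> B * \<bar>(y $ j - x $ j) - 0\<bar>"
  proof -
   have "norm (f (p + (y $ j - x $ j) *\<^sub>R axis j 1) - f (p + 0 *\<^sub>R axis j 1)) \<le> B * norm ((y $ j - x $ j) - 0)"
   proof (rule differentiable_bound[where S = UNIV and f = "\<lambda>s. f (p + s *\<^sub>R axis j 1)" and f' = "\<lambda>t h. h *\<^sub>R g j (p + t *\<^sub>R axis j 1)"])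
    show "((\<lambda>s. f (p + s *\<^sub>R axis j 1)) has_derivative (\<lambda>h. h *\<^sub>R g j (p + t *\<^sub>R axis j 1))) (at t)" for t
     using f[of p j t] by (simp add: has_vector_derivative_def)
    show "onorm (\<lambda>h. h *\<^sub>R g j (p + t *\<^sub>R axis j 1)) \<le> B" for t
     by (rule onorm_le) (simp add: mult.commute[of B] mult_left_mono b)
   qed auto
   then show ?thesis by simp
  qed
  ultimately have "cmod (f p - f (\<chi> i. if i \<in> insert j I then y $ i else x $ i)) \<le> B * \<bar>x $ j - y $ j\<bar>"
   by (simp add: norm_minus_commute abs_minus_commute)
  moreover have "cmod (f x - f p) \<le> B * (\<Sum>i\<in>I. \<bar>x $ i - y $ i\<bar>)"
   using insert.IH by (simp add: p_def)
  ultimately show ?case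
   using insert.hyps norm_triangle_le_diff[of "f x - f p" "f (\<chi> i. if i \<in> insert j I then y $ i else x $ i) - f p"]
    norm_triangle_ineq[of "f x - f p" "f p - f (\<chi> i. if i \<in> insert j I then y $ i else x $ i)"]
   by (simp add: distrib_left)
 qed
 from this[of UNIV] have "cmod (f x - f y) \<le> B * (\<Sum>i\<in>UNIV. \<bar>x $ i - y $ i\<bar>)"
  by simp
 also have "... \<le> B * (\<Sum>i\<in>(UNIV::'n set). norm (x - y))"
  using B component_le_norm_cart[of "x - y"] by (intro mult_left_mono sum_mono) auto
 finally show ?thesis by (simp add: mult_ac)
qed

lemma schwartz_continuous:
 fixes f :: "real^'n::finite => complex"
 assumes "schwartz f"
 shows "continuous_on UNIV f"
proof -
 have "\<exists>C. \<forall>x. cmod (partial_deriv [i] f x) \<le> C" for i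
  using schwartz_decay[OF schwartz_partial_deriv[OF assms], of "[i]" 0] by (metis mult.right_neutral power_0)
 then obtain C where C: "\<And>i x. cmod (partial_deriv [i] f x) \<le> C i" by metis
 define B where "B = (\<Sum>i\<in>UNIV. \<bar>C i\<bar>)"
 have CB: "cmod (partial_deriv [i] f x) \<le> B" for i x
  using C[of i x] member_le_sum[of i UNIV "\<lambda>i. \<bar>C i\<bar>"] by (force simp: B_def)
 have "B \<ge> 0" by (simp add: B_def sum_nonneg)
 have "(B * real CARD('n))-lipschitz_on UNIV f"
  using lipschitz_of_bounded_partials[OF schwartz_line_derivative[OF assms] CB] \<open>B \<ge> 0\<close>
  by (auto intro!: lipschitz_onI simp: dist_norm)
 then show ?thesis by (rule lipschitz_on_continuous_on)
qed

lemma lborel_integral_prod: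
 fixes f :: "'n::finite => real => 'b::{real_normed_field,banach,second_countable_topology}"
 assumes f: "\<And>i. integrable lborel (f i)"
 shows "integrable lborel (\<lambda>x::real^'n. \<Prod>i\<in>UNIV. f i (x $ i))"
  and "(LINT x|lborel. (\<Prod>i\<in>UNIV. f i ((x::real^'n) $ i))) = (\<Prod>i\<in>UNIV. LINT t|lborel. f i t)"
proof -
 interpret product_sigma_finite "\<lambda>_::real^'n. lborel :: real measure" by standard
 define g where "g b = f (THE i. b = axis i 1)" for b :: "real^'n"
 have g: "g (axis i 1) = f i" for i by (simp add: g_def axis_eq_axis)
 have B: "(Basis :: (real^'n) set) = range (\<lambda>i. axis i 1)" by (auto simp: Basis_vec_def)
 have inj: "inj (\<lambda>i::'n. axis i (1::real))" by (simp add: inj_def axis_eq_axis)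
 have gb: "integrable lborel (g b)" if "b \<in> Basis" for b using that by (auto simp: B g f)
 have reindex: "(\<Prod>b\<in>Basis. h b) = (\<Prod>i\<in>UNIV. h (axis i 1))" for h :: "real^'n => 'b"
  unfolding B by (simp add: prod.reindex[OF inj])
 define F where "F x = (\<Prod>b\<in>Basis. g b (x \<bullet> b))" for x :: "real^'n"
 have F: "F x = (\<Prod>i\<in>UNIV. f i (x $ i))" for x
  unfolding F_def reindex by (simp add: g inner_axis)
 have Fm: "F \<in> borel_measurable borel"
  unfolding F_def using borel_measurable_integrable[OF gb] by (intro borel_measurable_prod) (auto intro: measurable_compose[rotated])
 have m: "(\<lambda>y. \<Sum>b\<in>Basis. y b *\<^sub>R b) \<in> measurable (\<Pi>\<^sub>M b\<in>(Basis::(real^'n) set). lborel) borel"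
  by measurable
 have Fs: "F (\<Sum>b\<in>Basis. y b *\<^sub>R b) = (\<Prod>b\<in>Basis. g b (y b))" for y
  unfolding F_def by (rule prod.cong) (auto simp: inner_sum_left inner_Basis if_distrib cong: if_cong)
 have "integrable (\<Pi>\<^sub>M b\<in>(Basis::(real^'n) set). lborel) (\<lambda>y. F (\<Sum>b\<in>Basis. y b *\<^sub>R b))"
  unfolding Fs by (rule product_integrable_prod) (auto intro: gb)
 then have "integrable (distr (\<Pi>\<^sub>M b\<in>(Basis::(real^'n) set). lborel) borel (\<lambda>y. \<Sum>b\<in>Basis. y b *\<^sub>R b)) F"
  by (subst integrable_distr_eq[OF m Fm])
 then show "integrable lborel (\<lambda>x::real^'n. \<Prod>i\<in>UNIV. f i (x $ i))"
  unfolding lborel_eq[symmetric] F .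
 have "integral\<^sup>L lborel F = integral\<^sup>L (distr (\<Pi>\<^sub>M b\<in>(Basis::(real^'n) set). lborel) borel (\<lambda>y. \<Sum>b\<in>Basis. y b *\<^sub>R b)) F"
  unfolding lborel_eq[symmetric] ..
 also have "... = (LINT y|(\<Pi>\<^sub>M b\<in>(Basis::(real^'n) set). lborel). (\<Prod>b\<in>Basis. g b (y b)))"
  by (subst integral_distr[OF m Fm]) (simp add: Fs)
 also have "... = (\<Prod>b\<in>Basis. LINT t|lborel. g b t)"
  by (rule product_integral_prod) (auto intro: gb)
 finally show "(LINT x|lborel. (\<Prod>i\<in>UNIV. f i ((x::real^'n) $ i))) = (\<Prod>i\<in>UNIV. LINT t|lborel. f i t)"
  unfolding F reindex g .
qed

lemma integrable_polynomial_decay: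
 "integrable lborel (\<lambda>x::real^'n::finite. 1 / (1 + norm x) ^ (2 * CARD('n)))"
proof -
 have *: "integrable lborel (\<lambda>t::real. inverse (1 + t^2))"
  using integrable_inverse_1_plus_square by (simp add: set_integrable_def einterval_def)
 have "integrable lborel (\<lambda>x::real^'n. \<Prod>i\<in>UNIV. inverse (1 + (x $ i)^2))"
  by (rule lborel_integral_prod(1)) (rule *)
 then show ?thesis
 proof (rule Bochner_Integration.integrable_bound)
  show "(\<lambda>x::real^'n. 1 / (1 + norm x) ^ (2 * CARD('n))) \<in> borel_measurable lborel" by measurable
  have "(\<Prod>i\<in>UNIV. 1 + (x $ i)^2) \<le> (1 + norm x) ^ (2 * CARD('n))" for x :: "real^'n"
  proof -
   have "(\<Prod>i\<in>UNIV. 1 + (x $ i)^2) \<le> (\<Prod>i\<in>(UNIV::'n set). (1 + norm x)^2)"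
   proof (intro prod_mono conjI)
    fix i
    have "(x $ i)^2 \<le> (norm x)^2"
     using component_le_norm_cart[of x i] by (metis abs_ge_zero power2_abs power_mono)
    then show "1 + (x $ i)^2 \<le> (1 + norm x)^2"
     using norm_ge_zero[of x] by (simp add: power2_sum del: norm_ge_zero)
   qed auto
   then show ?thesis by (simp add: power_mult)
  qed
  then have "1 / (1 + norm x) ^ (2 * CARD('n)) \<le> (\<Prod>i\<in>UNIV. inverse (1 + (x $ i)^2))" for x :: "real^'n"
   using prod_inversef[of "\<lambda>i. 1 + (x $ i)\<^sup>2" UNIV]
   by (simp add: o_def divide_inverse le_imp_inverse_le prod_pos add_pos_nonneg)
  then have "norm (1 / (1 + norm x) ^ (2 * CARD('n))) \<le> norm (\<Prod>i\<in>UNIV. inverse (1 + (x $ i)^2))" for x :: "real^'n"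
   unfolding real_norm_def by (subst abs_of_nonneg) (auto intro: order_trans[OF _ abs_ge_self])
  then show "AE x in lborel. norm (1 / (1 + norm x) ^ (2 * CARD('n))) \<le> norm (\<Prod>i\<in>UNIV. inverse (1 + ((x :: real^'n) $ i)^2))"
   by (intro AE_I2)
 qed
qed

lemma schwartz_measurable: "schwartz f ==> f \<in> borel_measurable borel"
 by (rule borel_measurable_continuous_onI[OF schwartz_continuous])

lemma schwartz_bounded:
 assumes "schwartz f"
 obtains C where "C \<ge> 0" "\<And>x. cmod (f x) \<le> C"
 using schwartz_decay[OF assms, of 0] by (metis mult.right_neutral power_0)

lemma schwartz_integrable:
 fixes f :: "real^'n::finite => complex"
 assumes "schwartz f"
 shows "integrable lborel f"
proof -
 obtain C where C: "C \<ge> 0" "\<And>x. cmod (f x) * (1 + norm x) ^ (2 * CARD('n)) \<le> C"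
  using schwartz_decay[OF assms] by blast
 have "integrable lborel (\<lambda>x::real^'n. C * (1 / (1 + norm x) ^ (2 * CARD('n))))"
  by (intro integrable_mult_right integrable_polynomial_decay)
 then show ?thesis
 proof (rule Bochner_Integration.integrable_bound)
  show "f \<in> borel_measurable lborel" using schwartz_measurable[OF assms] by simp
  have "cmod (f x) \<le> C / (1 + norm x) ^ (2 * CARD('n))" for x
   using C(2)[of x] by (subst pos_le_divide_eq) (auto intro!: add_pos_nonneg zero_less_power)
  then show "AE x in lborel. norm (f x) \<le> norm (C * (1 / (1 + norm x) ^ (2 * CARD('n))))"
   using C(1) by auto
 qed
qed

lemma square_integrable_of_bounded_integrable:
 assumes "integrable lborel f" "\<And>x. cmod (f x) \<le> C"
 shows "square_integrable f"
proof -
 have [measurable]: "f \<in> borel_measurable borel" using borel_measurable_integrable[OF assms(1)] by simp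
 have C: "C \<ge> 0" using assms(2) norm_ge_zero order_trans by blast
 have "integrable lborel (\<lambda>x. (cmod (f x))\<^sup>2)"
 proof (rule Bochner_Integration.integrable_bound)
  show "integrable lborel (\<lambda>x. C * cmod (f x))"
   by (intro integrable_mult_right integrable_norm assms)
  show "AE x in lborel. norm ((cmod (f x))\<^sup>2) \<le> norm (C * cmod (f x))"
   using assms(2) C by (auto simp: power2_eq_square mult_right_mono)
 qed simp
 then show ?thesis by (simp add: square_integrable_def)
qed

lemma schwartz_square_integrable:
 assumes "schwartz f"
 shows "square_integrable f"
 by (rule schwartz_bounded[OF assms]) (rule square_integrable_of_bounded_integrable[OF schwartz_integrable[OF assms]])

text \<open>
 The functions \<open>P e\<^sup>-\<^sup>R\<close> with polynomials \<open>P\<close> and \<open>R\<close> are closed under differentiation, so that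
 they are Schwartz functions as soon as \<open>R\<close> grows quadratically.
\<close>

lemma polynomial_line_derivative:
 fixes P :: "'a::real_normed_vector => real"
 assumes "real_polynomial_function P"
 shows "\<exists>P'. real_polynomial_function P' \<and> (\<forall>z. ((\<lambda>s. P (z + s *\<^sub>R v)) has_real_derivative P' z) (at 0))"
 using assms
proof induction
 case (linear f)
 interpret bounded_linear f by fact
 have "((\<lambda>s. f (z + s *\<^sub>R v)) has_real_derivative f v) (at 0)" for z
  by (auto intro!: derivative_eq_intros simp: add scaleR)
 then show ?case by (intro exI[of _ "\<lambda>_. f v"]) auto
next
 case (const c)
 show ?case by (intro exI[of _ "\<lambda>_. 0"]) auto
next
 case (add f g)
 then obtain f' g' where "real_polynomial_function f'" "real_polynomial_function g'"
  "\<And>z. ((\<lambda>s. f (z + s *\<^sub>R v)) has_real_derivative f' z) (at 0)"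
  "\<And>z. ((\<lambda>s. g (z + s *\<^sub>R v)) has_real_derivative g' z) (at 0)" by metis
 then show ?case by (intro exI[of _ "\<lambda>z. f' z + g' z"]) (auto intro: DERIV_add)
next
 case (mult f g)
 then obtain f' g' where d: "real_polynomial_function f'" "real_polynomial_function g'"
  "\<And>z. ((\<lambda>s. f (z + s *\<^sub>R v)) has_real_derivative f' z) (at 0)"
  "\<And>z. ((\<lambda>s. g (z + s *\<^sub>R v)) has_real_derivative g' z) (at 0)" by metis
 have "((\<lambda>s. f (z + s *\<^sub>R v) * g (z + s *\<^sub>R v)) has_real_derivative f' z * g z + g' z * f z) (at 0)" for z
  using DERIV_mult[OF d(3)[of z] d(4)[of z]] by simp
 with d mult show ?case by (intro exI[of _ "\<lambda>z. f' z * g z + g' z * f z"]) auto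
qed

lemma polynomial_growth:
 fixes P :: "'a::real_normed_vector => real"
 assumes "real_polynomial_function P"
 shows "\<exists>C k. C \<ge> 0 \<and> (\<forall>x. \<bar>P x\<bar> \<le> C * (1 + norm x) ^ k)"
 using assms
proof induction
 case (linear f)
 then obtain K where K: "K > 0" "\<And>x. norm (f x) \<le> norm x * K" using bounded_linear.pos_bounded by blast
 have "\<bar>f x\<bar> \<le> K * (1 + norm x) ^ 1" for x
  using K(2)[of x] K(1) by (simp add: algebra_simps)
 then show ?case using K(1) by (intro exI[of _ K] exI[of _ 1]) auto
next
 case (const c)
 show ?case by (intro exI[of _ "\<bar>c\<bar>"] exI[of _ 0]) auto
next
 case (add f g)
 then obtain C k D j where *: "C \<ge> 0" "D \<ge> 0" "\<And>x. \<bar>f x\<bar> \<le> C * (1 + norm x) ^ k" "\<And>x. \<bar>g x\<bar> \<le> D * (1 + norm x) ^ j" by metis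
 have "\<bar>f x + g x\<bar> \<le> (C + D) * (1 + norm x) ^ (k + j)" for x
 proof -
  have "(1 + norm x) ^ k \<le> (1 + norm x) ^ (k + j)" "(1 + norm x) ^ j \<le> (1 + norm x) ^ (k + j)"
   by (auto intro!: power_increasing)
  then have "C * (1 + norm x) ^ k \<le> C * (1 + norm x) ^ (k + j)" "D * (1 + norm x) ^ j \<le> D * (1 + norm x) ^ (k + j)"
   using *(1,2) by (auto intro: mult_left_mono)
  then show ?thesis using *(3,4)[of x] by (simp add: distrib_right)
 qed
 then show ?case using *(1,2) by (intro exI[of _ "C + D"] exI[of _ "k + j"]) auto
next
 case (mult f g)
 then obtain C k D j where *: "C \<ge> 0" "D \<ge> 0" "\<And>x. \<bar>f x\<bar> \<le> C * (1 + norm x) ^ k" "\<And>x. \<bar>g x\<bar> \<le> D * (1 + norm x) ^ j" by metis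
 have "\<bar>f x * g x\<bar> \<le> (C * D) * (1 + norm x) ^ (k + j)" for x
  using mult_mono[OF *(3)[of x] *(4)[of x]] *(1) by (simp add: abs_mult power_add mult_ac)
 then show ?case using *(1,2) by (intro exI[of _ "C * D"] exI[of _ "k + j"]) auto
qed

lemma power_times_gaussian_bounded:
 fixes c :: real
 assumes "c > 0" "t \<ge> 0"
 shows "(1 + t) ^ N * exp (b - c * t\<^sup>2) \<le> fact N * exp (1 + 1 / (4 * c) + b)"
proof -
 have "(1 + t) ^ N / fact N \<le> exp (1 + t)"
  using sum_le_suminf[OF sums_summable[OF exp_converges[of "1 + t"]], of "{N}"]
   sums_unique[OF exp_converges[of "1 + t"]] assms by (simp add: divide_inverse mult.commute)
 then have "(1 + t) ^ N \<le> fact N * exp (1 + t)" by (simp add: field_simps)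
 then have "(1 + t) ^ N * exp (b - c * t\<^sup>2) \<le> fact N * exp (1 + t) * exp (b - c * t\<^sup>2)"
  by (rule mult_right_mono) simp
 also have "... = fact N * exp (1 + t + (b - c * t\<^sup>2))" by (simp add: exp_add)
 also have "1 + t + (b - c * t\<^sup>2) \<le> 1 + 1 / (4 * c) + b"
 proof -
  have "0 \<le> (2 * c * t - 1)\<^sup>2 / (4 * c)" using assms by simp
  also have "... = c * t\<^sup>2 - t + 1 / (4 * c)"
   using assms by (simp add: power2_eq_square field_simps)
  finally show ?thesis by simp
 qed
 finally show ?thesis by simp
qed

lemma schwartz_polynomial_exp:
 fixes P R :: "real^'n::finite => real"
 assumes P: "real_polynomial_function P" and R: "real_polynomial_function R"
  and c: "c > 0" "\<And>x. R x \<ge> c * (norm x)\<^sup>2 - b"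
 shows "schwartz (\<lambda>x. w * of_real (P x * exp (- R x)))"
proof -
 define G where "G P = (\<lambda>x. w * complex_of_real (P x * exp (- R x)))" for P
 have step: "\<exists>P'. real_polynomial_function P' \<and> has_dir_deriv (axis i 1) (G P) \<and> dir_deriv (axis i 1) (G P) = G P'"
  if P1: "real_polynomial_function P" for P i
 proof -
  obtain P' R' where d: "real_polynomial_function P'" "real_polynomial_function R'"
   "\<And>z. ((\<lambda>s. P (z + s *\<^sub>R axis i 1)) has_real_derivative P' z) (at 0)"
   "\<And>z. ((\<lambda>s. R (z + s *\<^sub>R axis i 1)) has_real_derivative R' z) (at 0)"
   using polynomial_line_derivative[OF P1, where v = "axis i 1"] polynomial_line_derivative[OF R, where v = "axis i 1"] by metis
  define Q where "Q z = P' z - P z * R' z" for z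
  have Q: "real_polynomial_function Q"
   unfolding Q_def using d P1 by (intro real_polynomial_function_diff) auto
  have "((\<lambda>s. P (z + s *\<^sub>R axis i 1) * exp (- R (z + s *\<^sub>R axis i 1))) has_real_derivative Q z * exp (- R z)) (at 0)" for z
  proof -
   have "((\<lambda>s. P (z + s *\<^sub>R axis i 1) * exp (- R (z + s *\<^sub>R axis i 1))) has_real_derivative
     P' z * exp (- R (z + 0 *\<^sub>R axis i 1)) + (exp (- R (z + 0 *\<^sub>R axis i 1)) * - R' z) * P (z + 0 *\<^sub>R axis i 1)) (at 0)"
    by (intro DERIV_mult d DERIV_minus DERIV_fun_exp)
   then show ?thesis by (simp add: Q_def algebra_simps)
  qed
  then have "((\<lambda>s. G P (z + s *\<^sub>R axis i 1)) has_vector_derivative G Q z) (at 0)" for z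
   unfolding G_def by (intro has_vector_derivative_mult_right has_vector_derivative_of_real) 
  then show ?thesis using dir_deriv_eqI[of "G P" "axis i 1" "G Q"] Q by blast
 qed
 have all: "\<exists>P'. real_polynomial_function P' \<and> partial_deriv I (G P) = G P'" for I
 proof (induction I)
  case Nil
  show ?case using P by (auto simp: partial_deriv_def)
 next
  case (Cons i I)
  then obtain P' where "real_polynomial_function P'" "partial_deriv I (G P) = G P'" by blast
  then show ?case using step[of P' i] by (auto simp: partial_deriv_Cons)
 qed
 have bd: "bounded (range (\<lambda>x. (1 + norm x) ^ N *\<^sub>R G P' x))" if P': "real_polynomial_function P'" for P' N
 proof -
  obtain C k where C: "C \<ge> 0" "\<And>x. \<bar>P' x\<bar> \<le> C * (1 + norm x) ^ k" using polynomial_growth[OF P'] by blast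
  have "norm ((1 + norm x) ^ N *\<^sub>R G P' x) \<le> cmod w * (C * (fact (N + k) * exp (1 + 1 / (4 * c) + b)))" for x
  proof -
   have "norm ((1 + norm x) ^ N *\<^sub>R G P' x) = cmod w * ((1 + norm x) ^ N * (\<bar>P' x\<bar> * exp (- R x)))"
    by (simp add: G_def norm_mult abs_mult)
   also have "... \<le> cmod w * ((1 + norm x) ^ N * ((C * (1 + norm x) ^ k) * exp (b - c * (norm x)\<^sup>2)))"
    using C c(2)[of x] by (intro mult_left_mono mult_mono) auto
   also have "... = cmod w * (C * ((1 + norm x) ^ (N + k) * exp (b - c * (norm x)\<^sup>2)))"
    by (simp add: power_add mult_ac)
   also have "... \<le> cmod w * (C * (fact (N + k) * exp (1 + 1 / (4 * c) + b)))"
    using C(1) c(1) by (intro mult_left_mono power_times_gaussian_bounded) auto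
   finally show ?thesis .
  qed
  then show ?thesis unfolding bounded_iff by blast
 qed
 have "schwartz (G P)"
  unfolding schwartz_def using all step bd by metis
 then show ?thesis by (simp add: G_def)
qed

lemma L2_dominated_convergence:
 fixes F :: "'a::euclidean_space => complex"
 assumes f: "\<And>k. f k \<in> borel_measurable borel" and F: "F \<in> borel_measurable borel"
  and g: "square_integrable g" and bf: "\<And>k x. cmod (f k x) \<le> cmod (g x)" and bF: "\<And>x. cmod (F x) \<le> cmod (g x)"
  and lim: "AE x in lborel. (\<lambda>k. f k x) \<longlonglongrightarrow> F x"
 shows "(\<lambda>k. abs_L2 (f k)) \<longlonglongrightarrow> abs_L2 F"
proof -
 have fs: "square_integrable (f k)" for k by (rule square_integrable_bound[OF g f bf])
 have Fs: "square_integrable F" by (rule square_integrable_bound[OF g F bF])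
 have [measurable]: "f k \<in> borel_measurable borel" "F \<in> borel_measurable borel" "g \<in> borel_measurable borel" for k
  using f F square_integrable_measurable[OF g] by auto
 have "(\<lambda>k. LINT x|lborel. (cmod (f k x - F x))\<^sup>2) \<longlonglongrightarrow> (LINT x|(lborel :: 'a measure). 0)"
 proof (rule Bochner_Integration.integral_dominated_convergence[where s = "\<lambda>k x. (cmod (f k x - F x))\<^sup>2" and f = "\<lambda>x. 0" and w = "\<lambda>x. 4 * (cmod (g x))\<^sup>2"])
  show "integrable lborel (\<lambda>x. 4 * (cmod (g x))\<^sup>2)"
   using g by (simp add: square_integrable_def)
  show "AE x in lborel. (\<lambda>k. (cmod (f k x - F x))\<^sup>2) \<longlonglongrightarrow> 0"
   using lim
  proof eventually_elim
   case (elim x)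
   then have "(\<lambda>k. (cmod (f k x - F x))\<^sup>2) \<longlonglongrightarrow> (cmod (F x - F x))\<^sup>2" by (intro tendsto_intros)
   then show ?case by simp
  qed
  show "AE x in lborel. norm ((cmod (f k x - F x))\<^sup>2) \<le> 4 * (cmod (g x))\<^sup>2" for k
  proof (rule AE_I2)
   fix x
   have "cmod (f k x - F x) \<le> 2 * cmod (g x)"
    using norm_triangle_ineq4[of "f k x" "F x"] bf[of k x] bF[of x] by linarith
   then have "(cmod (f k x - F x))\<^sup>2 \<le> (2 * cmod (g x))\<^sup>2" by (rule power_mono) simp
   then show "norm ((cmod (f k x - F x))\<^sup>2) \<le> 4 * (cmod (g x))\<^sup>2" by (simp add: power_mult_distrib)
  qed
 qed simp_all
 then have "(\<lambda>k. (norm (abs_L2 (f k) - abs_L2 F))\<^sup>2) \<longlonglongrightarrow> 0"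
  by (simp only: abs_L2_diff[OF fs Fs] norm_abs_L2_sq[OF square_integrable_diff[OF fs Fs]] integral_zero)
 then have "(\<lambda>k. sqrt ((norm (abs_L2 (f k) - abs_L2 F))\<^sup>2)) \<longlonglongrightarrow> sqrt 0"
  by (rule tendsto_real_sqrt)
 then show ?thesis
  by (simp add: tendsto_norm_zero_iff LIM_zero_iff)
qed

lemma AE_coordinate_neq:
 "AE x in lborel. (x :: real^'n::finite) $ i \<noteq> c"
proof -
 have "negligible {x :: real^'n. x $ i = c}"
  unfolding cart_eq_inner_axis by (rule negligible_standard_hyperplane) (simp add: axis_in_Basis_iff)
 then have "{x :: real^'n. x $ i = c} \<in> null_sets lebesgue" by (simp add: negligible_iff_null_sets)
 then have "AE x in lebesgue. (x :: real^'n) $ i \<noteq> c" by (rule AE_I') auto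
 then show ?thesis by (simp add: AE_completion_iff)
qed

text \<open>
 The functions \<open>exp (- \<Sum>\<^sub>i ((x\<^sub>i - c\<^sub>i) / w\<^sub>i)\<^sup>2\<^sup>k)\<close> are Schwartz functions and tend to the indicator function of the
 box with centre \<open>c\<close> and half widths \<open>w\<^sub>i\<close> as \<open>k \<rightarrow> \<infinity>\<close>.
\<close>

lemma box_indicator_limit:
 fixes a b :: "real^'n::finite"
 assumes ab: "\<And>i. a $ i < b $ i"
  and V: "closed V" "\<And>f. schwartz f ==> abs_L2 f \<in> V"
 shows "abs_L2 (\<lambda>x. z * indicator (box a b) x) \<in> V"
proof -
 define y where "y i x = (x $ i - (a $ i + b $ i) / 2) / ((b $ i - a $ i) / 2)" for i and x :: "real^'n"
 define R where "R k x = (\<Sum>i\<in>UNIV. (y i x) ^ (2 * Suc k))" for k x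
 define g where "g k x = z * complex_of_real (1 * exp (- R k x))" for k x
 have y2: "(y i x) ^ (2 * Suc k) \<ge> (y i x)\<^sup>2 - 1" for i x k
 proof (cases "\<bar>y i x\<bar> \<le> 1")
  case True
  then have "(y i x)\<^sup>2 \<le> 1" by (simp add: abs_square_le_1)
  moreover have "0 \<le> (y i x) ^ (2 * Suc k)" by (rule zero_le_even_power) simp
  ultimately show ?thesis by linarith
 next
  case False
  then have "1 \<le> (y i x)\<^sup>2" using abs_square_less_1[of "y i x"] abs_square_eq_1[of "y i x"]
   by (meson abs_square_le_1 linorder_linear le_cases)
  then have "((y i x)\<^sup>2) ^ 1 \<le> ((y i x)\<^sup>2) ^ Suc k" by (intro power_increasing) auto
  moreover have "((y i x)\<^sup>2) ^ Suc k = (y i x) ^ (2 * Suc k)" by (rule power_mult[symmetric])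
  ultimately show ?thesis unfolding power_one_right by linarith
 qed
 define W where "W = Max (range (\<lambda>i. (b $ i - a $ i) / 2))"
 have W: "(b $ i - a $ i) / 2 \<le> W" for i unfolding W_def by (intro Max_ge) auto
 have "(b $ undefined - a $ undefined) / 2 > 0" using ab[of undefined] by simp
 with W[of undefined] have Wp: "W > 0" by linarith
 define m where "m = (\<chi> i. (a $ i + b $ i) / 2)"
 have Rb: "R k x \<ge> 1 / (2 * W\<^sup>2) * (norm x)\<^sup>2 - ((norm m)\<^sup>2 / W\<^sup>2 + real CARD('n))" for k x
 proof -
  have "(x $ i - m $ i)\<^sup>2 / W\<^sup>2 \<le> (y i x)\<^sup>2" for i
  proof -
   have "(y i x)\<^sup>2 = (x $ i - m $ i)\<^sup>2 / ((b $ i - a $ i) / 2)\<^sup>2" unfolding y_def m_def by (simp only: power_divide vec_lambda_beta)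
   moreover have "((b $ i - a $ i) / 2)\<^sup>2 \<le> W\<^sup>2" using W[of i] ab[of i] by (intro power_mono) auto
   moreover have "0 < W\<^sup>2 * ((b $ i - a $ i) / 2)\<^sup>2"
    using ab[of i] Wp by (intro mult_pos_pos zero_less_power) auto
   ultimately show ?thesis by (simp only: divide_left_mono zero_le_power2)
  qed
  then have "(\<Sum>i\<in>UNIV. (x $ i - m $ i)\<^sup>2 / W\<^sup>2 - 1) \<le> (\<Sum>i\<in>UNIV. (y i x) ^ (2 * Suc k))"
   using y2[of _ x k] by (intro sum_mono) (meson diff_right_mono order_trans)
  moreover have "(\<Sum>i\<in>UNIV. (x $ i - m $ i)\<^sup>2 / W\<^sup>2 - 1) = (norm (x - m))\<^sup>2 / W\<^sup>2 - real CARD('n)"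
   by (simp add: sum_subtractf sum_divide_distrib[symmetric] norm_vec_def L2_set_def sum_nonneg)
  moreover have "(norm x)\<^sup>2 / 2 - (norm m)\<^sup>2 \<le> (norm (x - m))\<^sup>2"
  proof -
   have "norm x \<le> norm (x - m) + norm m" using norm_triangle_ineq[of "x - m" m] by simp
   then have "(norm x)\<^sup>2 \<le> (norm (x - m) + norm m)\<^sup>2" by (intro power_mono) auto
   also have "... \<le> 2 * (norm (x - m))\<^sup>2 + 2 * (norm m)\<^sup>2"
    using sum_squares_bound[of "norm (x - m)" "norm m"] by (simp add: power2_sum)
   finally show ?thesis by simp
  qed
  then have "((norm x)\<^sup>2 / 2 - (norm m)\<^sup>2) / W\<^sup>2 \<le> (norm (x - m))\<^sup>2 / W\<^sup>2" by (rule divide_right_mono) simp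
  moreover have "((norm x)\<^sup>2 / 2 - (norm m)\<^sup>2) / W\<^sup>2 = 1 / (2 * W\<^sup>2) * (norm x)\<^sup>2 - (norm m)\<^sup>2 / W\<^sup>2"
   by (simp add: diff_divide_distrib)
  ultimately show ?thesis unfolding R_def by linarith
 qed
 have poly: "real_polynomial_function (R k)" for k
 proof -
  have "real_polynomial_function (\<lambda>x::real^'n. x $ i)" for i
   by (rule real_polynomial_function.intros(1)) (rule bounded_linear_vec_nth)
  then have "real_polynomial_function (y i)" for i
   unfolding y_def[abs_def] divide_inverse
   by (intro real_polynomial_function.intros(4) real_polynomial_function_diff real_polynomial_function.intros(2))
  then show ?thesis
   unfolding R_def[abs_def] by (intro real_polynomial_function_sum real_polynomial_function_power) auto
 qed
 have gs: "schwartz (g k)" for k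
  unfolding g_def[abs_def]
  by (rule schwartz_polynomial_exp[OF real_polynomial_function.intros(2) poly _ Rb]) (use Wp in simp)
 define D where "D = exp (real CARD('n))"
 define G where "G x = of_real D * g 0 x" for x
 have Gs: "square_integrable G"
  unfolding G_def[abs_def] by (intro square_integrable_scale schwartz_square_integrable gs)
 have cg: "cmod (g k x) = cmod z * exp (- R k x)" for k x by (simp add: g_def norm_mult)
 have cG: "cmod (G x) = cmod z * exp (real CARD('n) - R 0 x)" for x
  by (simp add: G_def norm_mult cg D_def exp_diff exp_minus divide_inverse)
 have "(\<lambda>k. abs_L2 (g k)) \<longlonglongrightarrow> abs_L2 (\<lambda>x. z * indicator (box a b) x)"
 proof (rule L2_dominated_convergence[OF _ _ Gs])
  show "g k \<in> borel_measurable borel" for k by (rule schwartz_measurable[OF gs])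
  show "(\<lambda>x. z * indicator (box a b) x) \<in> borel_measurable borel" by measurable
  show "cmod (g k x) \<le> cmod (G x)" for k x
  proof -
   have "R k x \<ge> (\<Sum>i\<in>UNIV. (y i x)\<^sup>2 - 1)" unfolding R_def by (rule sum_mono) (rule y2)
   then have "- R k x \<le> real CARD('n) - R 0 x" by (simp add: R_def sum_subtractf)
   then show ?thesis unfolding cg cG by (intro mult_left_mono) auto
  qed
  show "cmod (z * indicator (box a b) x) \<le> cmod (G x)" for x
  proof (cases "x \<in> box a b")
   case True
   have "(y i x)\<^sup>2 \<le> 1" for i
   proof -
    have "\<bar>y i x\<bar> \<le> 1" using True ab[of i] by (auto simp: y_def mem_box_cart abs_le_iff field_simps dest!: spec[of _ i])
    then show ?thesis by (simp add: abs_square_le_1)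
   qed
   then have "(\<Sum>i\<in>UNIV. (y i x)\<^sup>2) \<le> (\<Sum>i\<in>(UNIV::'n set). 1)" by (intro sum_mono)
   then have "R 0 x \<le> real CARD('n)" by (simp add: R_def)
   then have "1 \<le> exp (real CARD('n) - R 0 x)" by simp
   from mult_left_mono[OF this, of "cmod z"] show ?thesis using True by (simp add: cG)
  qed simp
  have "AE x in lborel. \<forall>i. x $ i \<noteq> a $ i \<and> x $ i \<noteq> b $ i"
   using AE_coordinate_neq by (auto simp: AE_all_countable)
  then show "AE x in lborel. (\<lambda>k. g k x) \<longlonglongrightarrow> z * indicator (box a b) x"
  proof eventually_elim
   case (elim x)
   show ?case
   proof (cases "x \<in> box a b")
    case True
    have "(\<lambda>k. (y i x) ^ (2 * Suc k)) \<longlonglongrightarrow> 0" for i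
    proof -
     have "\<bar>y i x\<bar> < 1" using True ab[of i] by (auto simp: y_def mem_box_cart abs_less_iff field_simps dest!: spec[of _ i])
     then have "(y i x)\<^sup>2 < 1" by (simp add: abs_square_less_1)
     then have "(\<lambda>k. ((y i x)\<^sup>2) ^ k) \<longlonglongrightarrow> 0" by (intro LIMSEQ_realpow_zero) auto
     then have "(\<lambda>k. ((y i x)\<^sup>2) ^ Suc k) \<longlonglongrightarrow> 0" by (rule LIMSEQ_Suc)
     then show ?thesis by (simp only: power_mult)
    qed
    then have "(\<lambda>k. R k x) \<longlonglongrightarrow> (\<Sum>i\<in>(UNIV::'n set). 0)" unfolding R_def by (intro tendsto_sum)
    then have "(\<lambda>k. R k x) \<longlonglongrightarrow> 0" by simp
    then have "(\<lambda>k. z * of_real (1 * exp (- R k x))) \<longlonglongrightarrow> z * of_real (1 * exp (- 0))" by (intro tendsto_intros)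
    then show ?thesis using True by (simp add: g_def)
   next
    case False
    then obtain i where i: "x $ i \<le> a $ i \<or> x $ i \<ge> b $ i" by (auto simp: mem_box_cart not_less)
    with elim have "x $ i < a $ i \<or> x $ i > b $ i" by (metis order_le_less)
    then have "1 < \<bar>y i x\<bar>" using ab[of i] by (auto simp: y_def field_simps)
    then have "1 < (y i x)\<^sup>2" using one_less_power[of "\<bar>y i x\<bar>" 2] by simp
    then have "filterlim (\<lambda>k. norm (((y i x)\<^sup>2) ^ k)) at_top sequentially"
     unfolding filterlim_at_infinity_conv_norm_at_top[symmetric]
     by (intro filterlim_realpow_sequentially_gt1) simp
    then have "filterlim (\<lambda>k. ((y i x)\<^sup>2) ^ k) at_top sequentially" by simp
    then have *: "filterlim (\<lambda>k. ((y i x)\<^sup>2) ^ Suc k) at_top sequentially"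
     by (rule filterlim_compose) (rule filterlim_Suc)
    have "filterlim (\<lambda>k. R k x) at_top sequentially"
    proof (rule filterlim_at_top_mono[OF *])
     have "((y i x)\<^sup>2) ^ Suc k \<le> R k x" for k
      unfolding R_def power_mult by (rule member_le_sum) auto
     then show "\<forall>\<^sub>F k in sequentially. ((y i x)\<^sup>2) ^ Suc k \<le> R k x" by simp
    qed
    then have "(\<lambda>k. exp (- R k x)) \<longlonglongrightarrow> 0"
     by (intro filterlim_compose[OF exp_at_bot]) (simp add: filterlim_uminus_at_bot)
    then have "(\<lambda>k. z * of_real (1 * exp (- R k x))) \<longlonglongrightarrow> z * of_real (1 * 0)" by (intro tendsto_intros)
    then show ?thesis using False by (simp add: g_def)
   qed
  qed
 qed
 then show ?thesis
  by (rule closed_sequentially[OF V(1) V(2)[OF gs]])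
qed

lemma borel_set_indicator_in_closed_span:
 fixes A :: "(real^'n::finite) set"
 assumes A: "A \<in> sets borel"
  and V: "closed V" "subspace V" "\<And>f. schwartz f ==> abs_L2 f \<in> V"
 shows "abs_L2 (\<lambda>x. z * indicator (A \<inter> box l u) x) \<in> V"
proof -
 have box: "abs_L2 (\<lambda>x. z * indicator (box a b) x) \<in> V" for a b :: "real^'n"
 proof (cases "\<forall>i. a $ i < b $ i")
  case True
  then show ?thesis using box_indicator_limit[OF _ V(1,3), of a b z] by blast
 next
  case False
  then have "box a b = {}" by (auto simp: mem_box_cart) (meson less_trans)
  then show ?thesis using V(2) by (simp add: abs_L2_zero subspace_0)
 qed
 have fin: "square_integrable (\<lambda>x. z * indicator (S \<inter> box l u) x)" if "S \<in> sets borel" for S :: "(real^'n) set"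
 proof (rule square_integrable_scale)
  have "emeasure lborel (S \<inter> box l u) \<le> emeasure lborel (box l u)" by (intro emeasure_mono) auto
  also have "... < \<infinity>" by (rule emeasure_lborel_box_finite)
  finally have "integrable lborel (indicat_real (S \<inter> box l u))"
   using that by (intro integrable_real_indicator) auto
  moreover have "(cmod (indicator (S \<inter> box l u) x))\<^sup>2 = indicat_real (S \<inter> box l u) x" for x
   by (simp add: indicator_def)
  moreover have "(indicator (S \<inter> box l u) :: real^'n => complex) \<in> borel_measurable borel"
   using that by (intro borel_measurable_indicator) auto
  ultimately show "square_integrable (\<lambda>x. indicator (S \<inter> box l u) x)"
   by (simp add: square_integrable_def)
 qed
 have A': "A \<in> sigma_sets UNIV (range (\<lambda>(a, b). box a b :: (real^'n) set))"
  using A unfolding borel_eq_box by simp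
 have stable: "Int_stable (range (\<lambda>(a, b). box a b :: (real^'n) set))"
  by (auto simp: Int_stable_def box_Int_box)
 have sub: "range (\<lambda>(a, b). box a b) \<subseteq> Pow (UNIV :: (real^'n) set)" by simp
 from stable sub A' show ?thesis
 proof (induction rule: sigma_sets_induct_disjoint)
  case (basic A)
  then show ?case using box by (auto simp: box_Int_box)
 next
  case empty
  then show ?case using V(2) by (simp add: abs_L2_zero subspace_0)
 next
  case (compl A)
  have A: "A \<in> sets borel" using compl(1) unfolding borel_eq_box by simp
  have "(\<lambda>x. z * indicator ((UNIV - A) \<inter> box l u) x) = (\<lambda>x. z * indicator (UNIV \<inter> box l u) x - z * indicator (A \<inter> box l u) x)"
   by (auto simp: indicator_def)
  then have "abs_L2 (\<lambda>x. z * indicator ((UNIV - A) \<inter> box l u) x)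
    = abs_L2 (\<lambda>x. z * indicator (UNIV \<inter> box l u) x) - abs_L2 (\<lambda>x. z * indicator (A \<inter> box l u) x)"
   using abs_L2_diff[OF fin fin, of UNIV A] A by simp
  then show ?case using box[of l u] compl(2) V(2) by (simp add: subspace_diff)
 next
  case (union A)
  have A: "A i \<in> sets borel" for i using union(2) unfolding borel_eq_box by auto
  define U where "U k = (\<Union>i<k. A i)" for k :: nat
  have U: "U k \<in> sets borel" for k using A unfolding U_def by auto
  have "abs_L2 (\<lambda>x. z * indicator (U k \<inter> box l u) x) \<in> V" for k
  proof (induction k)
   case 0
   then show ?case using V(2) by (simp add: U_def abs_L2_zero subspace_0)
  next
   case (Suc k)
   have "A k \<inter> A i = {}" if "i < k" for i
    using union(1) that unfolding disjoint_family_on_def by (metis UNIV_I less_irrefl)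
   then have disj: "A k \<inter> U k = {}" by (auto simp: U_def)
   have "(\<lambda>x. z * indicator (U (Suc k) \<inter> box l u) x) = (\<lambda>x. z * indicator (U k \<inter> box l u) x + z * indicator (A k \<inter> box l u) x)"
   proof (rule ext)
    fix x
    have "x \<in> U (Suc k) \<longleftrightarrow> x \<in> U k \<or> x \<in> A k" by (auto simp: U_def less_Suc_eq)
    then show "z * indicator (U (Suc k) \<inter> box l u) x = z * indicator (U k \<inter> box l u) x + z * indicator (A k \<inter> box l u) x"
     using disj by (cases "x \<in> U k"; cases "x \<in> A k") (auto simp: indicator_def)
   qed
   then have "abs_L2 (\<lambda>x. z * indicator (U (Suc k) \<inter> box l u) x)
     = abs_L2 (\<lambda>x. z * indicator (U k \<inter> box l u) x) + abs_L2 (\<lambda>x. z * indicator (A k \<inter> box l u) x)"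
    by (simp only: abs_L2_add[OF fin[OF U] fin[OF A]])
   then show ?case using subspace_add[OF V(2) Suc union(3)[of k]] by (simp only:)
  qed
  moreover have "(\<lambda>k. abs_L2 (\<lambda>x. z * indicator (U k \<inter> box l u) x)) \<longlonglongrightarrow> abs_L2 (\<lambda>x. z * indicator ((\<Union>i. A i) \<inter> box l u) x)"
  proof (rule L2_dominated_convergence[OF _ _ fin[of UNIV]])
   show "(\<lambda>x. z * indicator (U k \<inter> box l u) x) \<in> borel_measurable borel" for k
    by (rule square_integrable_measurable[OF fin[OF U]])
   show "(\<lambda>x. z * indicator ((\<Union>i. A i) \<inter> box l u) x) \<in> borel_measurable borel"
    by (rule square_integrable_measurable[OF fin]) (use A in auto)
   show "AE x in lborel. (\<lambda>k. z * indicator (U k \<inter> box l u) x) \<longlonglongrightarrow> z * indicator ((\<Union>i. A i) \<inter> box l u) x"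
   proof (rule AE_I2)
    fix x
    show "(\<lambda>k. z * indicator (U k \<inter> box l u) x) \<longlonglongrightarrow> z * indicator ((\<Union>i. A i) \<inter> box l u) x"
    proof (cases "\<exists>i. x \<in> A i")
     case True
     then obtain i where i: "x \<in> A i" by blast
     have "\<forall>\<^sub>F k in sequentially. z * indicator (U k \<inter> box l u) x = z * indicator ((\<Union>i. A i) \<inter> box l u) x"
      by (rule eventually_sequentiallyI[of "Suc i"]) (use i in \<open>auto simp: U_def indicator_def Suc_le_eq\<close>)
     then show ?thesis by (rule tendsto_eventually)
    next
     case False
     then show ?thesis by (auto simp: U_def indicator_def)
    qed
   qed
  qed (auto simp: indicator_def)
  ultimately show ?case by (rule closed_sequentially[OF V(1)])
 qed
qed

lemma abs_L2_sum:
 assumes "finite S" "\<And>i. i \<in> S ==> square_integrable (f i)"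
 shows "square_integrable (\<lambda>x. \<Sum>i\<in>S. f i x)" "abs_L2 (\<lambda>x. \<Sum>i\<in>S. f i x) = (\<Sum>i\<in>S. abs_L2 (f i))"
 using assms
 by (induction S rule: finite_induct)
  (simp_all add: square_integrable_zero abs_L2_zero square_integrable_add abs_L2_add[symmetric])

theorem schwartz_dense:
 fixes v :: "(real^'n::finite) L2"
 assumes V: "closed V" "subspace V" "\<And>f. schwartz f ==> abs_L2 f \<in> V"
 shows "v \<in> V"
proof -
 define f where "f = rep_L2 v"
 have [measurable]: "f \<in> borel_measurable borel" by (simp add: f_def)
 have fs: "square_integrable f" by (simp add: f_def square_integrable_rep)
 obtain F where F: "\<And>i. simple_function lborel (F i)" "\<And>x. (\<lambda>i. F i x) \<longlonglongrightarrow> f x"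
  "\<And>i x. dist (F i x) 0 \<le> 2 * dist (f x) 0"
  using borel_measurable_implies_sequence_metric[of f lborel 0] by auto
 define b where "b k = box (\<chi> i. - real k) ((\<chi> i. real k) :: real^'n)" for k
 define s where "s k x = indicator (b k) x * F k x" for k x
 have Fm [measurable]: "F k \<in> borel_measurable borel" for k
  using borel_measurable_simple_function[OF F(1)[of k]] by simp
 have bm [measurable]: "b k \<in> sets borel" for k by (simp add: b_def)
 have si2: "square_integrable (\<lambda>x. 2 * f x)" by (rule square_integrable_scale[OF fs])
 have sV: "abs_L2 (s k) \<in> V" for k
 proof -
  have fin: "finite (range (F k))" using F(1)[of k] by (simp add: simple_function_def)
  define p where "p z x = z * indicator ((F k -` {z}) \<inter> b k) x" for z x
  have Fz: "F k -` {z} \<in> sets borel" for z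
   using measurable_sets[OF Fm, of "{z}" k] by simp
  have s: "s k = (\<lambda>x. \<Sum>z\<in>range (F k). p z x)"
  proof
   fix x
   have "(\<Sum>z\<in>range (F k). p z x) = (\<Sum>z\<in>range (F k). if z = F k x then z * indicator (b k) x else 0)"
    by (rule sum.cong) (auto simp: p_def indicator_def)
   also have "... = s k x" using fin by (simp add: s_def)
   finally show "s k x = (\<Sum>z\<in>range (F k). p z x)" by simp
  qed
  have pb: "cmod (p z x) \<le> cmod (2 * f x)" for z x
   using F(3)[of k x] by (auto simp: p_def indicator_def)
  have ps: "square_integrable (p z)" for z
   by (rule square_integrable_bound[OF si2 _ pb]) (use Fz bm in \<open>auto simp: p_def[abs_def]\<close>)
  have "abs_L2 (p z) \<in> V" for z
   unfolding p_def[abs_def] b_def by (rule borel_set_indicator_in_closed_span[OF Fz V])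
  then show ?thesis
   unfolding s abs_L2_sum(2)[OF fin ps] by (intro subspace_sum V(2))
 qed
 have "(\<lambda>k. abs_L2 (s k)) \<longlonglongrightarrow> abs_L2 f"
 proof (rule L2_dominated_convergence[OF _ _ si2])
  show "s k \<in> borel_measurable borel" for k unfolding s_def[abs_def] by measurable
  show "cmod (s k x) \<le> cmod (2 * f x)" for k x
   using F(3)[of k x] by (auto simp: s_def indicator_def)
  show "cmod (f x) \<le> cmod (2 * f x)" for x by simp
  show "AE x in lborel. (\<lambda>k. s k x) \<longlonglongrightarrow> f x"
  proof (rule AE_I2)
   fix x :: "real^'n"
   obtain N where N: "real N > norm x" using reals_Archimedean2 by blast
   have "F k x = s k x" if "k \<ge> N" for k
   proof -
    have "\<bar>x $ i\<bar> < real k" for i using component_le_norm_cart[of x i] N that by linarith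
    then have "x \<in> b k" by (auto simp: b_def mem_box_cart abs_less_iff minus_less_iff)
    then show ?thesis by (simp add: s_def)
   qed
   then have "\<forall>\<^sub>F k in sequentially. F k x = s k x" by (rule eventually_sequentiallyI)
   with F(2) show "(\<lambda>k. s k x) \<longlonglongrightarrow> f x" by (rule Lim_transform_eventually)
  qed
 qed simp
 then have "abs_L2 f \<in> V" by (rule closed_sequentially[OF V(1) sV])
 then show ?thesis by (simp add: f_def)
qed

section \<open>The Fourier transform on the space of square integrable functions\<close>

definition fourier_integral :: "real => (real^'n::finite => complex) => real^'n => complex" where
 "fourier_integral \<alpha> f \<xi> = (LINT x|lborel. cis (- (\<alpha> * (x \<bullet> \<xi>))) * f x)"

lemma cis_phase_measurable [measurable]:
 "(\<lambda>p::(real^'n::finite) \<times> (real^'n). cis (- (\<alpha> * (fst p \<bullet> snd p)))) \<in> borel_measurable borel"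
 "(\<lambda>p::(real^'n::finite) \<times> (real^'n). cis (\<alpha> * (fst p \<bullet> snd p))) \<in> borel_measurable borel"
 by (intro borel_measurable_continuous_onI continuous_intros)+

lemma cis_measurable [measurable]:
 "(\<lambda>x::real^'n::finite. cis (- (\<alpha> * (x \<bullet> \<xi>)))) \<in> borel_measurable borel"
 "(\<lambda>x::real^'n::finite. cis (\<alpha> * (x \<bullet> \<xi>))) \<in> borel_measurable borel"
 by (intro borel_measurable_continuous_onI continuous_intros)+

lemma integrable_cis_mult:
 fixes f :: "real^'n::finite => complex"
 assumes "integrable lborel f"
 shows "integrable lborel (\<lambda>x. cis (- (\<alpha> * (x \<bullet> \<xi>))) * f x)"
  "integrable lborel (\<lambda>x. cis (\<alpha> * (x \<bullet> \<xi>)) * f x)"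
 using borel_measurable_integrable[OF assms]
 by (auto intro!: Bochner_Integration.integrable_bound[OF assms] simp: norm_mult)

lemma fourier_integral_bound:
 "cmod (fourier_integral \<alpha> f \<xi>) \<le> (LINT x|lborel. cmod (f x))"
proof -
 have "cmod (fourier_integral \<alpha> f \<xi>) \<le> (LINT x|lborel. cmod (cis (- (\<alpha> * (x \<bullet> \<xi>))) * f x))"
  unfolding fourier_integral_def by (rule integral_norm_bound)
 then show ?thesis by (simp add: norm_mult)
qed

lemma fourier_integral_measurable:
 assumes "integrable lborel f"
 shows "fourier_integral \<alpha> f \<in> borel_measurable borel"
proof -
 have [measurable]: "f \<in> borel_measurable borel" using borel_measurable_integrable[OF assms] by simp
 have "(\<lambda>p::(real^'a) \<times> (real^'a). cis (- (\<alpha> * (snd p \<bullet> fst p)))) \<in> borel_measurable borel"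
  by (intro borel_measurable_continuous_onI continuous_intros)
 then have [measurable]: "(\<lambda>p::(real^'a) \<times> (real^'a). cis (- (\<alpha> * (snd p \<bullet> fst p)))) \<in> borel_measurable (borel \<Otimes>\<^sub>M borel)"
  by (simp add: borel_prod)
 have "(\<lambda>p. cis (- (\<alpha> * (snd p \<bullet> fst p))) * f (snd p)) \<in> borel_measurable (borel \<Otimes>\<^sub>M (lborel :: (real^'a) measure))"
  by measurable
 then have "(\<lambda>(\<xi>, x). cis (- (\<alpha> * (x \<bullet> \<xi>))) * f x) \<in> borel_measurable (borel \<Otimes>\<^sub>M (lborel :: (real^'a) measure))"
  by (simp add: case_prod_beta')
 then show ?thesis
  unfolding fourier_integral_def[abs_def] by (rule lborel.borel_measurable_lebesgue_integral)
qed

lemma integrable_product_lborel: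
 fixes f g :: "real^'n::finite => complex"
 assumes f: "integrable lborel f" and g: "integrable lborel g"
 shows "integrable (lborel \<Otimes>\<^sub>M lborel) (\<lambda>(x, y). f x * g y)"
proof (rule lborel_pair.Fubini_integrable)
 have [measurable]: "f \<in> borel_measurable borel" "g \<in> borel_measurable borel"
  using borel_measurable_integrable[OF f] borel_measurable_integrable[OF g] by auto
 show "(\<lambda>(x, y). f x * g y) \<in> borel_measurable (lborel \<Otimes>\<^sub>M lborel)" by measurable
 show "integrable lborel (\<lambda>x. LINT y|lborel. cmod (case (x, y) of (x, y) => f x * g y))"
  unfolding prod.case norm_mult integral_mult_right_zero
  by (intro integrable_mult_left integrable_norm f)
 show "AE x in lborel. integrable lborel (\<lambda>y. case (x, y) of (x, y) => f x * g y)"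
  unfolding prod.case by (intro AE_I2 integrable_mult_right g)
qed

lemma fourier_multiplication_formula:
 fixes f g :: "real^'n::finite => complex"
 assumes f: "integrable lborel f" and g: "integrable lborel g"
 shows "(LINT \<xi>|lborel. fourier_integral \<alpha> f \<xi> * g \<xi>) = (LINT x|lborel. f x * fourier_integral \<alpha> g x)"
proof -
 let ?h = "\<lambda>(x::real^'n, \<xi>::real^'n). cis (- (\<alpha> * (x \<bullet> \<xi>))) * (f x * g \<xi>)"
 have [measurable]: "f \<in> borel_measurable borel" "g \<in> borel_measurable borel"
  using borel_measurable_integrable[OF f] borel_measurable_integrable[OF g] by auto
 have int: "integrable (lborel \<Otimes>\<^sub>M lborel) ?h"
 proof (rule Bochner_Integration.integrable_bound[OF integrable_product_lborel[OF f g]])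
  have [measurable]: "(\<lambda>p::(real^'n) \<times> (real^'n). cis (- (\<alpha> * (fst p \<bullet> snd p)))) \<in> borel_measurable (borel \<Otimes>\<^sub>M borel)"
   by (simp add: borel_prod cis_phase_measurable)
  show "?h \<in> borel_measurable (lborel \<Otimes>\<^sub>M lborel)"
   unfolding case_prod_beta' by measurable
 qed (auto simp: norm_mult)
 have "(LINT \<xi>|lborel. fourier_integral \<alpha> f \<xi> * g \<xi>) = (LINT \<xi>|lborel. LINT x|lborel. cis (- (\<alpha> * (x \<bullet> \<xi>))) * (f x * g \<xi>))"
  unfolding fourier_integral_def by (simp add: mult.assoc flip: integral_mult_left_zero)
 also have "... = (LINT x|lborel. LINT \<xi>|lborel. cis (- (\<alpha> * (x \<bullet> \<xi>))) * (f x * g \<xi>))"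
  using lborel_pair.Fubini_integral[OF int] by simp
 also have "... = (LINT x|lborel. LINT \<xi>|lborel. f x * (cis (- (\<alpha> * (\<xi> \<bullet> x))) * g \<xi>))"
  by (simp add: inner_commute mult_ac)
 also have "... = (LINT x|lborel. f x * fourier_integral \<alpha> g x)"
  by (simp add: fourier_integral_def)
 finally show ?thesis .
qed

lemma fourier_integral_cnj:
 "cnj (fourier_integral \<alpha> f \<xi>) = fourier_integral (- \<alpha>) (\<lambda>x. cnj (f x)) \<xi>"
 unfolding fourier_integral_def by (simp add: cis_cnj flip: Bochner_Integration.integral_cnj)

lemma fourier_integral_shift:
 "fourier_integral \<alpha> (\<lambda>\<xi>. cis (\<alpha> * (\<xi> \<bullet> z)) * f \<xi>) y = fourier_integral \<alpha> f (y - z)"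
proof -
 have "cis (- (\<alpha> * (x \<bullet> y))) * (cis (\<alpha> * (x \<bullet> z)) * f x) = cis (- (\<alpha> * (x \<bullet> (y - z)))) * f x" for x
  unfolding mult.assoc[symmetric] cis_mult by (simp add: inner_diff_right algebra_simps)
 then show ?thesis unfolding fourier_integral_def by (simp only:)
qed

definition gauss :: "real => real^'n::finite => real" where
 "gauss s \<xi> = exp (- (s * norm \<xi>)\<^sup>2 / 2)"

lemma gauss_pos: "gauss s x > 0"
 by (simp add: gauss_def)

lemma gauss_measurable [measurable]: "(\<lambda>x. gauss t x) \<in> borel_measurable borel"
 unfolding gauss_def by measurable

lemma ennreal_half_sum:
 "0 \<le> a ==> 0 \<le> b ==> ennreal (1/2) * (ennreal a + ennreal b) = ennreal (1/2 * (a + b))"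
 by (subst ennreal_mult) (auto simp: ennreal_plus)

lemma gaussian_char_real:
 fixes s z :: real
 assumes "s > 0"
 shows "integrable lborel (\<lambda>t. cis (- (z * t)) * of_real (exp (- (s * t)\<^sup>2 / 2)))"
  and "(LINT t|lborel. cis (- (z * t)) * of_real (exp (- (s * t)\<^sup>2 / 2)))
   = of_real (sqrt (2 * pi) / s * exp (- (z / s)\<^sup>2 / 2))"
proof -
 let ?u = "- z / s"
 have e: "std_normal_density x *\<^sub>R iexp (?u * x) = (1 / sqrt (2 * pi)) *\<^sub>R (cis (?u * x) * of_real (exp (- x\<^sup>2 / 2)))" for x
  by (simp add: std_normal_density_def scaleR_conv_of_real cis_conv_exp mult_ac)
 have i0: "integrable lborel (\<lambda>x. std_normal_density x *\<^sub>R iexp (?u * x))"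
 proof (rule Bochner_Integration.integrable_bound[OF integrable_normal_density[of 1 0]])
  show "(\<lambda>x. std_normal_density x *\<^sub>R iexp (?u * x)) \<in> borel_measurable lborel" by measurable
 qed (auto simp: norm_mult)
 have "char std_normal_distribution ?u = (LINT x|lborel. std_normal_density x *\<^sub>R iexp (?u * x))"
  unfolding char_def by (rule integral_density) auto
 then have v0: "(LINT x|lborel. std_normal_density x *\<^sub>R iexp (?u * x)) = of_real (exp (- ?u\<^sup>2 / 2))"
  by (simp add: char_std_normal_distribution)
 have sc: "(LINT x|lborel. f x) = \<bar>s\<bar> *\<^sub>R (LINT t|lborel. f (0 + s * t))" for f :: "real => complex"
  by (rule lborel_integral_real_affine) (use assms in simp)
 have f: "std_normal_density (0 + s * t) *\<^sub>R iexp (?u * (0 + s * t)) =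
   (1 / sqrt (2 * pi)) *\<^sub>R (cis (- (z * t)) * of_real (exp (- (s * t)\<^sup>2 / 2)))" for t
  unfolding e using assms by simp
 have "integrable lborel (\<lambda>t. std_normal_density (0 + s * t) *\<^sub>R iexp (?u * (0 + s * t)))"
  by (rule lborel_integrable_real_affine[OF i0]) (use assms in simp)
 then have "integrable lborel (\<lambda>t. (1 / sqrt (2 * pi)) *\<^sub>R (cis (- (z * t)) * of_real (exp (- (s * t)\<^sup>2 / 2))))"
  unfolding f .
 then have "integrable lborel (\<lambda>t. sqrt (2 * pi) *\<^sub>R ((1 / sqrt (2 * pi)) *\<^sub>R (cis (- (z * t)) * of_real (exp (- (s * t)\<^sup>2 / 2)))))"
  by (rule integrable_scaleR_right)
 then show "integrable lborel (\<lambda>t. cis (- (z * t)) * of_real (exp (- (s * t)\<^sup>2 / 2)))"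
  by simp
 have "complex_of_real (exp (- ?u\<^sup>2 / 2)) = \<bar>s\<bar> *\<^sub>R (LINT t|lborel. (1 / sqrt (2 * pi)) *\<^sub>R (cis (- (z * t)) * of_real (exp (- (s * t)\<^sup>2 / 2))))"
  unfolding v0[symmetric] by (subst sc) (simp only: f)
 also have "... = (s / sqrt (2 * pi)) *\<^sub>R (LINT t|lborel. cis (- (z * t)) * of_real (exp (- (s * t)\<^sup>2 / 2)))"
  using assms by (simp only: integral_scaleR_right scaleR_scaleR) simp
 finally have "(sqrt (2 * pi) / s) *\<^sub>R complex_of_real (exp (- ?u\<^sup>2 / 2)) = (sqrt (2 * pi) / s) *\<^sub>R ((s / sqrt (2 * pi)) *\<^sub>R (LINT t|lborel. cis (- (z * t)) * of_real (exp (- (s * t)\<^sup>2 / 2))))"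
  by (rule arg_cong)
 also have "... = (LINT t|lborel. cis (- (z * t)) * of_real (exp (- (s * t)\<^sup>2 / 2)))"
  using assms by simp
 finally show "(LINT t|lborel. cis (- (z * t)) * of_real (exp (- (s * t)\<^sup>2 / 2)))
   = of_real (sqrt (2 * pi) / s * exp (- (z / s)\<^sup>2 / 2))"
  by (simp add: scaleR_conv_of_real)
qed

lemma gauss_prod: "gauss s \<xi> = (\<Prod>i\<in>UNIV. exp (- (s * \<xi> $ i)\<^sup>2 / 2))"
proof -
 have "(norm \<xi>)\<^sup>2 = (\<Sum>i\<in>UNIV. (\<xi> $ i)\<^sup>2)" by (simp add: norm_vec_def L2_set_def sum_nonneg)
 then show ?thesis
  by (simp add: gauss_def power_mult_distrib exp_sum[symmetric] sum_distrib_left sum_divide_distrib sum_negf)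
qed

lemma cis_sum: "finite I ==> cis (\<Sum>i\<in>I. f i) = (\<Prod>i\<in>I. cis (f i))"
 by (induction I rule: finite_induct) (auto simp: cis_mult[symmetric])

lemma fourier_gauss:
 fixes z :: "real^'n::finite"
 assumes s: "s > 0"
 shows "integrable lborel (\<lambda>\<xi>::real^'n. complex_of_real (gauss s \<xi>))"
  and "fourier_integral \<alpha> (\<lambda>\<xi>. of_real (gauss s \<xi>)) z = of_real ((sqrt (2 * pi) / s) ^ CARD('n) * gauss (\<alpha> / s) z)"
proof -
 have prod: "cis (- (\<alpha> * (\<xi> \<bullet> z))) * of_real (gauss s \<xi>) = (\<Prod>i\<in>UNIV. cis (- ((\<alpha> * z $ i) * \<xi> $ i)) * of_real (exp (- (s * \<xi> $ i)\<^sup>2 / 2)))"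
  for z \<xi> :: "real^'n" and \<alpha>
 proof -
  have "- (\<alpha> * (\<xi> \<bullet> z)) = (\<Sum>i\<in>UNIV. - ((\<alpha> * z $ i) * \<xi> $ i))"
   by (simp add: inner_vec_def sum_distrib_left sum_negf mult_ac)
  then show ?thesis by (simp only: prod.distrib cis_sum[OF finite] gauss_prod of_real_prod)
 qed
 have "integrable lborel (\<lambda>\<xi>::real^'n. cis (- (0 * (\<xi> \<bullet> z))) * of_real (gauss s \<xi>))"
  unfolding prod by (rule lborel_integral_prod(1)) (rule gaussian_char_real(1)[OF s])
 then show "integrable lborel (\<lambda>\<xi>::real^'n. complex_of_real (gauss s \<xi>))" by simp
 have "fourier_integral \<alpha> (\<lambda>\<xi>. of_real (gauss s \<xi>)) z
   = (\<Prod>i\<in>(UNIV::'n set). complex_of_real (sqrt (2 * pi) / s * exp (- ((\<alpha> * z $ i) / s)\<^sup>2 / 2)))"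
  unfolding fourier_integral_def prod
  by (subst lborel_integral_prod(2)[OF gaussian_char_real(1)[OF s]]) (simp only: gaussian_char_real(2)[OF s])
 also have "... = of_real ((sqrt (2 * pi) / s) ^ CARD('n) * gauss (\<alpha> / s) z)"
  unfolding gauss_prod of_real_prod[symmetric] prod.distrib by simp
 finally show "fourier_integral \<alpha> (\<lambda>\<xi>. of_real (gauss s \<xi>)) z = of_real ((sqrt (2 * pi) / s) ^ CARD('n) * gauss (\<alpha> / s) z)" .
qed

lemma lborel_integral_affine:
 fixes f :: "'a::euclidean_space => 'b::{banach, second_countable_topology}"
 assumes c: "c \<noteq> 0" and f: "f \<in> borel_measurable borel"
 shows "(LINT x|lborel. f x) = \<bar>c\<bar> ^ DIM('a) *\<^sub>R (LINT x|lborel. f (t + c *\<^sub>R x))"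
proof -
 have m: "(\<lambda>x. t + c *\<^sub>R x) \<in> measurable lborel borel" by simp
 have "(LINT x|lborel. f x) = (LINT x|density (distr lborel borel (\<lambda>x. t + c *\<^sub>R x)) (\<lambda>_. \<bar>c\<bar> ^ DIM('a)). f x)"
  using lborel_affine[OF c, of t] by simp
 also have "... = (LINT x|distr lborel borel (\<lambda>x. t + c *\<^sub>R x). \<bar>c\<bar> ^ DIM('a) *\<^sub>R f x)"
  by (rule integral_density) (use f in auto)
 also have "... = (LINT x|lborel. \<bar>c\<bar> ^ DIM('a) *\<^sub>R f (t + c *\<^sub>R x))"
  by (rule integral_distr[OF m]) (use f in auto)
 finally show ?thesis by simp
qed

lemma nn_integral_lborel_translate:
 fixes f :: "'a::euclidean_space => ennreal"
 assumes "f \<in> borel_measurable borel"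
 shows "(\<integral>\<^sup>+x. f (x + t) \<partial>lborel) = (\<integral>\<^sup>+x. f x \<partial>lborel)"
proof -
 have "(\<integral>\<^sup>+x. f x \<partial>lborel) = (\<integral>\<^sup>+x. f x \<partial>(distr lborel borel ((+) t)))"
  by (simp add: lborel_distr_plus)
 also have "... = (\<integral>\<^sup>+x. f (t + x) \<partial>lborel)"
  by (rule nn_integral_distr) (use assms in auto)
 finally show ?thesis by (simp add: add.commute)
qed

lemma lborel_integral_translate:
 fixes f :: "'a::euclidean_space => 'b::{banach, second_countable_topology}"
 assumes "f \<in> borel_measurable borel"
 shows "(LINT x|lborel. f (x + t)) = (LINT x|lborel. f x)"
 using lborel_integral_affine[OF _ assms, of 1 t] by (simp add: add.commute)

text \<open>
 With a Gaussian factor the iterated integrals may be interchanged; the Gaussian becomes an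
 approximate identity.  For bounded continuous \<open>g\<close> the limit gives Parseval's identity, and the
 Cauchy-Schwarz inequality applied before the limit gives the bound that makes the limit on the
 left legitimate.
\<close>

lemma fourier_gauss_pairing:
 fixes f g :: "real^'n::finite => complex"
 assumes f: "integrable lborel f" and g: "integrable lborel g" and s: "s > 0" and \<alpha>: "\<alpha> \<noteq> 0"
 shows "(LINT \<xi>|lborel. fourier_integral \<alpha> f \<xi> * cnj (fourier_integral \<alpha> g \<xi>) * of_real (gauss s \<xi>))
  = of_real ((sqrt (2 * pi) / \<bar>\<alpha>\<bar>) ^ CARD('n)) *
   (LINT x|lborel. f x * (LINT w|lborel. cnj (g (x + (s / \<alpha>) *\<^sub>R w)) * of_real (gauss 1 w)))"
proof -
 have [measurable]: "g \<in> borel_measurable borel"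
  using borel_measurable_integrable[OF g] by auto
 have gc: "integrable lborel (\<lambda>x. cnj (g x))" using g by simp
 note G = fourier_gauss(1)[OF s, where 'n='n]
 define \<phi> where "\<phi> \<xi> = cnj (fourier_integral \<alpha> g \<xi>) * complex_of_real (gauss s \<xi>)" for \<xi>
 have "\<phi> \<in> borel_measurable borel"
  unfolding \<phi>_def[abs_def] using fourier_integral_measurable[OF g, of \<alpha>] by measurable
 then have \<phi>: "integrable lborel \<phi>"
  using fourier_integral_bound[of \<alpha> g]
  by (intro Bochner_Integration.integrable_bound[OF integrable_mult_right[OF G, of "of_real (LINT x|lborel. cmod (g x))"]])
   (auto simp: \<phi>_def norm_mult less_imp_le[OF gauss_pos] intro!: AE_I2 mult_right_mono order_trans[OF _ abs_ge_self])
 have \<phi>F: "fourier_integral \<alpha> \<phi> x = of_real ((sqrt (2 * pi) / \<bar>\<alpha>\<bar>) ^ CARD('n)) *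
   (LINT w|lborel. cnj (g (x + (s / \<alpha>) *\<^sub>R w)) * of_real (gauss 1 w))" for x
 proof -
  define \<psi> where "\<psi> \<xi> = cis (- (\<alpha> * (\<xi> \<bullet> x))) * complex_of_real (gauss s \<xi>)" for \<xi>
  have \<psi>: "integrable lborel \<psi>" unfolding \<psi>_def[abs_def] by (rule integrable_cis_mult(1)[OF G])
  have \<psi>F: "fourier_integral (- \<alpha>) \<psi> y = of_real ((sqrt (2 * pi) / s) ^ CARD('n) * gauss (\<alpha> / s) (y - x))" for y
  proof -
   have "fourier_integral (- \<alpha>) \<psi> y = fourier_integral (- \<alpha>) (\<lambda>\<xi>. of_real (gauss s \<xi>)) (y - x)"
    unfolding \<psi>_def[abs_def] using fourier_integral_shift[of "- \<alpha>" x "\<lambda>\<xi>. of_real (gauss s \<xi>)" y] by simp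
   then show ?thesis unfolding fourier_gauss(2)[OF s] by (simp add: gauss_def power_mult_distrib)
  qed
  have "fourier_integral \<alpha> \<phi> x = (LINT \<xi>|lborel. fourier_integral (- \<alpha>) (\<lambda>x. cnj (g x)) \<xi> * \<psi> \<xi>)"
   unfolding fourier_integral_def[of \<alpha> \<phi>] \<phi>_def \<psi>_def fourier_integral_cnj by (simp add: mult_ac)
  also have "... = (LINT y|lborel. cnj (g y) * fourier_integral (- \<alpha>) \<psi> y)"
   by (rule fourier_multiplication_formula[OF gc \<psi>])
  also have "... = (LINT y|lborel. cnj (g y) * complex_of_real ((sqrt (2 * pi) / s) ^ CARD('n) * gauss (\<alpha> / s) (y - x)))"
   by (simp only: \<psi>F)
  also have "... = \<bar>s / \<alpha>\<bar> ^ DIM(real^'n) *\<^sub>R (LINT w|lborel. cnj (g (x + (s / \<alpha>) *\<^sub>R w)) *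
      complex_of_real ((sqrt (2 * pi) / s) ^ CARD('n) * gauss (\<alpha> / s) ((x + (s / \<alpha>) *\<^sub>R w) - x)))"
   by (rule lborel_integral_affine) (use s \<alpha> in \<open>simp, measurable\<close>)
  also have "... = \<bar>s / \<alpha>\<bar> ^ DIM(real^'n) *\<^sub>R (of_real ((sqrt (2 * pi) / s) ^ CARD('n)) * (LINT w|lborel. cnj (g (x + (s / \<alpha>) *\<^sub>R w)) * of_real (gauss 1 w)))"
   using s \<alpha> by (simp add: gauss_def mult_ac abs_mult power_mult_distrib power_divide flip: integral_mult_right_zero)
  also have "... = of_real (\<bar>s / \<alpha>\<bar> ^ CARD('n) * (sqrt (2 * pi) / s) ^ CARD('n)) * (LINT w|lborel. cnj (g (x + (s / \<alpha>) *\<^sub>R w)) * of_real (gauss 1 w))"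
   by (simp add: scaleR_conv_of_real)
  also have "\<bar>s / \<alpha>\<bar> ^ CARD('n) * (sqrt (2 * pi) / s) ^ CARD('n) = (sqrt (2 * pi) / \<bar>\<alpha>\<bar>) ^ CARD('n)"
   unfolding power_mult_distrib[symmetric] using s by (simp add: abs_divide)
  finally show ?thesis .
 qed
 have "(LINT \<xi>|lborel. fourier_integral \<alpha> f \<xi> * cnj (fourier_integral \<alpha> g \<xi>) * of_real (gauss s \<xi>))
   = (LINT \<xi>|lborel. fourier_integral \<alpha> f \<xi> * \<phi> \<xi>)" by (simp add: \<phi>_def mult.assoc)
 also have "... = (LINT x|lborel. f x * fourier_integral \<alpha> \<phi> x)"
  by (rule fourier_multiplication_formula[OF f \<phi>])
 also have "... = of_real ((sqrt (2 * pi) / \<bar>\<alpha>\<bar>) ^ CARD('n)) *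
   (LINT x|lborel. f x * (LINT w|lborel. cnj (g (x + (s / \<alpha>) *\<^sub>R w)) * of_real (gauss 1 w)))"
  unfolding \<phi>F by (simp add: mult.left_commute flip: integral_mult_right_zero)
 finally show ?thesis .
qed

lemma integral_gauss: "(LINT w|lborel. gauss 1 (w :: real^'n::finite)) = sqrt (2 * pi) ^ CARD('n)"
proof -
 have "complex_of_real (LINT w|lborel. gauss 1 (w :: real^'n)) = of_real (sqrt (2 * pi) ^ CARD('n))"
  using fourier_gauss(2)[of 1 0 "0::real^'n"] by (simp add: fourier_integral_def integral_complex_of_real gauss_def)
 then show ?thesis by (simp only: of_real_eq_iff)
qed

lemma integrable_gauss: "integrable lborel (\<lambda>w::real^'n::finite. gauss 1 w)"
 using integrable_Re[OF fourier_gauss(1)[of 1, where 'n='n]] by simp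

lemma gauss_scale_tendsto: "(\<lambda>k. gauss (1 / real (Suc k)) \<xi>) \<longlonglongrightarrow> 1"
proof -
 have "isCont (\<lambda>t::real. exp (- (t * norm \<xi>)\<^sup>2 / 2)) 0" by simp
 from isCont_tendsto_compose[OF this LIMSEQ_inverse_real_of_nat]
 have "(\<lambda>k. exp (- (inverse (real (Suc k)) * norm \<xi>)\<^sup>2 / 2)) \<longlonglongrightarrow> exp (- (0 * norm \<xi>)\<^sup>2 / 2)" .
 moreover have "exp (- (0 * norm \<xi>)\<^sup>2 / 2) = 1" by simp
 ultimately show ?thesis unfolding gauss_def inverse_eq_divide by (simp only:)
qed

lemma integral_norm_bound_ennreal_any:
 fixes f :: "'a => 'b::{banach, second_countable_topology}"
 shows "ennreal (norm (integral\<^sup>L M f)) \<le> (\<integral>\<^sup>+x. ennreal (norm (f x)) \<partial>M)"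
 by (cases "integrable M f") (simp_all add: integral_norm_bound_ennreal not_integrable_integral_eq)

text \<open>The pointwise inequality \<open>2 |f(x) f(x + v)| \<le> |f(x)|\<^sup>2 + |f(x + v)|\<^sup>2\<close> replaces Young's inequality.\<close>

lemma Bessel_fourier_integral:
 fixes f :: "real^'n::finite => complex"
 assumes f: "integrable lborel f" and f2: "square_integrable f" and \<alpha>: "\<alpha> \<noteq> 0"
 shows "(\<integral>\<^sup>+\<xi>. ennreal ((cmod (fourier_integral \<alpha> f \<xi>))\<^sup>2) \<partial>lborel) \<le> ennreal ((2 * pi / \<bar>\<alpha>\<bar>) ^ CARD('n) * (norm (abs_L2 f))\<^sup>2)"
proof -
 have [measurable]: "f \<in> borel_measurable borel"
  using borel_measurable_integrable[OF f] by auto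
 have Fm [measurable]: "fourier_integral \<alpha> f \<in> borel_measurable borel" by (rule fourier_integral_measurable[OF f])
 let ?C = "(sqrt (2 * pi) / \<bar>\<alpha>\<bar>) ^ CARD('n)"
 let ?N = "(norm (abs_L2 f))\<^sup>2"
 have bound: "(\<integral>\<^sup>+\<xi>. ennreal ((cmod (fourier_integral \<alpha> f \<xi>))\<^sup>2 * gauss s \<xi>) \<partial>lborel) \<le> ennreal ((2 * pi / \<bar>\<alpha>\<bar>) ^ CARD('n) * ?N)"
  if s: "s > 0" for s
 proof -
  have auto_bound: "(\<integral>\<^sup>+x. ennreal (cmod (f x) * cmod (f (x + v))) \<partial>lborel) \<le> ennreal ?N" for v
  proof -
   have "(\<integral>\<^sup>+x. ennreal (cmod (f x) * cmod (f (x + v))) \<partial>lborel)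
     \<le> (\<integral>\<^sup>+x. ennreal (1/2) * (ennreal ((cmod (f x))\<^sup>2) + ennreal ((cmod (f (x + v)))\<^sup>2)) \<partial>lborel)"
   proof (rule nn_integral_mono)
    fix x
    have "cmod (f x) * cmod (f (x + v)) \<le> 1/2 * ((cmod (f x))\<^sup>2 + (cmod (f (x + v)))\<^sup>2)"
     using sum_squares_bound[of "cmod (f x)" "cmod (f (x + v))"] by simp
    then show "ennreal (cmod (f x) * cmod (f (x + v))) \<le> ennreal (1/2) * (ennreal ((cmod (f x))\<^sup>2) + ennreal ((cmod (f (x + v)))\<^sup>2))"
     unfolding ennreal_half_sum[OF zero_le_power2 zero_le_power2] by (rule ennreal_leI)
   qed
   also have "... = ennreal (1/2) * ((\<integral>\<^sup>+x. ennreal ((cmod (f x))\<^sup>2) \<partial>lborel) + (\<integral>\<^sup>+x. ennreal ((cmod (f (x + v)))\<^sup>2) \<partial>lborel))"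
    by (subst nn_integral_cmult, measurable, subst nn_integral_add) measurable
   also have "(\<integral>\<^sup>+x. ennreal ((cmod (f (x + v)))\<^sup>2) \<partial>lborel) = (\<integral>\<^sup>+x. ennreal ((cmod (f x))\<^sup>2) \<partial>lborel)"
    by (rule nn_integral_lborel_translate) measurable
   also have "(\<integral>\<^sup>+x. ennreal ((cmod (f x))\<^sup>2) \<partial>lborel) = ennreal ?N" by (rule nn_norm_abs_L2[OF f2])
   also have "ennreal (1/2) * (ennreal ?N + ennreal ?N) = ennreal (1/2 * (?N + ?N))"
    by (rule ennreal_half_sum) simp_all
   finally show ?thesis by (simp only: mult_2[symmetric]) simp
  qed
  define J where "J = (LINT x|lborel. f x * (LINT w|lborel. cnj (f (x + (s / \<alpha>) *\<^sub>R w)) * of_real (gauss 1 w)))"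
  have Jb: "ennreal (cmod J) \<le> ennreal (?N * sqrt (2 * pi) ^ CARD('n))"
  proof -
   have "ennreal (cmod J) \<le> (\<integral>\<^sup>+x. ennreal (cmod (f x * (LINT w|lborel. cnj (f (x + (s / \<alpha>) *\<^sub>R w)) * of_real (gauss 1 w)))) \<partial>lborel)"
    unfolding J_def by (rule integral_norm_bound_ennreal_any)
   also have "... \<le> (\<integral>\<^sup>+x. \<integral>\<^sup>+w. ennreal (cmod (f x) * cmod (f (x + (s / \<alpha>) *\<^sub>R w))) * ennreal (gauss 1 w) \<partial>lborel \<partial>lborel)"
   proof (rule nn_integral_mono)
    fix x
    have "ennreal (cmod (f x * (LINT w|lborel. cnj (f (x + (s / \<alpha>) *\<^sub>R w)) * of_real (gauss 1 w))))
     = ennreal (cmod (LINT w|lborel. f x * (cnj (f (x + (s / \<alpha>) *\<^sub>R w)) * of_real (gauss 1 w))))" by simp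
    also have "... \<le> (\<integral>\<^sup>+w. ennreal (cmod (f x * (cnj (f (x + (s / \<alpha>) *\<^sub>R w)) * of_real (gauss 1 w)))) \<partial>lborel)"
     by (rule integral_norm_bound_ennreal_any)
    also have "... = (\<integral>\<^sup>+w. ennreal (cmod (f x) * cmod (f (x + (s / \<alpha>) *\<^sub>R w))) * ennreal (gauss 1 w) \<partial>lborel)"
     by (intro nn_integral_cong) (simp add: norm_mult ennreal_mult[symmetric] less_imp_le[OF gauss_pos] abs_of_pos[OF gauss_pos] mult_ac)
    finally show "ennreal (cmod (f x * (LINT w|lborel. cnj (f (x + (s / \<alpha>) *\<^sub>R w)) * of_real (gauss 1 w))))
     \<le> (\<integral>\<^sup>+w. ennreal (cmod (f x) * cmod (f (x + (s / \<alpha>) *\<^sub>R w))) * ennreal (gauss 1 w) \<partial>lborel)" .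
   qed
   also have "... = (\<integral>\<^sup>+w. \<integral>\<^sup>+x. ennreal (cmod (f x) * cmod (f (x + (s / \<alpha>) *\<^sub>R w))) * ennreal (gauss 1 w) \<partial>lborel \<partial>lborel)"
    by (rule lborel_pair.Fubini') measurable
   also have "... = (\<integral>\<^sup>+w. (\<integral>\<^sup>+x. ennreal (cmod (f x) * cmod (f (x + (s / \<alpha>) *\<^sub>R w))) \<partial>lborel) * ennreal (gauss 1 w) \<partial>lborel)"
    by (intro nn_integral_cong nn_integral_multc) measurable
   also have "... \<le> (\<integral>\<^sup>+w. ennreal ?N * ennreal (gauss 1 (w :: real^'n)) \<partial>lborel)"
    by (intro nn_integral_mono mult_right_mono auto_bound) simp
   also have "... = ennreal ?N * (\<integral>\<^sup>+w. ennreal (gauss 1 (w :: real^'n)) \<partial>lborel)"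
    by (rule nn_integral_cmult) measurable
   also have "(\<integral>\<^sup>+w. ennreal (gauss 1 (w :: real^'n)) \<partial>lborel) = ennreal (sqrt (2 * pi) ^ CARD('n))"
    unfolding integral_gauss[symmetric] by (intro nn_integral_eq_integral integrable_gauss) (simp add: less_imp_le[OF gauss_pos])
   also have "ennreal ?N * ennreal (sqrt (2 * pi) ^ CARD('n)) = ennreal (?N * sqrt (2 * pi) ^ CARD('n))"
    by (rule ennreal_mult[symmetric]) simp_all
   finally show ?thesis .
  qed
  then have Jb': "cmod J \<le> ?N * sqrt (2 * pi) ^ CARD('n)" by (subst (asm) ennreal_le_iff) simp_all
  define I where "I = (LINT \<xi>|lborel. (cmod (fourier_integral \<alpha> f \<xi>))\<^sup>2 * gauss s \<xi>)"
  have "complex_of_real I = (LINT \<xi>|lborel. fourier_integral \<alpha> f \<xi> * cnj (fourier_integral \<alpha> f \<xi>) * of_real (gauss s \<xi>))"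
   unfolding I_def integral_complex_of_real[symmetric] by (simp only: of_real_mult complex_norm_square)
  also have "... = of_real ?C * J" unfolding J_def by (rule fourier_gauss_pairing[OF f f s \<alpha>])
  finally have "complex_of_real I = of_real ?C * J" .
  then have "cmod (complex_of_real I) = cmod (of_real ?C * J)" by (rule arg_cong)
  moreover have "?C \<ge> 0" by simp
  ultimately have "\<bar>I\<bar> = ?C * cmod J" by (simp only: norm_mult norm_of_real abs_of_nonneg)
  also have "... \<le> ?C * (?N * sqrt (2 * pi) ^ CARD('n))" by (intro mult_left_mono Jb') simp
  also have "... = (sqrt (2 * pi) / \<bar>\<alpha>\<bar> * sqrt (2 * pi)) ^ CARD('n) * ?N" by (simp only: power_mult_distrib mult_ac)
  also have "sqrt (2 * pi) / \<bar>\<alpha>\<bar> * sqrt (2 * pi) = 2 * pi / \<bar>\<alpha>\<bar>" by simp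
  finally have Ib: "I \<le> (2 * pi / \<bar>\<alpha>\<bar>) ^ CARD('n) * ?N" by simp
  have "integrable lborel (\<lambda>\<xi>. (cmod (fourier_integral \<alpha> f \<xi>))\<^sup>2 * gauss s \<xi>)"
  proof (rule Bochner_Integration.integrable_bound[OF integrable_mult_right[OF fourier_gauss(1)[OF s], of "of_real ((LINT x|lborel. cmod (f x))\<^sup>2)"]])
   have "(cmod (fourier_integral \<alpha> f \<xi>))\<^sup>2 \<le> (LINT x|lborel. cmod (f x))\<^sup>2" for \<xi>
    by (intro power_mono fourier_integral_bound) simp
   then show "AE \<xi> in lborel. norm ((cmod (fourier_integral \<alpha> f \<xi>))\<^sup>2 * gauss s \<xi>) \<le> norm (complex_of_real ((LINT x|lborel. cmod (f x))\<^sup>2) * complex_of_real (gauss s \<xi>))"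
    by (intro AE_I2) (simp only: norm_mult norm_of_real real_norm_def abs_mult abs_power2 mult_right_mono abs_ge_zero)
  qed simp
  then have "(\<integral>\<^sup>+\<xi>. ennreal ((cmod (fourier_integral \<alpha> f \<xi>))\<^sup>2 * gauss s \<xi>) \<partial>lborel) = ennreal I"
   unfolding I_def by (rule nn_integral_eq_integral) (simp add: less_imp_le[OF gauss_pos])
  also have "... \<le> ennreal ((2 * pi / \<bar>\<alpha>\<bar>) ^ CARD('n) * ?N)" by (rule ennreal_leI[OF Ib])
  finally show ?thesis .
 qed
 have "(\<integral>\<^sup>+\<xi>. ennreal ((cmod (fourier_integral \<alpha> f \<xi>))\<^sup>2) \<partial>lborel)
   = (\<integral>\<^sup>+\<xi>. liminf (\<lambda>k. ennreal ((cmod (fourier_integral \<alpha> f \<xi>))\<^sup>2 * gauss (1 / real (Suc k)) \<xi>)) \<partial>lborel)"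
 proof (rule nn_integral_cong)
  fix \<xi>
  have "(\<lambda>k. ennreal ((cmod (fourier_integral \<alpha> f \<xi>))\<^sup>2 * gauss (1 / real (Suc k)) \<xi>)) \<longlonglongrightarrow> ennreal ((cmod (fourier_integral \<alpha> f \<xi>))\<^sup>2 * 1)"
   by (intro tendsto_ennrealI tendsto_mult_left gauss_scale_tendsto)
  then show "ennreal ((cmod (fourier_integral \<alpha> f \<xi>))\<^sup>2) = liminf (\<lambda>k. ennreal ((cmod (fourier_integral \<alpha> f \<xi>))\<^sup>2 * gauss (1 / real (Suc k)) \<xi>))"
   unfolding mult_1_right by (rule lim_imp_Liminf[OF sequentially_bot, symmetric])
 qed
 also have "... \<le> liminf (\<lambda>k. \<integral>\<^sup>+\<xi>. ennreal ((cmod (fourier_integral \<alpha> f \<xi>))\<^sup>2 * gauss (1 / real (Suc k)) \<xi>) \<partial>lborel)"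
  by (rule nn_integral_liminf) measurable
 also have "... \<le> liminf (\<lambda>k::nat. ennreal ((2 * pi / \<bar>\<alpha>\<bar>) ^ CARD('n) * ?N))"
  by (intro Liminf_mono always_eventually allI bound) simp
 also have "... = ennreal ((2 * pi / \<bar>\<alpha>\<bar>) ^ CARD('n) * ?N)" by (rule Liminf_const) simp
 finally show ?thesis .
qed

definition fourier_fun :: "real => (real^'n::finite => complex) => real^'n => complex" where
 "fourier_fun \<alpha> f \<xi> = of_real (sqrt (\<bar>\<alpha>\<bar> / (2 * pi)) ^ CARD('n)) * fourier_integral \<alpha> f \<xi>"

definition L12 :: "(real^'n::finite => complex) => bool" where
 "L12 f \<longleftrightarrow> integrable lborel f \<and> square_integrable f"

lemma L12_diff: "L12 f ==> L12 g ==> L12 (\<lambda>x. f x - g x)"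
 by (simp add: L12_def square_integrable_diff)

lemma L12_schwartz: "schwartz f ==> L12 f"
 by (simp add: L12_def schwartz_integrable schwartz_square_integrable)

lemma fourier_fun_square_integrable:
 fixes f :: "real^'n::finite => complex"
 assumes f: "L12 f" and \<alpha>: "\<alpha> \<noteq> 0"
 shows "square_integrable (fourier_fun \<alpha> f)" "norm (abs_L2 (fourier_fun \<alpha> f)) \<le> norm (abs_L2 f)"
proof -
 have i: "integrable lborel f" and s: "square_integrable f" using f by (auto simp: L12_def)
 note B = Bessel_fourier_integral[OF i s \<alpha>]
 have Fs: "square_integrable (fourier_integral \<alpha> f)"
  by (rule square_integrable_nnI[OF fourier_integral_measurable[OF i]])
   (rule le_less_trans[OF B], simp add: ennreal_less_top)
 then show "square_integrable (fourier_fun \<alpha> f)"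
  unfolding fourier_fun_def[abs_def] by (rule square_integrable_scale)
 let ?c = "sqrt (\<bar>\<alpha>\<bar> / (2 * pi)) ^ CARD('n)"
 have c2: "?c\<^sup>2 * (2 * pi / \<bar>\<alpha>\<bar>) ^ CARD('n) = 1"
  using \<alpha> by (simp add: power2_eq_square flip: power_mult_distrib)
 have "(norm (abs_L2 (fourier_integral \<alpha> f)))\<^sup>2 \<le> (2 * pi / \<bar>\<alpha>\<bar>) ^ CARD('n) * (norm (abs_L2 f))\<^sup>2"
  using B unfolding nn_norm_abs_L2[OF Fs] by (subst (asm) ennreal_le_iff) simp_all
 then have "?c\<^sup>2 * (norm (abs_L2 (fourier_integral \<alpha> f)))\<^sup>2 \<le> ?c\<^sup>2 * ((2 * pi / \<bar>\<alpha>\<bar>) ^ CARD('n) * (norm (abs_L2 f))\<^sup>2)"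
  by (rule mult_left_mono) simp
 also have "... = (norm (abs_L2 f))\<^sup>2" unfolding mult.assoc[symmetric] c2 by simp
 finally have "(?c * norm (abs_L2 (fourier_integral \<alpha> f)))\<^sup>2 \<le> (norm (abs_L2 f))\<^sup>2"
  by (simp only: power_mult_distrib)
 then have "?c * norm (abs_L2 (fourier_integral \<alpha> f)) \<le> norm (abs_L2 f)"
  by (rule power2_le_imp_le) simp
 moreover have "abs_L2 (fourier_fun \<alpha> f) = scaleC (of_real ?c) (abs_L2 (fourier_integral \<alpha> f))"
  unfolding fourier_fun_def[abs_def] by (rule abs_L2_scaleC[OF Fs, symmetric])
 moreover have "?c \<ge> 0" by simp
 ultimately show "norm (abs_L2 (fourier_fun \<alpha> f)) \<le> norm (abs_L2 f)"
  by (simp only: norm_scaleC norm_of_real abs_of_nonneg)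
qed

lemma fourier_fun_diff:
 assumes f: "L12 f" and g: "L12 g" and \<alpha>: "\<alpha> \<noteq> 0"
 shows "abs_L2 (fourier_fun \<alpha> f) - abs_L2 (fourier_fun \<alpha> g) = abs_L2 (fourier_fun \<alpha> (\<lambda>x. f x - g x))"
proof -
 have "fourier_integral \<alpha> (\<lambda>x. f x - g x) \<xi> = fourier_integral \<alpha> f \<xi> - fourier_integral \<alpha> g \<xi>" for \<xi>
  unfolding fourier_integral_def right_diff_distrib
  using f g by (intro Bochner_Integration.integral_diff integrable_cis_mult) (auto simp: L12_def)
 then have "fourier_fun \<alpha> (\<lambda>x. f x - g x) = (\<lambda>\<xi>. fourier_fun \<alpha> f \<xi> - fourier_fun \<alpha> g \<xi>)"
  by (auto simp: fourier_fun_def right_diff_distrib)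
 then show ?thesis
  by (simp add: abs_L2_diff fourier_fun_square_integrable[OF f \<alpha>] fourier_fun_square_integrable[OF g \<alpha>])
qed

lemma fourier_fun_diff_norm:
 assumes f: "L12 f" and g: "L12 g" and \<alpha>: "\<alpha> \<noteq> 0"
 shows "norm (abs_L2 (fourier_fun \<alpha> f) - abs_L2 (fourier_fun \<alpha> g)) \<le> norm (abs_L2 f - abs_L2 g)"
proof -
 have "norm (abs_L2 (fourier_fun \<alpha> (\<lambda>x. f x - g x))) \<le> norm (abs_L2 (\<lambda>x. f x - g x))"
  by (rule fourier_fun_square_integrable(2)[OF L12_diff[OF f g] \<alpha>])
 then show ?thesis
  using f g by (simp add: fourier_fun_diff[OF f g \<alpha>] abs_L2_diff L12_def)
qed

definition cutoff :: "nat => (real^'n::finite) L2 => real^'n => complex" where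
 "cutoff n u x = indicator (ball 0 (real n)) x * rep_L2 u x"

lemma L12_cutoff: "L12 (cutoff n u)"
 unfolding L12_def cutoff_def[abs_def]
 by (intro conjI integrable_L2_on_ball square_integrable_indicator ball_borel square_integrable_rep)

lemma cutoff_tendsto: "(\<lambda>n. abs_L2 (cutoff n u)) \<longlonglongrightarrow> u"
proof -
 have "(\<lambda>n. abs_L2 (cutoff n u)) \<longlonglongrightarrow> abs_L2 (rep_L2 u)"
 proof (rule L2_dominated_convergence[OF _ _ square_integrable_rep[of u]])
  show "cutoff n u \<in> borel_measurable borel" for n
   using L12_cutoff square_integrable_measurable unfolding L12_def by blast
  show "AE x in lborel. (\<lambda>n. cutoff n u x) \<longlonglongrightarrow> rep_L2 u x"
  proof (rule AE_I2)
   fix x :: "real^'a"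
   obtain N where N: "real N > norm x" using reals_Archimedean2 by blast
   have "\<forall>\<^sub>F n in sequentially. cutoff n u x = rep_L2 u x"
    by (rule eventually_sequentiallyI[of N]) (use N in \<open>simp add: cutoff_def\<close>)
   then show "(\<lambda>n. cutoff n u x) \<longlonglongrightarrow> rep_L2 u x" by (rule tendsto_eventually)
  qed
 qed (auto simp: cutoff_def indicator_def)
 then show ?thesis by simp
qed

lemma fourier_fun_AE_cong:
 assumes "f \<in> borel_measurable borel" "g \<in> borel_measurable borel" "AE x in lborel. f x = g x"
 shows "fourier_fun \<alpha> f = fourier_fun \<alpha> g"
proof -
 have "fourier_integral \<alpha> f \<xi> = fourier_integral \<alpha> g \<xi>" for \<xi>
  unfolding fourier_integral_def
 proof (rule integral_cong_AE)
  show "AE x in lborel. cis (- (\<alpha> * (x \<bullet> \<xi>))) * f x = cis (- (\<alpha> * (x \<bullet> \<xi>))) * g x"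
   using assms(3) by eventually_elim simp
 qed (use assms in measurable)
 then show ?thesis by (simp add: fourier_fun_def[abs_def])
qed

definition fourier_L2 :: "real => (real^'n::finite) L2 => (real^'n) L2" where
 "fourier_L2 \<alpha> u = lim (\<lambda>n. abs_L2 (fourier_fun \<alpha> (cutoff n u)))"

definition FT :: "real => (real^'n::finite) L2_op" where
 "FT \<alpha> = Blinfun (fourier_L2 \<alpha>)"

lemma fourier_L2_tendsto:
 assumes \<alpha>: "\<alpha> \<noteq> 0"
 shows "(\<lambda>n. abs_L2 (fourier_fun \<alpha> (cutoff n u))) \<longlonglongrightarrow> fourier_L2 \<alpha> u"
proof -
 have "Cauchy (\<lambda>n. abs_L2 (cutoff n u))" by (rule LIMSEQ_imp_Cauchy[OF cutoff_tendsto])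
 then have "Cauchy (\<lambda>n. abs_L2 (fourier_fun \<alpha> (cutoff n u)))"
  unfolding Cauchy_iff by (meson fourier_fun_diff_norm[OF L12_cutoff L12_cutoff \<alpha>] le_less_trans)
 then show ?thesis
  unfolding fourier_L2_def using Cauchy_convergent_iff convergent_LIMSEQ_iff by blast
qed

lemma fourier_L2_abs:
 assumes f: "L12 f" and \<alpha>: "\<alpha> \<noteq> 0"
 shows "fourier_L2 \<alpha> (abs_L2 f) = abs_L2 (fourier_fun \<alpha> f)"
proof (rule LIMSEQ_unique[OF fourier_L2_tendsto[OF \<alpha>]])
 have "(\<lambda>n. abs_L2 (cutoff n (abs_L2 f)) - abs_L2 f) \<longlonglongrightarrow> 0"
  using cutoff_tendsto[of "abs_L2 f"] by (rule LIM_zero)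
 then have "(\<lambda>n. abs_L2 (fourier_fun \<alpha> (cutoff n (abs_L2 f))) - abs_L2 (fourier_fun \<alpha> f)) \<longlonglongrightarrow> 0"
  by (rule Lim_null_comparison[OF always_eventually[OF allI[OF fourier_fun_diff_norm[OF L12_cutoff f \<alpha>]]] tendsto_norm_zero])
 then show "(\<lambda>n. abs_L2 (fourier_fun \<alpha> (cutoff n (abs_L2 f)))) \<longlonglongrightarrow> abs_L2 (fourier_fun \<alpha> f)"
  by (rule LIM_zero_cancel)
qed

lemma bounded_linear_fourier_L2:
 assumes \<alpha>: "\<alpha> \<noteq> 0"
 shows "bounded_linear (fourier_L2 \<alpha> :: (real^'n::finite) L2 => _)"
proof (rule bounded_linear_intro[where K = 1])
 fix u v :: "(real^'n) L2" and r :: real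
 have cm: "cutoff n u \<in> borel_measurable borel" for n and u :: "(real^'n) L2"
  using L12_cutoff square_integrable_measurable unfolding L12_def by blast
 have ci: "integrable lborel (cutoff n u)" for n and u :: "(real^'n) L2"
  using L12_cutoff unfolding L12_def by blast
 have "abs_L2 (fourier_fun \<alpha> (cutoff n (u + v))) = abs_L2 (fourier_fun \<alpha> (cutoff n u)) + abs_L2 (fourier_fun \<alpha> (cutoff n v))" for n
 proof -
  have "fourier_fun \<alpha> (cutoff n (u + v)) = fourier_fun \<alpha> (\<lambda>x. cutoff n u x + cutoff n v x)"
  proof (rule fourier_fun_AE_cong[OF cm])
   show "AE x in lborel. cutoff n (u + v) x = cutoff n u x + cutoff n v x"
    using AE_rep_add[of u v] by eventually_elim (simp add: cutoff_def distrib_left)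
  qed (use cm in measurable)
  also have "... = (\<lambda>\<xi>. fourier_fun \<alpha> (cutoff n u) \<xi> + fourier_fun \<alpha> (cutoff n v) \<xi>)"
   unfolding fourier_fun_def[abs_def] fourier_integral_def distrib_left
   by (subst Bochner_Integration.integral_add) (auto intro: integrable_cis_mult ci simp: distrib_left)
  finally show ?thesis
   by (simp add: abs_L2_add fourier_fun_square_integrable[OF L12_cutoff \<alpha>])
 qed
 then have "(\<lambda>n. abs_L2 (fourier_fun \<alpha> (cutoff n (u + v)))) \<longlonglongrightarrow> fourier_L2 \<alpha> u + fourier_L2 \<alpha> v"
  by (simp only:) (intro tendsto_add fourier_L2_tendsto \<alpha>)
 then show "fourier_L2 \<alpha> (u + v) = fourier_L2 \<alpha> u + fourier_L2 \<alpha> v"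
  by (rule LIMSEQ_unique[OF fourier_L2_tendsto[OF \<alpha>]])
 have "abs_L2 (fourier_fun \<alpha> (cutoff n (r *\<^sub>R u))) = r *\<^sub>R abs_L2 (fourier_fun \<alpha> (cutoff n u))" for n
 proof -
  have "fourier_fun \<alpha> (cutoff n (r *\<^sub>R u)) = fourier_fun \<alpha> (\<lambda>x. of_real r * cutoff n u x)"
  proof (rule fourier_fun_AE_cong[OF cm])
   show "AE x in lborel. cutoff n (r *\<^sub>R u) x = of_real r * cutoff n u x"
    using AE_rep_scaleR[of r u] by eventually_elim (simp add: cutoff_def)
  qed (use cm in measurable)
  also have "... = (\<lambda>\<xi>. of_real r * fourier_fun \<alpha> (cutoff n u) \<xi>)"
   unfolding fourier_fun_def[abs_def] fourier_integral_def by (simp add: mult.left_commute flip: integral_mult_right_zero)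
  finally show ?thesis
   by (simp add: abs_L2_scaleC[symmetric] fourier_fun_square_integrable[OF L12_cutoff \<alpha>] scaleC_of_real)
 qed
 then have "(\<lambda>n. abs_L2 (fourier_fun \<alpha> (cutoff n (r *\<^sub>R u)))) \<longlonglongrightarrow> r *\<^sub>R fourier_L2 \<alpha> u"
  by (simp only:) (intro tendsto_scaleR tendsto_const fourier_L2_tendsto \<alpha>)
 then show "fourier_L2 \<alpha> (r *\<^sub>R u) = r *\<^sub>R fourier_L2 \<alpha> u"
  by (rule LIMSEQ_unique[OF fourier_L2_tendsto[OF \<alpha>]])
 have "norm (fourier_L2 \<alpha> u) \<le> norm u"
  by (rule LIMSEQ_le[OF tendsto_norm[OF fourier_L2_tendsto[OF \<alpha>]] tendsto_norm[OF cutoff_tendsto]])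
   (intro exI[of _ 0] allI impI fourier_fun_square_integrable(2)[OF L12_cutoff \<alpha>])
 then show "norm (fourier_L2 \<alpha> u) \<le> norm u * 1" by simp
qed

lemma FT_apply: "\<alpha> \<noteq> 0 ==> blinfun_apply (FT \<alpha>) = fourier_L2 \<alpha>"
 unfolding FT_def by (rule bounded_linear_Blinfun_apply[OF bounded_linear_fourier_L2])

lemma FT_abs:
 "L12 f ==> \<alpha> \<noteq> 0 ==> blinfun_apply (FT \<alpha>) (abs_L2 f) = abs_L2 (fourier_fun \<alpha> f)"
 by (simp add: FT_apply fourier_L2_abs)

lemma AE_rep_FT_abs:
 "L12 f ==> \<alpha> \<noteq> 0 ==> AE x in lborel. rep_L2 (blinfun_apply (FT \<alpha>) (abs_L2 f)) x = fourier_fun \<alpha> f x"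
 by (simp add: FT_abs AE_rep_abs fourier_fun_square_integrable)

lemma fourier_fun_adjoint:
 assumes f: "L12 f" and g: "L12 g" and \<alpha>: "\<alpha> \<noteq> 0"
 shows "cinner (abs_L2 (fourier_fun \<alpha> f)) (abs_L2 g) = cinner (abs_L2 f) (abs_L2 (fourier_fun (- \<alpha>) g))"
proof -
 have gc: "integrable lborel (\<lambda>x. cnj (g x))" and fi: "integrable lborel f" using f g by (auto simp: L12_def)
 have \<alpha>': "- \<alpha> \<noteq> 0" using \<alpha> by simp
 let ?c = "complex_of_real (sqrt (\<bar>\<alpha>\<bar> / (2 * pi)) ^ CARD('a))"
 have "cinner (abs_L2 (fourier_fun \<alpha> f)) (abs_L2 g) = (LINT x|lborel. fourier_fun \<alpha> f x * cnj (g x))"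
  using g by (intro cinner_abs fourier_fun_square_integrable[OF f \<alpha>]) (simp add: L12_def)
 also have "... = ?c * (LINT x|lborel. fourier_integral \<alpha> f x * cnj (g x))"
  unfolding fourier_fun_def mult.assoc by (rule integral_mult_right_zero)
 also have "(LINT x|lborel. fourier_integral \<alpha> f x * cnj (g x)) = (LINT x|lborel. f x * fourier_integral \<alpha> (\<lambda>x. cnj (g x)) x)"
  by (rule fourier_multiplication_formula[OF fi gc])
 also have "?c * ... = (LINT x|lborel. ?c * (f x * fourier_integral \<alpha> (\<lambda>x. cnj (g x)) x))"
  by (rule integral_mult_right_zero[symmetric])
 also have "... = (LINT x|lborel. f x * cnj (fourier_fun (- \<alpha>) g x))"
  unfolding fourier_fun_def complex_cnj_mult fourier_integral_cnj by (simp add: mult.left_commute)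
 also have "... = cinner (abs_L2 f) (abs_L2 (fourier_fun (- \<alpha>) g))"
  using f by (intro cinner_abs[symmetric] fourier_fun_square_integrable[OF g \<alpha>']) (simp add: L12_def)
 finally show ?thesis .
qed

lemma is_adjoint_FT:
 assumes \<alpha>: "\<alpha> \<noteq> 0"
 shows "is_adjoint (FT \<alpha> :: (real^'n::finite) L2_op) (FT (- \<alpha>))"
 unfolding is_adjoint_def
proof (intro allI)
 fix u v :: "(real^'n) L2"
 have \<alpha>': "- \<alpha> \<noteq> 0" using \<alpha> by simp
 have 1: "cinner (fourier_L2 \<alpha> u) (abs_L2 (cutoff m v)) = cinner u (abs_L2 (fourier_fun (- \<alpha>) (cutoff m v)))" for m
 proof (rule LIMSEQ_unique)
  show "(\<lambda>n. cinner (abs_L2 (fourier_fun \<alpha> (cutoff n u))) (abs_L2 (cutoff m v))) \<longlonglongrightarrow> cinner (fourier_L2 \<alpha> u) (abs_L2 (cutoff m v))"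
   by (intro tendsto_cinner_left fourier_L2_tendsto \<alpha>)
  show "(\<lambda>n. cinner (abs_L2 (fourier_fun \<alpha> (cutoff n u))) (abs_L2 (cutoff m v))) \<longlonglongrightarrow> cinner u (abs_L2 (fourier_fun (- \<alpha>) (cutoff m v)))"
   unfolding fourier_fun_adjoint[OF L12_cutoff L12_cutoff \<alpha>] by (intro tendsto_cinner_left cutoff_tendsto)
 qed
 have "cinner (fourier_L2 \<alpha> u) v = cinner u (fourier_L2 (- \<alpha>) v)"
 proof (rule LIMSEQ_unique)
  show "(\<lambda>m. cinner (fourier_L2 \<alpha> u) (abs_L2 (cutoff m v))) \<longlonglongrightarrow> cinner (fourier_L2 \<alpha> u) v"
   by (intro tendsto_cinner_right cutoff_tendsto)
  show "(\<lambda>m. cinner (fourier_L2 \<alpha> u) (abs_L2 (cutoff m v))) \<longlonglongrightarrow> cinner u (fourier_L2 (- \<alpha>) v)"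
   unfolding 1 by (intro tendsto_cinner_right fourier_L2_tendsto \<alpha>')
 qed
 then show "cinner (blinfun_apply (FT \<alpha>) u) v = cinner u (blinfun_apply (FT (- \<alpha>)) v)"
  by (simp add: FT_apply \<alpha>)
qed

lemma fourier_fun_parseval:
 fixes f g :: "real^'n::finite => complex"
 assumes f: "L12 f" and g: "schwartz g" and \<alpha>: "\<alpha> \<noteq> 0"
 shows "cinner (abs_L2 (fourier_fun \<alpha> f)) (abs_L2 (fourier_fun \<alpha> g)) = cinner (abs_L2 f) (abs_L2 g)"
proof -
 note gL = L12_schwartz[OF g]
 have fi: "integrable lborel f" and gi: "integrable lborel g" using f gL by (auto simp: L12_def)
 have [measurable]: "f \<in> borel_measurable borel" "g \<in> borel_measurable borel"
  using borel_measurable_integrable[OF fi] borel_measurable_integrable[OF gi] by auto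
 have [measurable]: "fourier_integral \<alpha> f \<in> borel_measurable borel" "fourier_integral \<alpha> g \<in> borel_measurable borel"
  using fourier_integral_measurable fi gi by auto
 let ?c = "sqrt (\<bar>\<alpha>\<bar> / (2 * pi)) ^ CARD('n)"
 let ?C = "(sqrt (2 * pi) / \<bar>\<alpha>\<bar>) ^ CARD('n)"
 let ?S = "sqrt (2 * pi) ^ CARD('n)"
 define s where "s k = 1 / real (Suc k)" for k
 have s: "s k > 0" for k by (simp add: s_def)
 have s0: "s \<longlonglongrightarrow> 0" using LIMSEQ_inverse_real_of_nat by (simp add: s_def[abs_def] inverse_eq_divide)
 obtain B where B: "B \<ge> 0" "\<And>x. cmod (g x) \<le> B" using schwartz_bounded[OF g] by blast
 have gcont: "isCont g x" for x
  using schwartz_continuous[OF g] by (simp add: continuous_on_eq_continuous_at)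
 define \<Psi> where "\<Psi> k x = (LINT w|lborel. cnj (g (x + (s k / \<alpha>) *\<^sub>R w)) * of_real (gauss 1 w))" for k x
 have Gi: "integrable lborel (\<lambda>w::real^'n. B * gauss 1 w)" by (intro integrable_mult_right integrable_gauss)
 have \<Psi>b: "cmod (\<Psi> k x) \<le> B * ?S" for k x
 proof -
  have "cmod (\<Psi> k x) \<le> (LINT w|lborel. cmod (cnj (g (x + (s k / \<alpha>) *\<^sub>R w)) * of_real (gauss 1 w)))"
   unfolding \<Psi>_def by (rule integral_norm_bound)
  also have "... \<le> (LINT w|lborel. B * gauss 1 (w :: real^'n))"
   by (rule Bochner_Integration.integral_mono'[OF Gi])
    (auto simp: norm_mult abs_of_pos[OF gauss_pos] less_imp_le[OF gauss_pos] B intro!: mult_right_mono mult_nonneg_nonneg)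
  also have "... = B * ?S" by (simp add: integral_gauss)
  finally show ?thesis .
 qed
 have \<Psi>lim: "(\<lambda>k. \<Psi> k x) \<longlonglongrightarrow> cnj (g x) * of_real ?S" for x
 proof -
  have "(\<lambda>k. \<Psi> k x) \<longlonglongrightarrow> (LINT w|lborel. cnj (g x) * of_real (gauss 1 (w :: real^'n)))"
   unfolding \<Psi>_def
  proof (rule integral_dominated_convergence[OF _ _ Gi])
   show "AE w in lborel. (\<lambda>k. cnj (g (x + (s k / \<alpha>) *\<^sub>R w)) * of_real (gauss 1 w)) \<longlonglongrightarrow> cnj (g x) * of_real (gauss 1 (w :: real^'n))"
   proof (rule AE_I2)
    fix w :: "real^'n"
    have "(\<lambda>k. x + (s k / \<alpha>) *\<^sub>R w) \<longlonglongrightarrow> x + (0 / \<alpha>) *\<^sub>R w"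
     by (intro tendsto_add tendsto_const tendsto_scaleR tendsto_divide s0 \<alpha>)
    then have "(\<lambda>k. x + (s k / \<alpha>) *\<^sub>R w) \<longlonglongrightarrow> x" by simp
    from isCont_tendsto_compose[OF gcont this]
    show "(\<lambda>k. cnj (g (x + (s k / \<alpha>) *\<^sub>R w)) * of_real (gauss 1 w)) \<longlonglongrightarrow> cnj (g x) * of_real (gauss 1 w)"
     by (intro tendsto_mult tendsto_cnj tendsto_const)
   qed
   show "AE w in lborel. norm (cnj (g (x + (s k / \<alpha>) *\<^sub>R w)) * of_real (gauss 1 w)) \<le> B * gauss 1 w" for k
    by (intro AE_I2) (auto simp: norm_mult abs_of_pos[OF gauss_pos] less_imp_le[OF gauss_pos] B intro!: mult_right_mono)
  qed measurable
  also have "(LINT w|lborel. cnj (g x) * of_real (gauss 1 (w :: real^'n))) = cnj (g x) * of_real ?S"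
   by (simp add: integral_complex_of_real integral_gauss)
  finally show ?thesis .
 qed
 have \<Psi>m: "\<Psi> k \<in> borel_measurable borel" for k
 proof -
  have "(\<lambda>(x, w). cnj (g (x + (s k / \<alpha>) *\<^sub>R w)) * of_real (gauss 1 w)) \<in> borel_measurable (borel \<Otimes>\<^sub>M (lborel :: (real^'n) measure))"
   by measurable
  then show ?thesis unfolding \<Psi>_def[abs_def] by (rule lborel.borel_measurable_lebesgue_integral)
 qed
 have R: "(\<lambda>k. LINT x|lborel. f x * \<Psi> k x) \<longlonglongrightarrow> (LINT x|lborel. f x * (cnj (g x) * of_real ?S))"
 proof (rule integral_dominated_convergence[where w = "\<lambda>x. cmod (f x) * (B * ?S)"])
  show "integrable lborel (\<lambda>x. cmod (f x) * (B * ?S))" by (intro integrable_mult_left integrable_norm fi)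
  show "AE x in lborel. (\<lambda>k. f x * \<Psi> k x) \<longlonglongrightarrow> f x * (cnj (g x) * of_real ?S)"
   by (intro AE_I2 tendsto_mult tendsto_const \<Psi>lim)
  show "AE x in lborel. norm (f x * \<Psi> k x) \<le> cmod (f x) * (B * ?S)" for k
   unfolding norm_mult by (intro AE_I2 mult_left_mono \<Psi>b) simp
 qed (use \<Psi>m in measurable)
 let ?P = "\<lambda>\<xi>. fourier_integral \<alpha> f \<xi> * cnj (fourier_integral \<alpha> g \<xi>)"
 have si: "square_integrable (fourier_integral \<alpha> h)" if "L12 h" for h :: "real^'n => complex"
 proof -
  have "(\<lambda>\<xi>. of_real (1 / ?c) * fourier_fun \<alpha> h \<xi>) = fourier_integral \<alpha> h"
   using \<alpha> by (auto simp: fourier_fun_def)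
  then show ?thesis using square_integrable_scale[OF fourier_fun_square_integrable(1)[OF that \<alpha>], of "of_real (1 / ?c)"] by simp
 qed
 have Pi: "integrable lborel ?P" by (rule square_integrable_mult_cnj[OF si[OF f] si[OF gL]])
 have L: "(\<lambda>k. LINT \<xi>|lborel. ?P \<xi> * of_real (gauss (s k) \<xi>)) \<longlonglongrightarrow> (LINT \<xi>|lborel. ?P \<xi>)"
 proof (rule integral_dominated_convergence[OF _ _ integrable_norm[OF Pi]])
  have "(\<lambda>k. ?P \<xi> * of_real (gauss (s k) \<xi>)) \<longlonglongrightarrow> ?P \<xi> * of_real 1" for \<xi>
   unfolding s_def by (intro tendsto_mult tendsto_const tendsto_of_real gauss_scale_tendsto)
  then show "AE \<xi> in lborel. (\<lambda>k. ?P \<xi> * of_real (gauss (s k) \<xi>)) \<longlonglongrightarrow> ?P \<xi>" by simp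
  have "cmod (?P \<xi>) * gauss (s k) \<xi> \<le> cmod (?P \<xi>)" for k \<xi>
   by (rule mult_left_le) (auto simp: gauss_def)
  then show "AE \<xi> in lborel. norm (?P \<xi> * of_real (gauss (s k) \<xi>)) \<le> norm (?P \<xi>)" for k
   by (intro AE_I2) (simp only: norm_mult[of "?P _"] norm_of_real abs_of_pos[OF gauss_pos])
 qed measurable
 have "(LINT \<xi>|lborel. ?P \<xi>) = of_real ?C * (LINT x|lborel. f x * (cnj (g x) * of_real ?S))"
 proof (rule LIMSEQ_unique[OF L])
  show "(\<lambda>k. LINT \<xi>|lborel. ?P \<xi> * of_real (gauss (s k) \<xi>)) \<longlonglongrightarrow> of_real ?C * (LINT x|lborel. f x * (cnj (g x) * of_real ?S))"
   unfolding fourier_gauss_pairing[OF fi gi s \<alpha>] \<Psi>_def[symmetric] by (intro tendsto_mult tendsto_const R)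
 qed
 also have "... = of_real (?C * ?S) * (LINT x|lborel. f x * cnj (g x))"
  by (simp add: mult.assoc[symmetric])
 finally have P: "(LINT \<xi>|lborel. ?P \<xi>) = of_real (?C * ?S) * (LINT x|lborel. f x * cnj (g x))" .
 have one: "?c * ?c * (?C * ?S) = 1"
  using \<alpha> by (simp flip: power_mult_distrib)
 have "cinner (abs_L2 (fourier_fun \<alpha> f)) (abs_L2 (fourier_fun \<alpha> g)) = (LINT \<xi>|lborel. fourier_fun \<alpha> f \<xi> * cnj (fourier_fun \<alpha> g \<xi>))"
  by (intro cinner_abs fourier_fun_square_integrable f gL \<alpha>)
 also have "... = (LINT \<xi>|lborel. of_real (?c * ?c) * ?P \<xi>)"
  unfolding fourier_fun_def by (simp add: mult_ac)
 also have "... = of_real (?c * ?c) * (LINT \<xi>|lborel. ?P \<xi>)" by (rule integral_mult_right_zero)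
 also have "... = of_real (?c * ?c * (?C * ?S)) * (LINT x|lborel. f x * cnj (g x))"
  unfolding P by (simp only: of_real_mult mult.assoc)
 also have "... = cinner (abs_L2 f) (abs_L2 g)"
  unfolding one using f gL by (subst cinner_abs) (auto simp: L12_def)
 finally show ?thesis .
qed

theorem FT_unitary:
 assumes \<alpha>: "\<alpha> \<noteq> 0"
 shows "FT (- \<alpha>) o\<^sub>L FT \<alpha> = (id_blinfun :: (real^'n::finite) L2_op)"
proof -
 have 1: "cinner (blinfun_apply (FT \<alpha>) u) (blinfun_apply (FT \<alpha>) (abs_L2 g)) = cinner u (abs_L2 g)"
  if g: "schwartz g" for u and g :: "real^'n => complex"
  unfolding FT_apply[OF \<alpha>] fourier_L2_abs[OF L12_schwartz[OF g] \<alpha>]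
 proof (rule LIMSEQ_unique)
  show "(\<lambda>n. cinner (abs_L2 (fourier_fun \<alpha> (cutoff n u))) (abs_L2 (fourier_fun \<alpha> g))) \<longlonglongrightarrow> cinner (fourier_L2 \<alpha> u) (abs_L2 (fourier_fun \<alpha> g))"
   by (intro tendsto_cinner_left fourier_L2_tendsto \<alpha>)
  show "(\<lambda>n. cinner (abs_L2 (fourier_fun \<alpha> (cutoff n u))) (abs_L2 (fourier_fun \<alpha> g))) \<longlonglongrightarrow> cinner u (abs_L2 g)"
   unfolding fourier_fun_parseval[OF L12_cutoff g \<alpha>] by (intro tendsto_cinner_left cutoff_tendsto)
 qed
 have 2: "cinner (blinfun_apply (FT \<alpha>) u) (blinfun_apply (FT \<alpha>) v) = cinner u v" for u v :: "(real^'n) L2"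
 proof -
  define V where "V = {v. cinner (blinfun_apply (FT \<alpha>) u) (blinfun_apply (FT \<alpha>) v) = cinner u v}"
  have "v \<in> V"
  proof (rule schwartz_dense)
   show "subspace V"
    by (auto simp: subspace_def V_def blinfun.add_right blinfun.scaleR_right blinfun.zero_right cinner_add_right cinner_scaleR_right)
   show "abs_L2 f \<in> V" if "schwartz f" for f using 1[OF that] by (simp add: V_def)
   show "closed V"
    unfolding closed_sequential_limits
   proof (intro allI impI)
    fix x l assume xl: "(\<forall>n. x n \<in> V) \<and> x \<longlonglongrightarrow> l"
    have "(\<lambda>n. cinner (blinfun_apply (FT \<alpha>) u) (blinfun_apply (FT \<alpha>) (x n))) \<longlonglongrightarrow> cinner (blinfun_apply (FT \<alpha>) u) (blinfun_apply (FT \<alpha>) l)"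
     using xl by (intro tendsto_cinner_right blinfun.tendsto tendsto_const) auto
    moreover have "(\<lambda>n. cinner u (x n)) \<longlonglongrightarrow> cinner u l" using xl by (intro tendsto_cinner_right) auto
    moreover have "(\<lambda>n. cinner (blinfun_apply (FT \<alpha>) u) (blinfun_apply (FT \<alpha>) (x n))) = (\<lambda>n. cinner u (x n))"
     using xl by (auto simp: V_def)
    ultimately show "l \<in> V" unfolding V_def using LIMSEQ_unique by auto
   qed
  qed
  then show ?thesis by (simp add: V_def)
 qed
 show ?thesis
 proof (rule blinfun_eqI)
  fix v :: "(real^'n) L2"
  have "blinfun_apply (FT (- \<alpha>)) (blinfun_apply (FT \<alpha>) v) = v"
   by (rule cinner_eqI) (simp add: is_adjointD[OF is_adjoint_FT[OF \<alpha>], symmetric] 2)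
  then show "blinfun_apply (FT (- \<alpha>) o\<^sub>L FT \<alpha>) v = blinfun_apply id_blinfun v" by simp
 qed
qed

lemma FT_unitary': "\<alpha> \<noteq> 0 ==> FT \<alpha> o\<^sub>L FT (- \<alpha>) = (id_blinfun :: (real^'n::finite) L2_op)"
 using FT_unitary[of "- \<alpha>"] by simp

lemma tendsto_difference_quotient:
 fixes f :: "real => 'b::real_normed_vector"
 assumes "(f has_vector_derivative D) (at 0)" and h: "h \<longlonglongrightarrow> 0" "\<And>k. h k \<noteq> 0"
 shows "(\<lambda>k. (f (h k) - f 0) /\<^sub>R h k) \<longlonglongrightarrow> D"
proof -
 have "(\<lambda>t. norm (f (0 + t) - f 0 - t *\<^sub>R D) / norm t) \<midarrow>0\<rightarrow> 0"
  using assms(1) unfolding has_vector_derivative_def has_derivative_at by blast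
 moreover have "filterlim h (at 0) sequentially"
  using h by (auto simp: filterlim_at)
 ultimately have "(\<lambda>k. norm (f (0 + h k) - f 0 - h k *\<^sub>R D) / norm (h k)) \<longlonglongrightarrow> 0"
  by (rule filterlim_compose)
 moreover have "norm (f (0 + h k) - f 0 - h k *\<^sub>R D) / norm (h k) = norm ((f (h k) - f 0) /\<^sub>R h k - D)" for k
 proof -
  have "(f (h k) - f 0) /\<^sub>R h k - D = (f (0 + h k) - f 0 - h k *\<^sub>R D) /\<^sub>R h k"
   using h(2)[of k] by (simp add: scaleR_diff_right)
  then show ?thesis by (simp add: divide_inverse mult.commute)
 qed
 ultimately have "(\<lambda>k. norm ((f (h k) - f 0) /\<^sub>R h k - D)) \<longlonglongrightarrow> 0" by simp
 then show ?thesis by (simp add: tendsto_norm_zero_iff LIM_zero_iff)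
qed

text \<open>
 The integral of a derivative vanishes: it is the limit of integrals of difference quotients, and these
 vanish by translation invariance.  No iterated integrals are needed.
\<close>

lemma integral_line_derivative_eq_0:
 fixes f :: "'a::euclidean_space => complex"
 assumes d: "\<And>z t. ((\<lambda>s. f (z + s *\<^sub>R e)) has_vector_derivative f' (z + t *\<^sub>R e)) (at t)"
  and f: "integrable lborel f" and f': "f' \<in> borel_measurable borel"
  and G: "integrable lborel G" "\<And>z s. \<bar>s\<bar> \<le> 1 ==> cmod (f' (z + s *\<^sub>R e)) \<le> G z"
 shows "(LINT z|lborel. f' z) = 0"
proof -
 have [measurable]: "f \<in> borel_measurable borel" using borel_measurable_integrable[OF f] by simp
 define h where "h k = 1 / real (Suc k)" for k
 have h: "h k \<noteq> 0" "\<bar>h k\<bar> \<le> 1" for k by (auto simp: h_def)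
 have h0: "h \<longlonglongrightarrow> 0" using LIMSEQ_inverse_real_of_nat by (simp add: h_def[abs_def] inverse_eq_divide)
 have fs: "integrable lborel (\<lambda>z. f (z + h k *\<^sub>R e))" for k
 proof -
  have "(\<integral>\<^sup>+z. ennreal (cmod (f (z + h k *\<^sub>R e))) \<partial>lborel) = (\<integral>\<^sup>+z. ennreal (cmod (f z)) \<partial>lborel)"
   by (rule nn_integral_lborel_translate) measurable
  then show ?thesis using f by (simp add: integrable_iff_bounded)
 qed
 have "(\<lambda>k. LINT z|lborel. (f (z + h k *\<^sub>R e) - f z) /\<^sub>R h k) \<longlonglongrightarrow> (LINT z|lborel. f' z)"
 proof (rule integral_dominated_convergence[OF _ _ G(1)])
  show "AE z in lborel. (\<lambda>k. (f (z + h k *\<^sub>R e) - f z) /\<^sub>R h k) \<longlonglongrightarrow> f' z"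
  proof (rule AE_I2)
   fix z
   show "(\<lambda>k. (f (z + h k *\<^sub>R e) - f z) /\<^sub>R h k) \<longlonglongrightarrow> f' z"
    using tendsto_difference_quotient[OF d[of z 0] h0 h(1)] by simp
  qed
  show "AE z in lborel. norm ((f (z + h k *\<^sub>R e) - f z) /\<^sub>R h k) \<le> G z" for k
  proof (rule AE_I2)
   fix z
   have "norm (f (z + h k *\<^sub>R e) - f (z + 0 *\<^sub>R e)) \<le> G z * norm (h k - 0)"
   proof (rule differentiable_bound[where S = "{-1..1}" and f = "\<lambda>s. f (z + s *\<^sub>R e)" and f' = "\<lambda>t y. y *\<^sub>R f' (z + t *\<^sub>R e)"])
    show "((\<lambda>s. f (z + s *\<^sub>R e)) has_derivative (\<lambda>y. y *\<^sub>R f' (z + t *\<^sub>R e))) (at t within {-1..1})" for t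
     using d[of z t] by (simp add: has_vector_derivative_def has_derivative_at_withinI)
    show "onorm (\<lambda>y. y *\<^sub>R f' (z + t *\<^sub>R e)) \<le> G z" if "t \<in> {-1..1}" for t
     using that G(2)[of t z]
     by (intro onorm_le) (auto simp: mult.commute[of "G z"] intro!: mult_left_mono)
   qed (use h(2)[of k] in auto)
   then show "norm ((f (z + h k *\<^sub>R e) - f z) /\<^sub>R h k) \<le> G z"
    using h(1)[of k] unfolding norm_scaleR real_norm_def abs_inverse by (simp add: divide_simps mult.commute)
  qed
 qed (use f' in measurable)
 moreover have "(LINT z|lborel. (f (z + h k *\<^sub>R e) - f z) /\<^sub>R h k) = 0" for k
 proof -
  have "(LINT z|lborel. f (z + h k *\<^sub>R e)) = (LINT z|lborel. f z)"
   by (rule lborel_integral_translate) measurable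
  then show ?thesis
   unfolding integral_scaleR_right Bochner_Integration.integral_diff[OF fs f] by simp
 qed
 ultimately have "(\<lambda>k::nat. 0 :: complex) \<longlonglongrightarrow> (LINT z|lborel. f' z)" by (simp only:)
 then show ?thesis by (simp add: LIMSEQ_const_iff)
qed

lemma fourier_integral_line_derivative:
 fixes f :: "real^'n::finite => complex"
 assumes d: "\<And>z t. ((\<lambda>s. f (z + s *\<^sub>R axis k 1)) has_vector_derivative f' (z + t *\<^sub>R axis k 1)) (at t)"
  and f: "integrable lborel f" and f': "integrable lborel f'"
  and G: "integrable lborel G" "\<And>z s. \<bar>s\<bar> \<le> 1 ==> cmod (f' (z + s *\<^sub>R axis k 1)) \<le> G z"
   "\<And>z s. \<bar>s\<bar> \<le> 1 ==> cmod (f (z + s *\<^sub>R axis k 1)) \<le> G z"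
 shows "fourier_integral \<alpha> f' \<xi> = \<i> * of_real (\<alpha> * \<xi> $ k) * fourier_integral \<alpha> f \<xi>"
proof -
 define F where "F x = cis (- (\<alpha> * (x \<bullet> \<xi>))) * f x" for x
 define F' where "F' x = cis (- (\<alpha> * (x \<bullet> \<xi>))) * f' x - (\<i> * of_real (\<alpha> * \<xi> $ k)) * (cis (- (\<alpha> * (x \<bullet> \<xi>))) * f x)" for x
 have i1: "integrable lborel (\<lambda>x. cis (- (\<alpha> * (x \<bullet> \<xi>))) * f' x)" and i2: "integrable lborel (\<lambda>x. cis (- (\<alpha> * (x \<bullet> \<xi>))) * f x)"
  by (rule integrable_cis_mult(1)[OF f'], rule integrable_cis_mult(1)[OF f])
 have i3: "integrable lborel (\<lambda>x. (\<i> * of_real (\<alpha> * \<xi> $ k)) * (cis (- (\<alpha> * (x \<bullet> \<xi>))) * f x))"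
  by (rule integrable_mult_right[OF i2])
 have F'i: "integrable lborel F'"
  unfolding F'_def[abs_def] by (rule Bochner_Integration.integrable_diff[OF i1 i3])
 have "(LINT x|lborel. F' x) = 0"
 proof (rule integral_line_derivative_eq_0[where f = F and e = "axis k 1" and G = "\<lambda>z. (1 + \<bar>\<alpha> * \<xi> $ k\<bar>) * G z"])
  fix z t
  have ax: "axis k 1 \<bullet> \<xi> = \<xi> $ k" by (simp add: inner_axis')
  have "((\<lambda>s. cis (- (\<alpha> * ((z + s *\<^sub>R axis k 1) \<bullet> \<xi>)))) has_vector_derivative
    (- (\<alpha> * \<xi> $ k)) *\<^sub>R (\<i> * cis (- (\<alpha> * ((z + t *\<^sub>R axis k 1) \<bullet> \<xi>))))) (at t)"
  proof -
   have "((\<lambda>s. - (\<alpha> * (z \<bullet> \<xi> + s * \<xi> $ k))) has_real_derivative - (\<alpha> * \<xi> $ k)) (at t)"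
    by (auto intro!: derivative_eq_intros)
   moreover have "(cis has_vector_derivative \<i> * cis y) (at y)" for y
    unfolding cis_conv_exp using has_vector_derivative_iexp[of y UNIV] by (simp add: mult.commute)
   ultimately have "((cis \<circ> (\<lambda>s. - (\<alpha> * (z \<bullet> \<xi> + s * \<xi> $ k)))) has_vector_derivative (- (\<alpha> * \<xi> $ k)) *\<^sub>R (\<i> * cis (- (\<alpha> * (z \<bullet> \<xi> + t * \<xi> $ k))))) (at t)"
    by (intro vector_diff_chain_at) (auto simp: has_real_derivative_iff_has_vector_derivative)
   then show ?thesis by (simp add: o_def inner_add_left ax)
  qed
  from has_vector_derivative_mult[OF this d[of z t]]
  show "((\<lambda>s. F (z + s *\<^sub>R axis k 1)) has_vector_derivative F' (z + t *\<^sub>R axis k 1)) (at t)"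
   unfolding F_def F'_def by (simp add: scaleR_conv_of_real mult_ac)
 next
  show "integrable lborel F" unfolding F_def[abs_def] by (rule i2)
  show "F' \<in> borel_measurable borel" using borel_measurable_integrable[OF F'i] by simp
  show "integrable lborel (\<lambda>z. (1 + \<bar>\<alpha> * \<xi> $ k\<bar>) * G z)" by (rule integrable_mult_right[OF G(1)])
  fix z and s :: real assume s: "\<bar>s\<bar> \<le> 1"
  have "cmod (F' (z + s *\<^sub>R axis k 1)) \<le> cmod (f' (z + s *\<^sub>R axis k 1)) + \<bar>\<alpha> * \<xi> $ k\<bar> * cmod (f (z + s *\<^sub>R axis k 1))"
   unfolding F'_def by (rule order_trans[OF norm_triangle_ineq4]) (simp add: norm_mult abs_mult)
  also have "... \<le> G z + \<bar>\<alpha> * \<xi> $ k\<bar> * G z"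
   by (intro add_mono mult_left_mono G(2,3) s) simp
  finally show "cmod (F' (z + s *\<^sub>R axis k 1)) \<le> (1 + \<bar>\<alpha> * \<xi> $ k\<bar>) * G z" by (simp add: distrib_right)
 qed
 moreover have "(LINT x|lborel. F' x) = fourier_integral \<alpha> f' \<xi> - \<i> * of_real (\<alpha> * \<xi> $ k) * fourier_integral \<alpha> f \<xi>"
  unfolding F'_def Bochner_Integration.integral_diff[OF i1 i3] integral_mult_right_zero fourier_integral_def ..
 ultimately show ?thesis by simp
qed

lemma schwartz_local_domination:
 fixes f :: "real^'n::finite => complex"
 assumes "schwartz f"
 obtains G where "integrable lborel G" "\<And>z s. \<bar>s\<bar> \<le> 1 ==> cmod (f (z + s *\<^sub>R axis k 1)) \<le> G z"
proof -
 let ?N = "2 * CARD('n)"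
 obtain C where C: "C \<ge> 0" "\<And>x. cmod (f x) * (1 + norm x) ^ ?N \<le> C"
  using schwartz_decay[OF assms] by blast
 have "cmod (f (z + s *\<^sub>R axis k 1)) \<le> (C * 2 ^ ?N) * (1 / (1 + norm z) ^ ?N)" if s: "\<bar>s\<bar> \<le> 1" for z s
 proof -
  let ?x = "z + s *\<^sub>R axis k 1"
  have "norm z \<le> norm ?x + norm (s *\<^sub>R axis k (1::real))"
   using norm_triangle_ineq4[of ?x "s *\<^sub>R axis k (1::real)"] by simp
  then have "1 + norm z \<le> 2 * (1 + norm ?x)" using s norm_ge_zero[of ?x] by (simp del: norm_ge_zero)
  then have "(1 + norm z) ^ ?N \<le> (2 * (1 + norm ?x)) ^ ?N" by (intro power_mono) auto
  then have "cmod (f ?x) * (1 + norm z) ^ ?N \<le> cmod (f ?x) * (2 ^ ?N * (1 + norm ?x) ^ ?N)"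
   unfolding power_mult_distrib by (rule mult_left_mono) simp
  also have "... \<le> C * 2 ^ ?N" using mult_left_mono[OF C(2)[of ?x], of "2 ^ ?N"] by (simp add: mult_ac)
  finally have "cmod (f ?x) * (1 + norm z) ^ ?N \<le> C * 2 ^ ?N" .
  moreover have "(1 + norm z) ^ ?N > 0" by (intro zero_less_power) (auto intro: add_pos_nonneg)
  ultimately show ?thesis by (simp add: pos_le_divide_eq)
 qed
 moreover have "integrable lborel (\<lambda>z::real^'n. (C * 2 ^ ?N) * (1 / (1 + norm z) ^ ?N))"
  by (intro integrable_mult_right integrable_polynomial_decay)
 ultimately show ?thesis using that by blast
qed

lemma schwartz_fourier_derivative:
 assumes f: "schwartz f"
 shows "fourier_integral \<alpha> (partial_deriv [k] f) \<xi> = \<i> * of_real (\<alpha> * \<xi> $ k) * fourier_integral \<alpha> f \<xi>"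
proof -
 note f' = schwartz_partial_deriv[OF f, of "[k]"]
 obtain G where G: "integrable lborel G" "\<And>z s. \<bar>s\<bar> \<le> 1 ==> cmod (f (z + s *\<^sub>R axis k 1)) \<le> G z"
  using schwartz_local_domination[OF f] by metis
 obtain G' where G': "integrable lborel G'" "\<And>z s. \<bar>s\<bar> \<le> 1 ==> cmod (partial_deriv [k] f (z + s *\<^sub>R axis k 1)) \<le> G' z"
  using schwartz_local_domination[OF f'] by metis
 have n: "0 \<le> G z" "0 \<le> G' z" for z
  using G(2)[of 0 z] G'(2)[of 0 z] by (auto intro: order_trans[OF norm_ge_zero])
 show ?thesis
 proof (rule fourier_integral_line_derivative[where G = "\<lambda>z. G z + G' z"])
  show "((\<lambda>s. f (z + s *\<^sub>R axis k 1)) has_vector_derivative partial_deriv [k] f (z + t *\<^sub>R axis k 1)) (at t)" for z t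
   by (rule schwartz_line_derivative[OF f])
  show "cmod (partial_deriv [k] f (z + s *\<^sub>R axis k 1)) \<le> G z + G' z" if "\<bar>s\<bar> \<le> 1" for z s
   using G'(2)[OF that, of z] n(1)[of z] by linarith
  show "cmod (f (z + s *\<^sub>R axis k 1)) \<le> G z + G' z" if "\<bar>s\<bar> \<le> 1" for z s
   using G(2)[OF that, of z] n(2)[of z] by linarith
 qed (intro schwartz_integrable f f' Bochner_Integration.integrable_add G(1) G'(1))+
qed

lemma schwartz_fourier_power:
 assumes f: "schwartz f"
 shows "fourier_integral \<alpha> (partial_deriv (replicate N k) f) \<xi> = (\<i> * of_real (\<alpha> * \<xi> $ k)) ^ N * fourier_integral \<alpha> f \<xi>"
proof (induction N)
 case 0
 then show ?case by (simp add: partial_deriv_def)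
next
 case (Suc N)
 have "partial_deriv (replicate (Suc N) k) f = partial_deriv [k] (partial_deriv (replicate N k) f)"
  by (simp add: partial_deriv_def)
 then show ?case
  using schwartz_fourier_derivative[OF schwartz_partial_deriv[OF f], of \<alpha> k "replicate N k" \<xi>] Suc by (simp add: mult.assoc)
qed

lemma norm_power_le_sum_coordinates:
 fixes y :: "real^'n::finite"
 shows "norm y ^ N \<le> real CARD('n) ^ N * (\<Sum>k\<in>UNIV. \<bar>y $ k\<bar> ^ N)"
proof -
 obtain j where j: "\<And>k. \<bar>y $ k\<bar> \<le> \<bar>y $ j\<bar>"
 proof -
  have "finite (range (\<lambda>k. \<bar>y $ k\<bar>))" by simp
  then have "Max (range (\<lambda>k. \<bar>y $ k\<bar>)) \<in> range (\<lambda>k. \<bar>y $ k\<bar>)" by (rule Max_in) simp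
  then obtain j where "Max (range (\<lambda>k. \<bar>y $ k\<bar>)) = \<bar>y $ j\<bar>" by blast
  with Max_ge[OF \<open>finite (range (\<lambda>k. \<bar>y $ k\<bar>))\<close>] show ?thesis using that[of j] by auto
 qed
 have "norm y \<le> (\<Sum>k\<in>UNIV. \<bar>y $ k\<bar>)" by (rule norm_le_l1_cart)
 also have "... \<le> (\<Sum>k\<in>(UNIV::'n set). \<bar>y $ j\<bar>)" by (rule sum_mono) (rule j)
 finally have "norm y \<le> real CARD('n) * \<bar>y $ j\<bar>" by simp
 then have "norm y ^ N \<le> (real CARD('n) * \<bar>y $ j\<bar>) ^ N" by (rule power_mono) simp
 also have "... = real CARD('n) ^ N * \<bar>y $ j\<bar> ^ N" by (rule power_mult_distrib)
 also have "... \<le> real CARD('n) ^ N * (\<Sum>k\<in>UNIV. \<bar>y $ k\<bar> ^ N)"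
  by (intro mult_left_mono member_le_sum) auto
 finally show ?thesis .
qed

lemma schwartz_fourier_integrable:
 fixes f :: "real^'n::finite => complex"
 assumes f: "schwartz f" and \<alpha>: "\<alpha> \<noteq> 0"
 shows "integrable lborel (fourier_integral \<alpha> f)"
proof -
 let ?N = "2 * CARD('n)"
 define D where "D k = (LINT x|lborel. cmod (partial_deriv (replicate ?N k) f x))" for k
 define D0 where "D0 = (LINT x|lborel. cmod (f x))"
 have Dk: "\<bar>\<xi> $ k\<bar> ^ ?N * cmod (fourier_integral \<alpha> f \<xi>) \<le> D k / \<bar>\<alpha>\<bar> ^ ?N" for \<xi> k
 proof -
  have "cmod (fourier_integral \<alpha> (partial_deriv (replicate ?N k) f) \<xi>) \<le> D k"
   unfolding D_def by (rule fourier_integral_bound)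
  then have "\<bar>\<alpha> * \<xi> $ k\<bar> ^ ?N * cmod (fourier_integral \<alpha> f \<xi>) \<le> D k"
   unfolding schwartz_fourier_power[OF f] by (simp only: norm_mult norm_power norm_ii norm_of_real mult_1_left)
  then have "\<bar>\<alpha>\<bar> ^ ?N * (\<bar>\<xi> $ k\<bar> ^ ?N * cmod (fourier_integral \<alpha> f \<xi>)) \<le> D k"
   by (simp only: abs_mult power_mult_distrib mult.assoc)
  then show ?thesis using \<alpha> by (subst pos_le_divide_eq) (auto simp: mult.commute)
 qed
 define K where "K = 2 ^ ?N * (D0 + real CARD('n) ^ ?N * (\<Sum>k\<in>UNIV. D k / \<bar>\<alpha>\<bar> ^ ?N))"
 have K: "cmod (fourier_integral \<alpha> f \<xi>) * (1 + norm \<xi>) ^ ?N \<le> K" for \<xi>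
 proof -
  have "(1 + norm \<xi>) ^ ?N \<le> 2 ^ ?N * (1 + norm \<xi> ^ ?N)"
  proof (cases "norm \<xi> \<le> 1")
   case True
   then have "(1 + norm \<xi>) ^ ?N \<le> 2 ^ ?N" by (intro power_mono) auto
   also have "... \<le> 2 ^ ?N * (1 + norm \<xi> ^ ?N)" by simp
   finally show ?thesis .
  next
   case False
   then have "(1 + norm \<xi>) ^ ?N \<le> (2 * norm \<xi>) ^ ?N" by (intro power_mono) auto
   also have "... \<le> 2 ^ ?N * (1 + norm \<xi> ^ ?N)" unfolding power_mult_distrib by simp
   finally show ?thesis .
  qed
  also have "... \<le> 2 ^ ?N * (1 + real CARD('n) ^ ?N * (\<Sum>k\<in>UNIV. \<bar>\<xi> $ k\<bar> ^ ?N))"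
   by (intro mult_left_mono add_left_mono norm_power_le_sum_coordinates) simp
  finally have "cmod (fourier_integral \<alpha> f \<xi>) * (1 + norm \<xi>) ^ ?N
   \<le> cmod (fourier_integral \<alpha> f \<xi>) * (2 ^ ?N * (1 + real CARD('n) ^ ?N * (\<Sum>k\<in>UNIV. \<bar>\<xi> $ k\<bar> ^ ?N)))"
   by (rule mult_left_mono) simp
  also have "... = 2 ^ ?N * (cmod (fourier_integral \<alpha> f \<xi>) + real CARD('n) ^ ?N * (\<Sum>k\<in>UNIV. \<bar>\<xi> $ k\<bar> ^ ?N * cmod (fourier_integral \<alpha> f \<xi>)))"
   unfolding sum_distrib_right[symmetric] by (simp only: distrib_left distrib_right mult_1_right mult_ac)
  also have "... \<le> K"
   unfolding K_def D0_def
   by (intro mult_left_mono add_mono sum_mono Dk fourier_integral_bound) auto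
  finally show ?thesis .
 qed
 have "integrable lborel (\<lambda>x::real^'n. K * (1 / (1 + norm x) ^ ?N))"
  by (intro integrable_mult_right integrable_polynomial_decay)
 then show ?thesis
 proof (rule Bochner_Integration.integrable_bound)
  show "fourier_integral \<alpha> f \<in> borel_measurable lborel"
   using fourier_integral_measurable[OF schwartz_integrable[OF f]] by simp
  show "AE x in lborel. norm (fourier_integral \<alpha> f x) \<le> norm (K * (1 / (1 + norm x) ^ ?N))"
  proof (rule AE_I2)
   fix x :: "real^'n"
   have "(1 + norm x) ^ ?N > 0" by (intro zero_less_power) (auto intro: add_pos_nonneg)
   then have "cmod (fourier_integral \<alpha> f x) \<le> K / (1 + norm x) ^ ?N"
    using K[of x] by (simp add: pos_le_divide_eq)
   then show "norm (fourier_integral \<alpha> f x) \<le> norm (K * (1 / (1 + norm x) ^ ?N))"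
    using abs_ge_self[of "K * (1 / (1 + norm x) ^ ?N)"] by simp
  qed
 qed
qed

section \<open>Pseudodifferential operators with compactly supported symbols\<close>

definition symbol_kernel :: "real => ((real^'n::finite) \<times> (real^'n) => complex) => (real^'n) \<times> (real^'n) => complex" where
 "symbol_kernel \<alpha> a = (\<lambda>(x, \<xi>). of_real (sqrt (\<bar>\<alpha>\<bar> / (2 * pi)) ^ CARD('n)) * (cis (\<alpha> * (x \<bullet> \<xi>)) * a (x, \<xi>)))"

text \<open>
 The right quantization is built as an adjoint.  A compactly supported symbol gives a Hilbert-Schmidt kernel in the variables \<open>(x, \<xi>)\<close>,
 so that both quantizations are compositions of a kernel operator with the Fourier transform and boundedness is evident.
\<close>

definition left_pdo :: "real => ((real^'n::finite) \<times> (real^'n) => complex) => (real^'n) L2_op" where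
 "left_pdo \<alpha> a = kernel_op (symbol_kernel \<alpha> a) o\<^sub>L FT \<alpha>"

definition right_pdo :: "real => ((real^'n::finite) \<times> (real^'n) => complex) => (real^'n) L2_op" where
 "right_pdo \<alpha> a = FT (- \<alpha>) o\<^sub>L kernel_op (adjoint_kernel (symbol_kernel \<alpha> (\<lambda>z. cnj (a z))))"

lemma bounded_kernel_cnj: "bounded_kernel a ==> bounded_kernel (\<lambda>z. cnj (a z))"
 unfolding bounded_kernel_def by (auto intro: cnj_measurable)

lemma bounded_kernel_symbol_kernel:
 fixes a :: "(real^'n::finite) \<times> (real^'n) => complex"
 assumes "bounded_kernel a"
 shows "bounded_kernel (symbol_kernel \<alpha> a)"
proof -
 obtain B R where [measurable]: "a \<in> borel_measurable borel"
  and a: "\<And>x y. cmod (a (x, y)) \<le> B * indicator (ball 0 R) x * indicator (ball 0 R) y"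
  using bounded_kernelE[OF assms] by metis
 let ?c = "sqrt (\<bar>\<alpha>\<bar> / (2 * pi)) ^ CARD('n)"
 have "symbol_kernel \<alpha> a = (\<lambda>p. of_real ?c * (cis (\<alpha> * (fst p \<bullet> snd p)) * a p))"
  by (auto simp: symbol_kernel_def)
 then have "symbol_kernel \<alpha> a \<in> borel_measurable borel"
  using cis_phase_measurable(2)[of \<alpha>] by simp
 moreover have "cmod (symbol_kernel \<alpha> a (x, y)) \<le> (?c * B) * indicator (ball 0 R) x * indicator (ball 0 R) y" for x y
 proof -
  have "cmod (symbol_kernel \<alpha> a (x, y)) = ?c * cmod (a (x, y))"
   by (simp add: symbol_kernel_def norm_mult norm_power)
  also have "... \<le> ?c * (B * indicator (ball 0 R) x * indicator (ball 0 R) y)"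
   by (intro mult_left_mono a) simp
  finally show ?thesis by (simp only: mult.assoc)
 qed
 ultimately show ?thesis unfolding bounded_kernel_def by blast
qed

lemma is_adjoint_left_right:
 assumes "bounded_kernel a" "\<alpha> \<noteq> 0"
 shows "is_adjoint (left_pdo \<alpha> (\<lambda>z. cnj (a z))) (right_pdo \<alpha> a)"
 unfolding left_pdo_def right_pdo_def
 by (intro is_adjoint_compose is_adjoint_kernel_op is_adjoint_FT bounded_kernel_symbol_kernel bounded_kernel_cnj assms)

lemma Op_eqI:
 fixes T :: "(real^'n::finite) L2_op"
 assumes T: "\<And>u. schwartz u ==> AE x in lborel. rep_L2 (blinfun_apply T (abs_L2 u)) x = Op_fun \<alpha> t a u x"
 shows "Op \<alpha> t a = T"
 unfolding Op_def
proof (rule the_equality)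
 show "\<forall>u. schwartz u \<longrightarrow> (AE x in lborel. rep_L2 (blinfun_apply T (abs_L2 u)) x = Op_fun \<alpha> t a u x)"
  using T by blast
next
 fix S :: "(real^'n) L2_op"
 assume S: "\<forall>u. schwartz u \<longrightarrow> (AE x in lborel. rep_L2 (blinfun_apply S (abs_L2 u)) x = Op_fun \<alpha> t a u x)"
 show "S = T"
 proof (rule blinfun_eqI)
  fix v :: "(real^'n) L2"
  define V where "V = {v. blinfun_apply S v = blinfun_apply T v}"
  have "v \<in> V"
  proof (rule schwartz_dense)
   show "subspace V"
    by (auto simp: subspace_def V_def blinfun.add_right blinfun.scaleR_right blinfun.zero_right)
   show "closed V"
    unfolding V_def by (intro closed_Collect_eq linear_continuous_on blinfun.bounded_linear_right)
   fix u :: "real^'n => complex" assume u: "schwartz u"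
   have "AE x in lborel. rep_L2 (blinfun_apply S (abs_L2 u)) x = Op_fun \<alpha> t a u x" using S u by blast
   then have "AE x in lborel. rep_L2 (blinfun_apply S (abs_L2 u)) x = rep_L2 (blinfun_apply T (abs_L2 u)) x"
    using T[OF u] by eventually_elim simp
   then show "abs_L2 u \<in> V" unfolding V_def by (simp add: L2_eqI)
  qed
  then show "blinfun_apply S v = blinfun_apply T v" by (simp add: V_def)
 qed
qed

lemma fourier_const_sq:
 assumes "\<alpha> > 0"
 shows "complex_of_real (sqrt (\<bar>\<alpha>\<bar> / (2 * pi)) ^ N) * of_real (sqrt (\<bar>\<alpha>\<bar> / (2 * pi)) ^ N) = of_real ((\<alpha> / (2 * pi)) ^ N)"
 using assms unfolding of_real_mult[symmetric] power_mult_distrib[symmetric] by simp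

lemma Op_left:
 fixes a :: "(real^'n::finite) \<times> (real^'n) => complex"
 assumes a: "bounded_kernel a" and \<alpha>: "\<alpha> > 0"
 shows "Op \<alpha> 0 a = left_pdo \<alpha> a"
proof (rule Op_eqI)
 fix u :: "real^'n => complex" assume u: "schwartz u"
 have \<alpha>0: "\<alpha> \<noteq> 0" using \<alpha> by simp
 note k = bounded_kernel_symbol_kernel[OF a, of \<alpha>]
 let ?c = "complex_of_real (sqrt (\<bar>\<alpha>\<bar> / (2 * pi)) ^ CARD('n))"
 have val: "cinner (abs_L2 (fourier_fun \<alpha> u)) (abs_L2 (\<lambda>\<xi>. cnj (symbol_kernel \<alpha> a (x, \<xi>)))) = Op_fun \<alpha> 0 a u x" for x
 proof -
  have inner: "cis (\<alpha> * (x \<bullet> \<xi>)) * a (x, \<xi>) * fourier_integral \<alpha> u \<xi>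
    = (LINT y|lborel. cis (\<alpha> * ((x - y) \<bullet> \<xi>)) * a ((1 - 0) *\<^sub>R x + 0 *\<^sub>R y, \<xi>) * u y)" for \<xi>
  proof -
   have "cis (\<alpha> * ((x - y) \<bullet> \<xi>)) = cis (\<alpha> * (x \<bullet> \<xi>)) * cis (- (\<alpha> * (y \<bullet> \<xi>)))" for y
    by (simp add: cis_mult inner_diff_left right_diff_distrib)
   then show ?thesis
    unfolding fourier_integral_def integral_mult_right_zero[symmetric] by (simp add: mult_ac)
  qed
  have "cinner (abs_L2 (fourier_fun \<alpha> u)) (abs_L2 (\<lambda>\<xi>. cnj (symbol_kernel \<alpha> a (x, \<xi>))))
    = (LINT \<xi>|lborel. fourier_fun \<alpha> u \<xi> * symbol_kernel \<alpha> a (x, \<xi>))"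
   by (subst cinner_abs[OF fourier_fun_square_integrable(1)[OF L12_schwartz[OF u] \<alpha>0] bounded_kernel_row(2)[OF k]]) simp
  also have "... = (LINT \<xi>|lborel. (?c * ?c) * (cis (\<alpha> * (x \<bullet> \<xi>)) * a (x, \<xi>) * fourier_integral \<alpha> u \<xi>))"
   by (simp add: fourier_fun_def symbol_kernel_def mult_ac)
  also have "... = of_real ((\<alpha> / (2 * pi)) ^ CARD('n)) * (LINT \<xi>|lborel. cis (\<alpha> * (x \<bullet> \<xi>)) * a (x, \<xi>) * fourier_integral \<alpha> u \<xi>)"
   unfolding fourier_const_sq[OF \<alpha>] by (rule integral_mult_right_zero)
  finally show ?thesis by (simp only: Op_fun_def inner)
 qed
 have "blinfun_apply (left_pdo \<alpha> a) (abs_L2 u) = blinfun_apply (kernel_op (symbol_kernel \<alpha> a)) (abs_L2 (fourier_fun \<alpha> u))"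
  by (simp add: left_pdo_def FT_abs[OF L12_schwartz[OF u] \<alpha>0])
 then show "AE x in lborel. rep_L2 (blinfun_apply (left_pdo \<alpha> a) (abs_L2 u)) x = Op_fun \<alpha> 0 a u x"
  using AE_rep_kernel_op[OF k, of "abs_L2 (fourier_fun \<alpha> u)"] by (simp add: val)
qed

lemma L12_supported:
 fixes f :: "real^'n::finite => complex"
 assumes f: "square_integrable f" and "\<And>x. x \<notin> ball 0 R ==> f x = 0"
 shows "L12 f"
proof -
 have "f x * cnj (of_real 1 * indicator (ball 0 R) x) = f x" for x
  using assms(2)[of x] by (cases "x \<in> ball 0 R") auto
 then have "integrable lborel f"
  using square_integrable_mult_cnj[OF f square_integrable_ball[of 1 R]] by (simp only:)
 then show ?thesis using f by (simp add: L12_def)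
qed

lemma Op_right:
 fixes a :: "(real^'n::finite) \<times> (real^'n) => complex"
 assumes a: "bounded_kernel a" and \<alpha>: "\<alpha> > 0"
 shows "Op \<alpha> 1 a = right_pdo \<alpha> a"
proof (rule Op_eqI)
 fix u :: "real^'n => complex" assume u: "schwartz u"
 have \<alpha>0: "- \<alpha> \<noteq> 0" using \<alpha> by simp
 let ?c = "complex_of_real (sqrt (\<bar>\<alpha>\<bar> / (2 * pi)) ^ CARD('n))"
 define k where "k = adjoint_kernel (symbol_kernel \<alpha> (\<lambda>z. cnj (a z)))"
 have k: "bounded_kernel k"
  unfolding k_def by (intro bounded_kernel_adjoint bounded_kernel_symbol_kernel bounded_kernel_cnj a)
 have k_eq: "k (\<xi>, y) = ?c * (cis (- (\<alpha> * (y \<bullet> \<xi>))) * a (y, \<xi>))" for \<xi> y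
  by (simp add: k_def adjoint_kernel_def symbol_kernel_def cis_cnj)
 define g where "g \<xi> = (LINT y|lborel. k (\<xi>, y) * rep_L2 (abs_L2 u) y)" for \<xi>
 have g: "g \<xi> = ?c * (LINT y|lborel. cis (- (\<alpha> * (y \<bullet> \<xi>))) * a (y, \<xi>) * u y)" for \<xi>
 proof -
  have "g \<xi> = (LINT y|lborel. k (\<xi>, y) * u y)"
   unfolding g_def
  proof (rule integral_cong_AE)
   have "(\<lambda>y. k (\<xi>, y)) \<in> borel_measurable borel"
    by (rule square_integrable_measurable[OF bounded_kernel_row(1)[OF k]])
   then show "(\<lambda>y. k (\<xi>, y) * rep_L2 (abs_L2 u) y) \<in> borel_measurable lborel"
    "(\<lambda>y. k (\<xi>, y) * u y) \<in> borel_measurable lborel"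
    using schwartz_measurable[OF u] by simp_all
   show "AE y in lborel. k (\<xi>, y) * rep_L2 (abs_L2 u) y = k (\<xi>, y) * u y"
    using AE_rep_abs[OF schwartz_square_integrable[OF u]] by eventually_elim simp
  qed
  then show ?thesis unfolding k_eq by (simp only: mult.assoc integral_mult_right_zero)
 qed
 obtain B R where B: "\<And>x y. cmod (k (x, y)) \<le> B * indicator (ball 0 R) x * indicator (ball 0 R) y"
  using bounded_kernelE[OF k] by metis
 have gL: "L12 g"
 proof (rule L12_supported)
  show "square_integrable g" unfolding g_def[abs_def] by (rule square_integrable_kernel_integral(1)[OF k])
  fix x :: "real^'n" assume "x \<notin> ball 0 R"
  then have "k (x, y) = 0" for y using B[of x y] by simp
  then show "g x = 0" by (simp add: g_def)
 qed
 have val: "fourier_fun (- \<alpha>) g x = Op_fun \<alpha> 1 a u x" for x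
 proof -
  have inner: "cis (\<alpha> * (x \<bullet> \<xi>)) * (LINT y|lborel. cis (- (\<alpha> * (y \<bullet> \<xi>))) * a (y, \<xi>) * u y)
    = (LINT y|lborel. cis (\<alpha> * ((x - y) \<bullet> \<xi>)) * a ((1 - 1) *\<^sub>R x + 1 *\<^sub>R y, \<xi>) * u y)" for \<xi>
  proof -
   have "cis (\<alpha> * ((x - y) \<bullet> \<xi>)) = cis (\<alpha> * (x \<bullet> \<xi>)) * cis (- (\<alpha> * (y \<bullet> \<xi>)))" for y
    by (simp add: cis_mult inner_diff_left right_diff_distrib)
   then show ?thesis
    unfolding integral_mult_right_zero[symmetric] by (simp add: mult_ac)
  qed
  have "fourier_fun (- \<alpha>) g x = ?c * (LINT \<xi>|lborel. ?c * (cis (\<alpha> * (x \<bullet> \<xi>)) * (LINT y|lborel. cis (- (\<alpha> * (y \<bullet> \<xi>))) * a (y, \<xi>) * u y)))"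
   unfolding fourier_fun_def fourier_integral_def g by (simp add: inner_commute mult.left_commute)
  also have "... = of_real ((\<alpha> / (2 * pi)) ^ CARD('n)) * (LINT \<xi>|lborel. cis (\<alpha> * (x \<bullet> \<xi>)) * (LINT y|lborel. cis (- (\<alpha> * (y \<bullet> \<xi>))) * a (y, \<xi>) * u y))"
   unfolding integral_mult_right_zero fourier_const_sq[OF \<alpha>, symmetric] by (simp only: mult.assoc)
  finally show ?thesis by (simp only: Op_fun_def inner)
 qed
 have "blinfun_apply (right_pdo \<alpha> a) (abs_L2 u) = blinfun_apply (FT (- \<alpha>)) (abs_L2 g)"
  unfolding right_pdo_def k_def[symmetric] g_def[abs_def] by (simp add: kernel_op_apply[OF k])
 then show "AE x in lborel. rep_L2 (blinfun_apply (right_pdo \<alpha> a) (abs_L2 u)) x = Op_fun \<alpha> 1 a u x"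
  using AE_rep_FT_abs[OF gL \<alpha>0] by (simp add: val)
qed

lemma P_op_eq:
 fixes \<Omega> :: "(real^'n::finite) set"
 assumes \<Omega>: "\<Omega> \<in> sets borel" and \<alpha>: "\<alpha> > 0"
 shows "P_op \<Omega> \<alpha> = FT (- \<alpha>) o\<^sub>L chi_op \<Omega> o\<^sub>L FT \<alpha>"
 unfolding P_op_def
proof (rule Op_eqI)
 fix u :: "real^'n => complex" assume u: "schwartz u"
 have \<alpha>0: "\<alpha> \<noteq> 0" "- \<alpha> \<noteq> 0" using \<alpha> by auto
 let ?c = "complex_of_real (sqrt (\<bar>\<alpha>\<bar> / (2 * pi)) ^ CARD('n))"
 note Fs = fourier_fun_square_integrable(1)[OF L12_schwartz[OF u] \<alpha>0(1)]
 define g where "g \<xi> = indicator \<Omega> \<xi> * fourier_fun \<alpha> u \<xi>" for \<xi>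
 have gs: "square_integrable g"
  unfolding g_def[abs_def] by (intro square_integrable_indicator \<Omega> Fs)
 have "integrable lborel g"
 proof (rule Bochner_Integration.integrable_bound)
  show "integrable lborel (fourier_fun \<alpha> u)"
   unfolding fourier_fun_def[abs_def] by (intro integrable_mult_right schwartz_fourier_integrable u \<alpha>0)
  show "g \<in> borel_measurable lborel" using square_integrable_measurable[OF gs] by simp
 qed (auto simp: g_def indicator_def)
 then have gL: "L12 g" using gs by (simp add: L12_def)
 have val: "fourier_fun (- \<alpha>) g x = Op_fun \<alpha> 0 (\<lambda>(x, \<xi>). indicator \<Omega> \<xi>) u x" for x
 proof -
  have inner: "cis (\<alpha> * (x \<bullet> \<xi>)) * indicator \<Omega> \<xi> * fourier_integral \<alpha> u \<xi>
    = (LINT y|lborel. cis (\<alpha> * ((x - y) \<bullet> \<xi>)) * (\<lambda>(x, \<xi>). indicator \<Omega> \<xi>) ((1 - 0) *\<^sub>R x + 0 *\<^sub>R y, \<xi>) * u y)" for \<xi>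
  proof -
   have "cis (\<alpha> * ((x - y) \<bullet> \<xi>)) = cis (\<alpha> * (x \<bullet> \<xi>)) * cis (- (\<alpha> * (y \<bullet> \<xi>)))" for y
    by (simp add: cis_mult inner_diff_left right_diff_distrib)
   then show ?thesis
    unfolding fourier_integral_def integral_mult_right_zero[symmetric] by (simp add: mult_ac)
  qed
  have "fourier_fun (- \<alpha>) g x = ?c * (LINT \<xi>|lborel. ?c * (cis (\<alpha> * (x \<bullet> \<xi>)) * indicator \<Omega> \<xi> * fourier_integral \<alpha> u \<xi>))"
   unfolding fourier_fun_def fourier_integral_def[of "- \<alpha>"] g_def by (simp add: inner_commute mult_ac)
  also have "... = of_real ((\<alpha> / (2 * pi)) ^ CARD('n)) * (LINT \<xi>|lborel. cis (\<alpha> * (x \<bullet> \<xi>)) * indicator \<Omega> \<xi> * fourier_integral \<alpha> u \<xi>)"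
   unfolding integral_mult_right_zero fourier_const_sq[OF \<alpha>, symmetric] by (simp only: mult.assoc)
  finally show ?thesis by (simp only: Op_fun_def inner)
 qed
 have "blinfun_apply (chi_op \<Omega>) (abs_L2 (fourier_fun \<alpha> u)) = abs_L2 g"
 proof (rule L2_eqI)
  show "AE x in lborel. rep_L2 (blinfun_apply (chi_op \<Omega>) (abs_L2 (fourier_fun \<alpha> u))) x = rep_L2 (abs_L2 g) x"
   using AE_rep_chi_op[OF \<Omega>, of "abs_L2 (fourier_fun \<alpha> u)"] AE_rep_abs[OF Fs] AE_rep_abs[OF gs]
   by eventually_elim (simp add: g_def)
 qed
 then have "blinfun_apply (FT (- \<alpha>) o\<^sub>L chi_op \<Omega> o\<^sub>L FT \<alpha>) (abs_L2 u) = blinfun_apply (FT (- \<alpha>)) (abs_L2 g)"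
  by (simp add: FT_abs[OF L12_schwartz[OF u] \<alpha>0(1)])
 then show "AE x in lborel. rep_L2 (blinfun_apply (FT (- \<alpha>) o\<^sub>L chi_op \<Omega> o\<^sub>L FT \<alpha>) (abs_L2 u)) x = Op_fun \<alpha> 0 (\<lambda>(x, \<xi>). indicator \<Omega> \<xi>) u x"
  using AE_rep_FT_abs[OF gL \<alpha>0(2)] by (simp add: val)
qed

text \<open>
 Conjugation by the Fourier transform interchanges the two variables of the symbol and turns
 left into right quantization; this is what reduces the second estimate of the theorem to the first.
\<close>

lemma blinfun_compose_assoc': "(A o\<^sub>L B) o\<^sub>L C = A o\<^sub>L (B o\<^sub>L C)"
 by (rule blinfun_eqI) simp

lemma FT_conj_left:
 assumes "\<alpha> \<noteq> 0"
 shows "FT \<alpha> o\<^sub>L left_pdo \<alpha> a o\<^sub>L FT (- \<alpha>) = right_pdo (- \<alpha>) (\<lambda>z. a (prod.swap z))"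
proof -
 have "symbol_kernel \<alpha> a = adjoint_kernel (symbol_kernel (- \<alpha>) (\<lambda>z. cnj (a (prod.swap z))))"
  by (auto simp: symbol_kernel_def adjoint_kernel_def cis_cnj inner_commute)
 then show ?thesis
  unfolding left_pdo_def right_pdo_def blinfun_compose_assoc' FT_unitary'[OF assms] by (intro blinfun_eqI) simp
qed

lemma FT_conj_right:
 assumes "\<alpha> \<noteq> 0"
 shows "FT \<alpha> o\<^sub>L right_pdo \<alpha> a o\<^sub>L FT (- \<alpha>) = left_pdo (- \<alpha>) (\<lambda>z. a (prod.swap z))"
proof -
 have "adjoint_kernel (symbol_kernel \<alpha> (\<lambda>z. cnj (a z))) = symbol_kernel (- \<alpha>) (\<lambda>z. a (prod.swap z))"
  by (auto simp: symbol_kernel_def adjoint_kernel_def cis_cnj inner_commute)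
 moreover have "FT \<alpha> o\<^sub>L (FT (- \<alpha>) o\<^sub>L K) o\<^sub>L FT (- \<alpha>) = K o\<^sub>L FT (- \<alpha>)" for K :: "(real^'a) L2_op"
  unfolding blinfun_compose_assoc'[symmetric] FT_unitary'[OF assms] by (rule blinfun_eqI) simp
 ultimately show ?thesis
  unfolding left_pdo_def right_pdo_def by simp
qed

lemma P_op_sandwich:
 fixes \<Omega> :: "(real^'n::finite) set"
 assumes \<Omega>: "\<Omega> \<in> sets borel" and \<alpha>: "\<alpha> > 0"
 shows "P_op \<Omega> \<alpha> o\<^sub>L T o\<^sub>L (id_blinfun - P_op \<Omega> \<alpha>)
  = FT (- \<alpha>) o\<^sub>L (chi_op \<Omega> o\<^sub>L (FT \<alpha> o\<^sub>L T o\<^sub>L FT (- \<alpha>)) o\<^sub>L chi_op (- \<Omega>)) o\<^sub>L FT \<alpha>"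
proof (rule blinfun_eqI)
 fix u :: "(real^'n) L2"
 have "\<alpha> \<noteq> 0" using \<alpha> by simp
 then have inv: "blinfun_apply (FT (- \<alpha>)) (blinfun_apply (FT \<alpha>) v) = v" for v :: "(real^'n) L2"
  using arg_cong[OF FT_unitary, of \<alpha> "\<lambda>A. blinfun_apply A v"] by simp
 have "blinfun_apply (chi_op (- \<Omega>)) w = w - blinfun_apply (chi_op \<Omega>) w" for w
  using id_minus_chi_op[OF \<Omega>] by (metis blinfun.diff_left blinfun_apply_id_blinfun)
 then show "blinfun_apply (P_op \<Omega> \<alpha> o\<^sub>L T o\<^sub>L (id_blinfun - P_op \<Omega> \<alpha>)) u
   = blinfun_apply (FT (- \<alpha>) o\<^sub>L (chi_op \<Omega> o\<^sub>L (FT \<alpha> o\<^sub>L T o\<^sub>L FT (- \<alpha>)) o\<^sub>L chi_op (- \<Omega>)) o\<^sub>L FT \<alpha>) u"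
  unfolding P_op_eq[OF \<Omega> \<alpha>] by (simp add: blinfun.diff_left blinfun.diff_right inv)
qed

section \<open>Polynomial interpolation\<close>

text \<open>
 \<open>line_bound n C l S f\<close>: the derivatives of \<open>f\<close> on \<open>S\<close> up to the order \<open>n\<close> exist and that of order \<open>k\<close> is at most
 \<open>C l\<^sup>k\<close>.  In this form the bounds multiply under products while the frequencies \<open>l\<close> add up, without
 binomial coefficients.
\<close>

fun line_bound :: "nat => real => real => real set => (real => complex) => bool" where
 "line_bound 0 C l S f \<longleftrightarrow> (\<forall>t\<in>S. cmod (f t) \<le> C)"
| "line_bound (Suc n) C l S f \<longleftrightarrow> (\<forall>t\<in>S. cmod (f t) \<le> C) \<and>
   (\<exists>f'. (\<forall>t\<in>S. (f has_vector_derivative f' t) (at t within S)) \<and> line_bound n (C * l) l S f')"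

lemma line_boundD: "line_bound n C l S f ==> t \<in> S ==> cmod (f t) \<le> C"
 by (cases n) auto

lemma line_bound_mono:
 assumes "line_bound n C l S f" "C \<le> C'" "l \<le> l'" "0 \<le> C" "0 \<le> l"
 shows "line_bound n C' l' S f"
 using assms
proof (induction n arbitrary: C C' f)
 case (Suc n)
 then obtain f' where f': "\<forall>t\<in>S. (f has_vector_derivative f' t) (at t within S)" "line_bound n (C * l) l S f'"
  by auto
 have "line_bound n (C' * l') l' S f'"
  using Suc.prems by (intro Suc.IH[OF f'(2)] mult_mono) auto
 moreover have "\<forall>t\<in>S. cmod (f t) \<le> C'" using Suc.prems by force
 ultimately show ?case using f'(1) by auto
qed force

lemma line_bound_Suc: "line_bound (Suc n) C l S f ==> line_bound n C l S f"
proof (induction n arbitrary: C f)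
 case (Suc n)
 then obtain f' where "\<forall>t\<in>S. cmod (f t) \<le> C" "\<forall>t\<in>S. (f has_vector_derivative f' t) (at t within S)" "line_bound (Suc n) (C * l) l S f'"
  by auto
 then show ?case using Suc.IH[of "C * l" f'] by auto
qed auto

lemma line_bound_subset:
 "line_bound n C l S f ==> T \<subseteq> S ==> line_bound n C l T f"
proof (induction n arbitrary: C f)
 case (Suc n)
 then obtain f' where f': "\<forall>t\<in>S. (f has_vector_derivative f' t) (at t within S)" "line_bound n (C * l) l S f'"
  by auto
 then have "line_bound n (C * l) l T f'" using Suc by blast
 moreover have "\<forall>t\<in>T. (f has_vector_derivative f' t) (at t within T)"
  using f'(1) Suc.prems(2) by (auto intro: has_vector_derivative_within_subset)
 ultimately show ?case using Suc.prems by auto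
qed auto

lemma line_bound_add:
 "line_bound n C l S f ==> line_bound n D l S g ==> line_bound n (C + D) l S (\<lambda>t. f t + g t)"
proof (induction n arbitrary: C D f g)
 case 0
 then show ?case by (auto intro: norm_triangle_le add_mono)
next
 case (Suc n)
 then obtain f' g' where f': "\<forall>t\<in>S. (f has_vector_derivative f' t) (at t within S)" "line_bound n (C * l) l S f'"
  and g': "\<forall>t\<in>S. (g has_vector_derivative g' t) (at t within S)" "line_bound n (D * l) l S g'" by auto
 have "line_bound n (C * l + D * l) l S (\<lambda>t. f' t + g' t)" by (rule Suc.IH[OF f'(2) g'(2)])
 moreover have "\<forall>t\<in>S. ((\<lambda>t. f t + g t) has_vector_derivative f' t + g' t) (at t within S)"
  using f'(1) g'(1) by (auto intro: has_vector_derivative_add)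
 moreover have "\<forall>t\<in>S. cmod (f t + g t) \<le> C + D"
  using Suc.prems by (auto intro: norm_triangle_le add_mono)
 ultimately show ?case by (auto simp: distrib_right)
qed

lemma line_bound_mult:
 "line_bound n C k S f ==> line_bound n D l S g ==> 0 \<le> C ==> 0 \<le> D ==> 0 \<le> k ==> 0 \<le> l ==>
  line_bound n (C * D) (k + l) S (\<lambda>t. f t * g t)"
proof (induction n arbitrary: C D f g)
 case 0
 then show ?case by (auto simp: norm_mult intro!: mult_mono)
next
 case (Suc n)
 then obtain f' g' where f': "\<forall>t\<in>S. (f has_vector_derivative f' t) (at t within S)" "line_bound n (C * k) k S f'"
  and g': "\<forall>t\<in>S. (g has_vector_derivative g' t) (at t within S)" "line_bound n (D * l) l S g'" by auto
 have "line_bound n (C * (D * l)) (k + l) S (\<lambda>t. f t * g' t)"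
  by (rule Suc.IH[OF line_bound_Suc[OF Suc.prems(1)] g'(2)]) (use Suc.prems in auto)
 moreover have "line_bound n ((C * k) * D) (k + l) S (\<lambda>t. f' t * g t)"
  by (rule Suc.IH[OF f'(2) line_bound_Suc[OF Suc.prems(2)]]) (use Suc.prems in auto)
 ultimately have "line_bound n (C * (D * l) + (C * k) * D) (k + l) S (\<lambda>t. f t * g' t + f' t * g t)"
  by (rule line_bound_add)
 moreover have "C * (D * l) + (C * k) * D = C * D * (k + l)" by (simp add: algebra_simps)
 moreover have "\<forall>t\<in>S. ((\<lambda>t. f t * g t) has_vector_derivative f t * g' t + f' t * g t) (at t within S)"
  using f'(1) g'(1) by (auto intro: has_vector_derivative_mult)
 moreover have "\<forall>t\<in>S. cmod (f t * g t) \<le> C * D"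
  using Suc.prems by (auto simp: norm_mult intro!: mult_mono)
 ultimately show ?case by auto
qed

lemma line_bound_zero: "0 \<le> C ==> 0 \<le> l ==> line_bound n C l S (\<lambda>_. 0)"
 by (induction n arbitrary: C) (auto intro!: exI[of _ "\<lambda>_. 0"])

lemma line_bound_const: "0 \<le> l ==> cmod c \<le> C ==> line_bound n C l S (\<lambda>_. c)"
 using norm_ge_zero[of c] by (cases n) (auto intro!: exI[of _ "\<lambda>_. 0"] line_bound_zero mult_nonneg_nonneg simp del: norm_ge_zero)

lemma line_bound_cmult:
 assumes "line_bound n C l S f" "0 \<le> C" "0 \<le> l"
 shows "line_bound n (cmod c * C) l S (\<lambda>t. c * f t)"
 using line_bound_mult[OF line_bound_const[of 0 c "cmod c" n S] assms(1)] assms(2,3) by simp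

lemma line_bound_sum:
 assumes "finite I" "\<And>i. i \<in> I ==> line_bound n (C i) l S (f i)" "0 \<le> l"
 shows "line_bound n (\<Sum>i\<in>I. C i) l S (\<lambda>t. \<Sum>i\<in>I. f i t)"
 using assms by (induction I rule: finite_induct) (auto intro: line_bound_zero line_bound_add)

lemma line_bound_power:
 assumes "line_bound n C l S f" "0 \<le> C" "0 \<le> l"
 shows "line_bound n (C ^ r) (real r * l) S (\<lambda>t. f t ^ r)"
proof (induction r)
 case 0
 then show ?case using line_bound_const[of 0 1 1 n S] by simp
next
 case (Suc r)
 then show ?case
  using line_bound_mult[OF assms(1) Suc] assms(2,3) by (simp add: distrib_right)
qed

lemma line_bound_cnj:
 "line_bound n C l S f ==> line_bound n C l S (\<lambda>t. cnj (f t))"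
proof (induction n arbitrary: C f)
 case (Suc n)
 then obtain f' where f': "\<forall>t\<in>S. (f has_vector_derivative f' t) (at t within S)" "line_bound n (C * l) l S f'"
  by auto
 then have "\<forall>t\<in>S. ((\<lambda>t. cnj (f t)) has_vector_derivative cnj (f' t)) (at t within S)"
  by (auto intro: has_vector_derivative_cnj)
 then show ?case using Suc f' by auto
qed auto

lemma line_bound_cis:
 "\<bar>\<theta>\<bar> \<le> l ==> line_bound n 1 l S (\<lambda>t. cis (\<theta> * t + c))"
proof (induction n)
 case (Suc n)
 have "((\<lambda>t. cis (\<theta> * t + c)) has_vector_derivative (\<i> * of_real \<theta>) * cis (\<theta> * t + c)) (at t within S)" for t
 proof -
  have "((\<lambda>t. \<theta> * t + c) has_real_derivative \<theta>) (at t within S)" by (auto intro!: derivative_eq_intros)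
  moreover have "(cis has_vector_derivative \<i> * cis y) (at y within (\<lambda>t. \<theta> * t + c) ` S)" for y
   unfolding cis_conv_exp using has_vector_derivative_iexp[of y] by (simp add: mult.commute)
  ultimately have "((cis \<circ> (\<lambda>t. \<theta> * t + c)) has_vector_derivative \<theta> *\<^sub>R (\<i> * cis (\<theta> * t + c))) (at t within S)"
   by (intro vector_diff_chain_within) (auto simp: has_real_derivative_iff_has_vector_derivative)
  then show ?thesis by (simp add: o_def scaleR_conv_of_real mult_ac)
 qed
 moreover have "line_bound n (1 * l) l S (\<lambda>t. (\<i> * of_real \<theta>) * cis (\<theta> * t + c))"
 proof (rule line_bound_mono[OF line_bound_cmult[OF Suc.IH]])
  show "cmod (\<i> * of_real \<theta>) * 1 \<le> 1 * l" using Suc.prems by (simp add: norm_mult)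
 qed (use Suc.prems in auto)
 ultimately show ?case
  unfolding line_bound.simps by (intro conjI exI[of _ "\<lambda>t. (\<i> * of_real \<theta>) * cis (\<theta> * t + c)"]) simp_all
qed simp

lemma line_bound_ident:
 assumes "h > 0" "S \<subseteq> {0..h}"
 shows "line_bound n h (1 / h) S (\<lambda>t. of_real t)"
proof (cases n)
 case (Suc k)
 have "(complex_of_real has_vector_derivative 1) (at t within S)" for t
  using has_vector_derivative_of_real[OF DERIV_ident[of "at t within S"]] by simp
 moreover have "line_bound k (h * (1 / h)) (1 / h) S (\<lambda>_. 1)"
  using assms by (intro line_bound_const) auto
 ultimately show ?thesis using assms Suc by (auto intro!: exI[of _ "\<lambda>_. 1"])
qed (use assms in auto)

lemma line_bound_Taylor:
 assumes "line_bound n C l {0..\<delta>} F" "0 \<le> C" "0 \<le> l"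
 shows "\<exists>c. \<forall>t\<in>{0..\<delta>}. cmod (F t - (\<Sum>k<n. c k * of_real t ^ k)) \<le> C * (l * t) ^ n"
 using assms
proof (induction n arbitrary: C F)
 case (Suc n)
 then obtain F' where F': "\<forall>t\<in>{0..\<delta>}. (F has_vector_derivative F' t) (at t within {0..\<delta>})" "line_bound n (C * l) l {0..\<delta>} F'"
  by auto
 have "\<exists>c. \<forall>t\<in>{0..\<delta>}. cmod (F' t - (\<Sum>k<n. c k * of_real t ^ k)) \<le> (C * l) * (l * t) ^ n"
  by (rule Suc.IH[OF F'(2)]) (use Suc.prems in auto)
 then obtain c where c: "\<And>t. t \<in> {0..\<delta>} ==> cmod (F' t - (\<Sum>k<n. c k * of_real t ^ k)) \<le> (C * l) * (l * t) ^ n"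
  by blast
 define G where "G t = F t - (\<Sum>k<n. c k / of_nat (Suc k) * of_real t ^ Suc k)" for t
 have G: "(G has_vector_derivative F' t - (\<Sum>k<n. c k * of_real t ^ k)) (at t within {0..\<delta>})" if "t \<in> {0..\<delta>}" for t
 proof -
  have "((\<lambda>t. c k / of_nat (Suc k) * of_real t ^ Suc k) has_vector_derivative c k * of_real t ^ k) (at t within {0..\<delta>})" for k
  proof -
   have "((\<lambda>t. t ^ Suc k) has_real_derivative real (Suc k) * t ^ k) (at t within {0..\<delta>})"
    using DERIV_power[OF DERIV_ident[of "at t within {0..\<delta>}"], of "Suc k"] by simp
   then have "((\<lambda>t. c k / of_nat (Suc k) * of_real (t ^ Suc k)) has_vector_derivative c k / of_nat (Suc k) * of_real (real (Suc k) * t ^ k)) (at t within {0..\<delta>})"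
    by (intro has_vector_derivative_mult_right has_vector_derivative_of_real)
   moreover have "c k / of_nat (Suc k) * of_real (real (Suc k) * t ^ k) = c k * of_real t ^ k"
    by (simp del: of_nat_Suc)
   ultimately show ?thesis by simp
  qed
  then show ?thesis
   unfolding G_def[abs_def] using F'(1) that by (intro has_vector_derivative_diff has_vector_derivative_sum) auto
 qed
 have "cmod (G t - G 0) \<le> C * (l * t) ^ Suc n" if t: "t \<in> {0..\<delta>}" for t
 proof -
  have "norm (G t - G 0) \<le> ((C * l) * (l * t) ^ n) * norm (t - 0)"
  proof (rule differentiable_bound[where S = "{0..t}" and f = G and f' = "\<lambda>s y. y *\<^sub>R (F' s - (\<Sum>k<n. c k * of_real s ^ k))"])
   fix s assume s: "s \<in> {0..t}"
   then have s': "s \<in> {0..\<delta>}" using t by auto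
   show "(G has_derivative (\<lambda>y. y *\<^sub>R (F' s - (\<Sum>k<n. c k * of_real s ^ k)))) (at s within {0..t})"
    using G[OF s'] t unfolding has_vector_derivative_def by (rule_tac has_derivative_subset) auto
   have "cmod (F' s - (\<Sum>k<n. c k * of_real s ^ k)) \<le> (C * l) * (l * s) ^ n" by (rule c[OF s'])
   also have "... \<le> (C * l) * (l * t) ^ n"
    using s Suc.prems by (intro mult_left_mono power_mono) auto
   finally show "onorm (\<lambda>y. y *\<^sub>R (F' s - (\<Sum>k<n. c k * of_real s ^ k))) \<le> (C * l) * (l * t) ^ n"
    by (intro onorm_le) (auto simp: mult.commute[of "_ * _ ^ n"] intro!: mult_left_mono)
  qed (use t in auto)
  then show ?thesis using t by (simp add: mult_ac)
 qed
 moreover have "G t - G 0 = F t - (\<Sum>k<Suc n. (case k of 0 => F 0 | Suc k => c k / of_nat (Suc k)) * of_real t ^ k)" for t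
  unfolding sum.lessThan_Suc_shift by (simp add: G_def del: of_nat_Suc)
 ultimately show ?case by (intro exI[of _ "\<lambda>k. case k of 0 => F 0 | Suc k => c k / of_nat (Suc k)"]) auto
qed auto

definition lagrange :: "nat => nat => real => real" where
 "lagrange n j t = (\<Prod>i\<in>{..<n} - {j}. (real n * t - real i) / (real j - real i))"

lemma lagrange_bound:
 assumes "t \<in> {0..1}" "j < n"
 shows "\<bar>lagrange n j t\<bar> \<le> real n ^ n"
proof -
 have "\<bar>lagrange n j t\<bar> = (\<Prod>i\<in>{..<n} - {j}. \<bar>(real n * t - real i) / (real j - real i)\<bar>)"
  by (simp add: lagrange_def abs_prod)
 also have "... \<le> (\<Prod>i\<in>{..<n} - {j}. real n)"
 proof (intro prod_mono conjI)
  fix i assume i: "i \<in> {..<n} - {j}"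
  have "0 \<le> real n * t" "real n * t \<le> real n" using assms by (auto simp: mult_left_le)
  moreover have "real i \<le> real n" using i by simp
  ultimately have "\<bar>real n * t - real i\<bar> \<le> real n" by linarith
  moreover have "1 \<le> \<bar>real j - real i\<bar>" using i by (cases "i < j") auto
  ultimately have "\<bar>real n * t - real i\<bar> / \<bar>real j - real i\<bar> \<le> real n / 1" by (intro frac_le) auto
  then show "\<bar>(real n * t - real i) / (real j - real i)\<bar> \<le> real n" by simp
 qed simp
 also have "... \<le> real n ^ n"
  using assms by (auto simp: card_Diff_singleton intro!: power_increasing)
 finally show ?thesis .
qed

lemma lagrange_node: "i < n ==> j < n ==> lagrange n j (real i / real n) = (if i = j then 1 else 0)"
 by (auto simp: lagrange_def prod_zero_iff intro!: prod.neutral)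

lemma lagrange_reproduces:
 assumes k: "k < n"
 shows "(\<Sum>j<n. lagrange n j t * (real j / real n) ^ k) = t ^ k"
proof -
 define L where "L j = (\<Prod>i\<in>{..<n} - {j}. [:- real i / (real j - real i), real n / (real j - real i):])" for j
 have L: "poly (L j) t = lagrange n j t" for j t
  unfolding L_def lagrange_def poly_prod by (rule prod.cong) (auto simp: diff_divide_distrib)
 define p where "p = (\<Sum>j<n. smult ((real j / real n) ^ k) (L j)) - monom 1 k"
 have "degree (L j) \<le> n - 1" if "j < n" for j
 proof -
  have "degree (L j) \<le> (\<Sum>i\<in>{..<n} - {j}. degree [:- real i / (real j - real i), real n / (real j - real i):])"
   unfolding L_def by (rule degree_prod_sum_le[unfolded o_def]) simp
  also have "... \<le> (\<Sum>i\<in>{..<n} - {j}. 1)" by (rule sum_mono) simp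
  also have "... \<le> n - 1" using that by (simp add: card_Diff_singleton)
  finally show ?thesis .
 qed
 then have "degree (\<Sum>j<n. smult ((real j / real n) ^ k) (L j)) \<le> n - 1"
  by (intro degree_sum_le) (auto intro!: order_trans[OF degree_smult_le])
 then have deg: "degree p < n"
  using k unfolding p_def by (intro degree_diff_less) (auto simp: degree_monom_eq)
 have roots: "poly p (real i / real n) = 0" if "i < n" for i
 proof -
  have "(\<Sum>j<n. (real j / real n) ^ k * lagrange n j (real i / real n)) = (\<Sum>j<n. if j = i then (real i / real n) ^ k else 0)"
   by (rule sum.cong) (auto simp: lagrange_node[OF that])
  then show ?thesis using that by (simp add: p_def poly_sum L poly_monom)
 qed
 have "p = 0"
 proof (rule ccontr)
  assume p: "p \<noteq> 0"
  have "n = card ((\<lambda>i. real i / real n) ` {..<n})"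
   using k by (subst card_image) (auto simp: inj_on_def)
  also have "... \<le> card {x. poly p x = 0}"
   using roots by (intro card_mono poly_roots_finite[OF p]) auto
  also have "... \<le> degree p" by (rule card_poly_roots_bound[OF p])
  finally show False using deg by simp
 qed
 then have "poly p t = 0" by simp
 then show ?thesis by (simp add: p_def poly_sum L poly_monom mult.commute)
qed

definition interp_const :: "nat => real" where "interp_const n = real n * real n ^ n"

lemma interpolation_error_1d:
 assumes F: "line_bound n C l {0..\<delta>} F" and C: "0 \<le> C" "0 \<le> l" and \<delta>: "\<delta> > 0" and t: "t \<in> {0..\<delta>}"
 shows "cmod (F t - (\<Sum>j<n. of_real (lagrange n j (t / \<delta>)) * F (\<delta> * (real j / real n)))) \<le> C * (l * \<delta>) ^ n * (1 + interp_const n)"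
proof -
 obtain c where c: "\<And>t. t \<in> {0..\<delta>} ==> cmod (F t - (\<Sum>k<n. c k * of_real t ^ k)) \<le> C * (l * t) ^ n"
  using line_bound_Taylor[OF F C] by blast
 define r where "r t = F t - (\<Sum>k<n. c k * of_real t ^ k)" for t
 have r: "cmod (r t) \<le> C * (l * \<delta>) ^ n" if "t \<in> {0..\<delta>}" for t
 proof -
  have "cmod (r t) \<le> C * (l * t) ^ n" unfolding r_def by (rule c[OF that])
  also have "... \<le> C * (l * \<delta>) ^ n" using that C by (intro mult_left_mono power_mono) auto
  finally show ?thesis .
 qed
 have node: "\<delta> * (real j / real n) \<in> {0..\<delta>}" if "j < n" for j
  using that \<delta> by (auto simp: field_simps)
 have poly: "(\<Sum>j<n. of_real (lagrange n j (t / \<delta>)) * (\<Sum>k<n. c k * of_real (\<delta> * (real j / real n)) ^ k)) = (\<Sum>k<n. c k * of_real t ^ k)"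
 proof -
  have "(\<Sum>j<n. of_real (lagrange n j (t / \<delta>)) * (\<Sum>k<n. c k * of_real (\<delta> * (real j / real n)) ^ k))
    = (\<Sum>k<n. c k * of_real (\<delta> ^ k) * of_real (\<Sum>j<n. lagrange n j (t / \<delta>) * (real j / real n) ^ k))"
   unfolding sum_distrib_left of_real_sum by (subst sum.swap) (simp add: power_mult_distrib power_divide mult_ac)
  also have "... = (\<Sum>k<n. c k * of_real (\<delta> ^ k) * of_real ((t / \<delta>) ^ k))"
   by (intro sum.cong refl) (simp add: lagrange_reproduces)
  also have "... = (\<Sum>k<n. c k * of_real t ^ k)"
   using \<delta> by (intro sum.cong refl) (simp add: power_divide)
  finally show ?thesis .
 qed
 have "F t - (\<Sum>j<n. of_real (lagrange n j (t / \<delta>)) * F (\<delta> * (real j / real n)))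
   = r t - (\<Sum>j<n. of_real (lagrange n j (t / \<delta>)) * r (\<delta> * (real j / real n)))"
  unfolding r_def right_diff_distrib sum_subtractf poly by simp
 also have "cmod ... \<le> cmod (r t) + cmod (\<Sum>j<n. of_real (lagrange n j (t / \<delta>)) * r (\<delta> * (real j / real n)))"
  by (rule norm_triangle_ineq4)
 also have "... \<le> C * (l * \<delta>) ^ n + (\<Sum>j<n. real n ^ n * (C * (l * \<delta>) ^ n))"
 proof (intro add_mono r t sum_norm_le)
  fix j assume "j \<in> {..<n}"
  then show "cmod (of_real (lagrange n j (t / \<delta>)) * r (\<delta> * (real j / real n))) \<le> real n ^ n * (C * (l * \<delta>) ^ n)"
   unfolding norm_mult norm_of_real using t \<delta>
   by (intro mult_mono lagrange_bound r node) (auto simp: field_simps)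
 qed
 also have "... = C * (l * \<delta>) ^ n * (1 + interp_const n)"
  by (simp add: interp_const_def algebra_simps)
 finally show ?thesis .
qed

definition lagrange_prod :: "nat => 'n set => real^'n => real => ('n::finite => nat) => real^'n => real" where
 "lagrange_prod n I z \<delta> f x = (\<Prod>i\<in>I. lagrange n (f i) ((x $ i - z $ i) / \<delta>))"

definition node :: "nat => 'n set => real^'n => real => ('n::finite => nat) => real^'n => real^'n" where
 "node n I z \<delta> f x = (\<chi> i. if i \<in> I then z $ i + \<delta> * (real (f i) / real n) else x $ i)"

definition cube :: "real^'n::finite => real => (real^'n) set" where
 "cube z \<delta> = {x. \<forall>i. z $ i \<le> x $ i \<and> x $ i \<le> z $ i + \<delta>}"

text \<open>Interpolating in one coordinate after the other needs only pure derivatives.\<close>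

lemma interpolation_error:
 fixes F :: "real^'n::finite => complex"
 assumes F: "\<And>x i. x \<in> cube z \<delta> ==> x $ i = z $ i ==> line_bound n C l {0..\<delta>} (\<lambda>t. F (x + t *\<^sub>R axis i 1))"
  and C: "0 \<le> C" "0 \<le> l" and \<delta>: "\<delta> > 0" and x: "x \<in> cube z \<delta>" and I: "finite I"
 shows "cmod (F x - (\<Sum>f\<in>PiE I (\<lambda>_. {..<n}). of_real (lagrange_prod n I z \<delta> f x) * F (node n I z \<delta> f x)))
   \<le> C * (l * \<delta>) ^ n * (1 + interp_const n) * (\<Sum>k<card I. interp_const n ^ k)"
 using I x
proof (induction I arbitrary: x)
 case empty
 have "(\<chi> i. x $ i) = x" by (simp add: vec_eq_iff)
 then show ?case by (simp add: lagrange_prod_def node_def)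
next
 case (insert j I)
 let ?e = "C * (l * \<delta>) ^ n * (1 + interp_const n)"
 let ?s = "\<Sum>k<card I. interp_const n ^ k"
 have ic: "interp_const n \<ge> 0" by (simp add: interp_const_def)
 define w where "w p = lagrange n p ((x $ j - z $ j) / \<delta>)" for p
 define X where "X p = (\<chi> i. if i = j then z $ i + \<delta> * (real p / real n) else x $ i)" for p
 define J where "J y = (\<Sum>f\<in>PiE I (\<lambda>_. {..<n}). of_real (lagrange_prod n I z \<delta> f y) * F (node n I z \<delta> f y))" for y
 have Xc: "X p \<in> cube z \<delta>" if "p < n" for p
  using insert.prems that \<delta> by (auto simp: X_def cube_def field_simps)
 have split: "(\<Sum>f\<in>PiE (insert j I) (\<lambda>_. {..<n}). of_real (lagrange_prod n (insert j I) z \<delta> f x) * F (node n (insert j I) z \<delta> f x))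
   = (\<Sum>p<n. of_real (w p) * J (X p))"
 proof -
  have "(\<Sum>f\<in>PiE (insert j I) (\<lambda>_. {..<n}). of_real (lagrange_prod n (insert j I) z \<delta> f x) * F (node n (insert j I) z \<delta> f x))
    = (\<Sum>(p, f)\<in>{..<n} \<times> PiE I (\<lambda>_. {..<n}). of_real (lagrange_prod n (insert j I) z \<delta> (f(j := p)) x) * F (node n (insert j I) z \<delta> (f(j := p)) x))"
   unfolding PiE_insert_eq
   using inj_combinator[of j I "\<lambda>_. {..<n}"] insert.hyps
   by (subst sum.reindex) (simp_all add: o_def case_prod_beta')
  also have "... = (\<Sum>p<n. \<Sum>f\<in>PiE I (\<lambda>_. {..<n}). of_real (w p) * (of_real (lagrange_prod n I z \<delta> f (X p)) * F (node n I z \<delta> f (X p))))"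
   unfolding sum.cartesian_product[symmetric]
  proof (intro sum.cong refl)
   fix p f
   have "lagrange_prod n (insert j I) z \<delta> (f(j := p)) x = w p * (\<Prod>i\<in>I. lagrange n ((f(j := p)) i) ((x $ i - z $ i) / \<delta>))"
    unfolding lagrange_prod_def w_def using insert.hyps by simp
   also have "(\<Prod>i\<in>I. lagrange n ((f(j := p)) i) ((x $ i - z $ i) / \<delta>)) = lagrange_prod n I z \<delta> f (X p)"
    unfolding lagrange_prod_def using insert.hyps by (intro prod.cong) (auto simp: X_def)
   finally have 1: "lagrange_prod n (insert j I) z \<delta> (f(j := p)) x = w p * lagrange_prod n I z \<delta> f (X p)" .
   have 2: "node n (insert j I) z \<delta> (f(j := p)) x = node n I z \<delta> f (X p)"
    using insert.hyps by (auto simp: node_def X_def vec_eq_iff)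
   show "of_real (lagrange_prod n (insert j I) z \<delta> (f(j := p)) x) * F (node n (insert j I) z \<delta> (f(j := p)) x)
     = of_real (w p) * (of_real (lagrange_prod n I z \<delta> f (X p)) * F (node n I z \<delta> f (X p)))"
    unfolding 1 2 by simp
  qed
  finally show ?thesis by (simp add: J_def sum_distrib_left)
 qed
 have one: "cmod (F x - (\<Sum>p<n. of_real (w p) * F (X p))) \<le> ?e"
 proof -
  define y where "y = (\<chi> i. if i = j then z $ i else x $ i)"
  have y: "y \<in> cube z \<delta>" "y $ j = z $ j" using insert.prems \<delta> by (auto simp: y_def cube_def)
  have t: "x $ j - z $ j \<in> {0..\<delta>}" using insert.prems by (simp add: cube_def add.commute diff_le_eq)
  have "y + (x $ j - z $ j) *\<^sub>R axis j 1 = x" by (auto simp: y_def vec_eq_iff axis_def)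
  moreover have "y + (\<delta> * (real p / real n)) *\<^sub>R axis j 1 = X p" for p by (auto simp: y_def X_def vec_eq_iff axis_def)
  ultimately show ?thesis
   using interpolation_error_1d[OF F[OF y] C \<delta> t] by (simp add: w_def)
 qed
 have two: "cmod (\<Sum>p<n. of_real (w p) * (F (X p) - J (X p))) \<le> interp_const n * (?e * ?s)"
 proof -
  have "cmod (\<Sum>p<n. of_real (w p) * (F (X p) - J (X p))) \<le> (\<Sum>p<n. real n ^ n * (?e * ?s))"
  proof (rule sum_norm_le)
   fix p assume p: "p \<in> {..<n}"
   have "\<bar>w p\<bar> \<le> real n ^ n"
    unfolding w_def using p insert.prems \<delta> by (intro lagrange_bound) (auto simp: cube_def field_simps)
   moreover have "cmod (F (X p) - J (X p)) \<le> ?e * ?s"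
    unfolding J_def by (rule insert.IH) (use p in \<open>auto intro: Xc\<close>)
   ultimately show "cmod (of_real (w p) * (F (X p) - J (X p))) \<le> real n ^ n * (?e * ?s)"
    unfolding norm_mult norm_of_real by (intro mult_mono) auto
  qed
  then show ?thesis by (simp add: interp_const_def mult_ac)
 qed
 have "F x - (\<Sum>p<n. of_real (w p) * J (X p)) = (F x - (\<Sum>p<n. of_real (w p) * F (X p))) + (\<Sum>p<n. of_real (w p) * (F (X p) - J (X p)))"
  by (simp add: right_diff_distrib sum_subtractf)
 then have "cmod (F x - (\<Sum>p<n. of_real (w p) * J (X p))) \<le> ?e + interp_const n * (?e * ?s)"
  using norm_triangle_mono[OF one two] by (simp only:)
 also have "... = ?e * (1 + interp_const n * ?s)" by (simp add: distrib_left mult_ac)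
 also have "1 + interp_const n * ?s = (\<Sum>k<card (insert j I). interp_const n ^ k)"
 proof -
  have "card (insert j I) = Suc (card I)" using insert.hyps by simp
  then show ?thesis unfolding sum_distrib_left by (simp only: sum.lessThan_Suc_shift power_0 power_Suc)
 qed
 finally show ?case unfolding split .
qed

section \<open>Local estimates for the kernel\<close>

text \<open>
 \<open>d k j\<close> is the pure derivative \<open>\<partial>\<^sub>\<xi>\<^sub>k\<^sup>j b\<close>; each of these is bounded together with its pure derivatives in \<open>x\<close> along the
 coordinate lines.  These are all the derivatives that the estimates use, and in this form the hypothesis can be
 met with the roles of \<open>x\<close> and \<open>\<xi>\<close> exchanged.
\<close>

locale nice_symbol =
 fixes n m :: nat and l \<rho> A :: real and u \<mu> :: "real^'n::finite"
  and b :: "(real^'n) \<times> (real^'n) => complex" and d :: "'n => nat => (real^'n) \<times> (real^'n) => complex"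
 assumes l_pos: "0 < l" and \<rho>_pos: "0 < \<rho>" and A_nonneg: "0 \<le> A"
  and d_zero: "d k 0 = b"
  and d_deriv: "j < m ==> ((\<lambda>s. d k j (x, \<xi> + s *\<^sub>R axis k 1)) has_vector_derivative d k (Suc j) (x, \<xi> + t *\<^sub>R axis k 1)) (at t)"
  and d_cont: "j \<le> m ==> continuous_on UNIV (d k j)"
  and d_supp: "j \<le> m ==> d k j (x, \<xi>) \<noteq> 0 ==> x \<in> ball u l \<and> \<xi> \<in> ball \<mu> \<rho>"
  and d_line: "j \<le> m ==> line_bound n (A * (1 / \<rho>) ^ j) (1 / l) UNIV (\<lambda>t. d k j (x + t *\<^sub>R axis i 1, \<xi>))"

lemma nice_symbol_cnj:
 assumes "nice_symbol n m l \<rho> A u \<mu> b d"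
 shows "nice_symbol n m l \<rho> A u \<mu> (\<lambda>z. cnj (b z)) (\<lambda>k j z. cnj (d k j z))"
proof -
 interpret nice_symbol n m l \<rho> A u \<mu> b d by fact
 show ?thesis
 proof
  show "(\<lambda>z. cnj (d k 0 z)) = (\<lambda>z. cnj (b z))" for k by (simp add: d_zero)
  show "((\<lambda>s. cnj (d k j (x, \<xi> + s *\<^sub>R axis k 1))) has_vector_derivative cnj (d k (Suc j) (x, \<xi> + t *\<^sub>R axis k 1))) (at t)"
   if "j < m" for j k x \<xi> t
   by (rule has_vector_derivative_cnj[OF d_deriv[OF that]])
  show "continuous_on UNIV (\<lambda>z. cnj (d k j z))" if "j \<le> m" for j k
   by (rule continuous_on_cnj[OF d_cont[OF that]])
  show "x \<in> ball u l \<and> \<xi> \<in> ball \<mu> \<rho>" if "j \<le> m" "cnj (d k j (x, \<xi>)) \<noteq> 0" for j k x \<xi>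
   using d_supp[OF that(1), of k x \<xi>] that(2) by simp
  show "line_bound n (A * (1 / \<rho>) ^ j) (1 / l) UNIV (\<lambda>t. cnj (d k j (x + t *\<^sub>R axis i 1, \<xi>)))" if "j \<le> m" for j k x i \<xi>
   by (rule line_bound_cnj[OF d_line[OF that]])
 qed (use l_pos \<rho>_pos A_nonneg in auto)
qed

lemma fourier_integral_sum:
 fixes g :: "'i => real^'n::finite => complex"
 assumes "finite J" "\<And>j. j \<in> J ==> integrable lborel (g j)"
 shows "fourier_integral \<alpha> (\<lambda>\<xi>. \<Sum>j\<in>J. c j * g j \<xi>) y = (\<Sum>j\<in>J. c j * fourier_integral \<alpha> (g j) y)"
proof -
 have "fourier_integral \<alpha> (\<lambda>\<xi>. \<Sum>j\<in>J. c j * g j \<xi>) y = (LINT \<xi>|lborel. (\<Sum>j\<in>J. c j * (cis (- (\<alpha> * (\<xi> \<bullet> y))) * g j \<xi>)))"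
  unfolding fourier_integral_def sum_distrib_left by (simp add: mult.left_commute)
 also have "... = (\<Sum>j\<in>J. (LINT \<xi>|lborel. c j * (cis (- (\<alpha> * (\<xi> \<bullet> y))) * g j \<xi>)))"
  by (intro Bochner_Integration.integral_sum integrable_mult_right integrable_cis_mult(1) assms(2))
 finally show ?thesis by (simp add: fourier_integral_def)
qed

lemma L12_bounded_ball:
 fixes f :: "real^'n::finite => complex"
 assumes f: "f \<in> borel_measurable borel" and b: "\<And>\<xi>. cmod (f \<xi>) \<le> B * indicator (ball \<mu> \<rho>) \<xi>" and B: "B \<ge> 0" and \<rho>: "\<rho> \<ge> 0"
 shows "L12 f" "(norm (abs_L2 f))\<^sup>2 \<le> B\<^sup>2 * (unit_ball_vol (real CARD('n)) * \<rho> ^ CARD('n))"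
proof -
 have fin: "emeasure lborel (ball \<mu> \<rho>) < \<infinity>" using emeasure_lborel_ball_finite[of \<mu> \<rho>] by simp
 have i: "integrable lborel (indicat_real (ball \<mu> \<rho>))" by (rule integrable_real_indicator) (use fin in auto)
 have fi: "integrable lborel f"
 proof (rule Bochner_Integration.integrable_bound)
  show "integrable lborel (\<lambda>\<xi>. B * indicat_real (ball \<mu> \<rho>) \<xi>)" by (intro integrable_mult_right i)
  show "AE \<xi> in lborel. norm (f \<xi>) \<le> norm (B * indicat_real (ball \<mu> \<rho>) \<xi>)"
   by (intro AE_I2 order_trans[OF b]) simp
 qed (use f in simp)
 have "cmod (f \<xi>) \<le> B" for \<xi> using b[of \<xi>] B by (cases "\<xi> \<in> ball \<mu> \<rho>") auto
 then have fs: "square_integrable f" by (rule square_integrable_of_bounded_integrable[OF fi])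
 show "L12 f" using fi fs by (simp add: L12_def)
 have "(norm (abs_L2 f))\<^sup>2 = (LINT \<xi>|lborel. (cmod (f \<xi>))\<^sup>2)" by (rule norm_abs_L2_sq[OF fs])
 also have "... \<le> (LINT \<xi>|lborel. B\<^sup>2 * indicat_real (ball \<mu> \<rho>) \<xi>)"
 proof (rule integral_mono)
  show "integrable lborel (\<lambda>\<xi>. (cmod (f \<xi>))\<^sup>2)" using fs by (simp add: square_integrable_def)
  show "integrable lborel (\<lambda>\<xi>. B\<^sup>2 * indicat_real (ball \<mu> \<rho>) \<xi>)" by (intro integrable_mult_right i)
  show "(cmod (f \<xi>))\<^sup>2 \<le> B\<^sup>2 * indicat_real (ball \<mu> \<rho>) \<xi>" for \<xi>
   using power_mono[OF b[of \<xi>], of 2] by (cases "\<xi> \<in> ball \<mu> \<rho>") auto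
 qed
 also have "... = B\<^sup>2 * measure lborel (ball \<mu> \<rho>)" using fin by (simp add: less_top)
 also have "measure lborel (ball \<mu> \<rho>) = unit_ball_vol (real CARD('n)) * \<rho> ^ CARD('n)"
  using content_ball[OF \<rho>, of \<mu>] by simp
 finally show "(norm (abs_L2 f))\<^sup>2 \<le> B\<^sup>2 * (unit_ball_vol (real CARD('n)) * \<rho> ^ CARD('n))" .
qed

context nice_symbol
begin

lemma d_bound: "j \<le> m ==> cmod (d k j (x, \<xi>)) \<le> A * (1 / \<rho>) ^ j"
 using line_boundD[OF d_line[of j k x undefined \<xi>], of 0] by simp

lemma d_bound_ball: "j \<le> m ==> cmod (d k j (x, \<xi>)) \<le> A * (1 / \<rho>) ^ j * indicator (ball \<mu> \<rho>) \<xi>"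
 using d_bound[of j k x \<xi>] d_supp[of j k x \<xi>] A_nonneg \<rho>_pos
 by (cases "d k j (x, \<xi>) = 0") (auto simp: indicator_def)

lemma d_row_measurable: "j \<le> m ==> (\<lambda>\<xi>. d k j (x, \<xi>)) \<in> borel_measurable borel"
 by (intro borel_measurable_continuous_onI continuous_on_compose2[OF d_cont[of j k]] continuous_intros) auto

lemma d_row_L12: "j \<le> m ==> L12 (\<lambda>\<xi>. d k j (x, \<xi>))"
 using A_nonneg \<rho>_pos by (intro L12_bounded_ball(1)[OF d_row_measurable d_bound_ball]) auto

lemma bounded_kernel_b: "bounded_kernel b"
proof -
 have "\<exists>R. ball u l \<subseteq> ball 0 R \<and> ball \<mu> \<rho> \<subseteq> ball 0 R"
 proof (intro exI conjI)
  show "ball u l \<subseteq> ball 0 (norm u + l + (norm \<mu> + \<rho>))"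
   using \<rho>_pos by (intro ball_subset_ball_iff[THEN iffD2] disjI1) (simp add: dist_norm)
  show "ball \<mu> \<rho> \<subseteq> ball 0 (norm u + l + (norm \<mu> + \<rho>))"
   using l_pos by (intro ball_subset_ball_iff[THEN iffD2] disjI1) (simp add: dist_norm)
 qed
 then obtain R where R: "ball u l \<subseteq> ball 0 R" "ball \<mu> \<rho> \<subseteq> ball 0 R" by blast
 have "cmod (b (x, \<xi>)) \<le> A * indicator (ball 0 R) x * indicator (ball 0 R) \<xi>" for x \<xi>
 proof (cases "b (x, \<xi>) = 0")
  case False
  then have "x \<in> ball 0 R" "\<xi> \<in> ball 0 R" using d_supp[of 0 undefined x \<xi>] R by (auto simp: d_zero)
  then show ?thesis using d_bound[of 0 undefined x \<xi>] by (simp add: d_zero)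
 qed (use A_nonneg in simp)
 moreover have "b \<in> borel_measurable borel"
  using borel_measurable_continuous_onI[OF d_cont[of 0 undefined]] by (simp add: d_zero)
 ultimately show ?thesis unfolding bounded_kernel_def by blast
qed

lemma fourier_d:
 assumes "j \<le> m"
 shows "fourier_integral \<alpha> (\<lambda>\<xi>. d k j (x, \<xi>)) w = (\<i> * of_real (\<alpha> * w $ k)) ^ j * fourier_integral \<alpha> (\<lambda>\<xi>. b (x, \<xi>)) w"
 using assms
proof (induction j)
 case (Suc j)
 let ?B = "A * (1 / \<rho>) ^ j + A * (1 / \<rho>) ^ Suc j"
 have B: "A * (1 / \<rho>) ^ j \<ge> 0" "A * (1 / \<rho>) ^ Suc j \<ge> 0" using A_nonneg \<rho>_pos by auto
 have dom: "cmod (d k i (x, z + s *\<^sub>R axis k 1)) \<le> ?B * indicator (ball \<mu> (\<rho> + 1)) z"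
  if s: "\<bar>s\<bar> \<le> 1" and i: "i \<le> m" "i = j \<or> i = Suc j" for s z i
 proof (cases "d k i (x, z + s *\<^sub>R axis k 1) = 0")
  case False
  then have "z + s *\<^sub>R axis k 1 \<in> ball \<mu> \<rho>"
   using d_supp[OF i(1)] by blast
  then have "norm (z + s *\<^sub>R axis k 1 - \<mu>) < \<rho>"
   by (simp add: dist_norm norm_minus_commute)
  moreover have "norm (z - \<mu>) \<le> norm (z + s *\<^sub>R axis k 1 - \<mu>) + norm (s *\<^sub>R axis k (1::real))"
   using norm_triangle_ineq4[of "z + s *\<^sub>R axis k 1 - \<mu>" "s *\<^sub>R axis k (1::real)"] by simp
  ultimately have "z \<in> ball \<mu> (\<rho> + 1)" using s by (simp add: dist_norm norm_minus_commute)
  then show ?thesis using d_bound[OF i(1), of k x "z + s *\<^sub>R axis k 1"] i(2) B by auto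
 qed (use B in simp)
 have "integrable lborel (\<lambda>z. ?B * indicat_real (ball \<mu> (\<rho> + 1)) z)"
  by (intro integrable_mult_right integrable_real_indicator) (auto simp: emeasure_lborel_ball_finite[unfolded infinity_ennreal_def])
 then have "fourier_integral \<alpha> (\<lambda>\<xi>. d k (Suc j) (x, \<xi>)) w = \<i> * of_real (\<alpha> * w $ k) * fourier_integral \<alpha> (\<lambda>\<xi>. d k j (x, \<xi>)) w"
  using Suc.prems d_row_L12[of j k x] d_row_L12[of "Suc j" k x]
  by (intro fourier_integral_line_derivative[where G = "\<lambda>z. ?B * indicat_real (ball \<mu> (\<rho> + 1)) z"] d_deriv dom)
   (auto simp: L12_def)
 then show ?case using Suc by simp
qed (simp add: d_zero)

text \<open>
 Up to a constant phase, \<open>amplitude \<alpha> k 0 z x\<close> is the function of \<open>\<xi>\<close> whose Fourier transform is row \<open>x\<close> of the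
 kernel.  By the binomial theorem the weight \<open>(y\<^sub>k - z\<^sub>k)\<^sup>p = ((x\<^sub>k - z\<^sub>k) + (y\<^sub>k - x\<^sub>k))\<^sup>p\<close> on this row amounts to replacing \<open>0\<close>
 by \<open>p\<close>.  In this way no derivative in \<open>\<xi>\<close> is taken after one in \<open>x\<close>.
\<close>

definition amplitude :: "real => 'n => nat => real^'n => real^'n => real^'n => complex" where
 "amplitude \<alpha> k p z x \<xi> = cis (- (\<alpha> * (x \<bullet> (\<xi> - \<mu>)))) *
   (\<Sum>j\<le>p. (of_nat (p choose j) * of_real ((x $ k - z $ k) ^ (p - j)) * (\<i> / of_real \<alpha>) ^ j) * d k j (x, \<xi>))"

lemma amplitude_0: "amplitude \<alpha> k 0 z x \<xi> = cis (- (\<alpha> * (x \<bullet> (\<xi> - \<mu>)))) * b (x, \<xi>)"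
 by (simp add: amplitude_def d_zero)

lemma amplitude_outside: "p \<le> m ==> \<xi> \<notin> ball \<mu> \<rho> ==> amplitude \<alpha> k p z x \<xi> = 0"
 unfolding amplitude_def using d_supp[of _ k x \<xi>] by (intro mult_eq_0_iff[THEN iffD2] disjI2 sum.neutral) force

lemma amplitude_measurable: "p \<le> m ==> amplitude \<alpha> k p z x \<in> borel_measurable borel"
proof -
 assume p: "p \<le> m"
 have "(\<lambda>\<xi>. cis (- (\<alpha> * (x \<bullet> (\<xi> - \<mu>))))) \<in> borel_measurable borel"
  by (intro borel_measurable_continuous_onI continuous_intros)
 moreover have "(\<lambda>\<xi>. d k j (x, \<xi>)) \<in> borel_measurable borel" if "j \<in> {..p}" for j
  using that p by (intro d_row_measurable) auto
 ultimately show ?thesis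
  unfolding amplitude_def[abs_def] by (intro borel_measurable_times borel_measurable_sum borel_measurable_const)
qed

lemma fourier_amplitude:
 assumes p: "p \<le> m" and \<alpha>: "\<alpha> \<noteq> 0"
 shows "fourier_integral (- \<alpha>) (amplitude \<alpha> k p z x) y
  = of_real ((y $ k - z $ k) ^ p) * fourier_integral (- \<alpha>) (amplitude \<alpha> k 0 z x) y"
proof -
 have gen: "fourier_integral (- \<alpha>) (amplitude \<alpha> k p z x) y
  = cis (\<alpha> * (x \<bullet> \<mu>)) * (of_real ((y $ k - z $ k) ^ p) * fourier_integral (- \<alpha>) (\<lambda>\<xi>. b (x, \<xi>)) (y - x))"
  if p: "p \<le> m" for p
 proof -
  define c where "c j = of_nat (p choose j) * complex_of_real ((x $ k - z $ k) ^ (p - j)) * (\<i> / of_real \<alpha>) ^ j" for j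
  have "amplitude \<alpha> k p z x = (\<lambda>\<xi>. cis (- \<alpha> * (\<xi> \<bullet> x)) * (cis (\<alpha> * (x \<bullet> \<mu>)) * (\<Sum>j\<le>p. c j * d k j (x, \<xi>))))"
  proof
   fix \<xi>
   have "cis (- (\<alpha> * (x \<bullet> (\<xi> - \<mu>)))) = cis (- \<alpha> * (\<xi> \<bullet> x)) * cis (\<alpha> * (x \<bullet> \<mu>))"
    by (simp add: cis_mult inner_diff_right inner_commute algebra_simps)
   then show "amplitude \<alpha> k p z x \<xi> = cis (- \<alpha> * (\<xi> \<bullet> x)) * (cis (\<alpha> * (x \<bullet> \<mu>)) * (\<Sum>j\<le>p. c j * d k j (x, \<xi>)))"
    by (simp only: amplitude_def c_def mult.assoc)
  qed
  then have "fourier_integral (- \<alpha>) (amplitude \<alpha> k p z x) y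
    = fourier_integral (- \<alpha>) (\<lambda>\<xi>. cis (\<alpha> * (x \<bullet> \<mu>)) * (\<Sum>j\<le>p. c j * d k j (x, \<xi>))) (y - x)"
   by (simp only: fourier_integral_shift)
  also have "... = cis (\<alpha> * (x \<bullet> \<mu>)) * fourier_integral (- \<alpha>) (\<lambda>\<xi>. \<Sum>j\<le>p. c j * d k j (x, \<xi>)) (y - x)"
   unfolding fourier_integral_def by (simp add: mult.left_commute flip: integral_mult_right_zero)
  also have "fourier_integral (- \<alpha>) (\<lambda>\<xi>. \<Sum>j\<le>p. c j * d k j (x, \<xi>)) (y - x) = (\<Sum>j\<le>p. c j * fourier_integral (- \<alpha>) (\<lambda>\<xi>. d k j (x, \<xi>)) (y - x))"
   using d_row_L12[of _ k x] p by (intro fourier_integral_sum) (auto simp: L12_def)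
  also have "... = (\<Sum>j\<le>p. of_nat (p choose j) * of_real (y $ k - x $ k) ^ j * of_real (x $ k - z $ k) ^ (p - j)) * fourier_integral (- \<alpha>) (\<lambda>\<xi>. b (x, \<xi>)) (y - x)"
   unfolding sum_distrib_right
  proof (rule sum.cong)
   fix j assume "j \<in> {..p}"
   then have jm: "j \<le> m" using p by simp
   have "(\<i> / of_real \<alpha>) * (\<i> * of_real (- \<alpha> * (y - x) $ k)) = (of_real (y $ k - x $ k) :: complex)"
    using \<alpha> by (simp add: field_simps)
   then have "(\<i> / of_real \<alpha>) ^ j * (\<i> * of_real (- \<alpha> * (y - x) $ k)) ^ j = (of_real (y $ k - x $ k) :: complex) ^ j"
    unfolding power_mult_distrib[symmetric] by (rule arg_cong)
   then have e: "(\<i> / of_real \<alpha>) ^ j * ((\<i> * of_real (- \<alpha> * (y - x) $ k)) ^ j * X) = of_real (y $ k - x $ k) ^ j * X" for X :: complex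
    by (simp only: mult.assoc[symmetric])
   show "c j * fourier_integral (- \<alpha>) (\<lambda>\<xi>. d k j (x, \<xi>)) (y - x) = of_nat (p choose j) * of_real (y $ k - x $ k) ^ j * of_real (x $ k - z $ k) ^ (p - j) * fourier_integral (- \<alpha>) (\<lambda>\<xi>. b (x, \<xi>)) (y - x)"
    unfolding fourier_d[OF jm] c_def mult.assoc e by (simp only: of_real_power mult_ac)
  qed simp
  also have "(\<Sum>j\<le>p. of_nat (p choose j) * of_real (y $ k - x $ k) ^ j * of_real (x $ k - z $ k) ^ (p - j)) = (of_real (y $ k - x $ k) + of_real (x $ k - z $ k) :: complex) ^ p"
   by (rule binomial_ring[symmetric])
  also have "(of_real (y $ k - x $ k) + of_real (x $ k - z $ k) :: complex) ^ p = of_real ((y $ k - z $ k) ^ p)"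
   unfolding of_real_add[symmetric] of_real_power[symmetric] by simp
  finally show ?thesis .
 qed
 show ?thesis unfolding gen[OF p] using gen[of 0] by simp
qed

lemma amplitude_line_bound:
 assumes p: "p \<le> m" and \<alpha>: "\<alpha> \<noteq> 0" and h: "h = 1 / (\<bar>\<alpha>\<bar> * \<rho>)" and \<delta>: "0 < \<delta>" "\<delta> \<le> h"
  and x: "x \<in> cube z \<delta>" "x $ i = z $ i" and \<xi>: "\<xi> \<in> ball \<mu> \<rho>"
 shows "line_bound n (2 ^ p * h ^ p * A) ((1 + real m) / h + 1 / l) {0..\<delta>} (\<lambda>t. amplitude \<alpha> k p z (x + t *\<^sub>R axis i 1) \<xi>)"
proof -
 let ?L = "(1 + real m) / h + 1 / l"
 have hp: "h > 0" using h \<alpha> \<rho>_pos by simp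
 have cis: "line_bound n 1 (1 / h) {0..\<delta>} (\<lambda>t. cis (- (\<alpha> * ((x + t *\<^sub>R axis i 1) \<bullet> (\<xi> - \<mu>)))))"
 proof -
  have "\<bar>(\<xi> - \<mu>) $ i\<bar> \<le> \<rho>"
   using component_le_norm_cart[of "\<xi> - \<mu>" i] \<xi> by (simp add: dist_norm norm_minus_commute)
  then have "\<bar>\<alpha>\<bar> * \<bar>(\<xi> - \<mu>) $ i\<bar> \<le> \<bar>\<alpha>\<bar> * \<rho>" by (rule mult_left_mono) simp
  then have "\<bar>- (\<alpha> * (\<xi> - \<mu>) $ i)\<bar> \<le> 1 / h" by (simp add: h abs_mult)
  moreover have "- (\<alpha> * ((x + t *\<^sub>R axis i 1) \<bullet> (\<xi> - \<mu>))) = - (\<alpha> * (\<xi> - \<mu>) $ i) * t + - (\<alpha> * (x \<bullet> (\<xi> - \<mu>)))" for t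
   unfolding inner_add_left inner_scaleR_left inner_axis' by (simp add: algebra_simps)
  ultimately show ?thesis using line_bound_cis[of "- (\<alpha> * (\<xi> - \<mu>) $ i)" "1 / h" n "{0..\<delta>}" "- (\<alpha> * (x \<bullet> (\<xi> - \<mu>)))"]
   by (simp only:)
 qed
 have coord: "line_bound n h (1 / h) {0..\<delta>} (\<lambda>t. of_real ((x + t *\<^sub>R axis i 1) $ k - z $ k))"
 proof (cases "k = i")
  case True
  have "line_bound n h (1 / h) {0..\<delta>} (\<lambda>t. of_real t)"
   using hp \<delta> by (intro line_bound_ident) auto
  then show ?thesis using True x(2) by (simp add: axis_def)
 next
  case False
  have "\<bar>x $ k - z $ k\<bar> \<le> h" using x(1) \<delta> by (auto simp: cube_def abs_le_iff dest!: spec[of _ k])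
  then have "line_bound n h (1 / h) {0..\<delta>} (\<lambda>_. of_real (x $ k - z $ k))"
   using hp by (intro line_bound_const) (auto simp: norm_of_real simp del: of_real_diff)
  then show ?thesis using False by (simp add: axis_def)
 qed
 have summand: "line_bound n (real (p choose j) * (h ^ p * A)) (real m / h + 1 / l) {0..\<delta>}
   (\<lambda>t. (of_nat (p choose j) * of_real (((x + t *\<^sub>R axis i 1) $ k - z $ k) ^ (p - j)) * (\<i> / of_real \<alpha>) ^ j) * d k j (x + t *\<^sub>R axis i 1, \<xi>))"
  if "j \<in> {..p}" for j
 proof -
  have j: "j \<le> p" "j \<le> m" using that p by auto
  have 1: "line_bound n (h ^ (p - j)) (real (p - j) * (1 / h)) {0..\<delta>} (\<lambda>t. of_real ((x + t *\<^sub>R axis i 1) $ k - z $ k) ^ (p - j))"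
   using hp by (intro line_bound_power coord) auto
  have 2: "line_bound n (A * (1 / \<rho>) ^ j) (1 / l) {0..\<delta>} (\<lambda>t. d k j (x + t *\<^sub>R axis i 1, \<xi>))"
   by (rule line_bound_subset[OF d_line[OF j(2)]]) simp
  have 3: "line_bound n (h ^ (p - j) * (A * (1 / \<rho>) ^ j)) (real (p - j) * (1 / h) + 1 / l) {0..\<delta>}
    (\<lambda>t. of_real ((x + t *\<^sub>R axis i 1) $ k - z $ k) ^ (p - j) * d k j (x + t *\<^sub>R axis i 1, \<xi>))"
   using hp A_nonneg \<rho>_pos l_pos by (intro line_bound_mult 1 2) auto
  define c where "c = of_nat (p choose j) * (\<i> / complex_of_real \<alpha>) ^ j"
  have c: "cmod c = real (p choose j) * (1 / \<bar>\<alpha>\<bar>) ^ j"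
   by (simp add: c_def norm_mult norm_power norm_divide)
  have 4: "line_bound n (cmod c * (h ^ (p - j) * (A * (1 / \<rho>) ^ j))) (real (p - j) * (1 / h) + 1 / l) {0..\<delta>}
    (\<lambda>t. c * (of_real ((x + t *\<^sub>R axis i 1) $ k - z $ k) ^ (p - j) * d k j (x + t *\<^sub>R axis i 1, \<xi>)))"
   using hp A_nonneg \<rho>_pos l_pos by (intro line_bound_cmult 3) auto
  have "cmod c * (h ^ (p - j) * (A * (1 / \<rho>) ^ j)) = real (p choose j) * (h ^ p * A)"
  proof -
   have "(1 / \<bar>\<alpha>\<bar>) ^ j * (1 / \<rho>) ^ j = h ^ j" unfolding power_mult_distrib[symmetric] by (simp add: h)
   moreover have "h ^ (p - j) * h ^ j = h ^ p" using j by (simp flip: power_add)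
   moreover have "cmod c * (h ^ (p - j) * (A * (1 / \<rho>) ^ j)) = real (p choose j) * ((h ^ (p - j) * ((1 / \<bar>\<alpha>\<bar>) ^ j * (1 / \<rho>) ^ j)) * A)"
    unfolding c by (simp only: mult_ac)
   ultimately show ?thesis by (simp only:)
  qed
  note 5 = 4[unfolded this]
  have "line_bound n (real (p choose j) * (h ^ p * A)) (real m / h + 1 / l) {0..\<delta>}
    (\<lambda>t. c * (of_real ((x + t *\<^sub>R axis i 1) $ k - z $ k) ^ (p - j) * d k j (x + t *\<^sub>R axis i 1, \<xi>)))"
   using hp A_nonneg l_pos p j by (intro line_bound_mono[OF 5]) (auto intro!: divide_right_mono)
  then show ?thesis unfolding c_def of_real_power by (simp only: mult_ac)
 qed
 have "line_bound n (\<Sum>j\<le>p. real (p choose j) * (h ^ p * A)) (real m / h + 1 / l) {0..\<delta>}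
   (\<lambda>t. \<Sum>j\<le>p. (of_nat (p choose j) * of_real (((x + t *\<^sub>R axis i 1) $ k - z $ k) ^ (p - j)) * (\<i> / of_real \<alpha>) ^ j) * d k j (x + t *\<^sub>R axis i 1, \<xi>))"
  using hp l_pos by (intro line_bound_sum summand) auto
 moreover have "(\<Sum>j\<le>p. real (p choose j) * (h ^ p * A)) = 2 ^ p * h ^ p * A"
  unfolding sum_distrib_right[symmetric] of_nat_sum[symmetric] choose_row_sum by simp
 ultimately have "line_bound n (1 * (2 ^ p * h ^ p * A)) (1 / h + (real m / h + 1 / l)) {0..\<delta>} (\<lambda>t. amplitude \<alpha> k p z (x + t *\<^sub>R axis i 1) \<xi>)"
  unfolding amplitude_def using hp A_nonneg l_pos by (intro line_bound_mult cis) (auto simp only:, auto)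
 then show ?thesis by (simp add: add_divide_distrib add.assoc)
qed

text \<open>
 By Plancherel's theorem, multiplying row \<open>x\<close> by \<open>(y\<^sub>k - z\<^sub>k)\<^sup>m\<close> amounts to using the amplitude of order \<open>m\<close>.  If the amplitudes of
 all orders \<open>p \<le> m\<close> are approximated up to \<open>\<epsilon> h\<^sup>p\<close>, the error of the row therefore gains the factor \<open>(1 + \<kappa>)\<^sup>-\<^sup>m\<close> on a set
 whose distance from \<open>z\<close> is at least of order \<open>\<kappa> h\<close>.
\<close>

lemma row_approximation:
 fixes pt :: "'c => real^'n" and w :: "'c => real"
 assumes \<alpha>: "\<alpha> \<noteq> 0" and h: "h = 1 / (\<bar>\<alpha>\<bar> * \<rho>)" and X: "finite X" and \<epsilon>: "0 \<le> \<epsilon>"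
  and ap: "\<And>p k \<xi>. p \<le> m ==> \<xi> \<in> ball \<mu> \<rho> ==>
   cmod (amplitude \<alpha> k p z x \<xi> - (\<Sum>f\<in>X. of_real (w f) * amplitude \<alpha> k p z (pt f) \<xi>)) \<le> \<epsilon> * h ^ p"
  and S: "S \<in> sets borel" and far: "\<And>y. y \<in> S ==> (1 + \<kappa>) * h \<le> G * (norm (y - z) + h)" and G: "0 \<le> G" and \<kappa>: "0 \<le> \<kappa>"
 shows "(norm (blinfun_apply (chi_op S) (blinfun_apply (FT (- \<alpha>)) (abs_L2 (\<lambda>\<xi>. cis (- (\<alpha> * (x \<bullet> (\<xi> - \<mu>)))) * b (x, \<xi>)
   - (\<Sum>f\<in>X. of_real (w f) * (cis (- (\<alpha> * (pt f \<bullet> (\<xi> - \<mu>)))) * b (pt f, \<xi>))))))))\<^sup>2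
  \<le> (2 * G) ^ (2 * m) * (real CARD('n) ^ (2 * m + 1) + 1) * \<epsilon>\<^sup>2 * (unit_ball_vol (real CARD('n)) * \<rho> ^ CARD('n)) / (1 + \<kappa>) ^ (2 * m)"
proof -
 let ?V = "unit_ball_vol (real CARD('n)) * \<rho> ^ CARD('n)"
 have hp: "h > 0" using h \<alpha> \<rho>_pos by simp
 have \<alpha>': "- \<alpha> \<noteq> 0" using \<alpha> by simp
 define e where "e k p \<xi> = amplitude \<alpha> k p z x \<xi> - (\<Sum>f\<in>X. of_real (w f) * amplitude \<alpha> k p z (pt f) \<xi>)" for k p \<xi>
 have em: "e k p \<in> borel_measurable borel" if "p \<le> m" for k p
  unfolding e_def[abs_def]
  by (intro borel_measurable_diff borel_measurable_sum borel_measurable_times borel_measurable_const amplitude_measurable that)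
 have eb: "cmod (e k p \<xi>) \<le> \<epsilon> * h ^ p * indicator (ball \<mu> \<rho>) \<xi>" if "p \<le> m" for k p \<xi>
  using ap[OF that, of \<xi> k] amplitude_outside[OF that, of \<xi>] by (cases "\<xi> \<in> ball \<mu> \<rho>") (auto simp: e_def)
 have e0: "0 \<le> \<epsilon> * h ^ p" for p using \<epsilon> hp by simp
 have eL: "L12 (e k p)" and eN: "(norm (abs_L2 (e k p)))\<^sup>2 \<le> (\<epsilon> * h ^ p)\<^sup>2 * ?V" if "p \<le> m" for k p
  using L12_bounded_ball[OF em[OF that] eb[OF that] e0 less_imp_le[OF \<rho>_pos]] by auto
 define F where "F k p = fourier_fun (- \<alpha>) (e k p)" for k p
 have Fs: "square_integrable (F k p)" if "p \<le> m" for k p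
  unfolding F_def by (rule fourier_fun_square_integrable(1)[OF eL[OF that] \<alpha>'])
 have FN: "(LINT y|lborel. (cmod (F k p y))\<^sup>2) \<le> (\<epsilon> * h ^ p)\<^sup>2 * ?V" if "p \<le> m" for k p
 proof -
  have "(norm (abs_L2 (F k p)))\<^sup>2 \<le> (norm (abs_L2 (e k p)))\<^sup>2"
   unfolding F_def by (intro power_mono fourier_fun_square_integrable(2)[OF eL[OF that] \<alpha>']) simp
  then show ?thesis using eN[OF that, of k] by (simp add: norm_abs_L2_sq[OF Fs[OF that]])
 qed
 have aL: "integrable lborel (amplitude \<alpha> k p z v)" if "p \<le> m" for k p v
 proof -
  have 1: "(\<lambda>\<xi>. cis (- (\<alpha> * (v \<bullet> (\<xi> - \<mu>)))) * ((of_nat (p choose j) * of_real ((v $ k - z $ k) ^ (p - j)) * (\<i> / of_real \<alpha>) ^ j) * d k j (v, \<xi>))) \<in> borel_measurable borel" if "j \<le> m" for j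
   by (intro borel_measurable_times borel_measurable_const d_row_measurable[OF that] borel_measurable_continuous_onI continuous_intros)
  have "integrable lborel (\<lambda>\<xi>. cis (- (\<alpha> * (v \<bullet> (\<xi> - \<mu>)))) * ((of_nat (p choose j) * of_real ((v $ k - z $ k) ^ (p - j)) * (\<i> / of_real \<alpha>) ^ j) * d k j (v, \<xi>)))" if "j \<le> m" for j
  proof (rule Bochner_Integration.integrable_bound)
   show "integrable lborel (\<lambda>\<xi>. (of_nat (p choose j) * of_real ((v $ k - z $ k) ^ (p - j)) * (\<i> / of_real \<alpha>) ^ j) * d k j (v, \<xi>))"
    using d_row_L12[OF that, of k v] by (intro integrable_mult_right) (simp add: L12_def)
  qed (use 1[OF that] in \<open>auto simp: norm_mult\<close>)
  then show ?thesis
   unfolding amplitude_def[abs_def] sum_distrib_left using \<open>p \<le> m\<close> by (intro Bochner_Integration.integrable_sum) auto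
 qed
 have Fp: "F k p y = of_real ((y $ k - z $ k) ^ p) * F k 0 y" if p: "p \<le> m" for k p y
 proof -
  have "fourier_integral (- \<alpha>) (e k p) y = fourier_integral (- \<alpha>) (amplitude \<alpha> k p z x) y - (\<Sum>f\<in>X. of_real (w f) * fourier_integral (- \<alpha>) (amplitude \<alpha> k p z (pt f)) y)"
   if p: "p \<le> m" for p
  proof -
   have i: "integrable lborel (\<lambda>\<xi>. \<Sum>f\<in>X. of_real (w f) * amplitude \<alpha> k p z (pt f) \<xi>)"
    by (intro Bochner_Integration.integrable_sum integrable_mult_right aL p)
   have "fourier_integral (- \<alpha>) (e k p) y = fourier_integral (- \<alpha>) (amplitude \<alpha> k p z x) y - fourier_integral (- \<alpha>) (\<lambda>\<xi>. \<Sum>f\<in>X. of_real (w f) * amplitude \<alpha> k p z (pt f) \<xi>) y"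
    unfolding fourier_integral_def e_def right_diff_distrib
    by (intro Bochner_Integration.integral_diff integrable_cis_mult(1) aL p i)
   then show ?thesis by (simp only: fourier_integral_sum[OF X aL[OF p]])
  qed
  note lin = this
  have "fourier_integral (- \<alpha>) (e k p) y = of_real ((y $ k - z $ k) ^ p) * fourier_integral (- \<alpha>) (e k 0) y"
   unfolding lin[OF p] lin[OF le0] fourier_amplitude[OF p \<alpha>] by (simp add: right_diff_distrib sum_distrib_left mult.left_commute)
  then show ?thesis by (simp add: F_def fourier_fun_def mult.left_commute)
 qed
 obtain k0 :: 'n where True by blast
 define g where "g = F k0 0"
 have e_indep: "e k 0 = e k0 0" for k by (simp add: e_def[abs_def] amplitude_0)
 have gF: "F k 0 = g" for k by (simp add: g_def F_def e_indep[of k])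
 have gs: "square_integrable g" unfolding g_def by (rule Fs) simp
 have ge: "blinfun_apply (chi_op S) (blinfun_apply (FT (- \<alpha>)) (abs_L2 (e k0 0))) = abs_L2 (\<lambda>y. indicator S y * g y)"
 proof (rule L2_eqI)
  have "AE y in lborel. rep_L2 (blinfun_apply (FT (- \<alpha>)) (abs_L2 (e k0 0))) y = g y"
   using AE_rep_FT_abs[OF eL[OF le0] \<alpha>'] by (simp add: g_def F_def)
  then show "AE y in lborel. rep_L2 (blinfun_apply (chi_op S) (blinfun_apply (FT (- \<alpha>)) (abs_L2 (e k0 0)))) y = rep_L2 (abs_L2 (\<lambda>y. indicator S y * g y)) y"
   using AE_rep_chi_op[OF S, of "blinfun_apply (FT (- \<alpha>)) (abs_L2 (e k0 0))"] AE_rep_abs[OF square_integrable_indicator[OF S gs]]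
   by eventually_elim simp
 qed
 let ?D = "real CARD('n)"
 have point: "((1 + \<kappa>) * h) ^ (2 * m) * (cmod (indicator S y * g y))\<^sup>2
   \<le> (2 * G) ^ (2 * m) * (?D ^ (2 * m) * (\<Sum>k\<in>UNIV. (cmod (F k m y))\<^sup>2) + h ^ (2 * m) * (cmod (g y))\<^sup>2)" for y
 proof (cases "y \<in> S")
  case True
  have wF: "\<bar>(y - z) $ k\<bar> ^ (2 * m) * (cmod (g y))\<^sup>2 = (cmod (F k m y))\<^sup>2" for k
   unfolding Fp[OF order_refl] gF norm_mult norm_of_real power_abs power_mult_distrib
   by (simp add: power_mult[symmetric] mult.commute power_even_abs)
  have "((1 + \<kappa>) * h) ^ (2 * m) \<le> (G * (norm (y - z) + h)) ^ (2 * m)"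
   using far[OF True] \<kappa> hp by (intro power_mono) auto
  also have "... \<le> (G * (2 * max (norm (y - z)) h)) ^ (2 * m)"
   using hp G by (intro power_mono mult_left_mono) auto
  also have "... = (2 * G) ^ (2 * m) * max (norm (y - z)) h ^ (2 * m)" by (simp add: power_mult_distrib mult_ac)
  also have "... \<le> (2 * G) ^ (2 * m) * (norm (y - z) ^ (2 * m) + h ^ (2 * m))"
   using G hp by (intro mult_left_mono) (auto simp: max_def)
  also have "... \<le> (2 * G) ^ (2 * m) * (?D ^ (2 * m) * (\<Sum>k\<in>UNIV. \<bar>(y - z) $ k\<bar> ^ (2 * m)) + h ^ (2 * m))"
   using G by (intro mult_left_mono add_right_mono norm_power_le_sum_coordinates) auto
  finally have "((1 + \<kappa>) * h) ^ (2 * m) * (cmod (g y))\<^sup>2 \<le> (2 * G) ^ (2 * m) * (?D ^ (2 * m) * (\<Sum>k\<in>UNIV. \<bar>(y - z) $ k\<bar> ^ (2 * m)) + h ^ (2 * m)) * (cmod (g y))\<^sup>2"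
   by (rule mult_right_mono) simp
  also have "... = (2 * G) ^ (2 * m) * (?D ^ (2 * m) * (\<Sum>k\<in>UNIV. \<bar>(y - z) $ k\<bar> ^ (2 * m) * (cmod (g y))\<^sup>2) + h ^ (2 * m) * (cmod (g y))\<^sup>2)"
   by (simp add: sum_distrib_right distrib_right mult.assoc)
  finally show ?thesis using True by (simp only: wF indicator_simps mult_1_left)
 next
  case False
  have "0 \<le> (2 * G) ^ (2 * m) * (?D ^ (2 * m) * (\<Sum>k\<in>UNIV. (cmod (F k m y))\<^sup>2) + h ^ (2 * m) * (cmod (g y))\<^sup>2)"
   using G hp by (intro mult_nonneg_nonneg add_nonneg_nonneg sum_nonneg) auto
  then show ?thesis using False by simp
 qed
 have iF: "integrable lborel (\<lambda>y. (cmod (F k m y))\<^sup>2)" for k using Fs[of m k] by (simp add: square_integrable_def)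
 have ig: "integrable lborel (\<lambda>y. (cmod (g y))\<^sup>2)" using gs by (simp add: square_integrable_def)
 have isi: "square_integrable (\<lambda>y. indicator S y * g y)" by (rule square_integrable_indicator[OF S gs])
 have "((1 + \<kappa>) * h) ^ (2 * m) * (LINT y|lborel. (cmod (indicator S y * g y))\<^sup>2)
   = (LINT y|lborel. ((1 + \<kappa>) * h) ^ (2 * m) * (cmod (indicator S y * g y))\<^sup>2)" by (rule integral_mult_right_zero[symmetric])
 also have "... \<le> (LINT y|lborel. (2 * G) ^ (2 * m) * (?D ^ (2 * m) * (\<Sum>k\<in>UNIV. (cmod (F k m y))\<^sup>2) + h ^ (2 * m) * (cmod (g y))\<^sup>2))"
 proof (rule integral_mono[OF _ _ point])
  show "integrable lborel (\<lambda>y. ((1 + \<kappa>) * h) ^ (2 * m) * (cmod (indicator S y * g y))\<^sup>2)"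
   using isi unfolding square_integrable_def by (intro integrable_mult_right) blast
  show "integrable lborel (\<lambda>y. (2 * G) ^ (2 * m) * (?D ^ (2 * m) * (\<Sum>k\<in>UNIV. (cmod (F k m y))\<^sup>2) + h ^ (2 * m) * (cmod (g y))\<^sup>2))"
   by (intro integrable_mult_right Bochner_Integration.integrable_add Bochner_Integration.integrable_sum iF ig)
 qed
 also have "... = (2 * G) ^ (2 * m) * (?D ^ (2 * m) * (\<Sum>k\<in>UNIV. LINT y|lborel. (cmod (F k m y))\<^sup>2) + h ^ (2 * m) * (LINT y|lborel. (cmod (g y))\<^sup>2))"
  by (simp add: Bochner_Integration.integral_add integrable_mult_right Bochner_Integration.integrable_sum iF ig Bochner_Integration.integral_sum)
 also have "... \<le> (2 * G) ^ (2 * m) * (?D ^ (2 * m) * (\<Sum>k\<in>(UNIV :: 'n set). (\<epsilon> * h ^ m)\<^sup>2 * ?V) + h ^ (2 * m) * ((\<epsilon> * h ^ 0)\<^sup>2 * ?V))"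
  unfolding g_def using G hp by (intro mult_left_mono add_mono sum_mono FN) auto
 also have "... = h ^ (2 * m) * ((2 * G) ^ (2 * m) * (?D ^ (2 * m + 1) + 1) * \<epsilon>\<^sup>2 * ?V)"
 proof -
  have hh: "(\<epsilon> * h ^ m)\<^sup>2 = h ^ (2 * m) * \<epsilon>\<^sup>2" "(\<epsilon> * h ^ 0)\<^sup>2 = \<epsilon>\<^sup>2"
   unfolding power_mult_distrib power_mult[symmetric] mult.commute[of m 2] by simp_all
  show ?thesis
   unfolding hh sum_constant power_add power_one_right by (simp only: algebra_simps)
 qed
 finally have "h ^ (2 * m) * ((1 + \<kappa>) ^ (2 * m) * (LINT y|lborel. (cmod (indicator S y * g y))\<^sup>2))
   \<le> h ^ (2 * m) * ((2 * G) ^ (2 * m) * (?D ^ (2 * m + 1) + 1) * \<epsilon>\<^sup>2 * ?V)"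
  by (simp only: power_mult_distrib mult_ac)
 then have "(1 + \<kappa>) ^ (2 * m) * (LINT y|lborel. (cmod (indicator S y * g y))\<^sup>2) \<le> (2 * G) ^ (2 * m) * (?D ^ (2 * m + 1) + 1) * \<epsilon>\<^sup>2 * ?V"
  by (rule mult_left_le_imp_le) (use hp in simp)
 moreover have "(1 + \<kappa>) ^ (2 * m) > 0" using \<kappa> by (intro zero_less_power) simp
 ultimately have "(LINT y|lborel. (cmod (indicator S y * g y))\<^sup>2) \<le> (2 * G) ^ (2 * m) * (?D ^ (2 * m + 1) + 1) * \<epsilon>\<^sup>2 * ?V / (1 + \<kappa>) ^ (2 * m)"
  by (simp add: pos_le_divide_eq mult.commute)
 moreover have "e k0 0 = (\<lambda>\<xi>. cis (- (\<alpha> * (x \<bullet> (\<xi> - \<mu>)))) * b (x, \<xi>) - (\<Sum>f\<in>X. of_real (w f) * (cis (- (\<alpha> * (pt f \<bullet> (\<xi> - \<mu>)))) * b (pt f, \<xi>))))"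
  by (simp add: e_def[abs_def] amplitude_0)
 ultimately show ?thesis using ge norm_abs_L2_sq[OF isi] by simp
qed

end

section \<open>Approximation on a partition into cubes\<close>

text \<open>
 On a set \<open>X p\<close> where the rows \<open>K x\<close> stay close to a space of dimension \<open>card (J p)\<close>, the operator is approximated with
 that many dimensions; integrating the squared distance of the rows gives the Hilbert-Schmidt error.  For
 disjoint pieces both the dimensions and the errors add up.
\<close>

lemma rank_approx_pieces:
 fixes B :: "'a::euclidean_space L2_op" and X :: "'p => 'a set" and q :: "'p => 'j => 'a => complex"
 assumes P: "finite P" and J: "\<And>p. p \<in> P ==> finite (J p)"
  and X: "\<And>p. p \<in> P ==> X p \<in> sets borel" "\<And>p. p \<in> P ==> emeasure lborel (X p) < \<infinity>" and disj: "disjoint_family_on X P"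
  and rep: "\<And>v. AE x in lborel. rep_L2 (blinfun_apply B v) x = cinner v (K x)"
  and K0: "\<And>x. x \<notin> (\<Union>p\<in>P. X p) ==> K x = 0"
  and q: "\<And>p j. p \<in> P ==> j \<in> J p ==> square_integrable (\<lambda>x. indicator (X p) x * q p j x)"
  and ap: "\<And>p x. p \<in> P ==> x \<in> X p ==> (norm (K x - (\<Sum>j\<in>J p. scaleC (cnj (q p j x)) (k p j))))\<^sup>2 \<le> \<epsilon> p"
 shows "\<exists>r\<le>\<Sum>p\<in>P. card (J p). rank_approx B r (\<Sum>p\<in>P. \<epsilon> p * measure lborel (X p))"
proof -
 define e where "e = (\<lambda>(p, j). abs_L2 (\<lambda>x. indicator (X p) x * q p j x))"
 define g where "g v i = (\<lambda>(p, j). cinner (v i) (k p j))" for v :: "nat => 'a L2" and i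
 let ?I = "Sigma P J"
 have I: "finite ?I" using P J by simp
 have "\<exists>r\<le>card ?I. rank_approx B r (\<Sum>p\<in>P. \<epsilon> p * measure lborel (X p))"
 proof (rule rank_approxI[OF I, where g = g and e = e])
  fix N and v :: "nat => 'a L2" assume v: "orthonormal v N"
  define E where "E i = blinfun_apply B (v i) - (\<Sum>pj\<in>?I. scaleC (g v i pj) (e pj))" for i
  define H where "H x = (\<Sum>p\<in>P. \<epsilon> p * indicator (X p) x)" for x
  have sumrep: "AE x in lborel. rep_L2 (\<Sum>pj\<in>?I. scaleC (g v i pj) (e pj)) x = (\<Sum>(p, j)\<in>?I. cinner (v i) (k p j) * (indicator (X p) x * q p j x))" for i
  proof -
   have s: "square_integrable (case pj of (p, j) => \<lambda>x. cinner (v i) (k p j) * (indicator (X p) x * q p j x))" if "pj \<in> ?I" for pj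
    using that q by (auto intro!: square_integrable_scale)
   have "(\<Sum>pj\<in>?I. scaleC (g v i pj) (e pj)) = (\<Sum>pj\<in>?I. abs_L2 (case pj of (p, j) => \<lambda>x. cinner (v i) (k p j) * (indicator (X p) x * q p j x)))"
    by (rule sum.cong) (auto simp: e_def g_def abs_L2_scaleC q)
   also have "... = abs_L2 (\<lambda>x. \<Sum>pj\<in>?I. (case pj of (p, j) => \<lambda>x. cinner (v i) (k p j) * (indicator (X p) x * q p j x)) x)"
    by (rule abs_L2_sum(2)[OF I s, symmetric])
   finally have "(\<Sum>pj\<in>?I. scaleC (g v i pj) (e pj)) = ..." .
   then show ?thesis
    using AE_rep_abs[OF abs_L2_sum(1)[OF I s]] by (simp add: case_prod_beta')
  qed
  have "AE x in lborel. \<forall>i<N. rep_L2 (E i) x = cinner (v i) (K x) - (\<Sum>(p, j)\<in>?I. cinner (v i) (k p j) * (indicator (X p) x * q p j x))"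
   unfolding AE_all_countable
  proof
   fix i
   show "AE x in lborel. i < N \<longrightarrow> rep_L2 (E i) x = cinner (v i) (K x) - (\<Sum>(p, j)\<in>?I. cinner (v i) (k p j) * (indicator (X p) x * q p j x))"
    using AE_rep_diff[of "blinfun_apply B (v i)" "\<Sum>pj\<in>?I. scaleC (g v i pj) (e pj)"] rep[of "v i"] sumrep[of i]
    unfolding E_def by eventually_elim simp
  qed
  then have point: "AE x in lborel. (\<Sum>i<N. (cmod (rep_L2 (E i) x))\<^sup>2) \<le> H x"
  proof eventually_elim
   case (elim x)
   show ?case
   proof (cases "x \<in> (\<Union>p\<in>P. X p)")
    case True
    then obtain p where p: "p \<in> P" "x \<in> X p" by blast
    have other: "x \<notin> X p'" if "p' \<in> P" "p' \<noteq> p" for p'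
     using disj p that unfolding disjoint_family_on_def by blast
    have "(\<Sum>(p', j)\<in>?I. cinner (v i) (k p' j) * (indicator (X p') x * q p' j x)) = (\<Sum>j\<in>J p. cinner (v i) (k p j) * q p j x)" for i
    proof -
     have "(\<Sum>(p', j)\<in>?I. cinner (v i) (k p' j) * (indicator (X p') x * q p' j x)) = (\<Sum>p'\<in>P. \<Sum>j\<in>J p'. cinner (v i) (k p' j) * (indicator (X p') x * q p' j x))"
      using P J by (simp add: sum.Sigma)
     also have "... = (\<Sum>p'\<in>P. if p' = p then \<Sum>j\<in>J p. cinner (v i) (k p j) * q p j x else 0)"
      by (rule sum.cong) (use other p in auto)
     also have "... = (\<Sum>j\<in>J p. cinner (v i) (k p j) * q p j x)" using p P by simp
     finally show ?thesis .
    qed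
    then have "rep_L2 (E i) x = cinner (v i) (K x - (\<Sum>j\<in>J p. scaleC (cnj (q p j x)) (k p j)))" if "i < N" for i
     using elim that by (simp add: cinner_diff_right cinner_sum_right cinner_scaleC_right mult.commute)
    then have "(\<Sum>i<N. (cmod (rep_L2 (E i) x))\<^sup>2) = (\<Sum>i<N. (cmod (cinner (K x - (\<Sum>j\<in>J p. scaleC (cnj (q p j x)) (k p j))) (v i)))\<^sup>2)"
     by (intro sum.cong refl) (simp, metis cinner_cnj complex_mod_cnj)
    also have "... \<le> (norm (K x - (\<Sum>j\<in>J p. scaleC (cnj (q p j x)) (k p j))))\<^sup>2" by (rule Bessel_inequality[OF v])
    also have "... \<le> \<epsilon> p" by (rule ap[OF p])
    also have "\<epsilon> p = (\<Sum>p'\<in>P. if p' = p then \<epsilon> p else 0)" using p P by simp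
    also have "... = H x" unfolding H_def by (rule sum.cong) (use other p in auto)
    finally show ?thesis .
   next
    case False
    then have ind: "indicator (X p) x = (0 :: complex)" "indicator (X p) x = (0 :: real)" if "p \<in> P" for p using that by auto
    have "rep_L2 (E i) x = 0" if "i < N" for i
     using elim that K0[OF False] by (auto intro!: sum.neutral simp: ind)
    then show ?thesis by (simp add: H_def ind)
   qed
  qed
  have iE: "integrable lborel (\<lambda>x. (cmod (rep_L2 (E i) x))\<^sup>2)" for i
   using square_integrable_rep[of "E i"] by (simp add: square_integrable_def)
  have iH: "integrable lborel (\<lambda>x. \<epsilon> p * indicat_real (X p) x)" if "p \<in> P" for p
   using X[OF that] by (intro integrable_mult_right integrable_real_indicator) auto
  have "(\<Sum>i<N. (norm (E i))\<^sup>2) = (LINT x|lborel. (\<Sum>i<N. (cmod (rep_L2 (E i) x))\<^sup>2))"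
   unfolding norm_L2_sq by (subst Bochner_Integration.integral_sum) (auto intro: iE)
  also have "... \<le> (LINT x|lborel. H x)"
   unfolding H_def by (intro integral_mono_AE Bochner_Integration.integrable_sum iE iH point[unfolded H_def])
  also have "... = (\<Sum>p\<in>P. LINT x|lborel. \<epsilon> p * indicat_real (X p) x)"
   unfolding H_def by (rule Bochner_Integration.integral_sum) (rule iH)
  also have "... = (\<Sum>p\<in>P. \<epsilon> p * measure lborel (X p))"
   by (rule sum.cong) (use X in \<open>auto simp: less_top\<close>)
  finally show "(\<Sum>i<N. (norm (blinfun_apply B (v i) - (\<Sum>j\<in>?I. scaleC (g v i j) (e j))))\<^sup>2) \<le> (\<Sum>p\<in>P. \<epsilon> p * measure lborel (X p))"
   unfolding E_def .
 qed
 then show ?thesis using P J by (simp add: card_SigmaI)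
qed

context nice_symbol
begin

definition row :: "real => real^'n => (real^'n) L2" where
 "row \<alpha> x = abs_L2 (\<lambda>\<xi>. cis (- (\<alpha> * (x \<bullet> (\<xi> - \<mu>)))) * b (x, \<xi>))"

lemma row_L12: "L12 (\<lambda>\<xi>. cis (- (\<alpha> * (x \<bullet> (\<xi> - \<mu>)))) * b (x, \<xi>))"
proof -
 have "L12 (amplitude \<alpha> undefined 0 undefined x)"
 proof (rule L12_bounded_ball(1))
  show "amplitude \<alpha> undefined 0 undefined x \<in> borel_measurable borel" by (rule amplitude_measurable) simp
  show "cmod (amplitude \<alpha> undefined 0 undefined x \<xi>) \<le> A * indicator (ball \<mu> \<rho>) \<xi>" for \<xi>
   using d_bound_ball[of 0 undefined x \<xi>] by (simp add: amplitude_0 norm_mult d_zero)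
 qed (use A_nonneg \<rho>_pos in auto)
 then show ?thesis by (simp add: amplitude_0[abs_def])
qed

lemma row_combination:
 assumes "finite X"
 shows "abs_L2 (\<lambda>\<xi>. cis (- (\<alpha> * (x \<bullet> (\<xi> - \<mu>)))) * b (x, \<xi>)
   - (\<Sum>f\<in>X. of_real (w f) * (cis (- (\<alpha> * (pt f \<bullet> (\<xi> - \<mu>)))) * b (pt f, \<xi>))))
  = row \<alpha> x - (\<Sum>f\<in>X. scaleC (of_real (w f)) (row \<alpha> (pt f)))"
proof -
 have s: "square_integrable (\<lambda>\<xi>. cis (- (\<alpha> * (x \<bullet> (\<xi> - \<mu>)))) * b (x, \<xi>))" for x
  using row_L12 by (simp add: L12_def)
 have s2: "square_integrable (\<lambda>\<xi>. of_real (w f) * (cis (- (\<alpha> * (pt f \<bullet> (\<xi> - \<mu>)))) * b (pt f, \<xi>)))" for f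
  by (rule square_integrable_scale[OF s])
 show ?thesis
  unfolding row_def abs_L2_scaleC[OF s] abs_L2_sum(2)[OF assms s2, symmetric]
  by (rule abs_L2_diff[OF s abs_L2_sum(1)[OF assms s2], symmetric])
qed

lemma row_zero: "x \<notin> ball u l ==> row \<alpha> x = 0"
proof -
 assume "x \<notin> ball u l"
 then have "b (x, \<xi>) = 0" for \<xi> using d_supp[of 0 undefined x \<xi>] by (auto simp: d_zero)
 then show ?thesis by (simp add: row_def abs_L2_zero)
qed

text \<open>
 The vector representing the functional \<open>v \<mapsto> (B v)(x)\<close> for the operator \<open>B\<close> cut off by \<open>S\<close> on the left and by \<open>S'\<close> on the right.
 The phase \<open>exp (- i \<alpha> x \<bullet> \<mu>)\<close> is separated because it need not be approximated: it enters the approximating functions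
 as a factor, and what remains oscillates in \<open>x\<close> only with frequency \<open>|\<alpha>| \<rho>\<close>.
\<close>

definition sandwich_row :: "real => (real^'n) set => (real^'n) set => real^'n => (real^'n) L2" where
 "sandwich_row \<alpha> S S' x = scaleC (indicator S x * (of_real (sqrt (\<bar>\<alpha>\<bar> / (2 * pi)) ^ CARD('n)) * cis (- (\<alpha> * (x \<bullet> \<mu>)))))
   (blinfun_apply (chi_op S') (blinfun_apply (FT (- \<alpha>)) (row \<alpha> x)))"

lemma AE_rep_sandwich:
 assumes S: "S \<in> sets borel" and S': "S' \<in> sets borel" and \<alpha>: "\<alpha> \<noteq> 0"
 shows "AE x in lborel. rep_L2 (blinfun_apply (chi_op S o\<^sub>L left_pdo \<alpha> (\<lambda>z. cnj (b z)) o\<^sub>L chi_op S') v) x = cinner v (sandwich_row \<alpha> S S' x)"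
proof -
 let ?c = "of_real (sqrt (\<bar>\<alpha>\<bar> / (2 * pi)) ^ CARD('n)) :: complex"
 define W where "W = blinfun_apply (FT \<alpha>) (blinfun_apply (chi_op S') v)"
 note k = bounded_kernel_symbol_kernel[OF bounded_kernel_cnj[OF bounded_kernel_b], of \<alpha>]
 have row: "abs_L2 (\<lambda>\<xi>. cnj (symbol_kernel \<alpha> (\<lambda>z. cnj (b z)) (x, \<xi>))) = scaleC (?c * cis (- (\<alpha> * (x \<bullet> \<mu>)))) (row \<alpha> x)" for x
 proof -
  have "cnj (symbol_kernel \<alpha> (\<lambda>z. cnj (b z)) (x, \<xi>)) = (?c * cis (- (\<alpha> * (x \<bullet> \<mu>)))) * (cis (- (\<alpha> * (x \<bullet> (\<xi> - \<mu>)))) * b (x, \<xi>))" for \<xi>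
  proof -
   have "cis (- (\<alpha> * (x \<bullet> \<xi>))) = cis (- (\<alpha> * (x \<bullet> \<mu>))) * cis (- (\<alpha> * (x \<bullet> (\<xi> - \<mu>))))"
    by (simp add: cis_mult inner_diff_right algebra_simps)
   then show ?thesis by (simp add: symbol_kernel_def cis_cnj mult.assoc)
  qed
  then show ?thesis
   unfolding row_def using row_L12[of \<alpha> x] by (simp only: L12_def abs_L2_scaleC)
 qed
 have "cinner W (scaleC s (row \<alpha> x)) = cinner v (scaleC s (blinfun_apply (chi_op S') (blinfun_apply (FT (- \<alpha>)) (row \<alpha> x))))" for s x
  unfolding W_def cinner_scaleC_right is_adjointD[OF is_adjoint_FT[OF \<alpha>]] is_adjointD[OF is_adjoint_chi_op[OF S']] ..
 then have val: "cinner W (abs_L2 (\<lambda>\<xi>. cnj (symbol_kernel \<alpha> (\<lambda>z. cnj (b z)) (x, \<xi>))))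
   = cinner v (scaleC (?c * cis (- (\<alpha> * (x \<bullet> \<mu>)))) (blinfun_apply (chi_op S') (blinfun_apply (FT (- \<alpha>)) (row \<alpha> x))))" for x
  unfolding row .
 have "blinfun_apply (chi_op S o\<^sub>L left_pdo \<alpha> (\<lambda>z. cnj (b z)) o\<^sub>L chi_op S') v = blinfun_apply (chi_op S) (blinfun_apply (kernel_op (symbol_kernel \<alpha> (\<lambda>z. cnj (b z)))) W)"
  by (simp add: left_pdo_def W_def)
 note eq = this
 show ?thesis
  unfolding eq
  using AE_rep_chi_op[OF S, of "blinfun_apply (kernel_op (symbol_kernel \<alpha> (\<lambda>z. cnj (b z)))) W"] AE_rep_kernel_op[OF k, of W]
 proof eventually_elim
  case (elim x)
  show ?case
   unfolding elim val sandwich_row_def cinner_scaleC_right by (simp add: indicator_def)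
 qed
qed

end

lemma layer_sum:
 fixes \<psi> :: "nat => real"
 assumes Q: "finite Q" and card: "\<And>j. real (card {k \<in> Q. \<kappa> k = j}) \<le> D" and \<psi>: "summable \<psi>" "\<And>j. 0 \<le> \<psi> j"
 shows "(\<Sum>k\<in>Q. \<psi> (\<kappa> k)) \<le> D * (\<Sum>j. \<psi> j)"
proof -
 have D: "0 \<le> D" using card[of 0] of_nat_0_le_iff order_trans by blast
 have "(\<Sum>k\<in>Q. \<psi> (\<kappa> k)) = (\<Sum>j\<in>\<kappa> ` Q. \<Sum>k\<in>{k \<in> Q. \<kappa> k = j}. \<psi> (\<kappa> k))"
  by (rule sum.image_gen[OF Q])
 also have "... = (\<Sum>j\<in>\<kappa> ` Q. real (card {k \<in> Q. \<kappa> k = j}) * \<psi> j)"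
  by (rule sum.cong) auto
 also have "... \<le> (\<Sum>j\<in>\<kappa> ` Q. D * \<psi> j)" by (intro sum_mono mult_right_mono card \<psi>)
 also have "... = D * (\<Sum>j\<in>\<kappa> ` Q. \<psi> j)" by (rule sum_distrib_left[symmetric])
 also have "... \<le> D * (\<Sum>j. \<psi> j)"
  using Q \<psi> D by (intro mult_left_mono sum_le_suminf) auto
 finally show ?thesis .
qed

text \<open>
 Lattice points in a ball of radius \<open>R\<close> near the graph of a Lipschitz function are counted in coordinates adapted to the
 graph: the \<open>d - 1\<close> coordinates transversal to the axis \<open>e\<close> leave \<open>O(R\<^sup>d\<^sup>-\<^sup>1)\<close> possibilities, and each of these determines
 the point up to a bounded distance.
\<close>

lemma lattice_count:
 fixes e :: "real^'n::finite" and T :: "('n => int) set"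
 assumes e: "norm e = 1" and M: "0 \<le> M" and W: "0 \<le> W" and R: "0 \<le> R"
  and \<Phi>: "\<And>v w. v \<bullet> e = 0 ==> w \<bullet> e = 0 ==> \<bar>\<Phi> v - \<Phi> w\<bar> \<le> M * norm (v - w)"
  and ball: "\<And>k. k \<in> T ==> norm ((\<chi> i. real_of_int (k i)) - u) \<le> R"
  and strip: "\<And>k. k \<in> T ==> s \<le> (\<chi> i. real_of_int (k i)) \<bullet> e - \<Phi> ((\<chi> i. real_of_int (k i)) - ((\<chi> i. real_of_int (k i)) \<bullet> e) *\<^sub>R e)
    \<and> (\<chi> i. real_of_int (k i)) \<bullet> e - \<Phi> ((\<chi> i. real_of_int (k i)) - ((\<chi> i. real_of_int (k i)) \<bullet> e) *\<^sub>R e) \<le> s + W"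
 shows "finite T" "real (card T) \<le> (2 * (real CARD('n) + W + M * real CARD('n)) + 1) ^ CARD('n) * (2 * R + 2) ^ (CARD('n) - 1)"
proof -
 obtain Bs where Bs: "e \<in> Bs" "pairwise orthogonal Bs" "\<And>x. x \<in> Bs ==> norm x = 1"
  "independent Bs" "card Bs = DIM(real^'n)" "span Bs = UNIV"
  using vector_in_orthonormal_basis[OF e] by metis
 have fB: "finite Bs" using Bs(5) by (metis DIM_positive card.infinite less_irrefl)
 have cB: "card Bs = CARD('n)" using Bs(5) by simp
 define D where "D = real CARD('n) + W + M * real CARD('n)"
 have D: "D \<ge> 0" using W M by (simp add: D_def)
 define v where "v k = (\<chi> i. real_of_int (k i)) " for k :: "'n => int"
 define j where "j k = restrict (\<lambda>b. \<lfloor>v k \<bullet> b\<rfloor>) (Bs - {e})" for k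
 define J where "J = PiE (Bs - {e}) (\<lambda>b. {\<lfloor>u \<bullet> b - R\<rfloor>..\<lfloor>u \<bullet> b + R\<rfloor>})"
 have fJ: "finite J" unfolding J_def using fB by (intro finite_PiE) auto
 have jJ: "j ` T \<subseteq> J"
 proof
  fix y assume "y \<in> j ` T"
  then obtain k where k: "k \<in> T" "y = j k" by blast
  have "\<bar>(v k - u) \<bullet> b\<bar> \<le> R" if "b \<in> Bs" for b
   using Cauchy_Schwarz_ineq2[of "v k - u" b] ball[OF k(1)] Bs(3)[OF that] by (simp add: v_def)
  then have "u \<bullet> b - R \<le> v k \<bullet> b" "v k \<bullet> b \<le> u \<bullet> b + R" if "b \<in> Bs" for b
   using that by (auto simp: inner_diff_left abs_le_iff) (smt (verit) that)+
  then show "y \<in> J" unfolding k(2) j_def J_def by (auto intro!: floor_mono)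
 qed
 have cJ: "real (card J) \<le> (2 * R + 2) ^ (CARD('n) - 1)"
 proof -
  have "real (card J) = (\<Prod>b\<in>Bs - {e}. real (card {\<lfloor>u \<bullet> b - R\<rfloor>..\<lfloor>u \<bullet> b + R\<rfloor>}))"
   unfolding J_def using fB by (subst card_PiE) auto
  also have "... \<le> (\<Prod>b\<in>Bs - {e}. 2 * R + 2)"
  proof (intro prod_mono conjI)
   fix b
   have "real (card {\<lfloor>u \<bullet> b - R\<rfloor>..\<lfloor>u \<bullet> b + R\<rfloor>}) = real_of_int (\<lfloor>u \<bullet> b + R\<rfloor> + 1 - \<lfloor>u \<bullet> b - R\<rfloor>)"
    using R floor_mono[of "u \<bullet> b - R" "u \<bullet> b + R"] by simp
   also have "... \<le> 2 * R + 2"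
    using floor_correct[of "u \<bullet> b + R"] floor_correct[of "u \<bullet> b - R"]
    unfolding of_int_add of_int_diff of_int_1 by linarith
   finally show "real (card {\<lfloor>u \<bullet> b - R\<rfloor>..\<lfloor>u \<bullet> b + R\<rfloor>}) \<le> 2 * R + 2" .
  qed simp
  also have "... = (2 * R + 2) ^ (CARD('n) - 1)" using fB Bs(1) cB by simp
  finally show ?thesis .
 qed
 have close: "\<bar>k i - k' i\<bar> \<le> \<lfloor>D\<rfloor>" if k: "k \<in> T" "k' \<in> T" "j k = j k'" for k k' i
 proof -
  define w where "w = v k - v k'"
  have wb: "\<bar>w \<bullet> b\<bar> \<le> 1" if b: "b \<in> Bs - {e}" for b
  proof -
   have fl: "\<lfloor>v k \<bullet> b\<rfloor> = \<lfloor>v k' \<bullet> b\<rfloor>" using fun_cong[OF k(3), of b] b by (simp add: j_def)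
   show ?thesis
    using floor_correct[of "v k \<bullet> b", unfolded fl] floor_correct[of "v k' \<bullet> b"]
    unfolding w_def inner_diff_left of_int_add of_int_1 by linarith
  qed
  have expand: "(\<Sum>b\<in>Bs. (w \<bullet> b) *\<^sub>R b) = w"
   by (rule orthonormal_basis_expand[OF Bs(2,3)]) (use Bs(6) fB in auto)
  have split: "(\<Sum>b\<in>Bs. (w \<bullet> b) *\<^sub>R b) = (w \<bullet> e) *\<^sub>R e + (\<Sum>b\<in>Bs - {e}. (w \<bullet> b) *\<^sub>R b)"
   by (rule sum.remove[OF fB Bs(1)])
  have perp: "norm (w - (w \<bullet> e) *\<^sub>R e) \<le> real CARD('n)"
  proof -
   have "w - (w \<bullet> e) *\<^sub>R e = (\<Sum>b\<in>Bs - {e}. (w \<bullet> b) *\<^sub>R b)" using expand split by (simp add: algebra_simps)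
   also have "norm ... \<le> (\<Sum>b\<in>Bs - {e}. 1)"
    by (rule sum_norm_le) (use wb Bs(3) in auto)
   also have "... \<le> real CARD('n)" using fB Bs(1) cB by simp
   finally show ?thesis .
  qed
  define \<pi> where "\<pi> x = x - (x \<bullet> e) *\<^sub>R e" for x
  have ee: "e \<bullet> e = 1" using e by (simp add: dot_square_norm)
  have \<pi>0: "\<pi> x \<bullet> e = 0" for x by (simp add: \<pi>_def inner_diff_left ee)
  have "\<bar>\<Phi> (\<pi> (v k)) - \<Phi> (\<pi> (v k'))\<bar> \<le> M * norm (\<pi> (v k) - \<pi> (v k'))" by (rule \<Phi>[OF \<pi>0 \<pi>0])
  also have "\<pi> (v k) - \<pi> (v k') = w - (w \<bullet> e) *\<^sub>R e" by (simp add: \<pi>_def w_def inner_diff_left algebra_simps)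
  also have "M * norm (w - (w \<bullet> e) *\<^sub>R e) \<le> M * real CARD('n)" by (rule mult_left_mono[OF perp M])
  finally have f: "\<bar>\<Phi> (\<pi> (v k)) - \<Phi> (\<pi> (v k'))\<bar> \<le> M * real CARD('n)" .
  have "w \<bullet> e = v k \<bullet> e - v k' \<bullet> e" by (simp add: w_def inner_diff_left)
  then have we: "\<bar>w \<bullet> e\<bar> \<le> W + M * real CARD('n)"
   using strip[OF k(1)] strip[OF k(2)] f unfolding v_def[symmetric] \<pi>_def[symmetric] by linarith
  have "norm w \<le> norm ((w \<bullet> e) *\<^sub>R e) + norm (w - (w \<bullet> e) *\<^sub>R e)"
   using norm_triangle_ineq[of "(w \<bullet> e) *\<^sub>R e" "w - (w \<bullet> e) *\<^sub>R e"] by simp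
  also have "... \<le> D" using we perp e by (simp add: D_def)
  finally have "norm w \<le> D" .
  then have "\<bar>w $ i\<bar> \<le> D" using component_le_norm_cart[of w i] by linarith
  then have "real_of_int \<bar>k i - k' i\<bar> \<le> D" by (simp add: w_def v_def)
  then show ?thesis by (simp add: le_floor_iff)
 qed
 define C where "C = (2 * D + 1) ^ CARD('n)"
 have fiber: "finite {k \<in> T. j k = y} \<and> real (card {k \<in> T. j k = y}) \<le> C" for y
 proof (cases "{k \<in> T. j k = y} = {}")
  case False
  then obtain k0 where k0: "k0 \<in> T" "j k0 = y" by blast
  let ?P = "PiE UNIV (\<lambda>i. {k0 i - \<lfloor>D\<rfloor>..k0 i + \<lfloor>D\<rfloor>})"
  have sub: "{k \<in> T. j k = y} \<subseteq> ?P"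
  proof
   fix k assume "k \<in> {k \<in> T. j k = y}"
   then have "\<bar>k i - k0 i\<bar> \<le> \<lfloor>D\<rfloor>" for i using close[of k k0 i] k0 by simp
   then have "k0 i - \<lfloor>D\<rfloor> \<le> k i \<and> k i \<le> k0 i + \<lfloor>D\<rfloor>" for i by (simp add: abs_le_iff) (metis diff_le_eq add.commute minus_diff_eq)
   then show "k \<in> ?P" by auto
  qed
  have fP: "finite ?P" by (intro finite_PiE) auto
  have "real (card ?P) = (\<Prod>i\<in>(UNIV :: 'n set). real (card {k0 i - \<lfloor>D\<rfloor>..k0 i + \<lfloor>D\<rfloor>}))"
   by (subst card_PiE) auto
  also have "... \<le> (\<Prod>i\<in>(UNIV :: 'n set). 2 * D + 1)"
  proof (intro prod_mono conjI)
   fix i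
   have "0 \<le> \<lfloor>D\<rfloor>" using D by simp
   then have "real (card {k0 i - \<lfloor>D\<rfloor>..k0 i + \<lfloor>D\<rfloor>}) = 2 * real_of_int \<lfloor>D\<rfloor> + 1" by simp
   then show "real (card {k0 i - \<lfloor>D\<rfloor>..k0 i + \<lfloor>D\<rfloor>}) \<le> 2 * D + 1" using of_int_floor_le[of D] by linarith
  qed simp
  also have "... = C" by (simp add: C_def)
  finally have "real (card ?P) \<le> C" .
  moreover have "card {k \<in> T. j k = y} \<le> card ?P" by (rule card_mono[OF fP sub])
  ultimately show ?thesis using finite_subset[OF sub fP] by linarith
 next
  case True
  show ?thesis unfolding True using D by (simp add: C_def)
 qed
 have T: "T = (\<Union>y\<in>j ` T. {k \<in> T. j k = y})" by blast
 have fjT: "finite (j ` T)" by (rule finite_subset[OF jJ fJ])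
 show "finite T" by (subst T) (use fjT fiber in blast)
 have "real (card T) \<le> (\<Sum>y\<in>j ` T. real (card {k \<in> T. j k = y}))"
  by (subst T) (use card_UN_le[OF fjT, of "\<lambda>y. {k \<in> T. j k = y}"] in \<open>simp flip: of_nat_sum\<close>)
 also have "... \<le> (\<Sum>y\<in>j ` T. C)" by (intro sum_mono) (use fiber in blast)
 also have "... = C * real (card (j ` T))" by simp
 also have "... \<le> C * (2 * R + 2) ^ (CARD('n) - 1)"
 proof (rule mult_left_mono)
  have "real (card (j ` T)) \<le> real (card J)" using card_mono[OF fJ jJ] by simp
  then show "real (card (j ` T)) \<le> (2 * R + 2) ^ (CARD('n) - 1)" using cJ by linarith
 qed (use D in \<open>simp add: C_def\<close>)
 finally show "real (card T) \<le> (2 * (real CARD('n) + W + M * real CARD('n)) + 1) ^ CARD('n) * (2 * R + 2) ^ (CARD('n) - 1)"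
  by (simp add: C_def D_def)
qed

text \<open>
 The factors are, in turn, the gain from the distance, the weights of the Plancherel estimate, the volume of the support in \<open>\<xi>\<close>
 with the normalization of the kernel, and the error of interpolation.
\<close>

definition cube_constant :: "nat => nat => nat => real => real => real" where
 "cube_constant D n m G l0 = (2 * G) ^ (2 * m) * (real D ^ (2 * m + 1) + 1) * (unit_ball_vol (real D) / (2 * pi) ^ D)
   * (2 ^ m * (1 + (1 + real m + 1 / l0) ^ n * (1 + interp_const n) * (\<Sum>k<D. interp_const n ^ k)))\<^sup>2"

lemma cube_constant_nonneg: "0 \<le> G ==> 0 \<le> cube_constant D n m G l0"
 by (auto simp: cube_constant_def intro!: mult_nonneg_nonneg divide_nonneg_nonneg)

context nice_symbol
begin

text \<open>
 In the units \<open>h = 1 / (|\<alpha>| \<rho>)\<close> all amplitudes have bounded derivatives, because \<open>l\<close> is at least \<open>l0 h\<close>.  Interpolation with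
 \<open>n\<close> nodes per coordinate in a cube of side \<open>h / N\<close> thus has an error of order \<open>N\<^sup>-\<^sup>n\<close>.  With the empty set of nodes the
 same bound for \<open>N = 1\<close> is just the size of the row.
\<close>

lemma sandwich_row_approximation:
 fixes X :: "('n => nat) set" and w :: "('n => nat) => real" and S S' :: "(real^'n) set" and N :: nat
 assumes \<alpha>: "\<alpha> \<noteq> 0" and h: "h = 1 / (\<bar>\<alpha>\<bar> * \<rho>)" and l0: "0 < l0" "l0 * h \<le> l"
  and N: "1 \<le> N" and x: "x \<in> cube z (h / N)"
  and X: "X = PiE UNIV (\<lambda>_. {..<n}) \<or> X = {} \<and> N = 1"
  and S': "S' \<in> sets borel" and far: "\<And>y. y \<in> S' ==> (1 + \<kappa>) * h \<le> G * (norm (y - z) + h)" and G: "0 \<le> G" and \<kappa>: "0 \<le> \<kappa>"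
 shows "(norm (sandwich_row \<alpha> S S' x - (\<Sum>f\<in>X. scaleC ((indicator S x * (of_real (sqrt (\<bar>\<alpha>\<bar> / (2 * pi)) ^ CARD('n)) * cis (- (\<alpha> * (x \<bullet> \<mu>)))))
    * of_real (lagrange_prod n UNIV z (h / N) f x)) (blinfun_apply (chi_op S') (blinfun_apply (FT (- \<alpha>)) (row \<alpha> (node n UNIV z (h / N) f 0)))))))\<^sup>2
  \<le> cube_constant CARD('n) n m G l0 * A\<^sup>2 / h ^ CARD('n) / (1 + \<kappa>) ^ (2 * m) / real N ^ (2 * n)"
proof -
 let ?\<delta> = "h / real N"
 let ?D = "CARD('n)"
 define pt where "pt f = node n UNIV z ?\<delta> f 0" for f
 define w where "w f = lagrange_prod n UNIV z ?\<delta> f x" for f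
 define c0 where "c0 = (indicator S x :: complex) * (of_real (sqrt (\<bar>\<alpha>\<bar> / (2 * pi)) ^ CARD('n)) * cis (- (\<alpha> * (x \<bullet> \<mu>))))"
 define T where "T = blinfun_apply (chi_op S') \<circ> blinfun_apply (FT (- \<alpha>))"
 define P where "P = (1 + real m + 1 / l0) ^ n * (1 + interp_const n) * (\<Sum>k<?D. interp_const n ^ k)"
 define \<epsilon> where "\<epsilon> = 2 ^ m * A * (1 + P) / real N ^ n"
 have hp: "h > 0" using h \<alpha> \<rho>_pos by simp
 have Np: "real N \<ge> 1" using N by simp
 have \<delta>: "0 < ?\<delta>" "?\<delta> \<le> h" using hp Np by (auto simp: field_simps)
 have ic: "interp_const n \<ge> 0" by (simp add: interp_const_def)
 have P0: "P \<ge> 0" unfolding P_def using ic l0 by (intro mult_nonneg_nonneg sum_nonneg zero_le_power) auto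
 have \<epsilon>0: "\<epsilon> \<ge> 0" unfolding \<epsilon>_def using A_nonneg P0 by simp
 have fX: "finite X" using X by (auto intro: finite_PiE)
 have rate: "((1 + real m) / h + 1 / l) * ?\<delta> \<le> (1 + real m + 1 / l0) / real N"
 proof -
  have "h / l \<le> 1 / l0" using l0 l_pos hp by (simp add: field_simps)
  then have "(1 + real m) + h / l \<le> 1 + real m + 1 / l0" by simp
  then have "((1 + real m) + h / l) / real N \<le> (1 + real m + 1 / l0) / real N" using Np by (intro divide_right_mono) auto
  moreover have "((1 + real m) / h + 1 / l) * h = (1 + real m) + h / l"
   using distrib_right[of "(1 + real m) / h" "1 / l" h] hp by simp
  ultimately show ?thesis by (simp only: times_divide_eq_right)
 qed
 have ap: "cmod (amplitude \<alpha> k p z x \<xi> - (\<Sum>f\<in>X. of_real (w f) * amplitude \<alpha> k p z (pt f) \<xi>)) \<le> \<epsilon> * h ^ p"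
  if p: "p \<le> m" and \<xi>: "\<xi> \<in> ball \<mu> \<rho>" for p k \<xi>
 proof -
  let ?C = "2 ^ p * h ^ p * A"
  have C0: "0 \<le> ?C" using hp A_nonneg by simp
  have p2: "(2 :: real) ^ p \<le> 2 ^ m" using p by (intro power_increasing) auto
  have line: "line_bound n ?C ((1 + real m) / h + 1 / l) {0..?\<delta>} (\<lambda>t. amplitude \<alpha> k p z (x' + t *\<^sub>R axis i 1) \<xi>)"
   if "x' \<in> cube z ?\<delta>" "x' $ i = z $ i" for x' i
   by (rule amplitude_line_bound[OF p \<alpha> h \<delta> that \<xi>])
  show ?thesis
   using X
  proof
   assume X: "X = PiE UNIV (\<lambda>_. {..<n})"
   have "cmod (amplitude \<alpha> k p z x \<xi> - (\<Sum>f\<in>X. of_real (w f) * amplitude \<alpha> k p z (node n UNIV z ?\<delta> f x) \<xi>))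
     \<le> ?C * (((1 + real m) / h + 1 / l) * ?\<delta>) ^ n * (1 + interp_const n) * (\<Sum>k<?D. interp_const n ^ k)"
    unfolding X w_def
    by (rule interpolation_error[where F = "\<lambda>x. amplitude \<alpha> k p z x \<xi>", OF line C0 _ \<delta>(1) x finite_class.finite_UNIV])
     (use hp l_pos in auto)
   moreover have "node n UNIV z ?\<delta> f x = pt f" for f by (simp add: pt_def node_def)
   moreover have "?C * (((1 + real m) / h + 1 / l) * ?\<delta>) ^ n * (1 + interp_const n) * (\<Sum>k<?D. interp_const n ^ k)
     \<le> 2 ^ m * h ^ p * A * ((1 + real m + 1 / l0) / real N) ^ n * (1 + interp_const n) * (\<Sum>k<?D. interp_const n ^ k)"
    using hp l_pos A_nonneg ic
    by (intro mult_right_mono mult_mono power_mono rate p2 sum_nonneg zero_le_power mult_nonneg_nonneg add_nonneg_nonneg divide_nonneg_nonneg) (auto intro: sum_nonneg)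
   moreover have "2 ^ m * h ^ p * A * ((1 + real m + 1 / l0) / real N) ^ n * (1 + interp_const n) * (\<Sum>k<?D. interp_const n ^ k) = 2 ^ m * A * P / real N ^ n * h ^ p"
    by (simp add: P_def power_divide)
   moreover have "2 ^ m * A * P / real N ^ n * h ^ p \<le> \<epsilon> * h ^ p"
    unfolding \<epsilon>_def using A_nonneg hp by (intro mult_right_mono divide_right_mono mult_left_mono) auto
   ultimately show ?thesis by simp
  next
   assume X: "X = {} \<and> N = 1"
   define i :: 'n where "i = undefined"
   define x' where "x' = x - (x $ i - z $ i) *\<^sub>R axis i 1"
   have xc: "z $ j \<le> x $ j \<and> x $ j \<le> z $ j + ?\<delta>" for j using x by (simp add: cube_def)
   have "x' $ j = (if j = i then z $ i else x $ j)" for j by (simp add: x'_def axis_def)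
   then have x': "x' \<in> cube z ?\<delta>" "x' $ i = z $ i" using xc \<delta> by (auto simp: cube_def)
   have "x' + (x $ i - z $ i) *\<^sub>R axis i 1 = x" by (simp add: x'_def)
   moreover have "x $ i - z $ i \<in> {0..?\<delta>}" using xc[of i] by auto
   ultimately have "cmod (amplitude \<alpha> k p z x \<xi>) \<le> ?C"
    using line_boundD[OF line[OF x']] by fastforce
   also have "... \<le> 2 ^ m * h ^ p * A" using p2 hp A_nonneg by (intro mult_right_mono) auto
   also have "... = 2 ^ m * A * 1 * h ^ p" by simp
   also have "... \<le> 2 ^ m * A * (1 + P) * h ^ p"
    using P0 A_nonneg hp by (intro mult_right_mono mult_left_mono) auto
   finally show ?thesis using X by (simp add: \<epsilon>_def)
  qed
 qed
 note main = row_approximation[OF \<alpha> h fX \<epsilon>0 ap S' far G \<kappa>]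
 have lin: "T (row \<alpha> x - (\<Sum>f\<in>X. scaleC (of_real (w f)) (row \<alpha> (pt f)))) = T (row \<alpha> x) - (\<Sum>f\<in>X. scaleC (of_real (w f)) (T (row \<alpha> (pt f))))"
 proof -
  have "complex_linear (chi_op S')" by (rule is_adjoint_complex_linear[OF is_adjoint_chi_op[OF S']])
  moreover have "complex_linear (FT (- \<alpha>) :: (real^'n) L2_op)"
   by (rule is_adjoint_complex_linear[OF is_adjoint_FT]) (use \<alpha> in simp)
  ultimately show ?thesis by (simp add: T_def blinfun.diff_right blinfun.sum_right complex_linear_def)
 qed
 have "sandwich_row \<alpha> S S' x - (\<Sum>f\<in>X. scaleC (c0 * of_real (w f)) (T (row \<alpha> (pt f)))) = scaleC c0 (T (row \<alpha> x - (\<Sum>f\<in>X. scaleC (of_real (w f)) (row \<alpha> (pt f)))))"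
  unfolding lin by (simp add: scaleC_diff_right scaleC_sum_right sandwich_row_def c0_def T_def)
 then have "(norm (sandwich_row \<alpha> S S' x - (\<Sum>f\<in>X. scaleC (c0 * of_real (w f)) (T (row \<alpha> (pt f))))))\<^sup>2
   = (cmod c0)\<^sup>2 * (norm (T (row \<alpha> x - (\<Sum>f\<in>X. scaleC (of_real (w f)) (row \<alpha> (pt f))))))\<^sup>2"
  by (simp only: norm_scaleC power_mult_distrib)
 also have "... \<le> (\<bar>\<alpha>\<bar> / (2 * pi)) ^ ?D * ((2 * G) ^ (2 * m) * (real ?D ^ (2 * m + 1) + 1) * \<epsilon>\<^sup>2 * (unit_ball_vol (real ?D) * \<rho> ^ ?D) / (1 + \<kappa>) ^ (2 * m))"
 proof (rule mult_mono)
  have "cmod c0 \<le> sqrt (\<bar>\<alpha>\<bar> / (2 * pi)) ^ ?D" by (simp add: c0_def norm_mult norm_power indicator_def)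
  then have "(cmod c0)\<^sup>2 \<le> (sqrt (\<bar>\<alpha>\<bar> / (2 * pi)) ^ ?D)\<^sup>2" by (rule power_mono) simp
  also have "... = (sqrt (\<bar>\<alpha>\<bar> / (2 * pi)))\<^sup>2 ^ ?D" by (metis power_mult mult.commute)
  also have "... = (\<bar>\<alpha>\<bar> / (2 * pi)) ^ ?D" by simp
  finally show "(cmod c0)\<^sup>2 \<le> (\<bar>\<alpha>\<bar> / (2 * pi)) ^ ?D" .
  show "(norm (T (row \<alpha> x - (\<Sum>f\<in>X. scaleC (of_real (w f)) (row \<alpha> (pt f))))))\<^sup>2
    \<le> (2 * G) ^ (2 * m) * (real ?D ^ (2 * m + 1) + 1) * \<epsilon>\<^sup>2 * (unit_ball_vol (real ?D) * \<rho> ^ ?D) / (1 + \<kappa>) ^ (2 * m)"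
   using main unfolding row_combination[OF fX] T_def by simp
 qed auto
 also have "... = cube_constant ?D n m G l0 * A\<^sup>2 / h ^ ?D / (1 + \<kappa>) ^ (2 * m) / real N ^ (2 * n)"
 proof -
  have N2: "(real N ^ n)\<^sup>2 = real N ^ (2 * n)" by (metis power_mult mult.commute)
  have \<epsilon>2: "\<epsilon>\<^sup>2 = (2 ^ m * (1 + P))\<^sup>2 * A\<^sup>2 / real N ^ (2 * n)"
   unfolding \<epsilon>_def power_divide power_mult_distrib N2 by (simp only: mult_ac)
  have "\<bar>\<alpha>\<bar> / (2 * pi) * \<rho> = 1 / (2 * pi) / h" using \<alpha> \<rho>_pos by (simp add: h)
  then have scale: "(\<bar>\<alpha>\<bar> / (2 * pi)) ^ ?D * \<rho> ^ ?D = 1 / (2 * pi) ^ ?D / h ^ ?D"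
   by (metis power_mult_distrib power_divide power_one)
  have gen: "p * (a * e * (E * F / N2) * (v * r) / s) = a * e * E * F * v / s / N2 * (p * r)" for p a e E F N2 v r s :: real
   by (simp add: mult_ac)
  have gen2: "a * e * E * F * v / s / N2 * (1 / p / k) = a * e * (v / p) * E * F / k / s / N2" for p a e E F N2 v k s :: real
   by (simp add: mult_ac)
  show ?thesis unfolding cube_constant_def \<epsilon>2 P_def[symmetric] gen scale gen2 ..
 qed
 finally show ?thesis by (simp add: c0_def w_def pt_def T_def)
qed


text \<open>
 Each cube \<open>k\<close> of side \<open>h\<close> is cut into \<open>N k\<^sup>d\<close> cubes, each of which needs \<open>n\<^sup>d\<close> dimensions; for \<open>N k = 0\<close> the cube is left alone and its
 rows are discarded.
\<close>

lemma sandwich_rank_approx: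
 fixes Q :: "('n => int) set" and \<kappa> N :: "('n => int) => nat" and S S' :: "(real^'n) set"
 assumes \<alpha>: "\<alpha> \<noteq> 0" and h: "h = 1 / (\<bar>\<alpha>\<bar> * \<rho>)" and l0: "0 < l0" "l0 * h \<le> l" and n: "0 < n"
  and S: "S \<in> sets borel" and S': "S' \<in> sets borel" and G: "0 \<le> G" and Q: "finite Q"
  and cover: "\<And>x. x \<in> S \<inter> ball u l ==> (\<lambda>i. \<lfloor>x $ i / h\<rfloor>) \<in> Q"
  and far: "\<And>k y z. k \<in> Q ==> y \<in> S' ==> z \<in> cube (\<chi> i. h * k i) h ==> (1 + real (\<kappa> k)) * h \<le> G * (norm (y - z) + h)"
 shows "\<exists>r. real r \<le> real n ^ CARD('n) * (\<Sum>k\<in>Q. real (N k) ^ CARD('n)) \<and>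
  rank_approx (chi_op S o\<^sub>L left_pdo \<alpha> (\<lambda>z. cnj (b z)) o\<^sub>L chi_op S') r
   (cube_constant CARD('n) n m G l0 * A\<^sup>2 * (\<Sum>k\<in>Q. 1 / (1 + real (\<kappa> k)) ^ (2 * m) / real (max 1 (N k)) ^ (2 * n)))"
proof -
 let ?D = "CARD('n)"
 let ?K = "cube_constant CARD('n) n m G l0"
 have hp: "h > 0" using h \<alpha> \<rho>_pos by simp
 define N' where "N' k = max 1 (N k)" for k
 have N': "1 \<le> N' k" "real (N' k) > 0" for k by (auto simp: N'_def)
 define \<delta> where "\<delta> k = h / real (N' k)" for k
 have \<delta>: "\<delta> k > 0" "\<delta> k \<le> h" "real (N' k) * \<delta> k = h" for k using hp N'[of k] by (auto simp: \<delta>_def field_simps)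
 define P where "P = Sigma Q (\<lambda>k. PiE UNIV (\<lambda>i :: 'n. {..<N' k}))"
 define z where "z = (\<lambda>(k, r). (\<chi> i. h * of_int (k i) + \<delta> k * real (r i)) :: real^'n)"
 define X where "X = (\<lambda>(k, r). {x :: real^'n. \<forall>i. z (k, r) $ i \<le> x $ i \<and> x $ i < z (k, r) $ i + \<delta> k})"
 define J where "J = (\<lambda>(k, r :: 'n => nat). if N k = 0 then {} else PiE (UNIV :: 'n set) (\<lambda>_. {..<n}))"
 define g where "g p f = blinfun_apply (chi_op S') (blinfun_apply (FT (- \<alpha>)) (row \<alpha> (node n UNIV (z p) (\<delta> (fst p)) f 0)))" for p f
 define c where "c x = (indicator S x :: complex) * (of_real (sqrt (\<bar>\<alpha>\<bar> / (2 * pi)) ^ CARD('n)) * cis (- (\<alpha> * (x \<bullet> \<mu>))))" for x :: "real^'n"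
 define q where "q p f x = cnj (c x * of_real (lagrange_prod n UNIV (z p) (\<delta> (fst p)) f x))" for p f x
 define \<epsilon> where "\<epsilon> = (\<lambda>(k, r :: 'n => nat). ?K * A\<^sup>2 / h ^ ?D / (1 + real (\<kappa> k)) ^ (2 * m) / real (N' k) ^ (2 * n))"
 have P: "finite P" unfolding P_def using Q by (auto intro!: finite_SigmaI finite_PiE)
 have J: "finite (J p)" for p by (auto simp: J_def split: prod.split intro!: finite_PiE)
 have z_cube: "z p \<in> cube (\<chi> i. h * (fst p) i) h" if p: "p \<in> P" for p
 proof -
  obtain k r where kr: "p = (k, r)" "k \<in> Q" "\<And>i. r i < N' k" using p by (auto simp: P_def)
  have "\<delta> k * real (r i) \<le> h" for i
  proof -
   have "\<delta> k * real (r i) \<le> \<delta> k * real (N' k)" using kr(3)[of i] \<delta>(1)[of k] by (intro mult_left_mono) auto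
   then show ?thesis using \<delta>(3)[of k] by (simp add: mult.commute)
  qed
  then show ?thesis using \<delta>(1)[of k] by (simp add: kr z_def cube_def)
 qed
 have XC: "X p \<subseteq> cube (z p) (\<delta> (fst p))" for p by (cases p) (auto simp: X_def cube_def intro: less_imp_le)
 have Xb: "X p \<in> sets borel" for p
 proof -
  have "X p = {x. \<forall>i. z p $ i \<le> x $ i} \<inter> (\<Inter>i. {x. x $ i < z p $ i + \<delta> (fst p)})" by (cases p) (auto simp: X_def)
  moreover have "closed {x :: real^'n. \<forall>i. z p $ i \<le> x $ i}" by (intro closed_Collect_all closed_Collect_le continuous_intros)
  moreover have "open (\<Inter>i. {x :: real^'n. x $ i < z p $ i + \<delta> (fst p)})" by (intro open_INT finite_class.finite_UNIV ballI open_Collect_less continuous_intros)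
  ultimately show ?thesis by (simp add: borel_closed borel_open)
 qed
 have Xm: "emeasure lborel (X p) < \<infinity>" "measure lborel (X p) \<le> \<delta> (fst p) ^ ?D" for p
 proof -
  let ?B = "cbox (z p) (z p + (\<chi> i. \<delta> (fst p)))"
  have sub: "X p \<subseteq> ?B" using XC[of p] by (auto simp: cube_def mem_box_cart)
  have fin: "emeasure lborel ?B < \<infinity>" by (rule emeasure_lborel_cbox_finite)
  show "emeasure lborel (X p) < \<infinity>" by (rule le_less_trans[OF emeasure_mono[OF sub] fin]) simp
  have "measure lborel (X p) \<le> measure lborel ?B"
   by (rule measure_mono_fmeasurable[OF sub]) (use Xb fin in \<open>auto intro: fmeasurableI\<close>)
  also have "... = \<delta> (fst p) ^ ?D"
   using \<delta>(1)[of "fst p"] by (subst content_cbox_cart) (auto simp: interval_ne_empty_cart less_imp_le)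
  finally show "measure lborel (X p) \<le> \<delta> (fst p) ^ ?D" .
 qed
 have index: "k = (\<lambda>i. \<lfloor>x $ i / h\<rfloor>) \<and> r = (\<lambda>i. nat \<lfloor>(x $ i - h * of_int (k i)) / \<delta> k\<rfloor>)" if "(k, r) \<in> P" "x \<in> X (k, r)" for k r x
 proof (intro conjI ext)
  fix i
  have r: "r i < N' k" using that by (auto simp: P_def)
  have b: "h * of_int (k i) + \<delta> k * real (r i) \<le> x $ i" "x $ i < h * of_int (k i) + \<delta> k * real (r i) + \<delta> k"
   using that(2) by (auto simp: X_def z_def)
  have "\<delta> k * (real (r i) + 1) \<le> \<delta> k * real (N' k)" using r \<delta>(1)[of k] by (intro mult_left_mono) auto
  then have "\<delta> k * real (r i) + \<delta> k \<le> h" using \<delta>(3)[of k] by (simp add: algebra_simps)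
  moreover have "0 \<le> \<delta> k * real (r i)" using \<delta>(1)[of k] by simp
  ultimately have "h * of_int (k i) \<le> x $ i" "x $ i < h * of_int (k i) + h" using b by linarith+
  then have "\<lfloor>x $ i / h\<rfloor> = k i" using hp by (intro floor_unique) (auto simp: field_simps)
  then show "k i = \<lfloor>x $ i / h\<rfloor>" ..
  have "\<lfloor>(x $ i - h * of_int (k i)) / \<delta> k\<rfloor> = int (r i)"
   using b \<delta>(1)[of k] by (intro floor_unique) (auto simp: field_simps)
  then show "r i = nat \<lfloor>(x $ i - h * of_int (k i)) / \<delta> k\<rfloor>" by simp
 qed
 have disj: "disjoint_family_on X P"
  unfolding disjoint_family_on_def
 proof (intro ballI impI equals0I)
  fix p p' x assume p: "p \<in> P" "p' \<in> P" "p \<noteq> p'" and "x \<in> X p \<inter> X p'"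
  then have x: "x \<in> X p" "x \<in> X p'" by blast+
  obtain k r where kr: "p = (k, r)" by (cases p)
  obtain k' r' where kr': "p' = (k', r')" by (cases p')
  note i = index[OF p(1)[unfolded kr] x(1)[unfolded kr]] and i' = index[OF p(2)[unfolded kr'] x(2)[unfolded kr']]
  have kk: "k = k'" by (rule trans[OF conjunct1[OF i] conjunct1[OF i', symmetric]])
  have "r = r'" using trans[OF conjunct2[OF i, unfolded kk] conjunct2[OF i', symmetric]] .
  with kk show False using p(3) kr kr' by simp
 qed
 have K0: "sandwich_row \<alpha> S S' x = 0" if x: "x \<notin> (\<Union>p\<in>P. X p)" for x
 proof (cases "x \<in> S \<inter> ball u l")
  case True
  define k where "k = (\<lambda>i. \<lfloor>x $ i / h\<rfloor>)"
  define r where "r = (\<lambda>i. nat \<lfloor>(x $ i - h * of_int (k i)) / \<delta> k\<rfloor>)"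
  have kb: "h * of_int (k i) \<le> x $ i" "x $ i < h * of_int (k i) + h" for i
  proof -
   have "of_int (k i) \<le> x $ i / h" "x $ i / h < of_int (k i) + 1" unfolding k_def by linarith+
   then show "h * of_int (k i) \<le> x $ i" "x $ i < h * of_int (k i) + h" using hp by (auto simp: field_simps)
  qed
  have rb: "real (r i) \<le> (x $ i - h * of_int (k i)) / \<delta> k" "(x $ i - h * of_int (k i)) / \<delta> k < real (r i) + 1" for i
  proof -
   have "0 \<le> (x $ i - h * of_int (k i)) / \<delta> k" using kb(1)[of i] \<delta>(1)[of k] by simp
   then have "real (r i) = of_int \<lfloor>(x $ i - h * of_int (k i)) / \<delta> k\<rfloor>" unfolding r_def by simp
   then show "real (r i) \<le> (x $ i - h * of_int (k i)) / \<delta> k" "(x $ i - h * of_int (k i)) / \<delta> k < real (r i) + 1" by linarith+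
  qed
  have "r i < N' k" for i
  proof -
   have "real (r i) < real (N' k)"
   proof (rule le_less_trans[OF rb(1)])
    have "x $ i - h * of_int (k i) < real (N' k) * \<delta> k" using kb(2)[of i] \<delta>(3)[of k] by linarith
    then show "(x $ i - h * of_int (k i)) / \<delta> k < real (N' k)" using \<delta>(1)[of k] by (simp add: pos_divide_less_eq)
   qed
   then show ?thesis by simp
  qed
  moreover have "k \<in> Q" using cover[OF True] by (simp add: k_def)
  ultimately have "(k, r) \<in> P" by (auto simp: P_def)
  moreover have "x \<in> X (k, r)"
  proof -
   have "h * of_int (k i) + \<delta> k * real (r i) \<le> x $ i \<and> x $ i < h * of_int (k i) + \<delta> k * real (r i) + \<delta> k" for i
    using rb[of i] \<delta>(1)[of k] by (simp add: pos_le_divide_eq pos_divide_less_eq algebra_simps)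
   then show ?thesis by (simp add: X_def z_def)
  qed
  ultimately show ?thesis using x by blast
 next
  case False
  then show ?thesis by (auto simp: sandwich_row_def row_zero)
 qed
 have cm: "c \<in> borel_measurable borel"
  unfolding c_def[abs_def] using S by (auto intro!: borel_measurable_times borel_measurable_indicator borel_measurable_continuous_onI continuous_intros)
 have lm: "lagrange_prod n UNIV w e f \<in> borel_measurable borel" for w e f
  unfolding lagrange_prod_def[abs_def] lagrange_def divide_inverse
  by (intro borel_measurable_continuous_onI continuous_intros)
 have qs: "square_integrable (\<lambda>x. indicator (X p) x * q p f x)" if p: "p \<in> P" "f \<in> J p" for p f
 proof -
  let ?B = "sqrt (\<bar>\<alpha>\<bar> / (2 * pi)) ^ ?D * (real n ^ n) ^ ?D"
  have f: "f i < n" for i using p by (auto simp: J_def split: if_splits prod.splits)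
  have lb: "\<bar>lagrange_prod n UNIV (z p) (\<delta> (fst p)) f x\<bar> \<le> (real n ^ n) ^ ?D" if "x \<in> X p" for x
  proof -
   have xc: "z p $ i \<le> x $ i \<and> x $ i \<le> z p $ i + \<delta> (fst p)" for i using that XC[of p] by (auto simp: cube_def)
   have "(x $ i - z p $ i) / \<delta> (fst p) \<in> {0..1}" for i using xc[of i] \<delta>(1)[of "fst p"] by (auto simp: field_simps)
   then have "\<bar>lagrange_prod n UNIV (z p) (\<delta> (fst p)) f x\<bar> \<le> (\<Prod>i\<in>(UNIV :: 'n set). real n ^ n)"
    unfolding lagrange_prod_def abs_prod by (intro prod_mono conjI lagrange_bound f) auto
   then show ?thesis by simp
  qed
  have bd: "cmod (indicator (X p) x * q p f x) \<le> ?B * indicat_real (X p) x" for x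
  proof (cases "x \<in> X p")
   case True
   have "cmod (c x) \<le> sqrt (\<bar>\<alpha>\<bar> / (2 * pi)) ^ ?D" by (simp add: c_def norm_mult norm_power indicator_def)
   then show ?thesis
    using mult_mono[OF _ lb[OF True], of "cmod (c x)" "sqrt (\<bar>\<alpha>\<bar> / (2 * pi)) ^ ?D"] True by (simp add: q_def norm_mult)
  qed simp
  have "cnj \<in> borel_measurable borel" by (rule borel_measurable_continuous_onI[OF continuous_on_cnj[OF continuous_on_id]])
  then have qm: "(\<lambda>x. indicator (X p) x * q p f x) \<in> borel_measurable lborel"
   unfolding q_def using cm lm Xb by measurable
  have "integrable lborel (\<lambda>x. indicator (X p) x * q p f x)"
  proof (rule Bochner_Integration.integrable_bound[OF _ qm])
   show "integrable lborel (\<lambda>x. ?B * indicat_real (X p) x)"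
    by (intro integrable_mult_right integrable_real_indicator) (use Xb Xm in auto)
   show "AE x in lborel. norm (indicator (X p) x * q p f x) \<le> norm (?B * indicat_real (X p) x)"
    by (intro AE_I2 order_trans[OF bd]) simp
  qed
  moreover have "cmod (indicator (X p) x * q p f x) \<le> ?B" for x
   by (rule order_trans[OF bd]) (simp add: indicator_def)
  ultimately show ?thesis by (rule square_integrable_of_bounded_integrable)
 qed
 have ap: "(norm (sandwich_row \<alpha> S S' x - (\<Sum>f\<in>J p. scaleC (cnj (q p f x)) (g p f))))\<^sup>2 \<le> \<epsilon> p" if p: "p \<in> P" and x: "x \<in> X p" for p x
 proof -
  obtain k r where kr: "p = (k, r)" "k \<in> Q" using p by (auto simp: P_def)
  have xc: "x \<in> cube (z p) (h / real (N' k))" using x XC[of p] by (auto simp: kr \<delta>_def)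
  have JN: "J p = PiE UNIV (\<lambda>_. {..<n}) \<or> J p = {} \<and> N' k = 1" by (auto simp: J_def kr N'_def)
  have farp: "(1 + real (\<kappa> k)) * h \<le> G * (norm (y - z p) + h)" if "y \<in> S'" for y
   using far[OF kr(2) that] z_cube[OF p] by (simp add: kr)
  show ?thesis
   using sandwich_row_approximation[OF \<alpha> h l0 N'(1) xc JN S' farp G of_nat_0_le_iff, of S]
   unfolding q_def complex_cnj_cnj c_def g_def \<epsilon>_def kr \<delta>_def by simp
 qed
 obtain r where r: "r \<le> (\<Sum>p\<in>P. card (J p))"
  "rank_approx (chi_op S o\<^sub>L left_pdo \<alpha> (\<lambda>z. cnj (b z)) o\<^sub>L chi_op S') r (\<Sum>p\<in>P. \<epsilon> p * measure lborel (X p))"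
  using rank_approx_pieces[OF P J Xb Xm(1) disj AE_rep_sandwich[OF S S' \<alpha>] K0 qs ap] by blast
 have card_cells: "real (card (PiE (UNIV :: 'n set) (\<lambda>i. {..<N' k}))) = real (N' k) ^ ?D" for k by (simp add: card_PiE)
 show ?thesis
 proof (intro exI conjI)
  have "real r \<le> (\<Sum>p\<in>P. real (card (J p)))" using r(1) by (simp flip: of_nat_sum)
  also have "... = (\<Sum>k\<in>Q. \<Sum>r\<in>PiE UNIV (\<lambda>i :: 'n. {..<N' k}). real (card (J (k, r))))"
   unfolding P_def by (subst sum.Sigma) (use Q in \<open>auto intro!: finite_PiE\<close>)
  also have "... = (\<Sum>k\<in>Q. real n ^ ?D * real (N k) ^ ?D)"
  proof (rule sum.cong[OF refl])
   fix k
   show "(\<Sum>r\<in>PiE UNIV (\<lambda>i :: 'n. {..<N' k}). real (card (J (k, r)))) = real n ^ ?D * real (N k) ^ ?D"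
   proof (cases "N k = 0")
    case False
    then have "N' k = N k" by (simp add: N'_def)
    then show ?thesis using False card_cells[of k] by (simp add: J_def card_PiE)
   qed (simp add: J_def zero_power)
  qed
  finally show "real r \<le> real n ^ ?D * (\<Sum>k\<in>Q. real (N k) ^ ?D)" by (simp add: sum_distrib_left)
  have "(\<Sum>p\<in>P. \<epsilon> p * measure lborel (X p)) \<le> (\<Sum>p\<in>P. \<epsilon> p * \<delta> (fst p) ^ ?D)"
  proof (intro sum_mono mult_left_mono Xm)
   show "0 \<le> \<epsilon> p" for p
    using cube_constant_nonneg[OF G, of ?D n m l0] hp by (auto simp: \<epsilon>_def split: prod.split)
  qed
  also have "... = (\<Sum>k\<in>Q. \<Sum>r\<in>PiE UNIV (\<lambda>i :: 'n. {..<N' k}). \<epsilon> (k, r) * \<delta> k ^ ?D)"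
   unfolding P_def by (subst sum.Sigma) (use Q in \<open>auto intro!: finite_PiE sum.cong\<close>)
  also have "... = (\<Sum>k\<in>Q. ?K * A\<^sup>2 * (1 / (1 + real (\<kappa> k)) ^ (2 * m) / real (N' k) ^ (2 * n)))"
  proof (rule sum.cong[OF refl])
   fix k
   have "(\<Sum>r\<in>PiE UNIV (\<lambda>i :: 'n. {..<N' k}). \<epsilon> (k, r) * \<delta> k ^ ?D) = \<epsilon> (k, undefined) * (real (N' k) * \<delta> k) ^ ?D"
    using card_cells[of k] by (simp add: \<epsilon>_def power_mult_distrib)
   also have "... = ?K * A\<^sup>2 / h ^ ?D / (1 + real (\<kappa> k)) ^ (2 * m) / real (N' k) ^ (2 * n) * h ^ ?D"
    unfolding \<delta>(3) by (simp add: \<epsilon>_def)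
   also have "... = ?K * A\<^sup>2 * (1 / (1 + real (\<kappa> k)) ^ (2 * m) / real (N' k) ^ (2 * n))"
    using hp by simp
   finally show "(\<Sum>r\<in>PiE UNIV (\<lambda>i :: 'n. {..<N' k}). \<epsilon> (k, r) * \<delta> k ^ ?D) = ..." .
  qed
  also have "... = ?K * A\<^sup>2 * (\<Sum>k\<in>Q. 1 / (1 + real (\<kappa> k)) ^ (2 * m) / real (max 1 (N k)) ^ (2 * n))"
   by (simp add: sum_distrib_left N'_def)
  finally have le: "(\<Sum>p\<in>P. \<epsilon> p * measure lborel (X p)) \<le> ..." .
  show "rank_approx (chi_op S o\<^sub>L left_pdo \<alpha> (\<lambda>z. cnj (b z)) o\<^sub>L chi_op S') r
   (?K * A\<^sup>2 * (\<Sum>k\<in>Q. 1 / (1 + real (\<kappa> k)) ^ (2 * m) / real (max 1 (N k)) ^ (2 * n)))"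
   using r(2) le unfolding rank_approx_def by (meson order_trans)
 qed
qed

end

text \<open>
 \<open>s\<close> is the number of small cubes that a cube can afford.  Rounding costs a factor of at most \<open>2\<close> in \<open>N\<close> if \<open>s \<ge> 1\<close>, and if \<open>s < 1\<close> the
 right-hand side of the second bound is at least \<open>1\<close>.
\<close>

lemma subdivision_choice:
 fixes s \<gamma> :: real and D n :: nat
 assumes s: "s > 0" and D: "D \<ge> 1" and \<gamma>: "0 \<le> \<gamma>" "\<gamma> \<le> 2 * n / D"
 defines "N \<equiv> nat \<lfloor>s powr (1 / D)\<rfloor>"
 shows "real N ^ D \<le> s" "1 / real (max 1 N) ^ (2 * n) \<le> 4 ^ n * s powr - \<gamma>"
proof -
 let ?t = "s powr (1 / D)"
 have t: "?t > 0" using s by simp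
 have N: "real N \<le> ?t" "?t < real N + 1" unfolding N_def using t by linarith+
 have "real N ^ D \<le> ?t ^ D" using N t by (intro power_mono) auto
 also have "... = s" using s D by (simp add: powr_powr flip: powr_realpow)
 finally show "real N ^ D \<le> s" .
 show "1 / real (max 1 N) ^ (2 * n) \<le> 4 ^ n * s powr - \<gamma>"
 proof (cases "s \<ge> 1")
  case True
  then have "?t \<ge> 1" by (simp add: ge_one_powr_ge_zero)
  then have "1 \<le> \<lfloor>?t\<rfloor>" by simp
  then have N1: "real N \<ge> 1" unfolding N_def by linarith
  have "?t \<le> 2 * real N" using N(2) N1 by linarith
  then have "?t ^ (2 * n) \<le> (2 * real N) ^ (2 * n)" using t by (intro power_mono) auto
  also have "... = 4 ^ n * real N ^ (2 * n)" by (simp add: power_mult_distrib power_mult)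
  finally have "s powr (2 * n / D) \<le> 4 ^ n * real N ^ (2 * n)"
   using s by (simp add: powr_powr flip: powr_realpow)
  moreover have "s powr \<gamma> \<le> s powr (2 * n / D)" using True \<gamma> by (intro powr_mono) auto
  ultimately have "s powr \<gamma> \<le> 4 ^ n * real N ^ (2 * n)" by linarith
  moreover have "max 1 N = N" using N1 by simp
  ultimately show ?thesis using N1 s by (simp add: powr_minus divide_simps)
 next
  case False
  have "s powr \<gamma> \<le> 1" using False s \<gamma> by (simp add: powr_le1)
  moreover have "(1 :: real) \<le> 4 ^ n" by simp
  ultimately have "s powr \<gamma> \<le> 4 ^ n" by linarith
  then have "1 \<le> 4 ^ n * s powr - \<gamma>" using s by (simp add: powr_minus divide_simps)
  moreover have "1 / real (max 1 N) ^ (2 * n) \<le> 1" by (simp add: divide_simps)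
  ultimately show ?thesis by linarith
 qed
qed

section \<open>Counting the cubes along the boundary\<close>

lemma norm_cube_diff:
 fixes w :: "real^'n::finite"
 assumes "w \<in> cube v h"
 shows "norm (w - v) \<le> real CARD('n) * h"
proof -
 have "norm (w - v) \<le> (\<Sum>i\<in>UNIV. \<bar>(w - v) $ i\<bar>)" by (rule norm_le_l1_cart)
 also have "... \<le> (\<Sum>i\<in>(UNIV :: 'n set). h)"
 proof (rule sum_mono)
  fix i :: 'n
  have "v $ i \<le> w $ i \<and> w $ i \<le> v $ i + h" using assms by (simp add: cube_def)
  then show "\<bar>(w - v) $ i\<bar> \<le> h" by simp
 qed
 finally show ?thesis by simp
qed

lemma height_lipschitz:
 fixes e :: "'a::real_inner"
 assumes e: "norm e = 1" and \<Phi>: "\<And>v w. v \<bullet> e = 0 ==> w \<bullet> e = 0 ==> \<bar>\<Phi> v - \<Phi> w\<bar> \<le> M * norm (v - w)" and M: "0 \<le> M"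
 shows "\<bar>(x \<bullet> e - \<Phi> (x - (x \<bullet> e) *\<^sub>R e)) - (y \<bullet> e - \<Phi> (y - (y \<bullet> e) *\<^sub>R e))\<bar> \<le> (1 + M) * norm (x - y)"
proof -
 have ee: "e \<bullet> e = 1" using e by (simp add: norm_eq_1)
 have orth: "(x - (x \<bullet> e) *\<^sub>R e) \<bullet> e = 0" for x by (simp add: inner_diff_left ee)
 define w where "w = x - y"
 have "(norm (w - (w \<bullet> e) *\<^sub>R e))\<^sup>2 = (norm w)\<^sup>2 - (w \<bullet> e)\<^sup>2"
  unfolding power2_norm_eq_inner by (simp add: inner_diff_left inner_diff_right ee inner_commute power2_eq_square)
 then have "(norm (w - (w \<bullet> e) *\<^sub>R e))\<^sup>2 \<le> (norm w)\<^sup>2" by simp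
 then have le: "norm (w - (w \<bullet> e) *\<^sub>R e) \<le> norm w" by (rule power2_le_imp_le) simp
 have "(x - (x \<bullet> e) *\<^sub>R e) - (y - (y \<bullet> e) *\<^sub>R e) = w - (w \<bullet> e) *\<^sub>R e" by (simp add: w_def inner_diff_left algebra_simps)
 then have "\<bar>\<Phi> (x - (x \<bullet> e) *\<^sub>R e) - \<Phi> (y - (y \<bullet> e) *\<^sub>R e)\<bar> \<le> M * norm (w - (w \<bullet> e) *\<^sub>R e)"
  using \<Phi>[OF orth orth, of x y] by simp
 also have "... \<le> M * norm w" using le M by (rule mult_left_mono)
 finally have "\<bar>\<Phi> (x - (x \<bullet> e) *\<^sub>R e) - \<Phi> (y - (y \<bullet> e) *\<^sub>R e)\<bar> \<le> M * norm w" .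
 moreover have "\<bar>x \<bullet> e - y \<bullet> e\<bar> \<le> norm w" using Cauchy_Schwarz_ineq2[of w e] by (simp add: w_def e inner_diff_left)
 ultimately have "\<bar>(x \<bullet> e - \<Phi> (x - (x \<bullet> e) *\<^sub>R e)) - (y \<bullet> e - \<Phi> (y - (y \<bullet> e) *\<^sub>R e))\<bar> \<le> norm w + M * norm w" by linarith
 then show ?thesis by (simp add: w_def distrib_right)
qed

definition layer_constant :: "nat => real => real => real" where
 "layer_constant D M l0 = (2 * (real D + (1 + (1 + M) * real D) + M * real D) + 1) ^ D * (2 + (2 * real D + 2) / l0) ^ (D - 1)"

text \<open>
 \<open>\<kappa> k\<close> is the height of the corner of cube \<open>k\<close> above the graph in units of \<open>h\<close>.  The height has the Lipschitz constant \<open>1 + M\<close>, so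
 that it bounds the distance from \<open>S'\<close> from below, and every layer consists of the cubes within a bounded distance of
 a translate of the graph.
\<close>

lemma boundary_layers:
 fixes e u :: "real^'n::finite" and S S' :: "(real^'n) set"
 assumes e: "norm e = 1" and M: "0 \<le> M" and h: "0 < h" and l0: "0 < l0" "l0 * h \<le> l"
  and \<Phi>: "\<And>v w. v \<bullet> e = 0 ==> w \<bullet> e = 0 ==> \<bar>\<Phi> v - \<Phi> w\<bar> \<le> M * norm (v - w)"
  and S: "\<And>x. x \<in> S ==> 0 \<le> x \<bullet> e - \<Phi> (x - (x \<bullet> e) *\<^sub>R e)"
  and S': "\<And>x. x \<in> S' ==> x \<bullet> e - \<Phi> (x - (x \<bullet> e) *\<^sub>R e) \<le> 0"
 obtains Q :: "('n => int) set" and \<kappa> :: "('n => int) => nat" where "finite Q"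
  "\<And>x. x \<in> S \<inter> ball u l ==> (\<lambda>i. \<lfloor>x $ i / h\<rfloor>) \<in> Q"
  "\<And>k y z. k \<in> Q ==> y \<in> S' ==> z \<in> cube (\<chi> i. h * of_int (k i)) h ==> (1 + real (\<kappa> k)) * h \<le> (1 + (1 + M) * (1 + real CARD('n))) * (norm (y - z) + h)"
  "\<And>j. real (card {k \<in> Q. \<kappa> k = j}) \<le> layer_constant CARD('n) M l0 * (l / h) ^ (CARD('n) - 1)"
proof -
 let ?D = "real CARD('n)"
 define \<Psi> where "\<Psi> x = x \<bullet> e - \<Phi> (x - (x \<bullet> e) *\<^sub>R e)" for x
 have lip: "\<bar>\<Psi> x - \<Psi> y\<bar> \<le> (1 + M) * norm (x - y)" for x y
  unfolding \<Psi>_def by (rule height_lipschitz[OF e \<Phi> M])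
 define c where "c k = (\<chi> i. real_of_int (k i))" for k :: "'n => int"
 define Q where "Q = (\<lambda>x i. \<lfloor>x $ i / h\<rfloor>) ` (S \<inter> ball u l)"
 define \<kappa> where "\<kappa> k = nat \<lfloor>\<Psi> (h *\<^sub>R c k) / h\<rfloor>" for k
 have lp: "l / h \<ge> l0" "l > 0" using l0 h by (auto simp: field_simps intro: less_le_trans[OF mult_pos_pos])
 have hc: "(\<chi> i. h * of_int (k i)) = h *\<^sub>R c k" for k by (simp add: c_def vec_eq_iff)
 have point: "\<exists>x\<in>S. norm (x - u) < l \<and> norm (x - h *\<^sub>R c k) \<le> ?D * h" if k: "k \<in> Q" for k
 proof -
  obtain x where x: "x \<in> S" "x \<in> ball u l" "k = (\<lambda>i. \<lfloor>x $ i / h\<rfloor>)" using k by (auto simp: Q_def)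
  have "h * of_int (k i) \<le> x $ i \<and> x $ i \<le> h * of_int (k i) + h" for i
  proof -
   have "of_int (k i) \<le> x $ i / h" "x $ i / h \<le> of_int (k i) + 1" unfolding x(3) by linarith+
   then show ?thesis using h by (simp add: pos_le_divide_eq pos_divide_le_eq algebra_simps)
  qed
  then have "x \<in> cube (h *\<^sub>R c k) h" by (simp add: cube_def c_def)
  then have "norm (x - h *\<^sub>R c k) \<le> ?D * h" by (rule norm_cube_diff)
  then show ?thesis using x by (auto simp: dist_norm norm_minus_commute)
 qed
 have far: "(1 + real (\<kappa> k)) * h \<le> (1 + (1 + M) * (1 + ?D)) * (norm (y - z) + h)"
  if k: "k \<in> Q" and y: "y \<in> S'" and z: "z \<in> cube (\<chi> i. h * of_int (k i)) h" for k y z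
 proof -
  have zc: "norm (z - h *\<^sub>R c k) \<le> ?D * h" using norm_cube_diff[OF z] unfolding hc .
  have "norm (h *\<^sub>R c k - y) \<le> norm (z - h *\<^sub>R c k) + norm (y - z)"
   using norm_triangle_ineq[of "h *\<^sub>R c k - z" "z - y"] by (simp add: norm_minus_commute)
  then have nb: "norm (h *\<^sub>R c k - y) \<le> ?D * h + norm (y - z)" using zc by linarith
  have "\<Psi> (h *\<^sub>R c k) \<le> \<Psi> (h *\<^sub>R c k) - \<Psi> y" using S'[OF y] by (simp add: \<Psi>_def)
  also have "... \<le> (1 + M) * norm (h *\<^sub>R c k - y)" using lip[of "h *\<^sub>R c k" y] by linarith
  also have "... \<le> (1 + M) * (?D * h + norm (y - z))" using M by (intro mult_left_mono nb) auto
  finally have up: "\<Psi> (h *\<^sub>R c k) \<le> (1 + M) * (?D * h + norm (y - z))" .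
  have nonneg: "0 \<le> (1 + M) * (?D * h + norm (y - z))" using M h by simp
  have "real (\<kappa> k) * h \<le> (1 + M) * (?D * h + norm (y - z))"
  proof (cases "\<Psi> (h *\<^sub>R c k) / h \<ge> 0")
   case True
   then have "real (\<kappa> k) \<le> \<Psi> (h *\<^sub>R c k) / h" unfolding \<kappa>_def by linarith
   then have "real (\<kappa> k) * h \<le> \<Psi> (h *\<^sub>R c k)" using h by (simp add: pos_le_divide_eq)
   then show ?thesis using up by linarith
  next
   case False
   then have "\<kappa> k = 0" unfolding \<kappa>_def by simp
   then show ?thesis using nonneg by simp
  qed
  moreover have "(1 + (1 + M) * (1 + ?D)) * (norm (y - z) + h) = h + (1 + M) * (?D * h + norm (y - z)) + (norm (y - z) + (1 + M) * h + (1 + M) * (?D * norm (y - z)))"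
   by (simp add: algebra_simps)
  moreover have "0 \<le> norm (y - z) + (1 + M) * h + (1 + M) * (?D * norm (y - z))" using M h by simp
  ultimately show ?thesis by (simp add: distrib_right)
 qed
 define R where "R = l / h + ?D"
 have R: "R \<ge> 0" using lp l0 by (simp add: R_def)
 have ball: "norm (c k - u /\<^sub>R h) \<le> R" if k: "k \<in> Q" for k
 proof -
  obtain x where x: "norm (x - u) < l" "norm (x - h *\<^sub>R c k) \<le> ?D * h" using point[OF k] by blast
  have "norm (h *\<^sub>R c k - u) \<le> norm (x - h *\<^sub>R c k) + norm (x - u)"
   using norm_triangle_ineq[of "h *\<^sub>R c k - x" "x - u"] by (simp add: norm_minus_commute)
  then have "norm (h *\<^sub>R c k - u) \<le> ?D * h + l" using x by linarith
  moreover have "c k - u /\<^sub>R h = (h *\<^sub>R c k - u) /\<^sub>R h" using h by (simp add: scaleR_diff_right)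
  ultimately have "norm (c k - u /\<^sub>R h) \<le> (?D * h + l) / h" using h by (simp add: divide_right_mono divide_inverse mult.commute)
  then show ?thesis using h by (simp add: R_def add_divide_distrib)
 qed
 define V where "V = R + norm (u /\<^sub>R h)"
 have V: "0 \<le> V" using R by (simp add: V_def)
 have fin: "finite Q"
 proof (rule lattice_count(1)[OF e order_refl _ R, where \<Phi> = "\<lambda>_. 0"])
  fix k assume k: "k \<in> Q"
  show "norm ((\<chi> i. real_of_int (k i)) - u /\<^sub>R h) \<le> R" using ball[OF k] by (simp add: c_def)
  have "\<bar>c k \<bullet> e\<bar> \<le> norm (c k)" using Cauchy_Schwarz_ineq2[of "c k" e] e by simp
  also have "... \<le> V" using norm_triangle_ineq[of "c k - u /\<^sub>R h" "u /\<^sub>R h"] ball[OF k] by (simp add: V_def)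
  finally have "\<bar>c k \<bullet> e\<bar> \<le> V" .
  then show "- V \<le> (\<chi> i. real_of_int (k i)) \<bullet> e - 0 \<and> (\<chi> i. real_of_int (k i)) \<bullet> e - 0 \<le> - V + 2 * V"
   unfolding c_def abs_le_iff by simp
 qed (use V in auto)
 have count: "real (card {k \<in> Q. \<kappa> k = j}) \<le> layer_constant CARD('n) M l0 * (l / h) ^ (CARD('n) - 1)" for j
 proof -
  define \<Phi>' where "\<Phi>' v = \<Phi> (h *\<^sub>R v) / h" for v
  define s where "s = real j - (1 + M) * ?D"
  define W where "W = 1 + (1 + M) * ?D"
  have scaled: "c k \<bullet> e - \<Phi>' (c k - (c k \<bullet> e) *\<^sub>R e) = \<Psi> (h *\<^sub>R c k) / h" for k
   using h by (simp add: \<Psi>_def \<Phi>'_def diff_divide_distrib scaleR_diff_right)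
  have "real (card {k \<in> Q. \<kappa> k = j}) \<le> (2 * (?D + W + M * ?D) + 1) ^ CARD('n) * (2 * R + 2) ^ (CARD('n) - 1)"
  proof (rule lattice_count(2)[OF e M _ R, where \<Phi> = \<Phi>'])
   show "0 \<le> W" using M by (simp add: W_def)
   show "\<bar>\<Phi>' v - \<Phi>' w\<bar> \<le> M * norm (v - w)" if "v \<bullet> e = 0" "w \<bullet> e = 0" for v w
   proof -
    have "\<bar>\<Phi> (h *\<^sub>R v) - \<Phi> (h *\<^sub>R w)\<bar> \<le> M * norm (h *\<^sub>R v - h *\<^sub>R w)" using that by (intro \<Phi>) auto
    also have "... = M * norm (v - w) * h" using h by (simp flip: scaleR_diff_right)
    finally show ?thesis using h by (simp add: \<Phi>'_def pos_divide_le_eq flip: diff_divide_distrib)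
   qed
   fix k assume "k \<in> {k \<in> Q. \<kappa> k = j}"
   then have k: "k \<in> Q" and kj: "\<kappa> k = j" by auto
   show "norm ((\<chi> i. real_of_int (k i)) - u /\<^sub>R h) \<le> R" using ball[OF k] by (simp add: c_def)
   obtain x where x: "x \<in> S" "norm (x - h *\<^sub>R c k) \<le> ?D * h" using point[OF k] by blast
   have "(1 + M) * norm (x - h *\<^sub>R c k) \<le> (1 + M) * (?D * h)" using x M by (intro mult_left_mono) auto
   moreover have "0 \<le> \<Psi> x" using S[OF x(1)] by (simp add: \<Psi>_def)
   moreover have "\<Psi> x - \<Psi> (h *\<^sub>R c k) \<le> (1 + M) * norm (x - h *\<^sub>R c k)" using lip[of x "h *\<^sub>R c k"] by linarith
   ultimately have "- ((1 + M) * ?D) * h \<le> \<Psi> (h *\<^sub>R c k)" by (simp add: algebra_simps)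
   then have low: "- ((1 + M) * ?D) \<le> \<Psi> (h *\<^sub>R c k) / h" using h by (simp add: pos_le_divide_eq)
   have "s \<le> \<Psi> (h *\<^sub>R c k) / h"
   proof (cases "j = 0")
    case False
    then have "real j \<le> \<Psi> (h *\<^sub>R c k) / h" using kj unfolding \<kappa>_def by linarith
    moreover have "0 \<le> (1 + M) * ?D" using M by simp
    ultimately show ?thesis unfolding s_def by linarith
   qed (use low in \<open>simp add: s_def\<close>)
   moreover have "\<Psi> (h *\<^sub>R c k) / h \<le> s + W" using kj unfolding \<kappa>_def s_def W_def by linarith
   ultimately show "s \<le> (\<chi> i. real_of_int (k i)) \<bullet> e - \<Phi>' ((\<chi> i. real_of_int (k i)) - ((\<chi> i. real_of_int (k i)) \<bullet> e) *\<^sub>R e)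
    \<and> (\<chi> i. real_of_int (k i)) \<bullet> e - \<Phi>' ((\<chi> i. real_of_int (k i)) - ((\<chi> i. real_of_int (k i)) \<bullet> e) *\<^sub>R e) \<le> s + W"
    using scaled[of k] by (simp add: c_def)
  qed
  also have "... \<le> (2 * (?D + W + M * ?D) + 1) ^ CARD('n) * ((2 + (2 * ?D + 2) / l0) * (l / h)) ^ (CARD('n) - 1)"
  proof (intro mult_left_mono power_mono)
   define t where "t = (2 * ?D + 2) / l0 * (l / h)"
   have le: "2 * ?D + 2 \<le> t"
    using mult_left_mono[OF lp(1), of "(2 * ?D + 2) / l0"] l0 by (simp add: t_def)
   have eq: "(2 + (2 * ?D + 2) / l0) * (l / h) = 2 * (l / h) + t" unfolding t_def by (rule distrib_right)
   have "2 * R + 2 = 2 * (l / h) + (2 * ?D + 2)" by (simp add: R_def)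
   then show "2 * R + 2 \<le> (2 + (2 * ?D + 2) / l0) * (l / h)" unfolding eq using le by simp
  qed (use R M in \<open>auto simp: W_def\<close>)
  also have "... = layer_constant CARD('n) M l0 * (l / h) ^ (CARD('n) - 1)"
   unfolding layer_constant_def W_def power_mult_distrib by (simp only: mult.assoc)
  finally show ?thesis .
 qed
 show thesis by (rule that[OF fin _ far count]) (auto simp: Q_def)
qed

lemma rank_approx_mono: "rank_approx B r c ==> c \<le> c' ==> rank_approx B r c'"
 unfolding rank_approx_def by (meson order_trans)

text \<open>
 For a parameter \<open>T\<close> the cube \<open>k\<close> is allotted \<open>T / (1 + \<kappa> k)\<^sup>2\<close> small cubes.  As every layer contains \<open>O(L\<^sup>d\<^sup>-\<^sup>1)\<close> cubes, where
 \<open>L = |\<alpha>| l \<rho>\<close>, the total rank is \<open>O(L\<^sup>d\<^sup>-\<^sup>1 T)\<close>.  The choice of \<open>n\<close> gives \<open>\<gamma> \<le> 2 n / d\<close>, so that the error in cube \<open>k\<close> is at most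
 a multiple of \<open>T\<^sup>-\<^sup>\<gamma> (1 + \<kappa> k)\<^sup>2\<^sup>\<gamma>\<^sup>-\<^sup>2\<^sup>m\<close>; the choice of \<open>m\<close> makes these errors summable over the layers.
\<close>

lemma boundary_estimate:
 fixes q l0 M :: real and n m :: nat
 assumes q: "0 < q" "q \<le> 1" and l0: "0 < l0" and M: "0 \<le> M"
  and n_def: "n = nat \<lfloor>real CARD('n::finite) / q\<rfloor> + 1"
  and m_def: "m = nat \<lfloor>(real CARD('n) + 1) / q\<rfloor> + 1"
 obtains C where "0 \<le> C" "\<And>l \<rho> A (u :: real^'n) \<mu> b d \<alpha> e \<Phi> S S' C\<^sub>1 C\<^sub>2.
  nice_symbol n m l \<rho> A u \<mu> b d ==> \<alpha> \<noteq> 0 ==> l0 \<le> \<bar>\<alpha>\<bar> * l * \<rho> ==> norm e = 1 ==>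
  (\<And>v w. v \<bullet> e = 0 ==> w \<bullet> e = 0 ==> \<bar>\<Phi> v - \<Phi> w\<bar> \<le> M * norm (v - w)) ==>
  S \<in> sets borel ==> S' \<in> sets borel ==>
  (\<And>x. x \<in> S ==> 0 \<le> x \<bullet> e - \<Phi> (x - (x \<bullet> e) *\<^sub>R e)) ==> (\<And>x. x \<in> S' ==> x \<bullet> e - \<Phi> (x - (x \<bullet> e) *\<^sub>R e) \<le> 0) ==>
  is_adjoint C\<^sub>1 C\<^sub>2 ==> chi_op S o\<^sub>L left_pdo \<alpha> (\<lambda>z. cnj (b z)) o\<^sub>L chi_op S' \<in> {C\<^sub>1, C\<^sub>2} ==>
  C\<^sub>1 \<in> schatten_class q \<and> schatten_norm q C\<^sub>1 \<le> C * (\<bar>\<alpha>\<bar> * l * \<rho>) powr ((real CARD('n) - 1) / q) * A"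
proof -
 let ?D = "CARD('n)"
 define \<gamma> where "\<gamma> = 2 / q - 1 / 2"
 define G where "G = 1 + (1 + M) * (1 + real ?D)"
 define K where "K = cube_constant ?D n m G l0"
 define L\<^sub>0 where "L\<^sub>0 = layer_constant ?D M l0"
 define c2 where "c2 = (\<Sum>j. (1 + real j) powr - 2)"
 define c3 where "c3 = (\<Sum>j. (1 + real j) powr (2 * \<gamma> - 2 * real m))"
 define Z0 where "Z0 = K * 4 ^ n * (L\<^sub>0 * c3)"
 define Y0 where "Y0 = 1 + 1 / l0 ^ (?D - 1) + 2 * (real n ^ ?D * (L\<^sub>0 * c2))"
 define C where "C = sqrt (2 * Z0) * ((2 + 2 powr (q / 4) / (q / 4)) * Y0) powr (1 / q)"
 have D1: "1 \<le> ?D" by (simp add: Suc_leI)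
 have n1: "0 < n" by (simp add: n_def)
 have \<gamma>0: "0 \<le> \<gamma>" using q by (simp add: \<gamma>_def field_simps)
 have "real ?D / q \<le> n" unfolding n_def by linarith
 then have "1 / q \<le> real n / real ?D" using q D1 by (simp add: field_simps)
 then have \<gamma>n: "\<gamma> \<le> real (2 * n) / real ?D" by (simp add: \<gamma>_def)
 have m2: "2 * \<gamma> - 2 * real m < - 1"
 proof -
  have "2 / q \<le> (real ?D + 1) / q" using q D1 by (intro divide_right_mono) auto
  also have "... < m" unfolding m_def by linarith
  finally show ?thesis by (simp add: \<gamma>_def)
 qed
 have summable: "summable (\<lambda>j. (1 + real j) powr s)" if "s < - 1" for s
  using that summable_Suc_iff[of "\<lambda>j. real j powr s"] summable_real_powr_iff[of s] by (simp add: add.commute)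
 note sum2 = summable[of "- 2", simplified] and sum3 = summable[OF m2]
 have c2: "0 \<le> c2" unfolding c2_def by (rule suminf_nonneg[OF sum2]) simp
 have c3: "0 \<le> c3" unfolding c3_def by (rule suminf_nonneg[OF sum3]) simp
 have G: "0 \<le> G" using M by (simp add: G_def)
 have K: "0 \<le> K" unfolding K_def by (rule cube_constant_nonneg[OF G])
 have L0: "0 \<le> L\<^sub>0" using M l0 by (auto simp: L\<^sub>0_def layer_constant_def)
 have Z0: "0 \<le> Z0" using K L0 c3 by (simp add: Z0_def)
 have Y0: "1 \<le> Y0" "1 / l0 ^ (?D - 1) \<le> Y0" "2 * (real n ^ ?D * (L\<^sub>0 * c2)) \<le> Y0" using L0 c2 l0 by (auto simp: Y0_def)
 have C0: "0 \<le> C" using Z0 by (simp add: C_def)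
 have main: "C\<^sub>1 \<in> schatten_class q \<and> schatten_norm q C\<^sub>1 \<le> C * (\<bar>\<alpha>\<bar> * l * \<rho>) powr ((real CARD('n) - 1) / q) * A"
  if ns: "nice_symbol n m l \<rho> A u \<mu> b d" and \<alpha>: "\<alpha> \<noteq> 0" and big: "l0 \<le> \<bar>\<alpha>\<bar> * l * \<rho>" and e: "norm e = 1"
   and \<Phi>: "\<And>v w. v \<bullet> e = 0 ==> w \<bullet> e = 0 ==> \<bar>\<Phi> v - \<Phi> w\<bar> \<le> M * norm (v - w)"
   and Sb: "S \<in> sets borel" and Sb': "S' \<in> sets borel"
   and S: "\<And>x. x \<in> S ==> 0 \<le> x \<bullet> e - \<Phi> (x - (x \<bullet> e) *\<^sub>R e)" and S': "\<And>x. x \<in> S' ==> x \<bullet> e - \<Phi> (x - (x \<bullet> e) *\<^sub>R e) \<le> 0"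
   and adj: "is_adjoint C\<^sub>1 C\<^sub>2" and B: "chi_op S o\<^sub>L left_pdo \<alpha> (\<lambda>z. cnj (b z)) o\<^sub>L chi_op S' \<in> {C\<^sub>1, C\<^sub>2}"
  for l \<rho> A and u \<mu> :: "real^'n" and b d \<alpha> e \<Phi> S S' C\<^sub>1 C\<^sub>2
 proof -
  interpret nice_symbol n m l \<rho> A u \<mu> b d by fact
  define h where "h = 1 / (\<bar>\<alpha>\<bar> * \<rho>)"
  have h: "h > 0" using \<alpha> \<rho>_pos by (simp add: h_def)
  define L where "L = l / h"
  have L_eq: "L = \<bar>\<alpha>\<bar> * l * \<rho>" by (simp add: L_def h_def)
  have L: "l0 \<le> L" "0 < L" using big l0 by (auto simp: L_eq)
  have lh: "l0 * h \<le> l" using L h by (simp add: L_def pos_le_divide_eq)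
  obtain Q :: "('n => int) set" and \<kappa> :: "('n => int) => nat" where Q: "finite Q" "\<And>x. x \<in> S \<inter> ball u l ==> (\<lambda>i. \<lfloor>x $ i / h\<rfloor>) \<in> Q"
   "\<And>k y z. k \<in> Q ==> y \<in> S' ==> z \<in> cube (\<chi> i. h * of_int (k i)) h ==> (1 + real (\<kappa> k)) * h \<le> G * (norm (y - z) + h)"
   "\<And>j. real (card {k \<in> Q. \<kappa> k = j}) \<le> L\<^sub>0 * L ^ (?D - 1)"
   unfolding G_def L\<^sub>0_def L_def
   using boundary_layers[OF e M h l0 lh \<Phi> S S', where u = u] by blast
  define Y where "Y = Y0 * L ^ (?D - 1)"
  define Z where "Z = Z0 * A\<^sup>2"
  have Lp: "0 < L ^ (?D - 1)" using L by simp
  have Y1: "1 \<le> Y"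
  proof -
   have "l0 ^ (?D - 1) \<le> L ^ (?D - 1)" using L l0 by (intro power_mono) auto
   then have "1 \<le> 1 / l0 ^ (?D - 1) * L ^ (?D - 1)" using l0 by simp
   also have "... \<le> Y" unfolding Y_def using Y0(2) Lp by (intro mult_right_mono) auto
   finally show ?thesis .
  qed
  have LY: "L ^ (?D - 1) \<le> Y" unfolding Y_def using Y0(1) Lp by simp
  have layers: "(\<Sum>k\<in>Q. (1 + real (\<kappa> k)) powr (2 * \<gamma> - 2 * real m)) \<le> L\<^sub>0 * L ^ (?D - 1) * c3"
   unfolding c3_def by (rule layer_sum[OF Q(1) Q(4) sum3]) simp
  have layers2: "(\<Sum>k\<in>Q. (1 + real (\<kappa> k)) powr - 2) \<le> L\<^sub>0 * L ^ (?D - 1) * c2"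
   unfolding c2_def by (rule layer_sum[OF Q(1) Q(4) sum2]) simp
  let ?B = "chi_op S o\<^sub>L left_pdo \<alpha> (\<lambda>z. cnj (b z)) o\<^sub>L chi_op S'"
  have final: "K * A\<^sup>2 * (4 ^ n * t * (\<Sum>k\<in>Q. (1 + real (\<kappa> k)) powr (2 * \<gamma> - 2 * real m))) \<le> Z * Y * t" if "0 \<le> t" for t
  proof -
   have "K * A\<^sup>2 * (4 ^ n * t * (\<Sum>k\<in>Q. (1 + real (\<kappa> k)) powr (2 * \<gamma> - 2 * real m))) \<le> K * A\<^sup>2 * (4 ^ n * t * (L\<^sub>0 * L ^ (?D - 1) * c3))"
    using K that by (intro mult_left_mono layers) auto
   also have "... = Z * L ^ (?D - 1) * t" by (simp add: Z_def Z0_def)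
   also have "... \<le> Z * Y * t" using Z0 that by (intro mult_right_mono mult_left_mono LY) (auto simp: Z_def)
   finally show ?thesis .
  qed
  have approx: "\<exists>r. real r \<le> real n ^ ?D * (\<Sum>k\<in>Q. real (N k) ^ ?D) \<and>
    rank_approx ?B r (K * A\<^sup>2 * (\<Sum>k\<in>Q. 1 / (1 + real (\<kappa> k)) ^ (2 * m) / real (max 1 (N k)) ^ (2 * n)))" for N
   unfolding K_def by (rule sandwich_rank_approx[OF \<alpha> h_def l0 lh n1 Sb Sb' G Q(1)]) (use Q in blast)+
  have pw: "1 / (1 + real j) ^ (2 * m) = (1 + real j) powr - (2 * real m)" for j
   by (simp add: powr_minus divide_inverse flip: powr_realpow)
  have B0: "rank_approx ?B 0 (Z * Y)"
  proof -
   obtain r where r: "real r \<le> real n ^ ?D * (\<Sum>k\<in>Q. real 0 ^ ?D)"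
    "rank_approx ?B r (K * A\<^sup>2 * (\<Sum>k\<in>Q. 1 / (1 + real (\<kappa> k)) ^ (2 * m) / real (max 1 0) ^ (2 * n)))"
    using approx[where N = "\<lambda>_. 0"] by blast
   have "(\<Sum>k\<in>Q. 1 / (1 + real (\<kappa> k)) ^ (2 * m) / real (max 1 0) ^ (2 * n)) \<le> 4 ^ n * 1 * (\<Sum>k\<in>Q. (1 + real (\<kappa> k)) powr (2 * \<gamma> - 2 * real m))"
    unfolding sum_distrib_left
   proof (rule sum_mono)
    fix k
    have "1 / (1 + real (\<kappa> k)) ^ (2 * m) \<le> (1 + real (\<kappa> k)) powr (2 * \<gamma> - 2 * real m)"
     unfolding pw using \<gamma>0 by (intro powr_mono) auto
    also have "... \<le> 4 ^ n * (1 + real (\<kappa> k)) powr (2 * \<gamma> - 2 * real m)"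
     using mult_right_mono[of 1 "4 ^ n" "(1 + real (\<kappa> k)) powr (2 * \<gamma> - 2 * real m)"] by simp
    finally show "1 / (1 + real (\<kappa> k)) ^ (2 * m) / real (max 1 0) ^ (2 * n) \<le> 4 ^ n * 1 * (1 + real (\<kappa> k)) powr (2 * \<gamma> - 2 * real m)" by simp
   qed
   then have "K * A\<^sup>2 * (\<Sum>k\<in>Q. 1 / (1 + real (\<kappa> k)) ^ (2 * m) / real (max 1 0) ^ (2 * n)) \<le> Z * Y * 1"
    using final[of 1] K by (intro order_trans[OF mult_left_mono final]) auto
   moreover have "r = 0" using r(1) by (simp add: zero_power)
   ultimately show ?thesis using r(2) rank_approx_mono by fastforce
  qed
  have B1: "\<exists>r. real r \<le> Y * T / 2 \<and> rank_approx ?B r (Z * Y * T powr - (2 / q - 1 / 2))" if T: "T \<ge> 1" for T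
  proof -
   define s where "s k = T * (1 + real (\<kappa> k)) powr - 2" for k
   have s: "s k > 0" for k using T by (simp add: s_def)
   define N where "N k = nat \<lfloor>s k powr (1 / real ?D)\<rfloor>" for k
   note N = subdivision_choice[OF s D1 \<gamma>0 \<gamma>n, folded N_def]
   obtain r where r: "real r \<le> real n ^ ?D * (\<Sum>k\<in>Q. real (N k) ^ ?D)"
    "rank_approx ?B r (K * A\<^sup>2 * (\<Sum>k\<in>Q. 1 / (1 + real (\<kappa> k)) ^ (2 * m) / real (max 1 (N k)) ^ (2 * n)))"
    using approx[where N = N] by blast
   have "(\<Sum>k\<in>Q. real (N k) ^ ?D) \<le> (\<Sum>k\<in>Q. s k)" by (intro sum_mono N)
   also have "... = T * (\<Sum>k\<in>Q. (1 + real (\<kappa> k)) powr - 2)" unfolding s_def by (rule sum_distrib_left[symmetric])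
   also have "... \<le> T * (L\<^sub>0 * L ^ (?D - 1) * c2)" using T by (intro mult_left_mono layers2) auto
   finally have "real n ^ ?D * (\<Sum>k\<in>Q. real (N k) ^ ?D) \<le> real n ^ ?D * (T * (L\<^sub>0 * L ^ (?D - 1) * c2))" by (intro mult_left_mono) auto
   also have "... = 2 * (real n ^ ?D * (L\<^sub>0 * c2)) * L ^ (?D - 1) * T / 2" by simp
   also have "... \<le> Y * T / 2"
    unfolding Y_def using Y0(3) Lp T by (intro divide_right_mono mult_right_mono) auto
   finally have rank: "real r \<le> Y * T / 2" using r(1) by linarith
   have "(\<Sum>k\<in>Q. 1 / (1 + real (\<kappa> k)) ^ (2 * m) / real (max 1 (N k)) ^ (2 * n)) \<le> 4 ^ n * T powr - \<gamma> * (\<Sum>k\<in>Q. (1 + real (\<kappa> k)) powr (2 * \<gamma> - 2 * real m))"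
    unfolding sum_distrib_left
   proof (rule sum_mono)
    fix k
    have "1 / (1 + real (\<kappa> k)) ^ (2 * m) / real (max 1 (N k)) ^ (2 * n) = (1 + real (\<kappa> k)) powr - (2 * real m) * (1 / real (max 1 (N k)) ^ (2 * n))"
     unfolding pw[symmetric] by simp
    also have "... \<le> (1 + real (\<kappa> k)) powr - (2 * real m) * (4 ^ n * s k powr - \<gamma>)" by (intro mult_left_mono N) simp
    also have "s k powr - \<gamma> = T powr - \<gamma> * (1 + real (\<kappa> k)) powr (2 * \<gamma>)"
     unfolding s_def using T by (simp add: powr_mult powr_powr)
    also have "(1 + real (\<kappa> k)) powr - (2 * real m) * (4 ^ n * (T powr - \<gamma> * (1 + real (\<kappa> k)) powr (2 * \<gamma>)))
      = 4 ^ n * T powr - \<gamma> * ((1 + real (\<kappa> k)) powr - (2 * real m) * (1 + real (\<kappa> k)) powr (2 * \<gamma>))" by simp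
    also have "(1 + real (\<kappa> k)) powr - (2 * real m) * (1 + real (\<kappa> k)) powr (2 * \<gamma>) = (1 + real (\<kappa> k)) powr (2 * \<gamma> - 2 * real m)"
     by (simp flip: powr_add)
    finally show "1 / (1 + real (\<kappa> k)) ^ (2 * m) / real (max 1 (N k)) ^ (2 * n) \<le> 4 ^ n * T powr - \<gamma> * (1 + real (\<kappa> k)) powr (2 * \<gamma> - 2 * real m)" .
   qed
   then have "K * A\<^sup>2 * (\<Sum>k\<in>Q. 1 / (1 + real (\<kappa> k)) ^ (2 * m) / real (max 1 (N k)) ^ (2 * n)) \<le> Z * Y * T powr - \<gamma>"
    using K by (intro order_trans[OF mult_left_mono final]) auto
   then have "rank_approx ?B r (Z * Y * T powr - (2 / q - 1 / 2))"
    using rank_approx_mono[OF r(2)] unfolding \<gamma>_def by blast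
   then show ?thesis using rank by blast
  qed
  have Z: "0 \<le> Z" using Z0 by (simp add: Z_def)
  note sb = schatten_bound[OF q Y1 Z adj B B0 B1]
  have "sqrt (2 * Z) * ((2 + 2 powr (q / 4) / (q / 4)) * Y) powr (1 / q) = C * (\<bar>\<alpha>\<bar> * l * \<rho>) powr ((real ?D - 1) / q) * A"
  proof -
   have "sqrt (2 * Z) = sqrt (2 * Z0) * A" using A_nonneg by (simp add: Z_def real_sqrt_mult)
   moreover have "((2 + 2 powr (q / 4) / (q / 4)) * Y) powr (1 / q) = ((2 + 2 powr (q / 4) / (q / 4)) * Y0) powr (1 / q) * (L ^ (?D - 1)) powr (1 / q)"
    unfolding Y_def mult.assoc[symmetric] using q Y0(1) Lp by (intro powr_mult)
   moreover have "(L ^ (?D - 1)) powr (1 / q) = L powr ((real ?D - 1) / q)"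
    using L D1 by (simp add: powr_powr of_nat_diff flip: powr_realpow)
   ultimately show ?thesis unfolding C_def L_eq[symmetric] by simp
  qed
  then show ?thesis using sb by simp
 qed
 show thesis by (rule that[OF C0 main])
qed

section \<open>Symbol classes\<close>

text \<open>
 The mixed derivative is only assumed to exist in one order.  Integrating \<open>\<partial>\<^sub>w f = g\<close> along \<open>w\<close> and differentiating under the
 integral sign with respect to \<open>v\<close> expresses the increments of \<open>\<partial>\<^sub>v f\<close> along \<open>w\<close> as integrals of the continuous function \<open>\<partial>\<^sub>v g\<close>.
\<close>

lemma partial_derivatives_commute:
 fixes f f1 g g1 :: "'v::real_normed_vector => complex"
 assumes f1: "\<And>z t. ((\<lambda>s. f (z + s *\<^sub>R v)) has_vector_derivative f1 (z + t *\<^sub>R v)) (at t)"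
  and g: "\<And>z t. ((\<lambda>s. f (z + s *\<^sub>R w)) has_vector_derivative g (z + t *\<^sub>R w)) (at t)"
  and g1: "\<And>z t. ((\<lambda>s. g (z + s *\<^sub>R v)) has_vector_derivative g1 (z + t *\<^sub>R v)) (at t)"
  and cont: "continuous_on UNIV g" "continuous_on UNIV g1"
 shows "((\<lambda>s. f1 (z + s *\<^sub>R w)) has_vector_derivative g1 z) (at 0)"
proof -
 have FTC: "integral {-1..t} (\<lambda>\<tau>. g (y + \<tau> *\<^sub>R w)) = f (y + t *\<^sub>R w) - f (y + (-1) *\<^sub>R w)" if "-1 \<le> t" for t y
  by (rule integral_unique, rule fundamental_theorem_of_calculus[OF that])
   (rule has_vector_derivative_at_within[OF g])
 have gc: "continuous_on A (\<lambda>\<tau>. g (y + \<tau> *\<^sub>R w))" "continuous_on A (\<lambda>\<tau>. g1 (y + \<tau> *\<^sub>R w))" for A y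
  by (intro continuous_on_compose2[OF cont(1)] continuous_on_compose2[OF cont(2)] continuous_intros, simp)+
 have diff: "f1 (z + t *\<^sub>R w) - f1 (z + (-1) *\<^sub>R w) = integral {-1..t} (\<lambda>\<tau>. g1 (z + \<tau> *\<^sub>R w))" if t: "-1 \<le> t" for t
 proof -
  have "((\<lambda>s. integral (cbox (-1) t) (\<lambda>\<tau>. g ((z + \<tau> *\<^sub>R w) + s *\<^sub>R v))) has_vector_derivative
    integral (cbox (-1) t) (\<lambda>\<tau>. g1 ((z + \<tau> *\<^sub>R w) + 0 *\<^sub>R v))) (at 0 within UNIV)"
  proof (rule leibniz_rule_vector_derivative[where fx = "\<lambda>s \<tau>. g1 ((z + \<tau> *\<^sub>R w) + s *\<^sub>R v)"])
   show "(\<lambda>\<tau>. g (z + \<tau> *\<^sub>R w + s *\<^sub>R v)) integrable_on cbox (- 1) t" for s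
    using integrable_continuous_real[OF gc(1)[of "{-1..t}" "z + s *\<^sub>R v"]] by (simp add: ac_simps)
   show "continuous_on (UNIV \<times> cbox (- 1) t) (\<lambda>(s, \<tau>). g1 (z + \<tau> *\<^sub>R w + s *\<^sub>R v))"
    unfolding case_prod_beta by (intro continuous_on_compose2[OF cont(2)] continuous_intros) simp
   show "((\<lambda>x. g (z + \<tau> *\<^sub>R w + x *\<^sub>R v)) has_vector_derivative g1 (z + \<tau> *\<^sub>R w + s *\<^sub>R v)) (at s within UNIV)" for s \<tau>
    by (rule g1)
  qed auto
  moreover have "integral (cbox (-1) t) (\<lambda>\<tau>. g ((z + \<tau> *\<^sub>R w) + s *\<^sub>R v)) = f ((z + t *\<^sub>R w) + s *\<^sub>R v) - f ((z + (-1) *\<^sub>R w) + s *\<^sub>R v)" for s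
   using FTC[OF t, of "z + s *\<^sub>R v"] by (simp add: algebra_simps)
  ultimately have "((\<lambda>s. f ((z + t *\<^sub>R w) + s *\<^sub>R v) - f ((z + (-1) *\<^sub>R w) + s *\<^sub>R v)) has_vector_derivative integral {-1..t} (\<lambda>\<tau>. g1 (z + \<tau> *\<^sub>R w))) (at 0)"
   by simp
  moreover have "((\<lambda>s. f ((z + t *\<^sub>R w) + s *\<^sub>R v) - f ((z + (-1) *\<^sub>R w) + s *\<^sub>R v)) has_vector_derivative f1 ((z + t *\<^sub>R w) + 0 *\<^sub>R v) - f1 ((z + (-1) *\<^sub>R w) + 0 *\<^sub>R v)) (at 0)"
   by (intro has_vector_derivative_diff f1)
  ultimately show ?thesis using vector_derivative_unique_at by fastforce
 qed
 have "((\<lambda>t. integral {-1..t} (\<lambda>\<tau>. g1 (z + \<tau> *\<^sub>R w))) has_vector_derivative g1 (z + 0 *\<^sub>R w)) (at 0 within {-1..1})"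
  by (rule integral_has_vector_derivative[OF gc(2)]) auto
 then have "((\<lambda>t. f1 (z + (-1) *\<^sub>R w) + integral {-1..t} (\<lambda>\<tau>. g1 (z + \<tau> *\<^sub>R w))) has_vector_derivative g1 z) (at 0 within {-1..1})"
  using has_vector_derivative_add[OF has_vector_derivative_const[of "f1 (z + (-1) *\<^sub>R w)"]] by fastforce
 then have "((\<lambda>t. f1 (z + (-1) *\<^sub>R w) + integral {-1..t} (\<lambda>\<tau>. g1 (z + \<tau> *\<^sub>R w))) has_vector_derivative g1 z) (at 0 within {-1<..<1})"
  by (rule has_vector_derivative_within_subset) auto
 then have "((\<lambda>s. f1 (z + s *\<^sub>R w)) has_vector_derivative g1 z) (at 0 within {-1<..<1})"
 proof (rule has_vector_derivative_transform[rotated 2])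
  fix t :: real assume "t \<in> {-1<..<1}"
  then show "f1 (z + t *\<^sub>R w) = f1 (z + (-1) *\<^sub>R w) + integral {-1..t} (\<lambda>\<tau>. g1 (z + \<tau> *\<^sub>R w))"
   using diff[of t] by (simp add: algebra_simps)
 qed simp
 then show ?thesis unfolding at_within_open[of "0::real" "{-1<..<1}", simplified] .
qed

lemma mixed_deriv_bound:
 fixes a :: "(real^'n::finite) \<times> (real^'n) => complex"
 assumes a: "a \<in> symbol_class j k" and l: "0 < l" and \<rho>: "0 < \<rho>" and I: "length I \<le> j" and J: "length J \<le> k"
 shows "cmod (mixed_deriv I J a z) \<le> symbol_norm j k a l \<rho> * (1 / \<rho>) ^ length J * (1 / l) ^ length I"
proof -
 let ?i = "length I" and ?r = "length J"
 have fin: "finite {I :: 'n list. length I = p}" for p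
  using finite_lists_length_eq[of "UNIV :: 'n set" p] by simp
 have "(cmod (mixed_deriv I J a z))\<^sup>2 \<le> (\<Sum>J' | length J' = ?r. (cmod (mixed_deriv I J' a z))\<^sup>2)"
  by (rule member_le_sum[of J]) (auto simp: fin)
 also have "... \<le> (\<Sum>I' | length I' = ?i. \<Sum>J' | length J' = ?r. (cmod (mixed_deriv I' J' a z))\<^sup>2)"
  by (rule member_le_sum[of I "{I'. length I' = ?i}" "\<lambda>I'. \<Sum>J' | length J' = ?r. (cmod (mixed_deriv I' J' a z))\<^sup>2"]) (auto simp: fin intro!: sum_nonneg)
 finally have le: "cmod (mixed_deriv I J a z) \<le> deriv_tensor_norm ?i ?r a z"
  unfolding deriv_tensor_norm_def by (rule real_le_rsqrt)
 have bd: "bounded (range (deriv_tensor_norm ?i ?r a))" using a I J by (auto simp: symbol_class_def)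
 have "bdd_above (range (\<lambda>z. l ^ ?i * \<rho> ^ ?r * deriv_tensor_norm ?i ?r a z))"
  using bounded_imp_bdd_above[OF bounded_scaleR_comp[OF bd, of "l ^ ?i * \<rho> ^ ?r"]] by simp
 then have "l ^ ?i * \<rho> ^ ?r * deriv_tensor_norm ?i ?r a z \<le> (SUP z. l ^ ?i * \<rho> ^ ?r * deriv_tensor_norm ?i ?r a z)"
  by (rule cSUP_upper[OF UNIV_I])
 also have "... \<le> symbol_norm j k a l \<rho>"
  unfolding symbol_norm_def
  by (rule Max_ge) (use I J in \<open>auto intro!: image_eqI[of _ _ "(length I, length J)"]\<close>)
 finally have "l ^ ?i * \<rho> ^ ?r * deriv_tensor_norm ?i ?r a z \<le> symbol_norm j k a l \<rho>" .
 moreover have "l ^ ?i * \<rho> ^ ?r * cmod (mixed_deriv I J a z) \<le> l ^ ?i * \<rho> ^ ?r * deriv_tensor_norm ?i ?r a z"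
  using l \<rho> by (intro mult_left_mono le) auto
 ultimately have "l ^ ?i * \<rho> ^ ?r * cmod (mixed_deriv I J a z) \<le> symbol_norm j k a l \<rho>" by linarith
 then show ?thesis using l \<rho> by (simp add: power_divide field_simps)
qed

lemma symbol_norm_nonneg:
 fixes a :: "(real^'n::finite) \<times> (real^'n) => complex"
 assumes "a \<in> symbol_class j k" "0 < l" "0 < \<rho>"
 shows "0 \<le> symbol_norm j k a l \<rho>"
 using order_trans[OF norm_ge_zero mixed_deriv_bound[OF assms, of "[]" "[]" undefined]] by simp

lemma mixed_deriv_Cons:
 "mixed_deriv (i # I) J a = dir_deriv (axis i 1, 0) (mixed_deriv I J a)"
 "mixed_deriv [] (i # J) a = dir_deriv (0, axis i 1) (mixed_deriv [] J a)"
 "mixed_deriv [] [] a = a"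
 by (simp_all add: mixed_deriv_def)

lemma mixed_deriv_position:
 fixes a :: "(real^'n::finite) \<times> (real^'n) => complex"
 assumes "a \<in> symbol_class j k" "length I < j" "length J \<le> k"
 shows "((\<lambda>s. mixed_deriv I J a (x + s *\<^sub>R axis i 1, \<xi>)) has_vector_derivative mixed_deriv (i # I) J a (x + t *\<^sub>R axis i 1, \<xi>)) (at t)"
proof -
 have "has_dir_deriv (axis i 1, 0) (mixed_deriv I J a)" using assms by (auto simp: symbol_class_def)
 from has_dir_derivD[OF this, of "(x, \<xi>)" t] show ?thesis by (simp add: mixed_deriv_Cons)
qed

lemma mixed_deriv_momentum:
 fixes a :: "(real^'n::finite) \<times> (real^'n) => complex"
 assumes "a \<in> symbol_class j k" "length J < k"
 shows "((\<lambda>s. mixed_deriv [] J a (x, \<xi> + s *\<^sub>R axis i 1)) has_vector_derivative mixed_deriv [] (i # J) a (x, \<xi> + t *\<^sub>R axis i 1)) (at t)"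
proof -
 have "has_dir_deriv (0, axis i 1) (mixed_deriv [] J a)" using assms by (auto simp: symbol_class_def)
 from has_dir_derivD[OF this, of "(x, \<xi>)" t] show ?thesis by (simp add: mixed_deriv_Cons)
qed

lemma mixed_deriv_continuous:
 "a \<in> symbol_class j k ==> length I \<le> j ==> length J \<le> k ==> continuous_on UNIV (mixed_deriv I J a)"
 by (auto simp: symbol_class_def)

text \<open>
 The derivatives of a symbol are formed first in \<open>\<xi>\<close> and then in \<open>x\<close>.  For the estimate with exchanged variables
 a further derivative in \<open>\<xi>\<close> has to be moved inside.
\<close>

lemma mixed_deriv_momentum_general:
 fixes a :: "(real^'n::finite) \<times> (real^'n) => complex"
 assumes a: "a \<in> symbol_class j k" and I: "length I \<le> j" and J: "length J < k"
 shows "((\<lambda>s. mixed_deriv I J a (x, \<xi> + s *\<^sub>R axis i 1)) has_vector_derivative mixed_deriv I (i # J) a (x, \<xi> + t *\<^sub>R axis i 1)) (at t)"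
 using I
proof (induction I arbitrary: x \<xi> t)
 case Nil
 show ?case by (rule mixed_deriv_momentum[OF a J])
next
 case (Cons p I)
 have "((\<lambda>s. mixed_deriv (p # I) J a ((x, \<xi> + t *\<^sub>R axis i 1) + s *\<^sub>R (0, axis i 1))) has_vector_derivative mixed_deriv (p # I) (i # J) a (x, \<xi> + t *\<^sub>R axis i 1)) (at 0)"
 proof (rule partial_derivatives_commute)
  show "((\<lambda>s. mixed_deriv I J a (z + s *\<^sub>R (axis p 1, 0))) has_vector_derivative mixed_deriv (p # I) J a (z + t *\<^sub>R (axis p 1, 0))) (at t)" for z t
   using mixed_deriv_position[OF a, of I J "fst z" p "snd z" t] Cons.prems J by (cases z) simp
  show "((\<lambda>s. mixed_deriv I J a (z + s *\<^sub>R (0, axis i 1))) has_vector_derivative mixed_deriv I (i # J) a (z + t *\<^sub>R (0, axis i 1))) (at t)" for z t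
   using Cons.IH[of "fst z" "snd z" t] Cons.prems by (cases z) simp
  show "((\<lambda>s. mixed_deriv I (i # J) a (z + s *\<^sub>R (axis p 1, 0))) has_vector_derivative mixed_deriv (p # I) (i # J) a (z + t *\<^sub>R (axis p 1, 0))) (at t)" for z t
   using mixed_deriv_position[OF a, of I "i # J" "fst z" p "snd z" t] Cons.prems J by (cases z) simp
  show "continuous_on UNIV (mixed_deriv I (i # J) a)" "continuous_on UNIV (mixed_deriv (p # I) (i # J) a)"
   using Cons.prems J by (auto intro!: mixed_deriv_continuous[OF a])
 qed
 then have d: "((\<lambda>s. mixed_deriv (p # I) J a (x, (\<xi> + t *\<^sub>R axis i 1) + s *\<^sub>R axis i 1)) has_vector_derivative mixed_deriv (p # I) (i # J) a (x, \<xi> + t *\<^sub>R axis i 1)) (at 0)"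
  by simp
 have "(((\<lambda>s. mixed_deriv (p # I) J a (x, (\<xi> + t *\<^sub>R axis i 1) + s *\<^sub>R axis i 1)) \<circ> (\<lambda>s. s - t)) has_vector_derivative 1 *\<^sub>R mixed_deriv (p # I) (i # J) a (x, \<xi> + t *\<^sub>R axis i 1)) (at t)"
  by (rule vector_diff_chain_at) (use d in \<open>auto intro!: derivative_eq_intros\<close>)
 then show ?case by (simp add: o_def algebra_simps)
qed

lemma mixed_deriv_support:
 fixes a :: "(real^'n::finite) \<times> (real^'n) => complex"
 assumes z: "z \<notin> closure {z. a z \<noteq> 0}"
 shows "mixed_deriv I J a z = 0"
proof -
 let ?U = "- closure {z. a z \<noteq> 0}"
 have step: "dir_deriv v f z = 0" if f: "\<And>z. z \<in> ?U ==> f z = 0" and z: "z \<in> ?U" for v z and f :: "(real^'n) \<times> (real^'n) => complex"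
 proof -
  let ?T = "(\<lambda>s::real. z + s *\<^sub>R v) -` ?U"
  have "open ?T" by (intro open_vimage continuous_intros) simp
  moreover have "0 \<in> ?T" using z by simp
  ultimately have "((\<lambda>s. f (z + s *\<^sub>R v)) has_vector_derivative 0) (at 0)"
   by (rule has_vector_derivative_transform_within_open[rotated 1, where f = "\<lambda>_. 0"]) (use f in auto)
  then show ?thesis unfolding dir_deriv_def by (rule vector_derivative_at)
 qed
 have "\<forall>z\<in>?U. mixed_deriv [] J a z = 0"
 proof (induction J)
  case Nil
  have "a z = 0" if "z \<in> ?U" for z using that closure_subset[of "{z. a z \<noteq> 0}"] by auto
  then show ?case unfolding mixed_deriv_Cons by blast
 next
  case (Cons i J)
  then show ?case unfolding mixed_deriv_Cons using step[of "mixed_deriv [] J a"] by blast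
 qed
 then have "\<forall>z\<in>?U. mixed_deriv I J a z = 0"
 proof (induction I)
  case (Cons i I)
  then show ?case unfolding mixed_deriv_Cons using step[of "mixed_deriv I J a"] by blast
 qed
 then show ?thesis using z by blast
qed

lemma symbol_nice:
 fixes a :: "(real^'n::finite) \<times> (real^'n) => complex"
 assumes a: "a \<in> symbol_class n m" and l: "0 < l" and \<rho>: "0 < \<rho>" and supp: "closure {z. a z \<noteq> 0} \<subseteq> ball u l \<times> ball \<mu> \<rho>"
 shows "nice_symbol n m l \<rho> (symbol_norm n m a l \<rho>) u \<mu> a (\<lambda>k j. mixed_deriv [] (replicate j k) a)"
proof
 let ?A = "symbol_norm n m a l \<rho>"
 show "0 \<le> ?A" by (rule symbol_norm_nonneg[OF a l \<rho>])
 show "((\<lambda>s. mixed_deriv [] (replicate j k) a (x, \<xi> + s *\<^sub>R axis k 1)) has_vector_derivative mixed_deriv [] (replicate (Suc j) k) a (x, \<xi> + t *\<^sub>R axis k 1)) (at t)"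
  if "j < m" for j k x \<xi> t
  using mixed_deriv_momentum[OF a, of "replicate j k"] that by simp
 show "continuous_on UNIV (mixed_deriv [] (replicate j k) a)" if "j \<le> m" for j k
  using that by (intro mixed_deriv_continuous[OF a]) auto
 show "x \<in> ball u l \<and> \<xi> \<in> ball \<mu> \<rho>" if "mixed_deriv [] (replicate j k) a (x, \<xi>) \<noteq> 0" for j k x \<xi>
  using mixed_deriv_support that supp by blast
 have "line_bound p (?A * (1 / \<rho>) ^ j * (1 / l) ^ r) (1 / l) UNIV (\<lambda>t. mixed_deriv (replicate r i) (replicate j k) a (x + t *\<^sub>R axis i 1, \<xi>))"
  if "j \<le> m" "r + p \<le> n" for p r j k x i \<xi>
  using that
 proof (induction p arbitrary: r)
  case 0
  then show ?case using mixed_deriv_bound[OF a l \<rho>, of "replicate r i" "replicate j k"] by simp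
 next
  case (Suc p)
  show ?case
   unfolding line_bound.simps
  proof (intro conjI ballI exI)
   show "cmod (mixed_deriv (replicate r i) (replicate j k) a (x + t *\<^sub>R axis i 1, \<xi>)) \<le> ?A * (1 / \<rho>) ^ j * (1 / l) ^ r" for t
    using mixed_deriv_bound[OF a l \<rho>, of "replicate r i" "replicate j k"] Suc.prems by simp
   show "((\<lambda>t. mixed_deriv (replicate r i) (replicate j k) a (x + t *\<^sub>R axis i 1, \<xi>)) has_vector_derivative mixed_deriv (replicate (Suc r) i) (replicate j k) a (x + t *\<^sub>R axis i 1, \<xi>)) (at t within UNIV)" for t
    using mixed_deriv_position[OF a, of "replicate r i" "replicate j k"] Suc.prems by simp
   show "line_bound p (?A * (1 / \<rho>) ^ j * (1 / l) ^ r * (1 / l)) (1 / l) UNIV (\<lambda>t. mixed_deriv (replicate (Suc r) i) (replicate j k) a (x + t *\<^sub>R axis i 1, \<xi>))"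
    using Suc.IH[of "Suc r"] Suc.prems by (simp add: mult_ac)
  qed
 qed
 from this[of _ 0 n] show "line_bound n (?A * (1 / \<rho>) ^ j) (1 / l) UNIV (\<lambda>t. mixed_deriv [] (replicate j k) a (x + t *\<^sub>R axis i 1, \<xi>))"
  if "j \<le> m" for j k x i \<xi>
  using that by simp
qed (use l \<rho> in \<open>auto simp: mixed_deriv_Cons\<close>)

lemma symbol_nice_swap:
 fixes a :: "(real^'n::finite) \<times> (real^'n) => complex"
 assumes a: "a \<in> symbol_class m n" and l: "0 < l" and \<rho>: "0 < \<rho>" and supp: "closure {z. a z \<noteq> 0} \<subseteq> ball u l \<times> ball \<mu> \<rho>"
 shows "nice_symbol n m \<rho> l (symbol_norm m n a l \<rho>) \<mu> u (\<lambda>z. a (prod.swap z)) (\<lambda>k j z. mixed_deriv (replicate j k) [] a (prod.swap z))"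
proof
 let ?A = "symbol_norm m n a l \<rho>"
 show "0 \<le> ?A" by (rule symbol_norm_nonneg[OF a l \<rho>])
 show "((\<lambda>s. mixed_deriv (replicate j k) [] a (prod.swap (x, \<xi> + s *\<^sub>R axis k 1))) has_vector_derivative mixed_deriv (replicate (Suc j) k) [] a (prod.swap (x, \<xi> + t *\<^sub>R axis k 1))) (at t)"
  if "j < m" for j k x \<xi> t
  using mixed_deriv_position[OF a, of "replicate j k" "[]"] that by simp
 show "continuous_on UNIV (\<lambda>z. mixed_deriv (replicate j k) [] a (prod.swap z))" if "j \<le> m" for j k
  using that by (intro continuous_on_compose2[OF mixed_deriv_continuous[OF a]] continuous_intros) auto
 show "x \<in> ball \<mu> \<rho> \<and> \<xi> \<in> ball u l" if "mixed_deriv (replicate j k) [] a (prod.swap (x, \<xi>)) \<noteq> 0" for j k x \<xi>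
  using mixed_deriv_support that supp by fastforce
 have "line_bound p (?A * (1 / l) ^ j * (1 / \<rho>) ^ r) (1 / \<rho>) UNIV (\<lambda>t. mixed_deriv (replicate j k) (replicate r i) a (\<xi>, x + t *\<^sub>R axis i 1))"
  if "j \<le> m" "r + p \<le> n" for p r j k x i \<xi>
  using that
 proof (induction p arbitrary: r)
  case 0
  then show ?case using mixed_deriv_bound[OF a l \<rho>, of "replicate j k" "replicate r i"] by (simp add: mult_ac)
 next
  case (Suc p)
  show ?case
   unfolding line_bound.simps
  proof (intro conjI ballI exI)
   show "cmod (mixed_deriv (replicate j k) (replicate r i) a (\<xi>, x + t *\<^sub>R axis i 1)) \<le> ?A * (1 / l) ^ j * (1 / \<rho>) ^ r" for t
    using mixed_deriv_bound[OF a l \<rho>, of "replicate j k" "replicate r i"] Suc.prems by (simp add: mult_ac)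
   show "((\<lambda>t. mixed_deriv (replicate j k) (replicate r i) a (\<xi>, x + t *\<^sub>R axis i 1)) has_vector_derivative mixed_deriv (replicate j k) (replicate (Suc r) i) a (\<xi>, x + t *\<^sub>R axis i 1)) (at t within UNIV)" for t
    using mixed_deriv_momentum_general[OF a, of "replicate j k" "replicate r i"] Suc.prems by simp
   show "line_bound p (?A * (1 / l) ^ j * (1 / \<rho>) ^ r * (1 / \<rho>)) (1 / \<rho>) UNIV (\<lambda>t. mixed_deriv (replicate j k) (replicate (Suc r) i) a (\<xi>, x + t *\<^sub>R axis i 1))"
    using Suc.IH[of "Suc r"] Suc.prems by (simp add: mult_ac)
  qed
 qed
 from this[of _ 0 n] show "line_bound n (?A * (1 / l) ^ j) (1 / \<rho>) UNIV (\<lambda>t. mixed_deriv (replicate j k) [] a (prod.swap (x + t *\<^sub>R axis i 1, \<xi>)))"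
  if "j \<le> m" for j k x i \<xi>
  using that by simp
qed (use l \<rho> in \<open>auto simp: mixed_deriv_Cons\<close>)

section \<open>Basic domains and the estimates\<close>

text \<open>
 In dimension \<open>1\<close> a basic domain has this form with \<open>\<Phi> = 0\<close>, so that all dimensions can be treated alike.
\<close>

definition above_graph :: "real => real^'n::finite => (real^'n => real) => (real^'n) set => bool" where
 "above_graph M e \<Phi> \<Lambda> \<longleftrightarrow> norm e = 1 \<and>
   (\<forall>v w. v \<bullet> e = 0 \<longrightarrow> w \<bullet> e = 0 \<longrightarrow> \<bar>\<Phi> v - \<Phi> w\<bar> \<le> M * norm (v - w)) \<and>
   \<Lambda> = {x. 0 < x \<bullet> e - \<Phi> (x - (x \<bullet> e) *\<^sub>R e)}"

lemma above_graphD: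
 assumes "above_graph M e \<Phi> \<Lambda>"
 shows "norm e = 1" "v \<bullet> e = 0 ==> w \<bullet> e = 0 ==> \<bar>\<Phi> v - \<Phi> w\<bar> \<le> M * norm (v - w)"
  "\<Lambda> = {x. 0 < x \<bullet> e - \<Phi> (x - (x \<bullet> e) *\<^sub>R e)}"
 using assms by (simp_all add: above_graph_def)

lemma basic_domain_graph:
 fixes \<Lambda> :: "(real^'n::finite) set"
 assumes "basic_domain M \<Lambda>"
 shows "\<exists>e \<Phi>. above_graph (max M 0) e \<Phi> \<Lambda>"
proof (cases "CARD('n) = 1")
 case True
 then obtain e where "norm e = 1" "\<Lambda> = {x. 0 < x \<bullet> e}" using assms by (auto simp: basic_domain_def)
 then show ?thesis by (intro exI[of _ e] exI[of _ "\<lambda>_. 0"]) (simp add: above_graph_def)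
next
 case False
 then obtain e \<Phi> where e: "norm e = 1" "M-lipschitz_on {x. x \<bullet> e = 0} \<Phi>" "\<Lambda> = {x. x \<bullet> e > \<Phi> (x - (x \<bullet> e) *\<^sub>R e)}"
  using assms by (auto simp: basic_domain_def)
 have "max M 0 = M" using lipschitz_on_nonneg[OF e(2)] by simp
 moreover have "\<bar>\<Phi> v - \<Phi> w\<bar> \<le> M * norm (v - w)" if "v \<bullet> e = 0" "w \<bullet> e = 0" for v w
  using lipschitz_onD[OF e(2), of v w] that by (simp add: dist_norm)
 ultimately show ?thesis using e(1,3) by (intro exI[of _ e] exI[of _ \<Phi>]) (simp add: above_graph_def)
qed

lemma basic_domain_borel:
 fixes \<Lambda> :: "(real^'n::finite) set"
 assumes "basic_domain M \<Lambda>"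
 shows "\<Lambda> \<in> sets borel"
proof -
 obtain e \<Phi> where g: "above_graph (max M 0) e \<Phi> \<Lambda>"
  using basic_domain_graph[OF assms] by blast
 note e = above_graphD(1)[OF g] and \<Phi> = above_graphD(2)[OF g] and \<Lambda> = above_graphD(3)[OF g]
 have "(1 + max M 0)-lipschitz_on UNIV (\<lambda>x. x \<bullet> e - \<Phi> (x - (x \<bullet> e) *\<^sub>R e))"
 proof (rule lipschitz_onI)
  show "dist (x \<bullet> e - \<Phi> (x - (x \<bullet> e) *\<^sub>R e)) (y \<bullet> e - \<Phi> (y - (y \<bullet> e) *\<^sub>R e)) \<le> (1 + max M 0) * dist x y" for x y
   unfolding dist_norm real_norm_def by (rule height_lipschitz[OF e \<Phi> max.cobounded2])
 qed simp
 then have "continuous_on UNIV (\<lambda>x. x \<bullet> e - \<Phi> (x - (x \<bullet> e) *\<^sub>R e))" by (rule lipschitz_on_continuous_on)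
 then have "open \<Lambda>" unfolding \<Lambda> by (intro open_Collect_less continuous_on_const)
 then show ?thesis by (rule borel_open)
qed

text \<open>
 For the left quantization the cut-off rows are those of the operator itself.  For the right quantization they are those of
 the adjoint, in which the domain and its complement change places; the complement lies above the graph of \<open>- \<Phi>\<close>
 over the axis \<open>- e\<close>, up to the graph itself.
\<close>

lemma domain_estimate:
 fixes q l0 M :: real and n m :: nat
 assumes q: "0 < q" "q \<le> 1" and l0: "0 < l0"
  and n_def: "n = nat \<lfloor>real CARD('n::finite) / q\<rfloor> + 1"
  and m_def: "m = nat \<lfloor>(real CARD('n) + 1) / q\<rfloor> + 1"
 obtains C where "0 \<le> C" "\<And>l \<rho> A (u :: real^'n) \<mu> a d \<alpha> \<Lambda> T. nice_symbol n m l \<rho> A u \<mu> a d ==> \<alpha> \<noteq> 0 ==>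
  l0 \<le> \<bar>\<alpha>\<bar> * l * \<rho> ==> basic_domain M \<Lambda> ==> T \<in> {left_pdo \<alpha> a, right_pdo \<alpha> a} ==>
  (\<exists>T'. is_adjoint (chi_op \<Lambda> o\<^sub>L T o\<^sub>L chi_op (- \<Lambda>)) T') \<and> chi_op \<Lambda> o\<^sub>L T o\<^sub>L chi_op (- \<Lambda>) \<in> schatten_class q \<and>
  schatten_norm q (chi_op \<Lambda> o\<^sub>L T o\<^sub>L chi_op (- \<Lambda>)) \<le> C * (\<bar>\<alpha>\<bar> * l * \<rho>) powr ((real CARD('n) - 1) / q) * A"
proof -
 have M: "0 \<le> max M 0" by simp
 show thesis
 proof (rule boundary_estimate[OF q l0 M n_def m_def])
  fix C assume C0: "0 \<le> C" and C: "\<And>l \<rho> A (u :: real^'n) \<mu> b d \<alpha> e \<Phi> S S' C\<^sub>1 C\<^sub>2.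
  nice_symbol n m l \<rho> A u \<mu> b d ==> \<alpha> \<noteq> 0 ==> l0 \<le> \<bar>\<alpha>\<bar> * l * \<rho> ==> norm e = 1 ==>
  (\<And>v w. v \<bullet> e = 0 ==> w \<bullet> e = 0 ==> \<bar>\<Phi> v - \<Phi> w\<bar> \<le> max M 0 * norm (v - w)) ==>
  S \<in> sets borel ==> S' \<in> sets borel ==>
  (\<And>x. x \<in> S ==> 0 \<le> x \<bullet> e - \<Phi> (x - (x \<bullet> e) *\<^sub>R e)) ==> (\<And>x. x \<in> S' ==> x \<bullet> e - \<Phi> (x - (x \<bullet> e) *\<^sub>R e) \<le> 0) ==>
  is_adjoint C\<^sub>1 C\<^sub>2 ==> chi_op S o\<^sub>L left_pdo \<alpha> (\<lambda>z. cnj (b z)) o\<^sub>L chi_op S' \<in> {C\<^sub>1, C\<^sub>2} ==>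
  C\<^sub>1 \<in> schatten_class q \<and> schatten_norm q C\<^sub>1 \<le> C * (\<bar>\<alpha>\<bar> * l * \<rho>) powr ((real CARD('n) - 1) / q) * A"
  show thesis
  proof (rule that[OF C0])
  fix l \<rho> A and u \<mu> :: "real^'n" and a d \<alpha> and \<Lambda> :: "(real^'n) set" and T
  assume ns: "nice_symbol n m l \<rho> A u \<mu> a d" and \<alpha>: "\<alpha> \<noteq> 0" and big: "l0 \<le> \<bar>\<alpha>\<bar> * l * \<rho>" and dom: "basic_domain M \<Lambda>"
   and T: "T \<in> {left_pdo \<alpha> a, right_pdo \<alpha> a}"
  have \<Lambda>b: "\<Lambda> \<in> sets borel" "- \<Lambda> \<in> sets borel" using basic_domain_borel[OF dom] by auto
  obtain e \<Phi> where g: "above_graph (max M 0) e \<Phi> \<Lambda>"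
   using basic_domain_graph[OF dom] by blast
  note e = above_graphD(1)[OF g] and \<Phi> = above_graphD(2)[OF g] and \<Lambda> = above_graphD(3)[OF g]
  interpret nice_symbol n m l \<rho> A u \<mu> a d by fact
  note a = bounded_kernel_b
  note sandwich = is_adjoint_compose[OF is_adjoint_compose[OF is_adjoint_chi_op[OF \<Lambda>b(1)]] is_adjoint_chi_op[OF \<Lambda>b(2)]]
  show "(\<exists>T'. is_adjoint (chi_op \<Lambda> o\<^sub>L T o\<^sub>L chi_op (- \<Lambda>)) T') \<and> chi_op \<Lambda> o\<^sub>L T o\<^sub>L chi_op (- \<Lambda>) \<in> schatten_class q \<and>
   schatten_norm q (chi_op \<Lambda> o\<^sub>L T o\<^sub>L chi_op (- \<Lambda>)) \<le> C * (\<bar>\<alpha>\<bar> * l * \<rho>) powr ((real CARD('n) - 1) / q) * A"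
  proof (cases "T = left_pdo \<alpha> a")
   case True
   have "is_adjoint T (right_pdo \<alpha> (\<lambda>z. cnj (a z)))"
    using is_adjoint_left_right[OF bounded_kernel_cnj[OF a] \<alpha>] True by simp
   note adj = sandwich[OF this]
   have mem: "chi_op \<Lambda> o\<^sub>L left_pdo \<alpha> (\<lambda>z. cnj (cnj (a z))) o\<^sub>L chi_op (- \<Lambda>) \<in> {chi_op \<Lambda> o\<^sub>L T o\<^sub>L chi_op (- \<Lambda>), chi_op (- \<Lambda>) o\<^sub>L (right_pdo \<alpha> (\<lambda>z. cnj (a z)) o\<^sub>L chi_op \<Lambda>)}"
    using True by simp
   have "chi_op \<Lambda> o\<^sub>L T o\<^sub>L chi_op (- \<Lambda>) \<in> schatten_class q \<and>
    schatten_norm q (chi_op \<Lambda> o\<^sub>L T o\<^sub>L chi_op (- \<Lambda>)) \<le> C * (\<bar>\<alpha>\<bar> * l * \<rho>) powr ((real CARD('n) - 1) / q) * A"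
    by (rule C[OF nice_symbol_cnj[OF ns] \<alpha> big e _ \<Lambda>b, where \<Phi> = \<Phi>, OF _ _ _ adj mem])
     (use \<Phi> in \<open>auto simp: \<Lambda>\<close>)
   then show ?thesis using adj by blast
  next
   case False
   then have T: "T = right_pdo \<alpha> a" using T by simp
   have "is_adjoint T (left_pdo \<alpha> (\<lambda>z. cnj (a z)))"
    unfolding T by (rule is_adjoint_sym[OF is_adjoint_left_right[OF a \<alpha>]])
   note adj = sandwich[OF this]
   have mem: "chi_op (- \<Lambda>) o\<^sub>L left_pdo \<alpha> (\<lambda>z. cnj (a z)) o\<^sub>L chi_op \<Lambda> \<in> {chi_op \<Lambda> o\<^sub>L T o\<^sub>L chi_op (- \<Lambda>), chi_op (- \<Lambda>) o\<^sub>L (left_pdo \<alpha> (\<lambda>z. cnj (a z)) o\<^sub>L chi_op \<Lambda>)}"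
    by (simp add: blinfun_compose_assoc')
   have e': "norm (- e) = 1" using e by simp
   have "chi_op \<Lambda> o\<^sub>L T o\<^sub>L chi_op (- \<Lambda>) \<in> schatten_class q \<and>
    schatten_norm q (chi_op \<Lambda> o\<^sub>L T o\<^sub>L chi_op (- \<Lambda>)) \<le> C * (\<bar>\<alpha>\<bar> * l * \<rho>) powr ((real CARD('n) - 1) / q) * A"
    by (rule C[OF ns \<alpha> big e' _ \<Lambda>b(2,1), where \<Phi> = "\<lambda>v. - \<Phi> v", OF _ _ _ adj mem])
     (use \<Phi> in \<open>auto simp: \<Lambda> abs_minus_commute\<close>)
   then show ?thesis using adj by blast
  qed
 qed
 qed
qed

lemma schatten_unitary:
 fixes C :: "'a::euclidean_space L2_op"
 assumes C: "is_adjoint C C'" "C \<in> schatten_class q" and U: "is_adjoint U V" "V o\<^sub>L U = id_blinfun" "U o\<^sub>L V = id_blinfun"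
 shows "V o\<^sub>L C o\<^sub>L U \<in> schatten_class q" "schatten_norm q (V o\<^sub>L C o\<^sub>L U) = schatten_norm q C"
 using C(2) compact_operator_unitary[OF C(1) _ U(1,2)]
 by (simp_all add: schatten_class_def schatten_norm_def singular_value_unitary[OF C(1) U])

theorem theorem4p2:
  fixes q l0 M :: real and n m :: nat
  assumes "0 < q" and "q \<le> 1"
    and n_def: "n = nat \<lfloor>real CARD('d::finite) / q\<rfloor> + 1"
    and m_def: "m = nat \<lfloor>(real CARD('d) + 1) / q\<rfloor> + 1"
    and "0 < l0"
    and "CARD('d) \<ge> 2 \<Longrightarrow> 0 < M"
  shows "\<exists>C\<ge>0. \<forall>(\<Lambda> :: (real^'d) set) (\<Omega> :: (real^'d) set) \<alpha> l \<rho>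
            (a :: (real^'d) \<times> (real^'d) \<Rightarrow> complex) u \<mu>.
     basic_domain M \<Lambda> \<and> basic_domain M \<Omega> \<and>
     0 < \<alpha> \<and> 0 < l \<and> 0 < \<rho> \<and> \<alpha> * l * \<rho> \<ge> l0 \<and>
     a \<in> symbol_class n m \<and> closure {z. a z \<noteq> 0} \<subseteq> ball u l \<times> ball \<mu> \<rho> \<longrightarrow>
     (\<forall>t\<in>{0, 1}.
        (chi_op \<Lambda> o\<^sub>L Op \<alpha> t a o\<^sub>L (id_blinfun - chi_op \<Lambda>) \<in> schatten_class q \<and>
         schatten_norm q (chi_op \<Lambda> o\<^sub>L Op \<alpha> t a o\<^sub>L (id_blinfun - chi_op \<Lambda>))
           \<le> C * (\<alpha> * l * \<rho>) powr ((real CARD('d) - 1) / q) * symbol_norm n m a l \<rho>) \<and>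
        (a \<in> symbol_class m n \<longrightarrow>
         P_op \<Omega> \<alpha> o\<^sub>L Op \<alpha> t a o\<^sub>L (id_blinfun - P_op \<Omega> \<alpha>) \<in> schatten_class q \<and>
         schatten_norm q (P_op \<Omega> \<alpha> o\<^sub>L Op \<alpha> t a o\<^sub>L (id_blinfun - P_op \<Omega> \<alpha>))
           \<le> C * (\<alpha> * l * \<rho>) powr ((real CARD('d) - 1) / q) * symbol_norm m n a l \<rho>))"
proof -
 show ?thesis
 proof (rule domain_estimate[OF assms(1,2,5) n_def m_def, of M])
 fix C assume C0: "0 \<le> C" and C: "\<And>l \<rho> A (u :: real^'d) \<mu> a d \<alpha> \<Lambda> T. nice_symbol n m l \<rho> A u \<mu> a d ==> \<alpha> \<noteq> 0 ==>
  l0 \<le> \<bar>\<alpha>\<bar> * l * \<rho> ==> basic_domain M \<Lambda> ==> T \<in> {left_pdo \<alpha> a, right_pdo \<alpha> a} ==>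
  (\<exists>T'. is_adjoint (chi_op \<Lambda> o\<^sub>L T o\<^sub>L chi_op (- \<Lambda>)) T') \<and> chi_op \<Lambda> o\<^sub>L T o\<^sub>L chi_op (- \<Lambda>) \<in> schatten_class q \<and>
  schatten_norm q (chi_op \<Lambda> o\<^sub>L T o\<^sub>L chi_op (- \<Lambda>)) \<le> C * (\<bar>\<alpha>\<bar> * l * \<rho>) powr ((real CARD('d) - 1) / q) * A"
 show ?thesis
 proof (rule exI[of _ C], intro conjI allI impI C0 ballI; (elim conjE)?)
  fix \<Lambda> \<Omega> :: "(real^'d) set" and \<alpha> l \<rho> and a :: "(real^'d) \<times> (real^'d) => complex" and u \<mu> and t :: real
  assume \<Lambda>: "basic_domain M \<Lambda>" and \<Omega>: "basic_domain M \<Omega>" and pos: "0 < \<alpha>" "0 < l" "0 < \<rho>" and big: "\<alpha> * l * \<rho> \<ge> l0"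
   and a: "a \<in> symbol_class n m" and supp: "closure {z. a z \<noteq> 0} \<subseteq> ball u l \<times> ball \<mu> \<rho>" and t: "t \<in> {0, 1}"
  have \<alpha>: "\<alpha> \<noteq> 0" "- \<alpha> \<noteq> 0" using pos by auto
  note ns = symbol_nice[OF a pos(2,3) supp]
  interpret nice_symbol n m l \<rho> "symbol_norm n m a l \<rho>" u \<mu> a "\<lambda>k j. mixed_deriv [] (replicate j k) a"
   by (rule ns)
  have Op: "Op \<alpha> t a = (if t = 0 then left_pdo \<alpha> a else right_pdo \<alpha> a)"
   using t Op_left[OF bounded_kernel_b pos(1)] Op_right[OF bounded_kernel_b pos(1)] by auto
  have id: "id_blinfun - chi_op \<Lambda> = chi_op (- \<Lambda>)" by (rule id_minus_chi_op[OF basic_domain_borel[OF \<Lambda>]])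
  have est: "chi_op \<Lambda> o\<^sub>L Op \<alpha> t a o\<^sub>L (id_blinfun - chi_op \<Lambda>) \<in> schatten_class q \<and>
   schatten_norm q (chi_op \<Lambda> o\<^sub>L Op \<alpha> t a o\<^sub>L (id_blinfun - chi_op \<Lambda>))
     \<le> C * (\<alpha> * l * \<rho>) powr ((real CARD('d) - 1) / q) * symbol_norm n m a l \<rho>"
   unfolding id using C[OF ns \<alpha>(1) _ \<Lambda>, of "Op \<alpha> t a"] big pos by (simp add: Op)
  from est show "chi_op \<Lambda> o\<^sub>L Op \<alpha> t a o\<^sub>L (id_blinfun - chi_op \<Lambda>) \<in> schatten_class q" ..
  from est show "schatten_norm q (chi_op \<Lambda> o\<^sub>L Op \<alpha> t a o\<^sub>L (id_blinfun - chi_op \<Lambda>))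
     \<le> C * (\<alpha> * l * \<rho>) powr ((real CARD('d) - 1) / q) * symbol_norm n m a l \<rho>" ..
  assume a': "a \<in> symbol_class m n"
  define T where "T = FT \<alpha> o\<^sub>L Op \<alpha> t a o\<^sub>L FT (- \<alpha>)"
  have T: "T \<in> {left_pdo (- \<alpha>) (\<lambda>z. a (prod.swap z)), right_pdo (- \<alpha>) (\<lambda>z. a (prod.swap z))}"
   unfolding T_def Op using FT_conj_left[OF \<alpha>(1), of a] FT_conj_right[OF \<alpha>(1), of a] by simp
  define D where "D = chi_op \<Omega> o\<^sub>L T o\<^sub>L chi_op (- \<Omega>)"
  have P: "P_op \<Omega> \<alpha> o\<^sub>L Op \<alpha> t a o\<^sub>L (id_blinfun - P_op \<Omega> \<alpha>) = FT (- \<alpha>) o\<^sub>L D o\<^sub>L FT \<alpha>"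
   unfolding D_def T_def by (rule P_op_sandwich[OF basic_domain_borel[OF \<Omega>] pos(1)])
  have D: "(\<exists>T'. is_adjoint D T') \<and> D \<in> schatten_class q \<and>
   schatten_norm q D \<le> C * (\<bar>- \<alpha>\<bar> * \<rho> * l) powr ((real CARD('d) - 1) / q) * symbol_norm m n a l \<rho>"
   unfolding D_def
   by (rule C[OF symbol_nice_swap[OF a' pos(2,3) supp] \<alpha>(2) _ \<Omega> T]) (use big pos in \<open>simp add: mult_ac\<close>)
  then obtain D' where D': "is_adjoint D D'" by blast
  note unitary = schatten_unitary[OF D' _ is_adjoint_FT[OF \<alpha>(1)] FT_unitary[OF \<alpha>(1)] FT_unitary'[OF \<alpha>(1)]]
  show "P_op \<Omega> \<alpha> o\<^sub>L Op \<alpha> t a o\<^sub>L (id_blinfun - P_op \<Omega> \<alpha>) \<in> schatten_class q"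
   unfolding P using unitary(1) D by blast
  have scale: "\<bar>- \<alpha>\<bar> * \<rho> * l = \<alpha> * l * \<rho>" using pos by simp
  show "schatten_norm q (P_op \<Omega> \<alpha> o\<^sub>L Op \<alpha> t a o\<^sub>L (id_blinfun - P_op \<Omega> \<alpha>))
     \<le> C * (\<alpha> * l * \<rho>) powr ((real CARD('d) - 1) / q) * symbol_norm m n a l \<rho>"
   unfolding P unitary(2)[OF conjunct1[OF conjunct2[OF D]]] using D unfolding scale by blast
 qed
 qed
qed

end
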